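(* There exists a randomized algorithm that, given a parameter $\epsilon>0$, a text $T$ of length $n$ and a pattern $P$ of length $m$ over an alphabet $\Sigma$, with high probability solves the pattern-to-text approximate Hamming distance problem, i.e. outputs for every location $i\in[1,n-m+1]$ a value $\delta_i$ with $(1-\epsilon)\,\mathrm{HAM}(T_i,P)\le \delta_i\le (1+\epsilon)\,\mathrm{HAM}(T_i,P)$, and runs in $O\!\left(\frac{n}{\epsilon}\log\frac1\epsilon\,\log n\,\log m\,\log|\Sigma|\right)$ time.
   Context: The alphabet is $\Sigma=\{1,2,\ldots,|\Sigma|\}$. For two strings $X,Y$ of equal length, $\mathrm{HAM}(X,Y)$ is their Hamming distance, the number of positions at which the aligned characters differ. For a text $T$ of length $n$ and a pattern $P$ of length $m$, $T_j=T[j,\ldots,j+m-1]$. "With high probability" means with probability at least $1-n^{-\Omega(1)}$ (simultaneously for all locations). *)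

theory Defs
  imports "HOL-Probability.Probability"
begin

unbundle bit_operations_syntax

section \<open>Text-to-pattern Hamming distance\<close>

definition hamming :: "'a list \<Rightarrow> 'a list \<Rightarrow> nat" where
  "hamming X Y = card {j. j < length X \<and> X ! j \<noteq> Y ! j}"

text \<open>The substring \<open>T[i, \<dots>, i + m - 1]\<close>; locations are counted from 1.\<close>

definition window :: "'a list \<Rightarrow> nat \<Rightarrow> nat \<Rightarrow> 'a list" where
  "window T m i = take m (drop (i - 1) T)"

definition approximates_hamming :: "real \<Rightarrow> 'a list \<Rightarrow> 'a list \<Rightarrow> (nat \<Rightarrow> real) \<Rightarrow> bool" where
  "approximates_hamming \<epsilon> T P \<delta> \<longleftrightarrow>
     (\<forall>i \<in> {1..length T - length P + 1}.
        (1 - \<epsilon>) * real (hamming (window T (length P) i) P) \<le> \<delta> i \<and>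
        \<delta> i \<le> (1 + \<epsilon>) * real (hamming (window T (length P) i) P))"


section \<open>A randomized word RAM\<close>

text \<open>
  The machine has word size \<open>w\<close>: results of operations are reduced modulo \<open>2 ^ w\<close>, so memory
  addresses are \<open>w\<close>-bit words as well. Every instruction takes one time step. Only the registers
  named in a program are ever written, so each program uses finitely many of them.
\<close>

datatype binop = Add | Sub | Mul | Div | Mod | And | Or | Xor | Shl | Shr | Less | Equal

fun binop_val :: "nat \<Rightarrow> binop \<Rightarrow> nat \<Rightarrow> nat \<Rightarrow> nat" where
  "binop_val w Add x y = (x + y) mod 2 ^ w"
| "binop_val w Sub x y = nat ((int x - int y) mod 2 ^ w)"
| "binop_val w Mul x y = (x * y) mod 2 ^ w"
| "binop_val w Div x y = (x div y) mod 2 ^ w"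
| "binop_val w Mod x y = (x mod y) mod 2 ^ w"
| "binop_val w And x y = (x AND y) mod 2 ^ w"
| "binop_val w Or x y = (x OR y) mod 2 ^ w"
| "binop_val w Xor x y = (x XOR y) mod 2 ^ w"
| "binop_val w Shl x y = push_bit y x mod 2 ^ w"
| "binop_val w Shr x y = drop_bit y x mod 2 ^ w"
| "binop_val w Less x y = of_bool (x < y) mod 2 ^ w"
| "binop_val w Equal x y = of_bool (x = y) mod 2 ^ w"

text \<open>
  The first argument of \<open>Const\<close>, \<open>Arith\<close>, \<open>Load\<close> and \<open>Rand\<close> is the target register.
  \<open>Load r s\<close> reads the memory cell whose address is in register \<open>s\<close>; \<open>Store r s\<close> writes the
  content of register \<open>s\<close> to the memory cell whose address is in register \<open>r\<close>.
\<close>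

datatype instr =
    Const nat nat
  | Arith binop nat nat nat
  | Load nat nat
  | Store nat nat
  | Rand nat nat
  | Jump nat
  | JumpZero nat nat

record config =
  pc :: nat
  regs :: "nat \<Rightarrow> nat"
  mem :: "nat \<Rightarrow> nat"

definition set_reg :: "nat \<Rightarrow> nat \<Rightarrow> config \<Rightarrow> config" where
  "set_reg r v c = c\<lparr>pc := Suc (pc c), regs := (regs c)(r := v)\<rparr>"

text \<open>
  \<open>Rand r s\<close> draws a fresh uniform number below the content of register \<open>s\<close> (and yields 0 if
  that content is 0).
\<close>

fun exec :: "nat \<Rightarrow> instr \<Rightarrow> config \<Rightarrow> config pmf" where
  "exec w (Const r k) c = return_pmf (set_reg r (k mod 2 ^ w) c)"
| "exec w (Arith f r s t) c = return_pmf (set_reg r (binop_val w f (regs c s) (regs c t)) c)"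
| "exec w (Load r s) c = return_pmf (set_reg r (mem c (regs c s)) c)"
| "exec w (Store r s) c =
     return_pmf (c\<lparr>pc := Suc (pc c), mem := (mem c)(regs c r := regs c s)\<rparr>)"
| "exec w (Rand r s) c =
     (if regs c s = 0 then return_pmf (set_reg r 0 c)
      else map_pmf (\<lambda>v. set_reg r v c) (pmf_of_set {..<regs c s}))"
| "exec w (Jump l) c = return_pmf (c\<lparr>pc := l\<rparr>)"
| "exec w (JumpZero r l) c =
     return_pmf (c\<lparr>pc := (if regs c r = 0 then l else Suc (pc c))\<rparr>)"

definition halted :: "instr list \<Rightarrow> config \<Rightarrow> bool" where
  "halted prog c \<longleftrightarrow> length prog \<le> pc c"

definition step :: "nat \<Rightarrow> instr list \<Rightarrow> config \<Rightarrow> config pmf" where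
  "step w prog c = (if halted prog c then return_pmf c else exec w (prog ! pc c) c)"

text \<open>Distribution of the configuration after \<open>t\<close> time steps.\<close>

primrec run :: "nat \<Rightarrow> instr list \<Rightarrow> nat \<Rightarrow> config \<Rightarrow> config pmf" where
  "run w prog 0 c = return_pmf c"
| "run w prog (Suc t) c = bind_pmf (step w prog c) (run w prog t)"


section \<open>Input, output and cost conventions\<close>

text \<open>
  The registers 0, 1, 2, 3 initially hold \<open>n\<close>, \<open>m\<close>, the alphabet size and \<open>\<lceil>1 / \<epsilon>\<rceil>\<close>; the memory
  holds the text followed by the pattern. Since \<open>\<epsilon>\<close> is an arbitrary real number, the machine only
  sees it through the integer \<open>\<lceil>1 / \<epsilon>\<rceil>\<close>.
\<close>

definition initial_config :: "real \<Rightarrow> nat \<Rightarrow> nat list \<Rightarrow> nat list \<Rightarrow> config" where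
  "initial_config \<epsilon> \<sigma> T P =
     \<lparr>pc = 0,
      regs = (\<lambda>_. 0)(0 := length T, 1 := length P, 2 := \<sigma>, 3 := nat \<lceil>1 / \<epsilon>\<rceil>),
      mem = (\<lambda>a. if a < length T + length P then (T @ P) ! a else 0)\<rparr>"

text \<open>
  On halting, register 0 holds the address of the output array. The \<open>i\<close>-th output is a rational
  number, given as two consecutive words: a numerator and a positive denominator.
\<close>

definition out_num :: "config \<Rightarrow> nat \<Rightarrow> nat" where
  "out_num c i = mem c (regs c 0 + 2 * (i - 1))"

definition out_den :: "config \<Rightarrow> nat \<Rightarrow> nat" where
  "out_den c i = mem c (regs c 0 + 2 * (i - 1) + 1)"

definition correct_output :: "real \<Rightarrow> nat list \<Rightarrow> nat list \<Rightarrow> config \<Rightarrow> bool" where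
  "correct_output \<epsilon> T P c \<longleftrightarrow>
     (\<forall>i \<in> {1..length T - length P + 1}. 0 < out_den c i) \<and>
     approximates_hamming \<epsilon> T P (\<lambda>i. real (out_num c i) / real (out_den c i))"

text \<open>
  As usual inside an \<open>O\<close>-bound, a logarithmic factor is understood to be at least 1; read
  literally, the bound would be 0 for \<open>m = 1\<close> or for a unary alphabet, and negative for \<open>\<epsilon> > 1\<close>.
\<close>

definition lg :: "real \<Rightarrow> real" where
  "lg x = max 1 (log 2 x)"

text \<open>
  For \<open>\<epsilon> \<le> 1\<close> the factor \<open>max 1 (1 / \<epsilon>)\<close> is \<open>1 / \<epsilon>\<close>. For large \<open>\<epsilon>\<close> the linear term has to
  remain, because \<open>n - m + 1\<close> values are written.
\<close>

definition time_bound :: "real \<Rightarrow> nat \<Rightarrow> nat \<Rightarrow> nat \<Rightarrow> real" where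
  "time_bound \<epsilon> n m \<sigma> =
     real n * max 1 (1 / \<epsilon>) * lg (1 / \<epsilon>) * lg (real n) * lg (real m) * lg (real \<sigma>)"

text \<open>
  Word sizes logarithmic in the input parameters, with constant factor \<open>a\<close>. For \<open>a \<ge> 1\<close> all input
  words and their addresses fit into \<open>w\<close> bits.
\<close>

definition admissible_word_size :: "real \<Rightarrow> real \<Rightarrow> nat \<Rightarrow> nat \<Rightarrow> nat \<Rightarrow> nat \<Rightarrow> bool" where
  "admissible_word_size a \<epsilon> n m \<sigma> w \<longleftrightarrow>
     a * log 2 (real n + real m + real \<sigma> + 1 / \<epsilon>) \<le> real w"

end

theory Submission
  imports Defs
begin

text \<open>
  Hash the alphabet at random to \<open>2 * E\<close> letters, where \<open>E = \<lceil>1 / \<epsilon>\<rceil>\<close>. Equal symbols stay equal, so the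
  Hamming distance can only drop, and a mismatch is lost with probability \<open>1 / (2 * E)\<close>; by Markov's
  inequality the distance at a fixed location falls below \<open>1 - 1 / E\<close> times its true value with probability at
  most \<open>1 / 2\<close>. The maximum over \<open>2 * \<lceil>log n\<rceil>\<close> independent hash functions is therefore good at all locations
  with probability at least \<open>1 - 1 / n\<close>.

  For one hash function the distances are computed exactly: the text is cut into blocks of \<open>m\<close> locations, and
  for each letter the cyclic correlation of the indicator vectors, whose length \<open>N\<close> is a power of two between
  \<open>2 * m\<close> and \<open>16 * m\<close>, is obtained from a fast Fourier transform. A word RAM has no complex numbers and no convenient prime
  modulus is known to exist, so the transform uses fixed-point arithmetic with scale \<open>S = N ^ 16\<close>. In every
  level the error grows at most by a factor 4, hence it stays below \<open>1 / 2\<close> and rounding yields the exact integer result.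
\<close>

section \<open>Machine code over the integers\<close>

text \<open>Blocks keep the cost down: n / m blocks, 2 * E letters each and transforms of length N =
  O(m), so m cancels except inside a logarithm. N \<ge> 2 * m suffices because a block of m
  locations touches only 2 * m - 1 text positions, so the cyclic correlation does not wrap there.
  The inverse transform is left unnormalised: what gets rounded is N times an integer, and the
  tolerance is N / 2. Range and accuracy are separate concerns. Machine arrays are shown to equal an
  integer recursion exactly, which requires dividends below S ^ 3 in absolute value, and only that
  recursion is compared with complex numbers. Words that hold 2 * S ^ 3 with S = N ^ 16 account for
  the large word-size constant. Randomness enters through a single instruction, so time, termination
  and failure probability are all bounded by one judgement about expectations, of which
  deterministic code is a special case. Estimates never exceed the true distance, hence a maximum
  over rounds can only improve a location.\<close>

definition enc :: "nat \<Rightarrow> int \<Rightarrow> nat" where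
  "enc w z = nat (z mod 2 ^ w)"

lemma enc_less: "enc w z < 2 ^ w"
  by (simp add: enc_def nat_less_iff)

lemma int_enc: "int (enc w z) = z mod 2 ^ w"
  by (simp add: enc_def)

lemma int_mod: "x < 2 ^ w \<Longrightarrow> int x mod 2 ^ w = int x"
  by (metis mod_less of_nat_mod of_nat_numeral of_nat_power)

lemma enc_eqI: "x < 2 ^ w \<Longrightarrow> int x = z mod 2 ^ w \<Longrightarrow> x = enc w z"
  by (metis int_enc of_nat_eq_iff)

lemma enc_int: "enc w (int x) = x mod 2 ^ w"
  by (simp add: enc_def nat_mod_distrib nat_power_eq)

text \<open>
  Programs are analysed over unbounded integers: a register or memory cell with value \<open>z\<close> stands for
  the word \<open>z mod 2 ^ w\<close>. Only division, comparisons and addresses depend on the representative.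
\<close>

fun ival :: "nat \<Rightarrow> binop \<Rightarrow> int \<Rightarrow> int \<Rightarrow> int" where
  "ival w Add x y = x + y"
| "ival w Sub x y = x - y"
| "ival w Mul x y = x * y"
| "ival w Div x y = (x mod 2 ^ w) div (y mod 2 ^ w)"
| "ival w Less x y = of_bool (x mod 2 ^ w < y mod 2 ^ w)"
| "ival w Equal x y = of_bool (x mod 2 ^ w = y mod 2 ^ w)"
| "ival w f x y = int (binop_val w f (enc w x) (enc w y))"

lemma binop_val_less: "binop_val w f x y < 2 ^ w"
  by (cases f) (auto simp: nat_less_iff)

text \<open>Reduction modulo \<open>2 ^ w\<close> is a ring homomorphism, so \<open>Add\<close>,
  \<open>Sub\<close> and \<open>Mul\<close> commute with it without any range condition. The other
  clauses of \<open>ival\<close> already work on reduced operands.\<close>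

lemma binop_val_enc: "binop_val w f (enc w x) (enc w y) = enc w (ival w f x y)"
proof -
  have [simp]: "int (2 ^ w) = 2 ^ w" by simp
  have a: "int (a mod 2 ^ w) = int a mod 2 ^ w" for a by (simp add: zmod_int)
  \<comment> \<open>A truth value 1 survives the final reduction as soon as \<open>w > 0\<close>;
    for \<open>w = 0\<close> both sides are 0.\<close>
  have o: "1 mod (2 * 2 ^ k) = (1 :: int)" for k :: nat
    using one_less_power[of "2 :: int" "Suc k"] by (simp add: mod_pos_pos_trivial)
  have l: "enc w x < enc w y \<longleftrightarrow> x mod 2 ^ w < y mod 2 ^ w"
    by (metis int_enc of_nat_less_iff)
  have e: "enc w x = enc w y \<longleftrightarrow> x mod 2 ^ w = y mod 2 ^ w"
    by (metis int_enc of_nat_eq_iff)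
  show ?thesis
  proof (cases f)
    case Less
    then show ?thesis using l o by (cases w) (auto simp: enc_def of_bool_def)
  next
    case Equal
    then show ?thesis using e o by (cases w) (auto simp: enc_def of_bool_def)
  next
    case Add
    then show ?thesis by (intro enc_eqI) (simp_all add: zmod_int int_enc mod_simps)
  next
    case Mul
    then show ?thesis by (intro enc_eqI) (simp_all add: zmod_int int_enc mod_simps)
  next
    case Sub
    then show ?thesis
      by (intro enc_eqI) (simp_all add: int_enc mod_simps nat_less_iff)
  next
    case Div
    then show ?thesis by (intro enc_eqI) (simp_all add: zmod_int int_enc zdiv_int)
  qed (use binop_val_less[of w f "enc w x" "enc w y"] in \<open>simp_all add: enc_int\<close>)
qed

section \<open>Symbolic execution over the integers\<close>

type_synonym rfile = "nat \<Rightarrow> int"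
type_synonym memory = "int \<Rightarrow> int"

text \<open>Only cells below \<open>2 ^ w\<close> are constrained: registers hold words, so no
  instruction can address a cell beyond them.\<close>

definition represents :: "nat \<Rightarrow> config \<Rightarrow> rfile \<Rightarrow> memory \<Rightarrow> bool" where
  "represents w c \<rho> \<mu> \<longleftrightarrow>
     (\<forall>r. regs c r = enc w (\<rho> r)) \<and> (\<forall>a < 2 ^ w. mem c a = enc w (\<mu> (int a)))"

text \<open>Continuation-passing with an arbitrary result type lets one symbolic run deliver a
  predicate or a bound in \<open>ennreal\<close>. \<open>Rand\<close> and the jumps fall into the
  default clause; \<open>simple\<close> excludes them wherever a run is tied to the machine.\<close>

fun iexec :: "nat \<Rightarrow> instr \<Rightarrow> rfile \<Rightarrow> memory \<Rightarrow> (rfile \<Rightarrow> memory \<Rightarrow> 'b) \<Rightarrow> 'b" where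
  "iexec w (Const r k) \<rho> \<mu> f = f (\<rho>(r := int k)) \<mu>"
| "iexec w (Arith g r s t) \<rho> \<mu> f = f (\<rho>(r := ival w g (\<rho> s) (\<rho> t))) \<mu>"
| "iexec w (Load r s) \<rho> \<mu> f = f (\<rho>(r := \<mu> (\<rho> s mod 2 ^ w))) \<mu>"
| "iexec w (Store r s) \<rho> \<mu> f = f \<rho> (\<mu>(\<rho> r mod 2 ^ w := \<rho> s))"
| "iexec w _ \<rho> \<mu> f = f \<rho> \<mu>"

primrec iexecs :: "nat \<Rightarrow> instr list \<Rightarrow> rfile \<Rightarrow> memory \<Rightarrow> (rfile \<Rightarrow> memory \<Rightarrow> 'b) \<Rightarrow> 'b" where
  "iexecs w [] \<rho> \<mu> f = f \<rho> \<mu>"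
| "iexecs w (i # is) \<rho> \<mu> f = iexec w i \<rho> \<mu> (\<lambda>\<rho> \<mu>. iexecs w is \<rho> \<mu> f)"

text \<open>The continuation is applied only to the final state, so a run with \<open>Pair\<close>
  determines the run with any other continuation. This is how a postcondition and a bound are
  compared in \<open>hoare_Blk\<close>.\<close>

lemma iexecs_split: "iexecs w is \<rho> \<mu> f = (case iexecs w is \<rho> \<mu> Pair of (\<rho>', \<mu>') \<Rightarrow> f \<rho>' \<mu>')"
proof (induction "is" arbitrary: \<rho> \<mu>)
  case (Cons i "is")
  show ?case
  proof (cases i)
    case (Arith x1 x2 x3 x4)
    show ?thesis unfolding Arith iexecs.simps iexec.simps by (rule Cons)
  next
    case (Load x1 x2)
    show ?thesis unfolding Load iexecs.simps iexec.simps by (rule Cons)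
  next
    case (Store x1 x2)
    show ?thesis unfolding Store iexecs.simps iexec.simps by (rule Cons)
  next
    case (Const x1 x2)
    show ?thesis unfolding Const iexecs.simps iexec.simps by (rule Cons)
  next
    case (Rand x1 x2)
    show ?thesis unfolding Rand iexecs.simps iexec.simps by (rule Cons)
  next
    case (Jump x1)
    show ?thesis unfolding Jump iexecs.simps iexec.simps by (rule Cons)
  next
    case (JumpZero x1 x2)
    show ?thesis unfolding JumpZero iexecs.simps iexec.simps by (rule Cons)
  qed
qed simp

fun simple :: "instr \<Rightarrow> bool" where
  "simple (Rand _ _) = False"
| "simple (Jump _) = False"
| "simple (JumpZero _ _) = False"
| "simple _ = True"

lemma exec_simple:
  assumes "represents w c \<rho> \<mu>" "simple i"
  obtains c' where "exec w i c = return_pmf c'" "pc c' = Suc (pc c)"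
    "iexec w i \<rho> \<mu> (represents w c')"
proof (cases i)
  case (Const r k)
  show thesis
    by (rule that[of "set_reg r (k mod 2 ^ w) c"])
       (use assms Const in \<open>auto simp: represents_def set_reg_def enc_int\<close>)
next
  case (Arith g r s t)
  show thesis
    by (rule that[of "set_reg r (binop_val w g (regs c s) (regs c t)) c"])
       (use assms Arith in \<open>auto simp: represents_def set_reg_def binop_val_enc\<close>)
next
  case (Load r s)
  have "mem c (regs c s) = enc w (\<mu> (\<rho> s mod 2 ^ w))"
    using assms by (simp add: represents_def enc_less int_enc)
  then show thesis
    by (intro that[of "set_reg r (mem c (regs c s)) c"])
       (use assms Load in \<open>auto simp: represents_def set_reg_def\<close>)
next
  case (Store r s)
  have *: "a = enc w (\<rho> r) \<longleftrightarrow> int a = \<rho> r mod 2 ^ w" for a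
    by (metis int_enc of_nat_eq_iff)
  show thesis
    by (rule that[of "c\<lparr>pc := Suc (pc c), mem := (mem c)(regs c r := regs c s)\<rparr>"])
       (use assms Store * in \<open>auto simp: represents_def\<close>)
qed (use assms in auto)

section \<open>Expected failure of a run\<close>

definition expect :: "nat \<Rightarrow> instr list \<Rightarrow> (config \<Rightarrow> ennreal) \<Rightarrow> nat \<Rightarrow> config \<Rightarrow> ennreal" where
  "expect w prog fail T c = (\<integral>\<^sup>+ x. fail x \<partial>measure_pmf (run w prog T c))"

lemma expect_Suc:
  "expect w prog fail (Suc T) c = (\<integral>\<^sup>+ x. expect w prog fail T x \<partial>measure_pmf (step w prog c))"
  by (simp add: expect_def nn_integral_bind_pmf)

definition placed :: "instr list \<Rightarrow> nat \<Rightarrow> instr list \<Rightarrow> bool" where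
  "placed prog l code \<longleftrightarrow> (\<forall>k < length code. l + k < length prog \<and> prog ! (l + k) = code ! k)"

lemma placed_append:
  "placed prog l (a @ b) \<longleftrightarrow> placed prog l a \<and> placed prog (l + length a) b"
proof
  assume *: "placed prog l (a @ b)"
  show "placed prog l a \<and> placed prog (l + length a) b"
    unfolding placed_def
  proof (intro conjI allI impI)
    fix k assume "k < length a"
    then show "l + k < length prog" "prog ! (l + k) = a ! k"
      using *[unfolded placed_def, rule_format, of k] by (auto simp: nth_append)
  next
    fix k assume "k < length b"
    then show "l + length a + k < length prog" "prog ! (l + length a + k) = b ! k"
      using *[unfolded placed_def, rule_format, of "length a + k"] by (auto simp: nth_append add.assoc)
  qed
next
  assume *: "placed prog l a \<and> placed prog (l + length a) b"
  show "placed prog l (a @ b)"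
    unfolding placed_def
  proof (intro allI impI)
    fix k assume k: "k < length (a @ b)"
    show "l + k < length prog \<and> prog ! (l + k) = (a @ b) ! k"
    proof (cases "k < length a")
      case True
      then show ?thesis using * by (auto simp: placed_def nth_append)
    next
      case False
      then have "k - length a < length b" using k by simp
      with * False show ?thesis
        unfolding placed_def by (metis (no_types, lifting) add.assoc le_add_diff_inverse not_less nth_append)
    qed
  qed
qed

lemma placed_Cons:
  "placed prog l (i # is) \<longleftrightarrow> l < length prog \<and> prog ! l = i \<and> placed prog (Suc l) is"
  using placed_append[of prog l "[i]" "is"] by (auto simp: placed_def)

lemma step_placed: "placed prog (pc c) (i # is) \<Longrightarrow> step w prog c = exec w i c"
  by (simp add: placed_Cons step_def halted_def)

section \<open>Structured programs and bounds on expectations\<close>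

datatype com = Blk "instr list" | Seq com com (infixr ";;" 60) | For nat nat com

abbreviation tmp :: nat where "tmp \<equiv> 100"

primrec clen :: "com \<Rightarrow> nat" where
  "clen (Blk is) = length is"
| "clen (a ;; b) = clen a + clen b"
| "clen (For i r b) = clen b + 6"

text \<open>Jump targets are absolute, hence the start address as an argument. A loop has three
  instructions before its body and three after it, so its exit is \<open>l + clen b + 6\<close>; the
  back jump goes to \<open>l + 1\<close>, past the initialisation of the counter.\<close>

primrec compile :: "nat \<Rightarrow> com \<Rightarrow> instr list" where
  "compile l (Blk is) = is"
| "compile l (a ;; b) = compile l a @ compile (l + clen a) b"
| "compile l (For i r b) =
     [Const i 0, Arith Less tmp i r, JumpZero tmp (l + clen b + 6)] @ compile (l + 3) b @
     [Const tmp 1, Arith Add i i tmp, Jump (l + 1)]"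

lemma length_compile [simp]: "length (compile l c) = clen c"
  by (induction c arbitrary: l) auto

text \<open>
  A judgement in continuation-passing style: whatever failure function is evaluated at the end of
  the run, if its expectation is bounded by \<open>g\<close> whenever control leaves \<open>c\<close>, then it is bounded by
  \<open>v\<close> when control enters \<open>c\<close> with \<open>t\<close> more steps to go. A value \<open>\<infinity>\<close> marks excluded states.
\<close>

definition bounds ::
  "nat \<Rightarrow> com \<Rightarrow> nat \<Rightarrow> rfile \<Rightarrow> memory \<Rightarrow> ennreal \<Rightarrow> (rfile \<Rightarrow> memory \<Rightarrow> ennreal) \<Rightarrow> bool" where
  "bounds w c t \<rho> \<mu> v g \<longleftrightarrow>
    (\<forall>prog l x T fail. placed prog l (compile l c) \<longrightarrow> pc x = l \<longrightarrow> represents w x \<rho> \<mu> \<longrightarrow>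
      (\<forall>x' \<rho>' \<mu>'. pc x' = l + clen c \<longrightarrow> represents w x' \<rho>' \<mu>' \<longrightarrow>
         (\<forall>T' \<ge> T. expect w prog fail T' x' \<le> g \<rho>' \<mu>')) \<longrightarrow>
      (\<forall>T' \<ge> T + t. expect w prog fail T' x \<le> v))"

lemma boundsD:
  assumes "bounds w c t \<rho> \<mu> v g" "placed prog l (compile l c)" "pc x = l" "represents w x \<rho> \<mu>"
    "\<And>x' \<rho>' \<mu>' T'. pc x' = l + clen c \<Longrightarrow> represents w x' \<rho>' \<mu>' \<Longrightarrow> T \<le> T' \<Longrightarrow>
       expect w prog fail T' x' \<le> g \<rho>' \<mu>'"
    "T + t \<le> T'"
  shows "expect w prog fail T' x \<le> v"
  using assms unfolding bounds_def by blast

text \<open>The exit function stands in a hypothesis of the judgement, so it may be lowered, whereas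
  the time and the entry bound may be raised.\<close>

lemma bounds_mono:
  assumes "bounds w c t \<rho> \<mu> v g" "t \<le> t'" "v \<le> v'" "\<And>\<rho>' \<mu>'. g' \<rho>' \<mu>' \<le> g \<rho>' \<mu>'"
  shows "bounds w c t' \<rho> \<mu> v' g'"
  unfolding bounds_def
proof (intro allI impI)
  fix prog l x T fail T'
  assume *: "placed prog l (compile l c)" "pc x = l" "represents w x \<rho> \<mu>"
    "\<forall>x' \<rho>' \<mu>'. pc x' = l + clen c \<longrightarrow> represents w x' \<rho>' \<mu>' \<longrightarrow>
         (\<forall>T' \<ge> T. expect w prog fail T' x' \<le> g' \<rho>' \<mu>')" "T + t' \<le> T'"
  have "expect w prog fail T' x \<le> v"
  proof (rule boundsD[OF assms(1) *(1-3), where T = T])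
    fix x' \<rho>' \<mu>' T'
    assume "pc x' = l + clen c" "represents w x' \<rho>' \<mu>'" "T \<le> T'"
    then have "expect w prog fail T' x' \<le> g' \<rho>' \<mu>'" using *(4) by simp
    also have "\<dots> \<le> g \<rho>' \<mu>'" by (fact assms(4))
    finally show "expect w prog fail T' x' \<le> g \<rho>' \<mu>'" .
  qed (use *(5) assms(2) in linarith)
  then show "expect w prog fail T' x \<le> v'" using assms(3) by order
qed

text \<open>Lets the rules quantify over all states: a state outside the intended precondition
  receives the value \<top> and is thereby dealt with.\<close>

lemma bounds_infinity: "bounds w c t \<rho> \<mu> \<top> g"
  by (simp add: bounds_def)

lemma bounds_Blk:
  assumes "list_all simple is" "iexecs w is \<rho> \<mu> g \<le> v"
  shows "bounds w (Blk is) (length is) \<rho> \<mu> v g"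
  unfolding bounds_def
proof (intro allI impI)
  fix prog l x T fail T'
  assume *: "placed prog l (compile l (Blk is))" "pc x = l" "represents w x \<rho> \<mu>"
    "\<forall>x' \<rho>' \<mu>'. pc x' = l + clen (Blk is) \<longrightarrow> represents w x' \<rho>' \<mu>' \<longrightarrow>
         (\<forall>T' \<ge> T. expect w prog fail T' x' \<le> g \<rho>' \<mu>')" "T + length is \<le> T'"
  from assms(1) * have "expect w prog fail T' x \<le> iexecs w is \<rho> \<mu> g"
  proof (induction "is" arbitrary: l x \<rho> \<mu> T')
    case Nil
    then show ?case by simp
  next
    case (Cons i "is")
    obtain x' where x': "exec w i x = return_pmf x'" "pc x' = Suc (pc x)"
      "iexec w i \<rho> \<mu> (represents w x')"
      by (rule exec_simple[of w x \<rho> \<mu> i]) (use Cons.prems in auto)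
    obtain T1 where T1: "T' = Suc T1" using Cons.prems by (cases T') auto
    have st: "step w prog x = return_pmf x'"
      using step_placed[of prog x i "is"] Cons.prems x' by simp
    \<comment> \<open>The induction hypothesis is pushed under \<open>iexec\<close> as an
      implication from \<open>represents\<close>, where it meets the state supplied by
      \<open>exec_simple\<close>.\<close>
    have "iexec w i \<rho> \<mu> (\<lambda>\<rho> \<mu>. represents w x' \<rho> \<mu> \<longrightarrow>
        expect w prog fail T1 x' \<le> iexecs w is \<rho> \<mu> g)"
    proof -
      have "represents w x' \<rho>' \<mu>' \<longrightarrow> expect w prog fail T1 x' \<le> iexecs w is \<rho>' \<mu>' g" for \<rho>' \<mu>'
        by (rule impI, rule Cons.IH[where l = "Suc l"])
           (use Cons.prems x' T1 in \<open>auto simp: placed_Cons\<close>)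
      then show ?thesis by (cases i) auto
    qed
    then have "iexec w i \<rho> \<mu> (\<lambda>\<rho> \<mu>. expect w prog fail T1 x' \<le> iexecs w is \<rho> \<mu> g)"
      using x'(3) by (cases i) auto
    then have "expect w prog fail T1 x' \<le> iexecs w (i # is) \<rho> \<mu> g"
      by (cases i) auto
    then show ?case using T1 st by (simp add: expect_Suc nn_integral_return)
  qed
  then show "expect w prog fail T' x \<le> v" using assms(2) by order
qed

text \<open>The only rule that averages. The register must hold the canonical representative of its
  word, because the range of the draw is read off the word itself.\<close>

lemma bounds_Rand:
  assumes "0 \<le> \<rho> s" "\<rho> s < 2 ^ w" "0 < \<rho> s"
    and "(\<integral>\<^sup>+ v. g (\<rho>(r := int v)) \<mu> \<partial>measure_pmf (pmf_of_set {..<nat (\<rho> s)})) \<le> v"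
  shows "bounds w (Blk [Rand r s]) 1 \<rho> \<mu> v g"
  unfolding bounds_def
proof (intro allI impI)
  fix prog l x T fail T'
  assume *: "placed prog l (compile l (Blk [Rand r s]))" "pc x = l" "represents w x \<rho> \<mu>"
    "\<forall>x' \<rho>' \<mu>'. pc x' = l + clen (Blk [Rand r s]) \<longrightarrow> represents w x' \<rho>' \<mu>' \<longrightarrow>
         (\<forall>T' \<ge> T. expect w prog fail T' x' \<le> g \<rho>' \<mu>')" "T + 1 \<le> T'"
  have s: "regs x s = nat (\<rho> s)" using * assms by (simp add: represents_def enc_def)
  obtain T1 where T1: "T' = Suc T1" "T \<le> T1" using * by (cases T') auto
  have st: "step w prog x = map_pmf (\<lambda>v. set_reg r v x) (pmf_of_set {..<nat (\<rho> s)})"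
    using step_placed[of prog x "Rand r s" "[]"] * assms s by simp
  have "expect w prog fail T' x =
      (\<integral>\<^sup>+ v. expect w prog fail T1 (set_reg r v x) \<partial>measure_pmf (pmf_of_set {..<nat (\<rho> s)}))"
    by (simp add: T1 expect_Suc st)
  also have "\<dots> \<le> (\<integral>\<^sup>+ v. g (\<rho>(r := int v)) \<mu> \<partial>measure_pmf (pmf_of_set {..<nat (\<rho> s)}))"
  proof (rule nn_integral_mono_AE, rule AE_pmfI)
    fix v assume "v \<in> set_pmf (pmf_of_set {..<nat (\<rho> s)})"
    moreover have "{..<nat (\<rho> s)} \<noteq> {}" using assms(3) by (simp add: lessThan_empty_iff bot_nat_def)
    ultimately have "v < nat (\<rho> s)" by (subst (asm) set_pmf_of_set) auto
    then have "v < 2 ^ w" using assms(2)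
      by (metis less_trans nat_less_numeral_power_cancel_iff)
    then have "represents w (set_reg r v x) (\<rho>(r := int v)) \<mu>"
      using *(3) by (auto simp: represents_def set_reg_def enc_int)
    then show "expect w prog fail T1 (set_reg r v x) \<le> g (\<rho>(r := int v)) \<mu>"
      using *(2,4) T1 by (auto simp: set_reg_def)
  qed
  finally show "expect w prog fail T' x \<le> v" using assms(4) by order
qed

text \<open>\<open>h\<close> is the value function between the two programs, a bound on the failure
  still to be expected. Being a function of the state, it can depend on what \<open>a\<close> has
  drawn.\<close>

lemma bounds_Seq:
  assumes "bounds w a t1 \<rho> \<mu> v h" "\<And>\<rho>' \<mu>'. bounds w b t2 \<rho>' \<mu>' (h \<rho>' \<mu>') g" "t1 + t2 \<le> t"
  shows "bounds w (a ;; b) t \<rho> \<mu> v g"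
  unfolding bounds_def
proof (intro allI impI)
  fix prog l x T fail T'
  assume *: "placed prog l (compile l (a ;; b))" "pc x = l" "represents w x \<rho> \<mu>"
    "\<forall>x' \<rho>' \<mu>'. pc x' = l + clen (a ;; b) \<longrightarrow> represents w x' \<rho>' \<mu>' \<longrightarrow>
         (\<forall>T' \<ge> T. expect w prog fail T' x' \<le> g \<rho>' \<mu>')" "T + t \<le> T'"
  show "expect w prog fail T' x \<le> v"
  proof (rule boundsD[OF assms(1) _ *(2,3), where T = "T + t2"])
    show "placed prog l (compile l a)" using * by (simp add: placed_append)
    fix x' \<rho>' \<mu>' T'
    assume **: "pc x' = l + clen a" "represents w x' \<rho>' \<mu>'" "T + t2 \<le> T'"
    show "expect w prog fail T' x' \<le> h \<rho>' \<mu>'"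
      by (rule boundsD[OF assms(2) _ **(1,2) _ **(3)])
         (use * in \<open>auto simp: placed_append add.assoc\<close>)
  qed (use * assms in auto)
qed

text \<open>\<open>f k\<close> is a potential valid before round \<open>k\<close>; the \<top> in the
  exit function of the body forces it to keep the counter and the limit. \<open>upd\<close> accounts
  for loop control itself writing \<open>i\<close> and \<open>tmp\<close>. Five control instructions
  accompany each round; the initialisation and the last, failing test cost three.\<close>

lemma bounds_For:
  assumes r: "\<rho> r = int n" "n < 2 ^ w" and ne: "i \<noteq> r" "i \<noteq> tmp" "r \<noteq> tmp"
    and body: "\<And>k \<rho>' \<mu>'. k < n \<Longrightarrow> \<rho>' i = int k \<Longrightarrow> \<rho>' r = int n \<Longrightarrow>
      bounds w b tb \<rho>' \<mu>' (f k \<rho>' \<mu>')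
        (\<lambda>\<rho>'' \<mu>''. if \<rho>'' i = int k \<and> \<rho>'' r = int n then f (Suc k) \<rho>'' \<mu>'' else \<top>)"
    and upd: "\<And>k \<rho>' \<mu>' x y. k \<le> n \<Longrightarrow> f k (\<rho>'(i := x, tmp := y)) \<mu>' \<le> f k \<rho>' \<mu>'"
    and v: "f 0 \<rho> \<mu> \<le> v"
  shows "bounds w (For i r b) (n * (tb + 5) + 3) \<rho> \<mu> v (f n)"
  unfolding bounds_def
proof (intro allI impI)
  fix prog l x T fail T'
  assume *: "placed prog l (compile l (For i r b))" "pc x = l" "represents w x \<rho> \<mu>"
    and ex: "\<forall>x' \<rho>' \<mu>'. pc x' = l + clen (For i r b) \<longrightarrow> represents w x' \<rho>' \<mu>' \<longrightarrow>
         (\<forall>T' \<ge> T. expect w prog fail T' x' \<le> f n \<rho>' \<mu>')" and T': "T + (n * (tb + 5) + 3) \<le> T'"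
  note pl = *(1)[simplified, unfolded placed_append placed_Cons length_compile, simplified]
  have upd': "f k (\<rho>'(i := x)) \<mu>' \<le> f k \<rho>' \<mu>'" "f k (\<rho>'(tmp := y)) \<mu>' \<le> f k \<rho>' \<mu>'"
    if "k \<le> n" for k \<rho>' \<mu>' x y
    using upd[OF that, of \<rho>' x "\<rho>' tmp" \<mu>'] upd[OF that, of \<rho>' "\<rho>' i" y \<mu>'] ne
    by (simp_all add: fun_upd_idem fun_upd_twist)
  have det: "expect w prog fail (Suc U) y = expect w prog fail U y'"
    if "pc y = p" "p < length prog" "prog ! p = j" "exec w j y = return_pmf y'" for U y y' p j
    using that by (simp add: expect_Suc step_def halted_def nn_integral_return)
  \<comment> \<open>Induction on the number of remaining rounds, started at the loop test
    \<open>l + 1\<close> and not at the entry \<open>l\<close>, which would reset the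
    counter.\<close>
  have loop: "expect w prog fail U y \<le> f k \<rho>' \<mu>'"
    if "k \<le> n" "pc y = l + 1" "represents w y \<rho>' \<mu>'" "\<rho>' i = int k" "\<rho>' r = int n"
      "T + ((n - k) * (tb + 5) + 2) \<le> U" for k y \<rho>' \<mu>' U
    using that
  proof (induction "n - k" arbitrary: k y \<rho>' \<mu>' U)
    case (0 k)
    then have k: "k = n" by simp
    obtain U1 where U1: "U = Suc (Suc U1)" "T \<le> U1"
      using 0 by (cases U; cases "U - 1") auto
    obtain y1 where y1: "exec w (Arith Less tmp i r) y = return_pmf y1" "pc y1 = l + 2"
      "represents w y1 (\<rho>'(tmp := ival w Less (\<rho>' i) (\<rho>' r))) \<mu>'"
      by (rule exec_simple[of w y \<rho>' \<mu>' "Arith Less tmp i r"]) (use 0 in \<open>auto simp del: exec.simps\<close>)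
    have z: "regs y1 tmp = 0" using y1(3) 0 k by (simp add: represents_def enc_def)
    have "expect w prog fail U y = expect w prog fail U1 (y1\<lparr>pc := l + clen b + 6\<rparr>)"
      unfolding U1 using det[OF _ _ _ y1(1), of "Suc l"] 0 pl z
        det[of y1 "Suc (Suc l)" "JumpZero tmp (l + clen b + 6)"] y1
      by auto
    also have "\<dots> \<le> f n (\<rho>'(tmp := ival w Less (\<rho>' i) (\<rho>' r))) \<mu>'"
      using ex y1(3) U1 by (auto simp: represents_def)
    also have "\<dots> \<le> f n \<rho>' \<mu>'" by (rule upd') simp
    finally show ?case using k by simp
  next
    case (Suc d k)
    then have k: "k < n" by simp
    have kw: "k < 2 ^ w" using k r(2) by simp
    have md: "int k mod 2 ^ w = int k" "int n mod 2 ^ w = int n"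
      using int_mod[OF kw] int_mod[OF r(2)] by auto
    have Suc2: "0 < w" using k r(2)
      by (cases w) auto
    have nk: "n - k = Suc (n - Suc k)" using k by simp
    obtain U1 where U1: "U = Suc (Suc U1)" "T + ((n - Suc k) * (tb + 5) + 2) + 3 + tb \<le> U1"
      using Suc.prems(6) unfolding nk by (cases U; cases "U - 1") auto
    obtain y1 where y1: "exec w (Arith Less tmp i r) y = return_pmf y1" "pc y1 = l + 2"
      "represents w y1 (\<rho>'(tmp := ival w Less (\<rho>' i) (\<rho>' r))) \<mu>'"
      by (rule exec_simple[of w y \<rho>' \<mu>' "Arith Less tmp i r"]) (use Suc in \<open>auto simp del: exec.simps\<close>)
    have z: "regs y1 tmp \<noteq> 0" using y1(3) Suc.prems k md Suc2
      by (auto simp: represents_def enc_def)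
    have "expect w prog fail U y = expect w prog fail U1 (y1\<lparr>pc := l + 3\<rparr>)"
      unfolding U1 using det[OF _ _ _ y1(1), of "Suc l"] Suc.prems pl z
        det[of y1 "Suc (Suc l)" "JumpZero tmp (l + clen b + 6)"] y1
      by (auto simp: numeral_3_eq_3)
    also have "\<dots> \<le> f k (\<rho>'(tmp := ival w Less (\<rho>' i) (\<rho>' r))) \<mu>'"
    proof (rule boundsD[OF body, where T = "T + ((n - Suc k) * (tb + 5) + 2) + 3" and l = "l + 3"])
      show "k < n" by (fact k)
      show "placed prog (l + 3) (compile (l + 3) b)" using pl by (simp add: numeral_3_eq_3)
      show "represents w (y1\<lparr>pc := l + 3\<rparr>) (\<rho>'(tmp := ival w Less (\<rho>' i) (\<rho>' r))) \<mu>'"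
        using y1(3) by (simp add: represents_def)
      show "T + ((n - Suc k) * (tb + 5) + 2) + 3 + tb \<le> U1" using U1 by simp
      fix x' \<rho>'' \<mu>'' V
      assume x': "pc x' = l + 3 + clen b" "represents w x' \<rho>'' \<mu>''"
        "T + ((n - Suc k) * (tb + 5) + 2) + 3 \<le> V"
      show "expect w prog fail V x' \<le>
        (if \<rho>'' i = int k \<and> \<rho>'' r = int n then f (Suc k) \<rho>'' \<mu>'' else \<top>)"
      proof (cases "\<rho>'' i = int k \<and> \<rho>'' r = int n")
        case True
        obtain V1 where V1: "V = Suc (Suc (Suc V1))" "T + ((n - Suc k) * (tb + 5) + 2) \<le> V1"
          using x'(3) by (cases V; cases "V - 1"; cases "V - 2") auto
        obtain z1 where z1: "exec w (Const tmp 1) x' = return_pmf z1" "pc z1 = Suc (pc x')"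
          "represents w z1 (\<rho>''(tmp := 1)) \<mu>''"
          by (rule exec_simple[OF x'(2), of "Const tmp 1"]) (auto simp del: exec.simps)
        obtain z2 where z2: "exec w (Arith Add i i tmp) z1 = return_pmf z2" "pc z2 = Suc (pc z1)"
          "represents w z2 (\<rho>''(tmp := 1, i := int k + 1)) \<mu>''"
          by (rule exec_simple[OF z1(3), of "Arith Add i i tmp"]) (use True ne in \<open>auto simp del: exec.simps\<close>)
        have "expect w prog fail V x' = expect w prog fail (Suc (Suc V1)) z1"
          unfolding V1 by (rule det[OF x'(1) _ _ z1(1)]) (use pl in \<open>simp_all add: numeral_3_eq_3\<close>)
        also have "\<dots> = expect w prog fail (Suc V1) z2"
          by (rule det[OF z1(2) _ _ z2(1)]) (use pl x'(1) in \<open>simp_all add: numeral_3_eq_3\<close>)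
        also have "\<dots> = expect w prog fail V1 (z2\<lparr>pc := l + 1\<rparr>)"
          by (rule det[OF z2(2), where j = "Jump (l + 1)"])
             (use pl x'(1) z1(2) in \<open>simp_all add: numeral_3_eq_3\<close>)
        also have "\<dots> \<le> f (Suc k) (\<rho>''(tmp := 1, i := int k + 1)) \<mu>''"
          by (rule Suc.hyps(1))
             (use Suc.hyps k True ne V1 z2(3) in \<open>auto simp: represents_def\<close>)
        also have "\<dots> \<le> f (Suc k) \<rho>'' \<mu>''"
          using upd[of "Suc k" \<rho>'' "int k + 1" 1 \<mu>''] k ne by (simp add: fun_upd_twist)
        finally show ?thesis using True by simp
      qed auto
    qed (use Suc.prems ne in auto)
    also have "\<dots> \<le> f k \<rho>' \<mu>'" using upd' k by simp
    finally show ?case .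
  qed
  obtain x1 where x1: "exec w (Const i 0) x = return_pmf x1" "pc x1 = l + 1"
    "represents w x1 (\<rho>(i := 0)) \<mu>"
    by (rule exec_simple[OF *(3), of "Const i 0"]) (use *(2) in \<open>auto simp del: exec.simps\<close>)
  obtain T1 where T1: "T' = Suc T1" "T + (n * (tb + 5) + 2) \<le> T1" using T' by (cases T') auto
  have "expect w prog fail T' x = expect w prog fail T1 x1"
    unfolding T1 using det[OF *(2) _ _ x1(1)] pl by simp
  also have "\<dots> \<le> f 0 (\<rho>(i := 0)) \<mu>"
    by (rule loop) (use x1 T1 r ne in auto)
  also have "\<dots> \<le> f 0 \<rho> \<mu>" using upd' by simp
  finally show "expect w prog fail T' x \<le> v" using v by order
qed

text \<open>A postcondition for deterministic code, phrased through \<open>bounds\<close>: any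
  number that bounds the failure in all states satisfying \<open>Q\<close> also bounds it on entry.
  Quantifying over \<open>v\<close> keeps the triple independent of the probabilistic quantity being
  tracked.\<close>

definition hoare ::
  "nat \<Rightarrow> com \<Rightarrow> nat \<Rightarrow> rfile \<Rightarrow> memory \<Rightarrow> (rfile \<Rightarrow> memory \<Rightarrow> bool) \<Rightarrow> bool" where
  "hoare w c t \<rho> \<mu> Q \<longleftrightarrow> (\<forall>v. bounds w c t \<rho> \<mu> v (\<lambda>\<rho>' \<mu>'. if Q \<rho>' \<mu>' then v else \<top>))"

text \<open>The bridge back: a deterministic segment of a randomised computation can be used with
  every value function that is at most \<open>v\<close> on \<open>Q\<close>.\<close>

lemma bounds_hoare:
  assumes "hoare w c t \<rho> \<mu> Q" "\<And>\<rho>' \<mu>'. Q \<rho>' \<mu>' \<Longrightarrow> g \<rho>' \<mu>' \<le> v"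
  shows "bounds w c t \<rho> \<mu> v g"
  using assms(1)[unfolded hoare_def, rule_format, of v]
  by (rule bounds_mono) (use assms(2) in auto)

lemma hoare_mono:
  assumes "hoare w c t \<rho> \<mu> Q" "t \<le> t'" "\<And>\<rho>' \<mu>'. Q \<rho>' \<mu>' \<Longrightarrow> Q' \<rho>' \<mu>'"
  shows "hoare w c t' \<rho> \<mu> Q'"
  unfolding hoare_def
  by (rule allI, rule bounds_mono[OF bounds_hoare[OF assms(1)] assms(2) order_refl order_refl])
     (use assms(3) in auto)

lemma hoare_Blk:
  assumes "list_all simple is" "length is = t" "iexecs w is \<rho> \<mu> Q"
  shows "hoare w (Blk is) t \<rho> \<mu> Q"
  unfolding hoare_def assms(2)[symmetric]
  by (rule allI, rule bounds_Blk[OF assms(1)])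
     (use assms(3) in \<open>simp add: iexecs_split[of _ _ _ _ Q] iexecs_split[of _ _ _ _ "\<lambda>\<rho> \<mu>. if Q \<rho> \<mu> then _ else _"] split: prod.splits\<close>)

lemma hoare_Seq:
  assumes "hoare w a t1 \<rho> \<mu> R" "\<And>\<rho>' \<mu>'. R \<rho>' \<mu>' \<Longrightarrow> hoare w b t2 \<rho>' \<mu>' Q" "t1 + t2 \<le> t"
  shows "hoare w (a ;; b) t \<rho> \<mu> Q"
  unfolding hoare_def
proof
  fix v
  show "bounds w (a ;; b) t \<rho> \<mu> v (\<lambda>\<rho>' \<mu>'. if Q \<rho>' \<mu>' then v else \<top>)"
    using assms(1)[unfolded hoare_def, rule_format, of v]
  proof (rule bounds_Seq[OF _ _ assms(3)])
    fix \<rho>' \<mu>'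
    show "bounds w b t2 \<rho>' \<mu>' (if R \<rho>' \<mu>' then v else \<top>) (\<lambda>\<rho>' \<mu>'. if Q \<rho>' \<mu>' then v else \<top>)"
      using assms(2)[unfolded hoare_def] bounds_infinity by simp
  qed
qed

text \<open>The instance of \<open>bounds_For\<close> whose potential is constant on the invariant
  and \<top> outside it.\<close>

lemma hoare_For:
  assumes r: "\<rho> r = int n" "n < 2 ^ w" and ne: "i \<noteq> r" "i \<noteq> tmp" "r \<noteq> tmp"
    and body: "\<And>k \<rho>' \<mu>'. k < n \<Longrightarrow> \<rho>' i = int k \<Longrightarrow> \<rho>' r = int n \<Longrightarrow> I k \<rho>' \<mu>' \<Longrightarrow>
      hoare w b tb \<rho>' \<mu>' (\<lambda>\<rho>'' \<mu>''. \<rho>'' i = int k \<and> \<rho>'' r = int n \<and> I (Suc k) \<rho>'' \<mu>'')"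
    and upd: "\<And>k \<rho>' \<mu>' x y. k \<le> n \<Longrightarrow> I k \<rho>' \<mu>' \<Longrightarrow> I k (\<rho>'(i := x, tmp := y)) \<mu>'"
    and init: "I 0 \<rho> \<mu>"
    and t: "n * (tb + 5) + 3 \<le> t"
  shows "hoare w (For i r b) t \<rho> \<mu> (I n)"
  unfolding hoare_def
proof
  fix v
  define f :: "nat \<Rightarrow> rfile \<Rightarrow> memory \<Rightarrow> ennreal" where "f = (\<lambda>k \<rho>' \<mu>'. if I k \<rho>' \<mu>' then v else \<top>)"
  have f: "f k \<rho>' \<mu>' = v" if "I k \<rho>' \<mu>'" for k \<rho>' \<mu>' using that by (simp add: f_def)
  have nf: "f k \<rho>' \<mu>' = \<top>" if "\<not> I k \<rho>' \<mu>'" for k \<rho>' \<mu>' using that by (simp add: f_def)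
  have "bounds w (For i r b) (n * (tb + 5) + 3) \<rho> \<mu> v (f n)"
  proof (rule bounds_For[where r = r and \<rho> = \<rho> and n = n and i = i, OF r ne])
    fix k \<rho>' \<mu>' assume *: "k < n" "\<rho>' i = int k" "\<rho>' r = int n"
    show "bounds w b tb \<rho>' \<mu>' (f k \<rho>' \<mu>')
       (\<lambda>\<rho>'' \<mu>''. if \<rho>'' i = int k \<and> \<rho>'' r = int n then f (Suc k) \<rho>'' \<mu>'' else \<top>)"
    proof (cases "I k \<rho>' \<mu>'")
      case True
      show ?thesis unfolding f[OF True]
        by (rule bounds_hoare[OF body[OF * True]]) (simp add: f)
    next
      case False
      then show ?thesis by (simp add: bounds_infinity nf)
    qed
  next
    fix k \<rho>' \<mu>' x y assume k: "k \<le> n"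
    show "f k (\<rho>'(i := x, tmp := y)) \<mu>' \<le> f k \<rho>' \<mu>'"
      by (cases "I k \<rho>' \<mu>'") (simp_all add: f nf upd[OF k])
  next
    show "f 0 \<rho> \<mu> \<le> v" using init by (simp add: f)
  qed
  then show "bounds w (For i r b) t \<rho> \<mu> v (\<lambda>\<rho>' \<mu>'. if I n \<rho>' \<mu>' then v else \<top>)"
    by (rule bounds_mono) (auto simp: t f_def)
qed

section \<open>The transform\<close>

text \<open>pi times the binary fraction 0.b0 b1 b2 ... where n = b0 + 2 * b1 + 4 * b2 + ...: the
  digits are read in reverse, matching the bit-reversed order of the transform's output.\<close>

fun bitrev_angle :: "nat \<Rightarrow> real" where
  "bitrev_angle n = (if n = 0 then 0 else bitrev_angle (n div 2) / 2 + (if odd n then pi / 2 else 0))"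

declare bitrev_angle.simps [simp del]

definition tw :: "nat \<Rightarrow> complex" where
  "tw n = cis (bitrev_angle n)"

text \<open>The constant c of the modulus \<open>x ^ L - c\<close> that belongs to block
  \<open>b\<close>. The two children of a block carry the opposite square roots of its own
  constant.\<close>

definition block_const :: "nat \<Rightarrow> complex" where
  "block_const b = (if even b then tw (b div 2) else - tw (b div 2))"

lemma bitrev_angle_0 [simp]: "bitrev_angle 0 = 0"
  by (simp add: bitrev_angle.simps)

lemma tw_0 [simp]: "tw 0 = 1"
  by (simp add: tw_def)

lemma norm_tw [simp]: "norm (tw n) = 1"
  by (simp add: tw_def)

lemma tw_mult_cnj [simp]: "tw n * cnj (tw n) = 1"
  by (simp add: tw_def cis_cnj cis_mult)

text \<open>Doubling the angle turns its halved part into the angle of \<open>n div 2\<close>, and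
  the summand pi / 2 of an odd index into pi, a sign. Hence
  \<open>x ^ (2 * L) - block_const n\<close> factors into \<open>x ^ L - tw n\<close> and
  \<open>x ^ L + tw n\<close>.\<close>

lemma tw_power2: "tw n ^ 2 = block_const n"
proof (cases "n = 0")
  case False
  have pi: "cis (x + pi) = - cis x" for x by (simp add: complex_eq_iff)
  from False show ?thesis
    by (subst tw_def, subst bitrev_angle.simps)
       (auto simp: block_const_def tw_def power2_eq_square cis_mult add.assoc pi)
qed (simp add: block_const_def)

text \<open>A new leading bit of the index becomes the last digit of the reversed fraction. This is
  what allows the table of twiddle factors to be built by doubling.\<close>

lemma bitrev_angle_add:
  "b < 2 ^ k \<Longrightarrow> bitrev_angle (b + 2 ^ k) = bitrev_angle b + pi / 2 ^ (k + 1)"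
proof (induction k arbitrary: b)
  case 0
  have "bitrev_angle (Suc 0) = pi / 2" by (subst bitrev_angle.simps) simp
  with 0 show ?case by simp
next
  case (Suc k)
  have d: "(b + 2 ^ Suc k) div 2 = b div 2 + 2 ^ k" by simp
  have lt: "b div 2 < 2 ^ k" using Suc.prems by auto
  have "bitrev_angle (b + 2 ^ Suc k) =
      bitrev_angle (b div 2 + 2 ^ k) / 2 + (if odd b then pi / 2 else 0)"
    by (subst bitrev_angle.simps) (simp only: d, simp)
  also have "\<dots> = bitrev_angle (b div 2) / 2 + (if odd b then pi / 2 else 0) + pi / 2 ^ (Suc k + 1)"
    using Suc.IH[OF lt] by (simp add: field_simps)
  also have "bitrev_angle (b div 2) / 2 + (if odd b then pi / 2 else 0) = bitrev_angle b"
    by (cases "b = 0") (simp_all add: bitrev_angle.simps[of b])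
  finally show ?case .
qed

lemma tw_add: "b < 2 ^ k \<Longrightarrow> tw (b + 2 ^ k) = tw b * cis (pi / 2 ^ (k + 1))"
  by (simp add: tw_def bitrev_angle_add cis_mult)

lemma norm_block_const [simp]: "norm (block_const b) = 1"
  by (simp add: block_const_def)

text \<open>Squaring a block constant halves its index, so \<open>d\<close> squarings bring an index
  below \<open>2 ^ d\<close> down to 0. The evaluation points of the transform are therefore roots
  of unity of order dividing its length.\<close>

lemma block_const_power: "b < 2 ^ d \<Longrightarrow> block_const b ^ (2 ^ d) = 1"
proof (induction d arbitrary: b)
  case 0
  then show ?case by (simp add: block_const_def)
next
  case (Suc d)
  have lt: "b div 2 < 2 ^ d" using Suc.prems by auto
  have "block_const b ^ (2 ^ Suc d) = (block_const b ^ 2) ^ (2 ^ d)" by (simp add: power_mult)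
  also have "block_const b ^ 2 = tw (b div 2) ^ 2" by (simp add: block_const_def)
  also have "\<dots> = block_const (b div 2)" by (rule tw_power2)
  finally show ?case using Suc.IH[OF lt] by simp
qed

text \<open>
  One level of the transform reduces, in every block of length \<open>2 * L\<close> of the array, a polynomial
  modulo \<open>x ^ (2 * L) - c\<^sup>2\<close> to its residues modulo \<open>x ^ L - c\<close> and \<open>x ^ L + c\<close>.
\<close>

definition fstep :: "nat \<Rightarrow> (nat \<Rightarrow> complex) \<Rightarrow> nat \<Rightarrow> complex" where
  "fstep L F p = (if p mod (2 * L) < L then F p + tw (p div (2 * L)) * F (p + L)
     else F (p - L) - tw (p div (2 * L)) * F p)"

text \<open>Inverse of \<open>fstep\<close> up to a factor 2. The halving is omitted in every level
  and made up for by a single division at the end.\<close>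

definition bstep :: "nat \<Rightarrow> (nat \<Rightarrow> complex) \<Rightarrow> nat \<Rightarrow> complex" where
  "bstep L F p = (if p mod (2 * L) < L then F p + F (p + L)
     else (F (p - L) - F p) * cnj (tw (p div (2 * L))))"

lemma low_half:
  fixes p L :: nat
  assumes "p mod (2 * L) < L"
  shows "(p + L) div (2 * L) = p div (2 * L)" "\<not> (p + L) mod (2 * L) < L"
proof -
  define q where "q = p div (2 * L)"
  define r where "r = p mod (2 * L)"
  have p: "p = 2 * L * q + r" by (simp add: q_def r_def)
  have r: "r + L < 2 * L" using assms by (simp add: r_def)
  have e: "p + L = (r + L) + 2 * L * q" using p by simp
  have L: "2 * L \<noteq> 0" using r by auto
  show "(p + L) div (2 * L) = p div (2 * L)"
    unfolding e q_def[symmetric] div_mult_self2[OF L] using r by simp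
  show "\<not> (p + L) mod (2 * L) < L"
    unfolding e mod_mult_self2 using r by simp
qed

lemma high_half:
  fixes p L :: nat
  assumes "\<not> p mod (2 * L) < L" "0 < L"
  shows "(p - L) div (2 * L) = p div (2 * L)" "(p - L) mod (2 * L) < L" "L \<le> p"
proof -
  define q where "q = p div (2 * L)"
  define r where "r = p mod (2 * L)"
  have p: "p = 2 * L * q + r" by (simp add: q_def r_def)
  have r: "L \<le> r" "r < 2 * L" using assms by (simp_all add: r_def)
  have e: "p - L = (r - L) + 2 * L * q" using p r by simp
  have L: "2 * L \<noteq> 0" using assms by simp
  show "(p - L) div (2 * L) = p div (2 * L)"
    unfolding e q_def[symmetric] div_mult_self2[OF L] using r by simp
  show "(p - L) mod (2 * L) < L"
    unfolding e mod_mult_self2 using r by simp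
  show "L \<le> p" using p r by simp
qed

lemma bstep_fstep:
  assumes "0 < L"
  shows "bstep L (fstep L F) p = 2 * F p"
proof (cases "p mod (2 * L) < L")
  case True
  note low = low_half[OF True]
  have "bstep L (fstep L F) p = (F p + tw (p div (2 * L)) * F (p + L)) +
      (F (p + L - L) - tw ((p + L) div (2 * L)) * F (p + L))"
    using True low(2) by (simp add: bstep_def fstep_def)
  then show ?thesis by (simp add: low(1))
next
  case False
  note high = high_half[OF False assms]
  let ?t = "tw (p div (2 * L))"
  have "bstep L (fstep L F) p =
      ((F (p - L) + ?t * F (p - L + L)) - (F (p - L) - ?t * F p)) * cnj ?t"
    using False high by (simp add: bstep_def fstep_def)
  also have "\<dots> = 2 * F p * (?t * cnj ?t)" using high(3) by (simp add: algebra_simps)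
  finally show ?thesis by simp
qed

lemma bstep_scale: "bstep L (\<lambda>p. c * F p) p = c * bstep L F p"
  by (simp add: bstep_def algebra_simps)

lemma step_index:
  fixes p L N :: nat
  assumes "2 * L dvd N" "p < N" "0 < L"
  shows "p mod (2 * L) < L \<Longrightarrow> p + L < N" "p div (2 * L) < N"
proof -
  obtain k where k: "N = 2 * L * k" using assms by auto
  have "p div (2 * L) \<le> p" by simp
  then show "p div (2 * L) < N" using assms by linarith
  assume l: "p mod (2 * L) < L"
  have q: "p div (2 * L) < k" using assms(2,3) k by (simp add: less_mult_imp_div_less mult.commute)
  have "p + L < 2 * L * (p div (2 * L)) + 2 * L" using l
    by (metis add_less_mono1 group_cancel.add1 mult_2 mult_div_mod_eq nat_add_left_cancel_less add.assoc)
  also have "\<dots> = 2 * L * Suc (p div (2 * L))" by simp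
  also have "\<dots> \<le> N" unfolding k using q by (intro mult_le_mono2) simp
  finally show "p + L < N" .
qed

lemma bstep_cong:
  assumes "2 * L dvd N" "p < N" "0 < L" "\<And>p. p < N \<Longrightarrow> F p = G p"
  shows "bstep L F p = bstep L G p"
  using assms step_index(1)[OF assms(1-3)] unfolding bstep_def by auto

section \<open>Iterated levels and their closed form\<close>

primrec forward :: "nat \<Rightarrow> nat \<Rightarrow> (nat \<Rightarrow> complex) \<Rightarrow> nat \<Rightarrow> complex" where
  "forward \<kappa> 0 F = F"
| "forward \<kappa> (Suc d) F = fstep (2 ^ (\<kappa> - Suc d)) (forward \<kappa> d F)"

primrec backward :: "nat \<Rightarrow> (nat \<Rightarrow> complex) \<Rightarrow> nat \<Rightarrow> complex" where
  "backward 0 F = F"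
| "backward (Suc d) F = bstep (2 ^ d) (backward d F)"

lemma backward_cong:
  assumes "\<And>p. p < 2 ^ \<kappa> \<Longrightarrow> F p = G p" "d \<le> \<kappa>" "p < 2 ^ \<kappa>"
  shows "backward d F p = backward d G p"
  using assms(2,3)
proof (induction d arbitrary: p)
  case (Suc d)
  have "(2 :: nat) * 2 ^ d dvd 2 ^ \<kappa>" using Suc.prems(1) le_imp_power_dvd[of "Suc d" \<kappa> "2 :: nat"] by simp
  then show ?case unfolding backward.simps
    by (rule bstep_cong) (use Suc in auto)
qed (use assms in simp)

text \<open>Undoing the last \<open>d\<close> of the \<kappa> levels leads back to the state after
  \<kappa> - d levels; each matching pair of steps contributes a factor 2.\<close>

lemma backward_forward_aux:
  "d \<le> \<kappa> \<Longrightarrow> backward d (forward \<kappa> \<kappa> F) p = 2 ^ d * forward \<kappa> (\<kappa> - d) F p"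
proof (induction d arbitrary: p)
  case (Suc d)
  obtain e where e: "\<kappa> - d = Suc e" "\<kappa> - Suc d = e" "\<kappa> - Suc e = d" using Suc.prems by (cases "\<kappa> - d") auto
  have "backward d (forward \<kappa> \<kappa> F) = (\<lambda>p. 2 ^ d * forward \<kappa> (Suc e) F p)"
    using Suc e by auto
  then have "backward (Suc d) (forward \<kappa> \<kappa> F) p = 2 ^ d * bstep (2 ^ d) (fstep (2 ^ d) (forward \<kappa> e F)) p"
    by (simp add: bstep_scale e)
  then show ?case by (simp add: bstep_fstep e)
qed simp

lemma backward_forward: "backward \<kappa> (forward \<kappa> \<kappa> F) p = 2 ^ \<kappa> * F p"
  by (simp add: backward_forward_aux)

lemma sum_even_odd: "(\<Sum>i<2 * n. g i) = (\<Sum>i<n. g (2 * i)) + (\<Sum>i<n. g (2 * i + 1 :: nat))"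
  for g :: "nat \<Rightarrow> complex"
  by (induction n) (auto simp: algebra_simps)

text \<open>After \<open>d\<close> levels the array holds the residues of the input polynomial
  modulo \<open>x ^ L - block_const b\<close> for the blocks \<open>b\<close> of length L = 2 ^
  (\<kappa> - d). Reduction replaces \<open>x ^ L\<close> by the constant, so coefficients at
  distance L are collected. For d = \<kappa> this is evaluation at
  \<open>block_const p\<close>.\<close>

lemma forward_eq:
  assumes "d \<le> \<kappa>" "p < 2 ^ \<kappa>"
  shows "forward \<kappa> d F p =
    (\<Sum>i<2 ^ d. F (p mod 2 ^ (\<kappa> - d) + i * 2 ^ (\<kappa> - d)) * block_const (p div 2 ^ (\<kappa> - d)) ^ i)"
  using assms
proof (induction d arbitrary: p)
  case 0
  then show ?case by simp
next
  case (Suc d)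
  define L :: nat where "L = 2 ^ (\<kappa> - Suc d)"
  have L: "0 < L" by (simp add: L_def)
  have L2: "2 ^ (\<kappa> - d) = 2 * L"
    using Suc.prems(1) by (simp add: L_def Suc_diff_Suc flip: power_Suc)
  have dv: "2 * L dvd 2 ^ \<kappa>" unfolding L2[symmetric] by (rule le_imp_power_dvd) simp
  define b where "b = p div (2 * L)"
  have eo: "block_const (2 * b) = tw b" "block_const (Suc (2 * b)) = - tw b" by (simp_all add: block_const_def)
  have IH: "forward \<kappa> d F q = (\<Sum>i<2 ^ d. F (q mod (2 * L) + i * (2 * L)) * block_const (q div (2 * L)) ^ i)"
    if "q < 2 ^ \<kappa>" for q using Suc.IH[of q] Suc.prems that by (simp add: L2)
  \<comment> \<open>The constant of the parent block is the square of \<open>tw b\<close>, so its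
    powers supply the even exponents; the factor \<open>tw b\<close> of the butterfly supplies the
    odd ones.\<close>
  have bc: "block_const (p div (2 * L)) ^ i = tw b ^ (2 * i)" for i
    by (simp add: power_mult tw_power2 b_def)
  note idx = step_index[OF dv Suc.prems(2) L]
  show ?case
  proof (cases "p mod (2 * L) < L")
    case True
    note low = low_half[OF True]
    have pL: "p mod L = p mod (2 * L)" "p div L = 2 * b"
    proof -
      have "p = 2 * L * b + p mod (2 * L)" by (simp add: b_def)
      then have e: "p = p mod (2 * L) + L * (2 * b)" by simp
      show "p mod L = p mod (2 * L)"
        by (subst (1) e, subst mod_mult_self2) (use True in simp)
      show "p div L = 2 * b"
        by (subst (1) e, subst div_mult_self2) (use True L in simp_all)
    qed
    have m: "(p + L) mod (2 * L) = p mod (2 * L) + L"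
    proof -
      have e: "p + L = (p mod (2 * L) + L) + 2 * L * b" using mult_div_mod_eq[of "2 * L" p] by (simp add: b_def)
      show ?thesis by (subst e, subst mod_mult_self2) (use True in simp)
    qed
    have "forward \<kappa> (Suc d) F p = forward \<kappa> d F p + tw b * forward \<kappa> d F (p + L)"
      using True by (simp add: fstep_def b_def L_def)
    also have "\<dots> = (\<Sum>i<2 ^ d. F (p mod L + (2 * i) * L) * tw b ^ (2 * i)) +
        (\<Sum>i<2 ^ d. F (p mod L + (2 * i + 1) * L) * tw b ^ (2 * i + 1))"
      unfolding IH[OF Suc.prems(2)] IH[OF idx(1)[OF True]] low(1) m pL(1) bc
      by (simp add: b_def[symmetric] sum_distrib_left algebra_simps)
    also have "\<dots> = (\<Sum>i<2 ^ Suc d. F (p mod L + i * L) * tw b ^ i)"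
      by (simp only: power_Suc sum_even_odd)
    finally show ?thesis unfolding L_def[symmetric] pL(2) eo .
  next
    case False
    note high = high_half[OF False L]
    have pL: "p mod L = (p - L) mod (2 * L)" "p div L = Suc (2 * b)" "p mod (2 * L) = p mod L + L"
    proof -
      have "p - L = 2 * L * b + (p - L) mod (2 * L)" using high(1) by (simp add: b_def) (metis mult_div_mod_eq mult.assoc)
      then have p: "p = (p - L) mod (2 * L) + L * Suc (2 * b)" using high(3) by simp
      have 1: "p mod L = (p - L) mod (2 * L)"
        by (subst (1) p, subst mod_mult_self2) (use high(2) in simp)
      show "p mod L = (p - L) mod (2 * L)" by (fact 1)
      show "p div L = Suc (2 * b)"
        by (subst (1) p, subst div_mult_self2) (use high(2) L in simp_all)
      have e: "p = (p mod L + L) + 2 * L * b" unfolding 1 using p by simp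
      show "p mod (2 * L) = p mod L + L"
        by (subst (1) e, subst mod_mult_self2) (use 1 high in simp)
    qed
    have "forward \<kappa> (Suc d) F p = forward \<kappa> d F (p - L) - tw b * forward \<kappa> d F p"
      using False by (simp add: fstep_def b_def L_def)
    also have "\<dots> = (\<Sum>i<2 ^ d. F (p mod L + (2 * i) * L) * (- tw b) ^ (2 * i)) +
        (\<Sum>i<2 ^ d. F (p mod L + (2 * i + 1) * L) * (- tw b) ^ (2 * i + 1))"
    proof -
      have pl: "p - L < 2 ^ \<kappa>" using Suc.prems(2) by simp
      show ?thesis
        unfolding IH[OF Suc.prems(2)] IH[OF pl] high(1) pL(1)[symmetric] pL(3) bc
        by (simp add: b_def[symmetric] sum_distrib_left sum_negf algebra_simps)
    qed
    also have "\<dots> = (\<Sum>i<2 ^ Suc d. F (p mod L + i * L) * (- tw b) ^ i)"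
      by (simp only: power_Suc sum_even_odd)
    finally show ?thesis unfolding L_def[symmetric] pL(2) eo .
  qed
qed

definition correlate :: "nat \<Rightarrow> (nat \<Rightarrow> complex) \<Rightarrow> (nat \<Rightarrow> complex) \<Rightarrow> nat \<Rightarrow> complex" where
  "correlate N f g c = (\<Sum>j<N. f ((c + j) mod N) * g j)"

text \<open>On the unit circle the conjugate of the value of a real polynomial is its value at the
  inverse point, and multiplication by the inverse of \<open>z ^ j\<close> rotates the coefficients
  of \<open>f\<close> by \<open>j\<close>, because \<open>z ^ N = 1\<close>. Summing with the
  weights \<open>g j\<close> yields a correlation instead of a convolution.\<close>

lemma forward_correlate:
  assumes "p < 2 ^ \<kappa>" "\<And>j. cnj (g j) = g j"
  shows "forward \<kappa> \<kappa> f p * cnj (forward \<kappa> \<kappa> g p) = forward \<kappa> \<kappa> (correlate (2 ^ \<kappa>) f g) p"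
proof -
  define N :: nat where "N = 2 ^ \<kappa>"
  define z where "z = block_const p"
  have N: "0 < N" by (simp add: N_def)
  have zN: "z ^ N = 1" unfolding z_def N_def by (rule block_const_power) (use assms in simp)
  have zz: "z * cnj z = 1" unfolding z_def by (metis complex_norm_square norm_block_const of_real_1 power_one)
  have zmod: "z ^ (i mod N) = z ^ i" for i
    by (metis mult_div_mod_eq power_add power_mult power_one zN mult_1)
  have shift: "(\<Sum>i<N. f i * z ^ i) * cnj z ^ j = (\<Sum>c<N. f ((c + j) mod N) * z ^ c)" for j
  proof -
    \<comment> \<open>Rotation permutes the index set, so the sum can be reindexed by it.\<close>
    have inj: "inj_on (\<lambda>c. (c + j) mod N) {..<N}"
    proof (rule inj_onI)
      fix a b assume ab: "a \<in> {..<N}" "b \<in> {..<N}" and eq: "(a + j) mod N = (b + j) mod N"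
      have "int a mod int N = int b mod int N"
      proof -
        have "(int a + int j) mod int N = (int b + int j) mod int N" using eq by (metis of_nat_add of_nat_mod)
        then have "((int a + int j) - int j) mod int N = ((int b + int j) - int j) mod int N"
          by (metis mod_diff_left_eq)
        then show ?thesis by simp
      qed
      with ab show "a = b" by simp
    qed
    have "bij_betw (\<lambda>c. (c + j) mod N) {..<N} {..<N}"
      unfolding bij_betw_def
      by (intro conjI inj endo_inj_surj[OF _ _ inj]) (use N in auto)
    then have "(\<Sum>i<N. f i * z ^ i) = (\<Sum>c<N. f ((c + j) mod N) * z ^ ((c + j) mod N))"
      by (rule sum.reindex_bij_betw[symmetric])
    also have "\<dots> = (\<Sum>c<N. f ((c + j) mod N) * z ^ c) * z ^ j"
      by (simp add: zmod power_add sum_distrib_right mult.assoc)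
    finally have "(\<Sum>i<N. f i * z ^ i) * cnj z ^ j = (\<Sum>c<N. f ((c + j) mod N) * z ^ c) * (z ^ j * cnj z ^ j)"
      by (simp add: mult.assoc)
    also have "z ^ j * cnj z ^ j = 1" using zz by (metis power_mult_distrib power_one)
    finally show ?thesis by simp
  qed
  have fw: "forward \<kappa> \<kappa> F p = (\<Sum>i<N. F i * z ^ i)" for F
    using forward_eq[of \<kappa> \<kappa> p F] assms by (simp add: N_def z_def)
  have "forward \<kappa> \<kappa> f p * cnj (forward \<kappa> \<kappa> g p) = (\<Sum>j<N. (\<Sum>i<N. f i * z ^ i) * cnj z ^ j * g j)"
    unfolding fw by (simp add: sum_distrib_left cnj_sum assms mult_ac)
  also have "\<dots> = (\<Sum>j<N. \<Sum>c<N. f ((c + j) mod N) * g j * z ^ c)"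
    unfolding shift by (simp add: sum_distrib_right sum_distrib_left mult_ac)
  also have "\<dots> = (\<Sum>c<N. correlate N f g c * z ^ c)"
    by (subst sum.swap) (simp add: correlate_def sum_distrib_right)
  finally show ?thesis unfolding fw N_def .
qed

section \<open>Fixed-point arithmetic\<close>

type_synonym ipair = "int \<times> int"

definition cx :: "int \<Rightarrow> ipair \<Rightarrow> complex" where
  "cx S z = Complex (of_int (fst z) / of_int S) (of_int (snd z) / of_int S)"

definition fmul :: "int \<Rightarrow> ipair \<Rightarrow> ipair \<Rightarrow> ipair" where
  "fmul S a b = ((fst a * fst b - snd a * snd b) div S, (fst a * snd b + snd a * fst b) div S)"

definition cj :: "ipair \<Rightarrow> ipair" where
  "cj z = (fst z, - snd z)"

lemma cx_add: "cx S (a + b) = cx S a + cx S b"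
  by (simp add: cx_def add_divide_distrib complex_eq_iff)

lemma cx_diff: "cx S (a - b) = cx S a - cx S b"
  by (simp add: cx_def diff_divide_distrib complex_eq_iff)

lemma cx_cj: "cx S (cj a) = cnj (cx S a)"
  by (simp add: cx_def cj_def complex_eq_iff)

lemma div_error:
  fixes t S :: int
  assumes "0 < S"
  shows "real_of_int (t div S) \<le> of_int t / of_int S" "of_int t / of_int S < real_of_int (t div S) + 1"
proof -
  have "t div S = \<lfloor>real_of_int t / of_int S\<rfloor>" by (simp add: floor_divide_of_int_eq)
  then show "real_of_int (t div S) \<le> of_int t / of_int S" "of_int t / of_int S < real_of_int (t div S) + 1"
    by linarith+
qed

text \<open>Rounding down costs each component at most one unit, that is 1 / S, and the norm is at
  most the sum of both losses.\<close>

lemma cx_fmul: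
  assumes "0 < S"
  shows "norm (cx S (fmul S a b) - cx S a * cx S b) \<le> 2 / of_int S"
proof -
  have *: "\<bar>real_of_int (t div S) / of_int S - of_int t / (of_int S * of_int S)\<bar> \<le> 1 / of_int S" for t
  proof -
    have "real_of_int (t div S) / of_int S - of_int t / (of_int S * of_int S) =
        (real_of_int (t div S) - of_int t / of_int S) / of_int S"
      using assms by (simp add: field_simps)
    also have "\<bar>\<dots>\<bar> \<le> 1 / of_int S"
    proof -
      have "\<bar>real_of_int (t div S) - of_int t / of_int S\<bar> \<le> 1" using div_error[OF assms, of t] by linarith
      then show ?thesis using assms by (simp only: abs_divide) (simp add: divide_right_mono)
    qed
    finally show ?thesis .
  qed
  let ?d = "cx S (fmul S a b) - cx S a * cx S b"
  have "\<bar>Re ?d\<bar> \<le> 1 / of_int S" "\<bar>Im ?d\<bar> \<le> 1 / of_int S"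
    using *[of "fst a * fst b - snd a * snd b"] *[of "fst a * snd b + snd a * fst b"]
    by (simp_all add: cx_def fmul_def diff_divide_distrib add_divide_distrib)
  then show ?thesis using cmod_le[of ?d] by simp
qed

lemma cx_component:
  assumes "norm (cx S z) \<le> r" "0 < S"
  shows "\<bar>real_of_int (fst z)\<bar> \<le> r * of_int S" "\<bar>real_of_int (snd z)\<bar> \<le> r * of_int S"
proof -
  have "\<bar>real_of_int (fst z) / of_int S\<bar> \<le> r" "\<bar>real_of_int (snd z) / of_int S\<bar> \<le> r"
    using abs_Re_le_cmod[of "cx S z"] abs_Im_le_cmod[of "cx S z"] assms(1) by (simp_all add: cx_def)
  then show "\<bar>real_of_int (fst z)\<bar> \<le> r * of_int S" "\<bar>real_of_int (snd z)\<bar> \<le> r * of_int S"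
    using assms(2) by (simp_all add: field_simps)
qed

text \<open>The splitting pairs the error of the first factor with the computed second factor, and
  the error of the second with the exact first factor; hence the asymmetric bounds \<open>A\<close>
  on \<open>a\<close> and \<open>B\<close> on \<open>b'\<close>.\<close>

lemma mult_error:
  fixes a b a' b' :: complex
  assumes "norm (a' - a) \<le> e" "norm (b' - b) \<le> d" "norm a \<le> A" "norm b' \<le> B" "0 \<le> e" "0 \<le> d"
  shows "norm (a' * b' - a * b) \<le> e * B + A * d"
proof -
  have "a' * b' - a * b = (a' - a) * b' + a * (b' - b)" by (simp add: algebra_simps)
  also have "norm \<dots> \<le> norm (a' - a) * norm b' + norm a * norm (b' - b)"
    by (metis norm_mult norm_triangle_ineq)
  also have "\<dots> \<le> e * B + A * d"
    using assms by (intro add_mono mult_mono) (auto intro: order_trans[OF norm_ge_zero])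
  finally show ?thesis .
qed

lemma fmul_error:
  assumes S: "0 < S" and "norm (cx S a' - a) \<le> e" "norm (cx S b' - b) \<le> d" "norm a \<le> A" "norm (cx S b') \<le> B"
    "0 \<le> e" "0 \<le> d"
  shows "norm (cx S (fmul S a' b') - a * b) \<le> e * B + A * d + 2 / of_int S"
proof -
  have "norm (cx S (fmul S a' b') - a * b) \<le>
      norm (cx S (fmul S a' b') - cx S a' * cx S b') + norm (cx S a' * cx S b' - a * b)"
    using norm_triangle_ineq[of "cx S (fmul S a' b') - cx S a' * cx S b'" "cx S a' * cx S b' - a * b"] by simp
  then show ?thesis using cx_fmul[OF S, of a' b'] mult_error[OF assms(2-7)] by linarith
qed

section \<open>Rounded levels of the transform\<close>

definition ifstep :: "int \<Rightarrow> (nat \<Rightarrow> ipair) \<Rightarrow> nat \<Rightarrow> (nat \<Rightarrow> ipair) \<Rightarrow> nat \<Rightarrow> ipair" where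
  "ifstep S t L F p = (if p mod (2 * L) < L then F p + fmul S (F (p + L)) (t (p div (2 * L)))
     else F (p - L) - fmul S (F p) (t (p div (2 * L))))"

definition ibstep :: "int \<Rightarrow> (nat \<Rightarrow> ipair) \<Rightarrow> nat \<Rightarrow> (nat \<Rightarrow> ipair) \<Rightarrow> nat \<Rightarrow> ipair" where
  "ibstep S t L F p = (if p mod (2 * L) < L then F p + F (p + L)
     else fmul S (F (p - L) - F p) (cj (t (p div (2 * L)))))"

primrec iforward :: "int \<Rightarrow> (nat \<Rightarrow> ipair) \<Rightarrow> nat \<Rightarrow> nat \<Rightarrow> (nat \<Rightarrow> ipair) \<Rightarrow> nat \<Rightarrow> ipair" where
  "iforward S t \<kappa> 0 F = F"
| "iforward S t \<kappa> (Suc d) F = ifstep S t (2 ^ (\<kappa> - Suc d)) (iforward S t \<kappa> d F)"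

primrec ibackward :: "int \<Rightarrow> (nat \<Rightarrow> ipair) \<Rightarrow> nat \<Rightarrow> (nat \<Rightarrow> ipair) \<Rightarrow> nat \<Rightarrow> ipair" where
  "ibackward S t 0 F = F"
| "ibackward S t (Suc d) F = ibstep S t (2 ^ d) (ibackward S t d F)"

definition near :: "nat \<Rightarrow> int \<Rightarrow> real \<Rightarrow> (nat \<Rightarrow> ipair) \<Rightarrow> (nat \<Rightarrow> complex) \<Rightarrow> bool" where
  "near N S e F G \<longleftrightarrow> (\<forall>p < N. norm (cx S (F p) - G p) \<le> e)"

lemma near_mono: "near N S e F G \<Longrightarrow> e \<le> e' \<Longrightarrow> near N S e' F G"
  by (force simp: near_def)

text \<open>The input that is not multiplied contributes e, the other one 2 * e, since the computed
  twiddle factor has norm at most 2. The bound 4 * e is chosen to serve the backward step as well;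
  the additive part comes from the twiddle error and the rounding.\<close>

lemma near_ifstep:
  assumes F: "near N S e F G" and G: "\<And>p. p < N \<Longrightarrow> norm (G p) \<le> M"
    and t: "near N S \<tau> t tw" and S: "0 < S" and nn: "0 \<le> e" "0 \<le> \<tau>" "\<tau> \<le> 1" "0 \<le> M"
    and L: "2 * L dvd N" "0 < L"
  shows "near N S (4 * e + (2 * \<tau> * M + 2 / of_int S)) (ifstep S t L F) (fstep L G)"
  unfolding near_def
proof (intro allI impI)
  fix p assume p: "p < N"
  note idx = step_index[OF L(1) p L(2)]
  let ?t = "t (p div (2 * L))" and ?w = "tw (p div (2 * L))"
  have tt: "norm (cx S ?t - ?w) \<le> \<tau>" using t idx by (simp add: near_def)
  have t2: "norm (cx S ?t) \<le> 2"
    using norm_triangle_sub[of "cx S ?t" ?w] tt nn by simp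
  have m: "norm (cx S (fmul S (F q) ?t) - G q * ?w) \<le> 2 * e + M * \<tau> + 2 / of_int S" if "q < N" for q
    using fmul_error[OF S _ tt _ t2, of "F q" "G q" e M] F G that nn by (simp add: near_def mult.commute)
  have M: "0 \<le> M * \<tau>" using nn by simp
  have MM: "2 * \<tau> * M = 2 * (M * \<tau>)" by simp
  show "norm (cx S (ifstep S t L F p) - fstep L G p) \<le> 4 * e + (2 * \<tau> * M + 2 / of_int S)"
  proof (cases "p mod (2 * L) < L")
    case True
    have "cx S (ifstep S t L F p) - fstep L G p =
      (cx S (F p) - G p) + (cx S (fmul S (F (p + L)) ?t) - G (p + L) * ?w)"
      using True by (simp add: ifstep_def fstep_def cx_add mult.commute)
    also have "norm \<dots> \<le> e + (2 * e + M * \<tau> + 2 / of_int S)"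
      by (intro order_trans[OF norm_triangle_ineq] add_mono m) (use F p idx True in \<open>auto simp: near_def\<close>)
    finally show ?thesis using nn M unfolding MM by linarith
  next
    case False
    have "cx S (ifstep S t L F p) - fstep L G p =
      (cx S (F (p - L)) - G (p - L)) - (cx S (fmul S (F p) ?t) - G p * ?w)"
      using False by (simp add: ifstep_def fstep_def cx_diff mult.commute)
    also have "norm \<dots> \<le> e + (2 * e + M * \<tau> + 2 / of_int S)"
      by (rule order_trans[OF norm_triangle_ineq4], rule add_mono)
         (use F p m[OF p] in \<open>auto simp: near_def\<close>)
    finally show ?thesis using nn M unfolding MM by linarith
  qed
qed

text \<open>Here 4 * e is really used: the subtraction doubles the error and the computed twiddle
  factor may double it again. The sum in the first half of a block involves no product.\<close>

lemma near_ibstep: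
  assumes F: "near N S e F G" and G: "\<And>p. p < N \<Longrightarrow> norm (G p) \<le> M"
    and t: "near N S \<tau> t tw" and S: "0 < S" and nn: "0 \<le> e" "0 \<le> \<tau>" "\<tau> \<le> 1" "0 \<le> M"
    and L: "2 * L dvd N" "0 < L"
  shows "near N S (4 * e + (2 * \<tau> * M + 2 / of_int S)) (ibstep S t L F) (bstep L G)"
  unfolding near_def
proof (intro allI impI)
  fix p assume p: "p < N"
  note idx = step_index[OF L(1) p L(2)]
  let ?t = "t (p div (2 * L))" and ?w = "tw (p div (2 * L))"
  have tt: "norm (cx S ?t - ?w) \<le> \<tau>" using t idx by (simp add: near_def)
  have t2: "norm (cx S ?t) \<le> 2"
    using norm_triangle_sub[of "cx S ?t" ?w] tt nn by simp
  have M: "0 \<le> M * \<tau>" using nn by simp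
  have MM: "2 * \<tau> * M = 2 * (M * \<tau>)" by simp
  have S0: "0 \<le> 2 / real_of_int S" using S by simp
  show "norm (cx S (ibstep S t L F p) - bstep L G p) \<le> 4 * e + (2 * \<tau> * M + 2 / of_int S)"
  proof (cases "p mod (2 * L) < L")
    case True
    have "cx S (ibstep S t L F p) - bstep L G p =
      (cx S (F p) - G p) + (cx S (F (p + L)) - G (p + L))"
      using True by (simp add: ibstep_def bstep_def cx_add)
    also have "norm \<dots> \<le> e + e"
      by (intro order_trans[OF norm_triangle_ineq] add_mono) (use F p idx True in \<open>auto simp: near_def\<close>)
    finally show ?thesis using nn M S0 unfolding MM by linarith
  next
    case False
    have c: "norm (cx S (cj ?t) - cnj ?w) \<le> \<tau>" "norm (cx S (cj ?t)) \<le> 2"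
      using tt t2 by (simp_all add: cx_cj flip: complex_cnj_diff)
    have "norm (cx S (F (p - L) - F p) - (G (p - L) - G p)) \<le> 2 * e"
    proof -
      have "cx S (F (p - L) - F p) - (G (p - L) - G p) = (cx S (F (p - L)) - G (p - L)) - (cx S (F p) - G p)"
        by (simp add: cx_diff)
      also have "norm \<dots> \<le> e + e"
        by (rule order_trans[OF norm_triangle_ineq4], rule add_mono) (use F p in \<open>auto simp: near_def\<close>)
      finally show ?thesis by simp
    qed
    moreover have "norm (G (p - L) - G p) \<le> 2 * M"
    proof -
      have "norm (G (p - L) - G p) \<le> M + M"
        by (intro order_trans[OF norm_triangle_ineq4] add_mono G) (use p in auto)
      then show ?thesis by simp
    qed
    ultimately have "norm (cx S (fmul S (F (p - L) - F p) (cj ?t)) - (G (p - L) - G p) * cnj ?w) \<le>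
      2 * e * 2 + 2 * M * \<tau> + 2 / of_int S"
      using fmul_error[OF S _ c(1) _ c(2), of "F (p - L) - F p" "G (p - L) - G p" "2 * e" "2 * M"] nn
      by simp
    then show ?thesis using False by (simp add: ibstep_def bstep_def algebra_simps)
  qed
qed

lemma norm_fstep:
  assumes G: "\<And>p. p < N \<Longrightarrow> norm (G p) \<le> M" and L: "2 * L dvd N" "0 < L" and p: "p < N"
  shows "norm (fstep L G p) \<le> 2 * M"
proof -
  note idx = step_index[OF L(1) p L(2)]
  have "norm (fstep L G p) \<le> M + M"
  proof (cases "p mod (2 * L) < L")
    case True
    then show ?thesis using norm_triangle_ineq[of "G p" "tw (p div (2 * L)) * G (p + L)"] G[OF p] G[OF idx(1)]
      by (simp add: fstep_def norm_mult)
  next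
    case False
    have "p - L < N" using p by simp
    then show ?thesis using False norm_triangle_ineq4[of "G (p - L)" "tw (p div (2 * L)) * G p"] G[OF p] G[of "p - L"]
      by (simp add: fstep_def norm_mult)
  qed
  then show ?thesis by simp
qed

lemma norm_bstep:
  assumes G: "\<And>p. p < N \<Longrightarrow> norm (G p) \<le> M" and L: "2 * L dvd N" "0 < L" and p: "p < N"
  shows "norm (bstep L G p) \<le> 2 * M"
proof -
  note idx = step_index[OF L(1) p L(2)]
  have "norm (bstep L G p) \<le> M + M"
  proof (cases "p mod (2 * L) < L")
    case True
    then show ?thesis using norm_triangle_ineq[of "G p" "G (p + L)"] G[OF p] G[OF idx(1)]
      by (simp add: bstep_def norm_mult)
  next
    case False
    have "p - L < N" using p by simp
    then show ?thesis using False norm_triangle_ineq4[of "G (p - L)" "G p"] G[OF p] G[of "p - L"]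
      by (simp add: bstep_def norm_mult)
  qed
  then show ?thesis by simp
qed

lemma dvd_two_power: "d < \<kappa> \<Longrightarrow> 2 * 2 ^ d dvd (2 :: nat) ^ \<kappa>"
  using le_imp_power_dvd[of "Suc d" \<kappa> "2 :: nat"] by simp

lemma norm_forward:
  assumes G: "\<And>p. p < 2 ^ \<kappa> \<Longrightarrow> norm (G p) \<le> M" and "d \<le> \<kappa>" "p < 2 ^ \<kappa>"
  shows "norm (forward \<kappa> d G p) \<le> 2 ^ d * M"
  using assms(2,3)
proof (induction d arbitrary: p)
  case (Suc d)
  then show ?case
    using norm_fstep[of "2 ^ \<kappa>" "forward \<kappa> d G" "2 ^ d * M" "2 ^ (\<kappa> - Suc d)" p] dvd_two_power[of "\<kappa> - Suc d" \<kappa>]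
    by simp
qed (use G in simp)

lemma norm_backward:
  assumes G: "\<And>p. p < 2 ^ \<kappa> \<Longrightarrow> norm (G p) \<le> M" and "d \<le> \<kappa>" "p < 2 ^ \<kappa>"
  shows "norm (backward d G p) \<le> 2 ^ d * M"
  using assms(2,3)
proof (induction d arbitrary: p)
  case (Suc d)
  then show ?case
    using norm_bstep[of "2 ^ \<kappa>" "backward d G" "2 ^ d * M" "2 ^ d" p] dvd_two_power[of d \<kappa>]
    by simp
qed (use G in simp)

text \<open>\<tau> is the accuracy that the computed twiddle table will turn out to have. \<eta>
  bounds the error introduced by one level as long as the exact values have norm at most N ^ 3,
  which covers the inverse transform of a product of two spectra.\<close>

locale fixed_point =
  fixes \<kappa> :: nat and N :: nat and S :: int and t :: "nat \<Rightarrow> ipair" and \<tau> \<eta> :: real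
  assumes \<kappa>: "4 \<le> \<kappa>"
  defines "N \<equiv> 2 ^ \<kappa>"
    and "S \<equiv> 2 ^ (16 * \<kappa>)"
    and "\<tau> \<equiv> real N ^ 4 / of_int S"
    and "\<eta> \<equiv> 4 * real N ^ 7 / of_int S"
  assumes t: "near N S \<tau> t tw"
begin

lemma S_eq: "S = int N ^ 16" "real_of_int S = real N ^ 16"
  by (simp_all add: S_def N_def mult.commute flip: power_mult)

lemma N16: "16 \<le> N"
  using power_increasing[OF \<kappa>, of "2 :: nat"] by (simp add: N_def)

lemma S_pos: "0 < S"
  by (simp add: S_def)

lemma \<tau>_bounds: "0 \<le> \<tau>" "\<tau> \<le> 1"
  using N16 by (simp_all add: \<tau>_def S_eq power_increasing)

lemma \<eta>_ge:
  assumes "M \<le> real N ^ 3" "0 \<le> M"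
  shows "2 * \<tau> * M + 2 / of_int S \<le> \<eta>"
proof -
  have "2 * real N ^ 4 * M + 2 \<le> 2 * real N ^ 4 * real N ^ 3 + 2 * real N ^ 7"
    by (intro add_mono mult_left_mono assms) (use N16 in auto)
  also have "\<dots> = 4 * real N ^ 7" by (simp flip: power_add)
  finally have "(2 * real N ^ 4 * M + 2) / of_int S \<le> 4 * real N ^ 7 / of_int S"
    by (rule divide_right_mono) (use S_pos in simp)
  then show ?thesis by (simp add: \<tau>_def \<eta>_def add_divide_distrib)
qed

lemma \<eta>_pos: "0 < \<eta>"
  using N16 S_pos by (simp add: \<eta>_def)

text \<open>The recursion e \<mapsto> 4 * e + \<eta> from e = 0 is solved, with some room, by (4 ^ d
  - 1) * \<eta>.\<close>

lemma near_iforward: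
  assumes "near N S 0 F G" "\<And>p. p < N \<Longrightarrow> norm (G p) \<le> 1" "d \<le> \<kappa>"
  shows "near N S ((4 ^ d - 1) * \<eta>) (iforward S t \<kappa> d F) (forward \<kappa> d G)"
  using assms(3)
proof (induction d)
  case 0
  then show ?case using assms by simp
next
  case (Suc d)
  have M: "2 ^ d \<le> real N ^ 3"
  proof -
    have "(2 :: real) ^ d \<le> 2 ^ (\<kappa> * 3)" using Suc.prems by (intro power_increasing) auto
    then show ?thesis by (simp add: N_def power_mult)
  qed
  have "near N S (4 * ((4 ^ d - 1) * \<eta>) + (2 * \<tau> * 2 ^ d + 2 / of_int S))
      (iforward S t \<kappa> (Suc d) F) (forward \<kappa> (Suc d) G)"
    unfolding iforward.simps forward.simps
  proof (rule near_ifstep[OF _ _ t S_pos _ \<tau>_bounds])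
    show "norm (forward \<kappa> d G p) \<le> 2 ^ d" if "p < N" for p
      using norm_forward[of \<kappa> G 1 d p] assms(2) that Suc.prems by (simp add: N_def)
    show "2 * 2 ^ (\<kappa> - Suc d) dvd N" using Suc.prems by (simp add: N_def dvd_two_power)
  qed (use Suc \<eta>_pos in auto)
  then show ?case
    by (rule near_mono) (use \<eta>_ge[OF M] \<eta>_pos in \<open>simp add: algebra_simps\<close>)
qed

text \<open>The subtracted \<eta> makes the induction close: 4 * (X - \<eta>) + \<eta> \<le> 4 * X -
  \<eta>.\<close>

lemma near_ibackward:
  assumes "near N S e F G" "\<And>p. p < N \<Longrightarrow> norm (G p) \<le> real N ^ 2" "d \<le> \<kappa>" "0 \<le> e"
  shows "near N S (4 ^ d * (e + \<eta>) - \<eta>) (ibackward S t d F) (backward d G)"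
  using assms(3)
proof (induction d)
  case 0
  then show ?case using assms by simp
next
  case (Suc d)
  have M: "2 ^ d * real N ^ 2 \<le> real N ^ 3"
  proof -
    have "(2 :: real) ^ d \<le> 2 ^ \<kappa>" using Suc.prems by (intro power_increasing) auto
    then have "2 ^ d * real N ^ 2 \<le> real N * real N ^ 2" by (intro mult_right_mono) (auto simp: N_def)
    then show ?thesis by (simp add: power3_eq_cube power2_eq_square)
  qed
  have nn: "0 \<le> 4 ^ d * (e + \<eta>) - \<eta>"
  proof -
    have "1 * \<eta> \<le> 4 ^ d * (e + \<eta>)" using assms(4) \<eta>_pos by (intro mult_mono) auto
    then show ?thesis by simp
  qed
  have "near N S (4 * (4 ^ d * (e + \<eta>) - \<eta>) + (2 * \<tau> * (2 ^ d * real N ^ 2) + 2 / of_int S))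
      (ibackward S t (Suc d) F) (backward (Suc d) G)"
    unfolding ibackward.simps backward.simps
  proof (rule near_ibstep[OF _ _ t S_pos nn \<tau>_bounds])
    show "norm (backward d G p) \<le> 2 ^ d * real N ^ 2" if "p < N" for p
      using norm_backward[of \<kappa> G "real N ^ 2" d p] assms(2) that Suc.prems by (simp add: N_def)
    show "2 * 2 ^ d dvd N" using Suc.prems by (simp add: N_def dvd_two_power)
  qed (use Suc \<eta>_pos in auto)
  then show ?case
    by (rule near_mono) (use \<eta>_ge[OF M] \<eta>_pos in \<open>simp add: algebra_simps\<close>)
qed

text \<open>Magnitude in units of the scale. Accuracy alone is no use to the machine: this bound
  keeps the products inside a word before they are divided by \<open>S\<close>.\<close>

definition small :: "int \<Rightarrow> (nat \<Rightarrow> ipair) \<Rightarrow> bool" where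
  "small c F \<longleftrightarrow> (\<forall>p < N. \<bar>fst (F p)\<bar> \<le> c * S \<and> \<bar>snd (F p)\<bar> \<le> c * S)"

lemma near_small:
  assumes "near N S e F G" "\<And>p. p < N \<Longrightarrow> norm (G p) \<le> M" "e + M \<le> of_int c"
  shows "small c F"
  unfolding small_def
proof (intro allI impI)
  fix p assume p: "p < N"
  have "norm (cx S (F p)) \<le> of_int c"
    using norm_triangle_sub[of "cx S (F p)" "G p"] assms(1)[unfolded near_def] assms(2)[OF p] assms(3) p
    by force
  from cx_component[OF this S_pos]
  have "real_of_int \<bar>fst (F p)\<bar> \<le> real_of_int (c * S)" "real_of_int \<bar>snd (F p)\<bar> \<le> real_of_int (c * S)"
    by simp_all
  then show "\<bar>fst (F p)\<bar> \<le> c * S \<and> \<bar>snd (F p)\<bar> \<le> c * S" by (simp only: of_int_le_iff)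
qed

lemma small_t: "small 2 t"
  by (rule near_small[OF t, of 1]) (use \<tau>_bounds in auto)

text \<open>Where the exponent 16 of the scale is spent: N ^ 7 * (4 * N ^ 7) * N \<le> N ^ 16, as 4
  \<le> N.\<close>

lemma N2_\<eta>: "real N ^ k * \<eta> \<le> 1 / real N" if "k \<le> 7"
proof -
  have "real N ^ k * (4 * real N ^ 7) * real N \<le> real N ^ 7 * (real N * real N ^ 7) * real N"
    using N16 that by (intro mult_mono power_increasing) auto
  also have "\<dots> = real N ^ 16" by (simp flip: power_add power_Suc power_Suc2)
  finally show ?thesis using N16 by (simp add: \<eta>_def S_eq field_simps)
qed

lemma four_power: "d \<le> \<kappa> \<Longrightarrow> 4 ^ d \<le> real N ^ 2"
  using power_increasing[of d \<kappa> "4 :: real"] power_mult[of "2 :: real" 2 \<kappa>] power_mult[of "2 :: real" \<kappa> 2]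
  by (simp add: N_def mult.commute)

lemma near_iforward_uniform:
  assumes "near N S 0 F G" "\<And>p. p < N \<Longrightarrow> norm (G p) \<le> 1" "d \<le> \<kappa>"
  shows "near N S (real N ^ 2 * \<eta>) (iforward S t \<kappa> d F) (forward \<kappa> d G)"
  by (rule near_mono[OF near_iforward[OF assms]])
     (use four_power[OF assms(3)] \<eta>_pos in \<open>auto intro!: mult_right_mono\<close>)

lemma inverse_N: "1 / real N \<le> 1"
  using N16 by simp

lemma small_iforward:
  assumes "near N S 0 F G" "\<And>p. p < N \<Longrightarrow> norm (G p) \<le> 1" "d \<le> \<kappa>"
  shows "small (2 * int N) (iforward S t \<kappa> d F)"
proof (rule near_small[OF near_iforward_uniform[OF assms]])
  have "(2 :: real) ^ d \<le> 2 ^ \<kappa>" using assms(3) by (intro power_increasing) auto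
  then show "norm (forward \<kappa> d G p) \<le> real N" if "p < N" for p
    using order_trans[OF norm_forward[of \<kappa> G 1 d p]] assms that by (simp add: N_def)
  have "real N ^ 2 * \<eta> \<le> 1" using N2_\<eta>[of 2] inverse_N by linarith
  then show "real N ^ 2 * \<eta> + real N \<le> real_of_int (2 * int N)" using N16 by simp
qed

definition imult :: "(nat \<Rightarrow> ipair) \<Rightarrow> (nat \<Rightarrow> ipair) \<Rightarrow> nat \<Rightarrow> ipair" where
  "imult F G p = fmul S (F p) (cj (G p))"

text \<open>With e = N ^ 2 * \<eta> for either spectrum and norms up to N, the product has error at
  most e * (N + 1) + N * e + e \<le> 4 * N * e.\<close>

lemma near_imult:
  assumes "near N S (real N ^ 2 * \<eta>) F F'" "near N S (real N ^ 2 * \<eta>) G G'"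
    and "\<And>p. p < N \<Longrightarrow> norm (F' p) \<le> real N" "\<And>p. p < N \<Longrightarrow> norm (G' p) \<le> real N"
  shows "near N S (4 * real N ^ 3 * \<eta>) (imult F G) (\<lambda>p. F' p * cnj (G' p))"
  unfolding near_def
proof (intro allI impI)
  fix p assume p: "p < N"
  define e where "e = real N ^ 2 * \<eta>"
  have e: "0 \<le> e" "e \<le> 1" using N2_\<eta>[of 2] inverse_N \<eta>_pos by (simp_all add: e_def)
  have g: "norm (cx S (cj (G p)) - cnj (G' p)) \<le> e"
    using assms(2) p by (simp add: near_def e_def cx_cj flip: complex_cnj_diff)
  have "norm (cx S (cj (G p))) \<le> real N + e"
    using norm_triangle_sub[of "cx S (cj (G p))" "cnj (G' p)"] g assms(4)[OF p] by simp
  then have "norm (cx S (fmul S (F p) (cj (G p))) - F' p * cnj (G' p)) \<le> e * (real N + e) + real N * e + 2 / of_int S"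
    using fmul_error[OF S_pos _ g, of "F p" "F' p" e "real N"] assms p e by (simp add: near_def e_def)
  also have "\<dots> \<le> e * (real N + 1) + real N * e + e"
  proof (intro add_mono mult_left_mono)
    have "2 / of_int S \<le> 1 * \<eta>" using \<eta>_ge[of 0] \<tau>_bounds by simp
    also have "\<dots> \<le> e" unfolding e_def using N16 \<eta>_pos by (intro mult_right_mono) (auto simp: one_le_power)
    finally show "2 / of_int S \<le> e" .
  qed (use e in auto)
  also have "\<dots> = e * (2 * real N + 2)" by (simp add: algebra_simps)
  also have "\<dots> \<le> e * (4 * real N)" by (intro mult_left_mono) (use N16 e in auto)
  also have "\<dots> = 4 * real N ^ 3 * \<eta>" by (simp add: e_def power3_eq_cube power2_eq_square)
  finally show "norm (cx S (imult F G p) - F' p * cnj (G' p)) \<le> 4 * real N ^ 3 * \<eta>" by (simp add: imult_def)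
qed

text \<open>Indicator sequences; they are stored without error, since 0 and 1 are multiples of 1 /
  S.\<close>

context
  fixes F G :: "nat \<Rightarrow> ipair" and f g :: "nat \<Rightarrow> nat"
  assumes F: "\<And>p. p < N \<Longrightarrow> F p = (int (f p) * S, 0)" and G: "\<And>p. p < N \<Longrightarrow> G p = (int (g p) * S, 0)"
    and f: "\<And>p. f p \<le> 1" and g: "\<And>p. g p \<le> 1"
begin

lemma near_input: "near N S 0 F (\<lambda>p. of_nat (f p))" "near N S 0 G (\<lambda>p. of_nat (g p))"
  using S_pos by (auto simp: near_def F G cx_def complex_eq_iff)

lemma norm_input: "norm (of_nat (f p) :: complex) \<le> 1" "norm (of_nat (g p) :: complex) \<le> 1"
  using f[of p] g[of p] by simp_all

lemma near_product:
  "near N S (4 * real N ^ 3 * \<eta>) (imult (iforward S t \<kappa> \<kappa> F) (iforward S t \<kappa> \<kappa> G))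
     (\<lambda>p. forward \<kappa> \<kappa> (\<lambda>p. of_nat (f p)) p * cnj (forward \<kappa> \<kappa> (\<lambda>p. of_nat (g p)) p))"
  using norm_forward[where M = 1 and d = \<kappa> and \<kappa> = \<kappa>] norm_input
  by (intro near_imult near_iforward_uniform near_input) (auto simp: N_def)

lemma norm_product:
  assumes "p < N"
  shows "norm (forward \<kappa> \<kappa> (\<lambda>p. of_nat (f p)) p * cnj (forward \<kappa> \<kappa> (\<lambda>p. of_nat (g p)) p)) \<le> real N ^ 2"
proof -
  have "norm (forward \<kappa> \<kappa> (\<lambda>p. of_nat (f p)) p) * norm (forward \<kappa> \<kappa> (\<lambda>p. of_nat (g p)) p) \<le> real N * real N"
    using norm_forward[where M = 1 and d = \<kappa> and \<kappa> = \<kappa> and p = p] norm_input assms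
    by (intro mult_mono) (auto simp: N_def)
  then show ?thesis by (simp add: norm_mult power2_eq_square)
qed

lemma small_ibackward:
  assumes "d \<le> \<kappa>"
  shows "small (2 * int N ^ 3) (ibackward S t d (imult (iforward S t \<kappa> \<kappa> F) (iforward S t \<kappa> \<kappa> G)))"
proof (rule near_small[OF near_ibackward[OF near_product norm_product assms]])
  show "0 \<le> 4 * real N ^ 3 * \<eta>" using \<eta>_pos by simp
  have "(2 :: real) ^ d \<le> 2 ^ \<kappa>" using assms by (intro power_increasing) auto
  then have d: "2 ^ d * real N ^ 2 \<le> real N * real N ^ 2" by (intro mult_right_mono) (auto simp: N_def)
  show "norm (backward d (\<lambda>p. forward \<kappa> \<kappa> (\<lambda>p. of_nat (f p)) p * cnj (forward \<kappa> \<kappa> (\<lambda>p. of_nat (g p)) p)) p) \<le> real N ^ 3"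
    if "p < N" for p
  proof (rule order_trans[OF norm_backward[where M = "real N ^ 2" and \<kappa> = \<kappa>]])
    show "2 ^ d * real N ^ 2 \<le> real N ^ 3" using d by (simp add: power3_eq_cube power2_eq_square)
  qed (use norm_product that assms in \<open>auto simp: N_def\<close>)
  have "4 ^ d * (4 * real N ^ 3 * \<eta> + \<eta>) - \<eta> \<le> real N ^ 2 * (4 * real N ^ 3 * \<eta> + real N ^ 3 * \<eta>)"
  proof -
    have "4 ^ d * (4 * real N ^ 3 * \<eta> + \<eta>) \<le> real N ^ 2 * (4 * real N ^ 3 * \<eta> + real N ^ 3 * \<eta>)"
      using four_power[OF assms] \<eta>_pos N16 by (intro mult_mono add_mono) (auto simp: one_le_power)
    then show ?thesis using \<eta>_pos by simp
  qed
  also have "\<dots> = 5 * (real N ^ 5 * \<eta>)" by (simp add: algebra_simps flip: power_add)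
  also have "\<dots> \<le> 5 * (1 / real N)" using N2_\<eta>[of 5] by simp
  also have "\<dots> \<le> 1" using N16 by simp
  also have "1 \<le> real N ^ 3" using N16 by (simp add: one_le_power)
  finally show "4 ^ d * (4 * real N ^ 3 * \<eta> + \<eta>) - \<eta> + real N ^ 3 \<le> real_of_int (2 * int N ^ 3)" by simp
qed

text \<open>The unnormalised inverse yields N * h with error at most 5 / N \<le> N / 4, so the
  stored integer is within a quarter of N * S of a multiple of N * S. Adding half of N * S before
  the floor division normalises and rounds at once. The two range facts make the unsigned division
  of the machine see the same dividend.\<close>

theorem correlation_rounding:
  assumes c: "c < N"
  defines "R \<equiv> fst (ibackward S t \<kappa> (imult (iforward S t \<kappa> \<kappa> F) (iforward S t \<kappa> \<kappa> G)) c)"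
    and "h \<equiv> \<Sum>j<N. f ((c + j) mod N) * g j"
  shows "(R + int N * S div 2) div (int N * S) = int h" "0 \<le> R + int N * S div 2"
    "R + int N * S div 2 \<le> 2 * int N ^ 3 * S + int N * S"
proof -
  define A where "A = imult (iforward S t \<kappa> \<kappa> F) (iforward S t \<kappa> \<kappa> G)"
  define H where "H p = forward \<kappa> \<kappa> (\<lambda>p. of_nat (f p)) p * cnj (forward \<kappa> \<kappa> (\<lambda>p. of_nat (g p)) p)" for p
  have "backward \<kappa> H c = backward \<kappa> (forward \<kappa> \<kappa> (correlate N (\<lambda>p. of_nat (f p)) (\<lambda>p. of_nat (g p)))) c"
    by (rule backward_cong[where \<kappa> = \<kappa>]) (use c in \<open>auto simp: H_def N_def forward_correlate\<close>)
  also have "\<dots> = of_nat (N * h)"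
    by (simp add: backward_forward correlate_def N_def h_def)
  finally have bH: "backward \<kappa> H c = of_nat (N * h)" .
  have "near N S (4 ^ \<kappa> * (4 * real N ^ 3 * \<eta> + \<eta>) - \<eta>) (ibackward S t \<kappa> A) (backward \<kappa> H)"
    using near_ibackward[OF near_product norm_product, of \<kappa>] \<eta>_pos by (simp add: A_def H_def[abs_def])
  then have "norm (cx S (ibackward S t \<kappa> A c) - of_nat (N * h)) \<le> 4 ^ \<kappa> * (4 * real N ^ 3 * \<eta> + \<eta>) - \<eta>"
    using c unfolding near_def bH[symmetric] by blast
  also have "\<dots> \<le> 4 ^ \<kappa> * (4 * real N ^ 3 * \<eta> + \<eta>)" using \<eta>_pos by simp
  also have "\<dots> \<le> real N ^ 2 * (4 * real N ^ 3 * \<eta> + real N ^ 3 * \<eta>)"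
    using four_power[of \<kappa>] \<eta>_pos N16 by (intro mult_mono add_mono) (auto simp: one_le_power)
  also have "\<dots> = 5 * (real N ^ 5 * \<eta>)" by (simp add: algebra_simps flip: power_add)
  also have "\<dots> \<le> 5 * (1 / real N)" using N2_\<eta>[of 5] by simp
  also have "\<dots> \<le> real N / 4"
  proof -
    have "20 \<le> real N * real N" using mult_mono[of 16 "real N" 16 "real N"] N16 by simp
    then show ?thesis using N16 by (simp add: field_simps)
  qed
  finally have "\<bar>Re (cx S (ibackward S t \<kappa> A c) - of_nat (N * h))\<bar> \<le> real N / 4"
    using abs_Re_le_cmod order_trans by blast
  then have R: "\<bar>real_of_int R / of_int S - real (N * h)\<bar> \<le> real N / 4"
    by (simp add: cx_def R_def A_def)
  define NS where "NS = int N * S"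
  have NS: "0 < NS" using N16 S_pos by (simp add: NS_def)
  \<comment> \<open>So \<open>NS div 2\<close> is exactly one half of \<open>NS\<close>.\<close>
  have "even N" using \<kappa> by (simp add: N_def)
  then have half: "real_of_int (NS div 2) = of_int NS / 2"
    by (simp add: NS_def real_of_int_div)
  have "\<bar>real_of_int R - real (N * h) * of_int S\<bar> \<le> real N / 4 * of_int S"
  proof -
    have "real_of_int R - real (N * h) * of_int S = (real_of_int R / of_int S - real (N * h)) * of_int S"
      using S_pos by (simp add: field_simps)
    then show ?thesis using R S_pos by (simp add: abs_mult mult_right_mono)
  qed
  then have *: "\<bar>real_of_int R - of_int (int h * NS)\<bar> \<le> of_int NS / 4" by (simp add: NS_def mult_ac)
  then have "real_of_int (int h * NS) \<le> real_of_int (R + NS div 2)"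
    "real_of_int (R + NS div 2) < real_of_int (int h * NS + NS)"
    using NS half by (simp_all add: abs_if split: if_splits)
  then have **: "int h * NS \<le> R + NS div 2" "R + NS div 2 < int h * NS + NS"
    by (simp_all only: of_int_le_iff of_int_less_iff)
  then show "(R + int N * S div 2) div (int N * S) = int h"
    unfolding NS_def[symmetric] using NS
    by (intro int_div_pos_eq[where r = "R + NS div 2 - int h * NS"]) (auto simp: mult.commute)
  show "0 \<le> R + int N * S div 2"
    using ** NS unfolding NS_def[symmetric] by (meson mult_nonneg_nonneg of_nat_0_le_iff order_trans less_imp_le)
  have "R \<le> 2 * int N ^ 3 * S"
    using small_ibackward[of \<kappa>] c by (auto simp: small_def R_def)
  moreover have "NS div 2 \<le> NS" using NS by simp
  ultimately show "R + int N * S div 2 \<le> 2 * int N ^ 3 * S + int N * S"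
    unfolding NS_def by linarith
qed

end

end

section \<open>Twiddle factors\<close>

text \<open>Fixed-point values of cis (pi / 2 ^ (k + 1)), starting from the imaginary unit, by cos
  (x / 2) = sqrt ((1 + cos x) / 2) and sin (x / 2) = sin x / (2 * cos (x / 2)). The second formula
  avoids the cancellation in 1 - cos x for small angles.\<close>

primrec rho :: "int \<Rightarrow> nat \<Rightarrow> ipair" where
  "rho S 0 = (0, S)"
| "rho S (Suc k) = (let c = \<lfloor>sqrt (real_of_int ((S + fst (rho S k)) * S div 2))\<rfloor>
     in (c, snd (rho S k) * S div (2 * c)))"

text \<open>Doubling as in \<open>tw_add\<close>: setting bit \<open>k\<close> of the index
  multiplies the entry by one further root.\<close>

primrec twtab :: "int \<Rightarrow> nat \<Rightarrow> nat \<Rightarrow> ipair" where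
  "twtab S 0 b = (S, 0)"
| "twtab S (Suc k) b = (if b < 2 ^ k then twtab S k b else fmul S (twtab S k (b - 2 ^ k)) (rho S k))"

lemma twtab_eq: "b < 2 ^ k \<Longrightarrow> k \<le> l \<Longrightarrow> twtab S l b = twtab S k b"
proof (induction l)
  case (Suc l)
  show ?case
  proof (cases "k = Suc l")
    case False
    then have "k \<le> l" using Suc by simp
    moreover have "b < 2 ^ l" using less_le_trans[OF Suc.prems(1) power_increasing[OF \<open>k \<le> l\<close>]] by simp
    ultimately show ?thesis using Suc by simp
  qed simp
qed simp

text \<open>Pins down the rounded root by integer inequalities, the form in which a binary search
  establishes it.\<close>

lemma floor_sqrt_unique:
  fixes r X :: int
  assumes "0 \<le> r" "r * r \<le> X" "X < (r + 1) * (r + 1)"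
  shows "\<lfloor>sqrt (real_of_int X)\<rfloor> = r"
proof (rule floor_unique)
  have "real_of_int (r * r) \<le> real_of_int X" using assms by (simp only: of_int_le_iff)
  then show "real_of_int r \<le> sqrt (real_of_int X)"
    using assms by (intro real_le_rsqrt) (simp add: power2_eq_square)
  have "real_of_int X < real_of_int ((r + 1) * (r + 1))" using assms by (simp only: of_int_less_iff)
  then show "sqrt (real_of_int X) < real_of_int r + 1"
    using assms by (intro real_less_lsqrt) (auto simp: power2_eq_square)
qed

text \<open>From x - y = (u - v) * (u + v). The lower bound 7 / 10 is met by the cosine of every
  angle between 0 and pi / 4.\<close>

lemma sqrt_error:
  fixes u v x y :: real
  assumes "0 \<le> u" "7 / 10 \<le> v" "u ^ 2 = x" "v ^ 2 = y" "\<bar>x - y\<bar> \<le> d"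
  shows "\<bar>u - v\<bar> \<le> d / (7 / 10)"
proof -
  have "\<bar>x - y\<bar> = \<bar>u - v\<bar> * (u + v)"
  proof -
    have "x - y = (u - v) * (u + v)" using assms by (simp add: algebra_simps power2_eq_square)
    moreover have "\<bar>u + v\<bar> = u + v" using assms by simp
    ultimately show ?thesis by (simp add: abs_mult)
  qed
  moreover have "\<bar>u - v\<bar> * (7 / 10) \<le> \<bar>u - v\<bar> * (u + v)" using assms by (intro mult_left_mono) auto
  ultimately show ?thesis using assms by (simp add: field_simps)
qed

lemma close_half:
  fixes x y z a d :: real
  assumes "x \<le> (1 + y) / 2" "(1 + y) / 2 \<le> x + d" "\<bar>y - z\<bar> \<le> a" "0 \<le> d"
  shows "\<bar>x - (1 + z) / 2\<bar> \<le> a / 2 + d"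
proof -
  have "y - z \<le> a" "z - y \<le> a" using assms(3) by (simp_all add: abs_le_iff)
  then show ?thesis unfolding abs_le_iff using assms(1,2,4) by (simp add: field_simps)
qed

text \<open>To be applied with x = 4 ^ k and v = N ^ 2.\<close>

lemma quarter_bound:
  fixes x v :: real
  assumes "x \<le> v" "1 \<le> v"
  shows "(x - 1) * (8 / 3) + 3 \<le> 3 * v + 3 * v" "(x - 1) * (8 / 3) \<le> 3 * v"
  using assms by (simp_all add: field_simps)

lemma seven_tenths:
  fixes a x y :: real
  assumes "x \<le> y" "0 \<le> a" "0 \<le> x"
  shows "(a / 2 + x) / (7 / 10) \<le> a + 2 * y"
  using assms by (simp add: field_simps)

lemma twelve_tenths:
  fixes a y :: real
  assumes "0 \<le> a" "0 \<le> y"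
  shows "(a + 2 * (a + 3 * y)) / (12 / 10) \<le> 3 * a + 6 * y"
  using assms by (simp add: field_simps)

text \<open>Halving is well conditioned because \<theta> / 2 \<le> pi / 4 keeps the cosine away from
  0: the cosine error is at most a + 3 / S, and dividing by twice a computed cosine of at least 6 /
  10 gives a sine error of at most 3 * a + 7 / S. A common bound for both components makes the
  recursion simple.\<close>

lemma half_angle_error:
  fixes c s S :: int and \<theta> a :: real
  assumes S: "0 < S" and \<theta>: "0 \<le> \<theta>" "\<theta> \<le> pi / 2" and c0: "0 \<le> c"
    and c: "\<bar>of_int c / of_int S - cos \<theta>\<bar> \<le> a" and s: "\<bar>of_int s / of_int S - sin \<theta>\<bar> \<le> a"
    and a: "a + 3 / of_int S \<le> 1 / 10"
  defines "c' \<equiv> \<lfloor>sqrt (real_of_int ((S + c) * S div 2))\<rfloor>"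
  shows "\<bar>of_int c' / of_int S - cos (\<theta> / 2)\<bar> \<le> 4 * a + 8 / of_int S"
    "\<bar>of_int (s * S div (2 * c')) / of_int S - sin (\<theta> / 2)\<bar> \<le> 4 * a + 8 / of_int S"
proof -
  define X where "X = (S + c) * S div 2"
  define T where "T = real_of_int S"
  have T: "1 \<le> T" using S by (simp add: T_def)
  have a0: "0 \<le> a" using c by linarith
  have C: "7 / 10 \<le> cos (\<theta> / 2)"
  proof -
    have "cos (pi / 4) \<le> cos (\<theta> / 2)" using \<theta> by (intro cos_monotone_0_pi_le) auto
    moreover have "14 / 10 \<le> sqrt 2"
      by (rule real_le_rsqrt) (simp add: power2_eq_square)
    ultimately show ?thesis unfolding cos_45 by linarith
  qed
  have X0: "0 \<le> X" using S c0 by (simp add: X_def)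
  have X1: "real_of_int X \<le> (T + of_int c) * T / 2" "(T + of_int c) * T / 2 < real_of_int X + 1"
    using div_error[of 2 "(S + c) * S"] by (simp_all add: X_def T_def)
  have x: "\<bar>real_of_int X / T ^ 2 - (cos (\<theta> / 2)) ^ 2\<bar> \<le> a / 2 + 1 / T ^ 2"
  proof -
    have cc: "(cos (\<theta> / 2)) ^ 2 = (1 + cos \<theta>) / 2" using cos_double_cos[of "\<theta> / 2"] by (simp add: field_simps)
    have e: "(T + of_int c) * T / 2 / T ^ 2 = (1 + of_int c / T) / 2"
      using T by (simp add: field_simps power2_eq_square)
    have b: "real_of_int X / T ^ 2 \<le> (1 + of_int c / T) / 2"
      using X1(1) T unfolding e[symmetric] by (intro divide_right_mono) auto
    have b': "(1 + of_int c / T) / 2 \<le> real_of_int X / T ^ 2 + 1 / T ^ 2"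
      using X1(2) T unfolding e[symmetric] add_divide_distrib[symmetric] by (intro divide_right_mono) auto
    have cT: "\<bar>of_int c / T - cos \<theta>\<bar> \<le> a" using c by (simp add: T_def)
    show ?thesis unfolding cc
      using close_half[OF b b' cT] by simp
  qed
  have T2: "1 / T ^ 2 \<le> 1 / T" using T by (simp add: field_simps power2_eq_square)
  have r: "\<bar>sqrt (of_int X) / T - cos (\<theta> / 2)\<bar> \<le> (a / 2 + 1 / T ^ 2) / (7 / 10)"
    by (rule sqrt_error[OF _ C _ refl x]) (use X0 T in \<open>auto simp: power_divide\<close>)
  have fl: "real_of_int c' \<le> sqrt (of_int X)" "sqrt (of_int X) \<le> of_int c' + 1"
    unfolding c'_def X_def by linarith+
  have f: "\<bar>of_int c' / T - sqrt (of_int X) / T\<bar> \<le> 1 / T"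
  proof -
    have "of_int c' / T \<le> sqrt (of_int X) / T" "sqrt (of_int X) / T \<le> (of_int c' + 1) / T"
      using fl T by (intro divide_right_mono; simp)+
    then show ?thesis by (simp add: add_divide_distrib)
  qed
  have c': "\<bar>of_int c' / T - cos (\<theta> / 2)\<bar> \<le> a + 3 / T"
  proof -
    have d: "(a / 2 + 1 / T ^ 2) / (7 / 10) \<le> a + 2 * (1 / T)" by (rule seven_tenths[OF T2 a0]) simp
    show ?thesis using r f d by linarith
  qed
  have T0: "0 \<le> 1 / T" using T by simp
  show "\<bar>of_int c' / of_int S - cos (\<theta> / 2)\<bar> \<le> 4 * a + 8 / of_int S"
    using c' a0 T0 unfolding T_def by linarith
  \<comment> \<open>7 / 10 from the exact cosine, minus the 1 / 10 granted by assumption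
    \<open>a\<close>.\<close>
  have low: "6 / 10 \<le> of_int c' / T" using c' C a unfolding T_def by linarith
  then have c'pos: "0 < c'" using T by (simp add: zero_less_divide_iff field_simps)
  have q: "\<bar>of_int (s * S div (2 * c')) / T - of_int s / (2 * of_int c')\<bar> \<le> 1 / T"
  proof -
    have e: "of_int (s * S) / of_int (2 * c') / T = of_int s / (2 * of_int c')"
      using T by (simp add: T_def)
    have "of_int (s * S div (2 * c')) / T \<le> of_int s / (2 * of_int c')"
      "of_int s / (2 * of_int c') \<le> (of_int (s * S div (2 * c')) + 1) / T"
      using div_error[of "2 * c'" "s * S"] c'pos T unfolding e[symmetric] by (intro divide_right_mono; simp)+
    then show ?thesis by (simp add: add_divide_distrib)
  qed
  define x where "x = of_int c' / T"
  define y where "y = of_int s / T"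
  have x0: "0 < x" using low unfolding x_def by linarith
  have xy: "of_int s / (2 * of_int c') = y / (2 * x)" using T by (simp add: x_def y_def)
  have sn: "sin \<theta> = 2 * sin (\<theta> / 2) * cos (\<theta> / 2)" using sin_double[of "\<theta> / 2"] by simp
  have sn1: "0 \<le> sin (\<theta> / 2)" "sin (\<theta> / 2) \<le> 1" using \<theta> by (auto intro!: sin_ge_zero)
  \<comment> \<open>The double-angle formula holds for the exact cosine; replacing it by the
    computed one costs 2 * (a + 3 / T).\<close>
  have A: "\<bar>y - 2 * x * sin (\<theta> / 2)\<bar> \<le> a + 2 * (a + 3 / T)"
  proof -
    have "y - 2 * x * sin (\<theta> / 2) = (y - sin \<theta>) + 2 * (cos (\<theta> / 2) - x) * sin (\<theta> / 2)"
      unfolding sn by (simp add: algebra_simps)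
    also have "\<bar>\<dots>\<bar> \<le> \<bar>y - sin \<theta>\<bar> + \<bar>2 * (cos (\<theta> / 2) - x) * sin (\<theta> / 2)\<bar>" by (rule abs_triangle_ineq)
    also have "\<bar>2 * (cos (\<theta> / 2) - x) * sin (\<theta> / 2)\<bar> \<le> 2 * (a + 3 / T) * 1"
      unfolding abs_mult using c' sn1 by (intro mult_mono) (auto simp: x_def abs_minus_commute)
    finally show ?thesis using s by (simp add: y_def T_def)
  qed
  have B: "y / (2 * x) - sin (\<theta> / 2) = (y - 2 * x * sin (\<theta> / 2)) / (2 * x)"
    using x0 by (simp add: field_simps)
  have "\<bar>y / (2 * x) - sin (\<theta> / 2)\<bar> \<le> (a + 2 * (a + 3 / T)) / (12 / 10)"
    unfolding B abs_divide
  proof (rule frac_le[OF _ A])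
    show "0 \<le> a + 2 * (a + 3 / T)" using A by linarith
    show "12 / 10 \<le> \<bar>2 * x\<bar>" using low x0 unfolding x_def[symmetric] by simp
  qed simp
  then have "\<bar>of_int s / (2 * of_int c') - sin (\<theta> / 2)\<bar> \<le> 3 * a + 6 * (1 / T)"
    unfolding xy using twelve_tenths[OF a0 T0] by simp
  then show "\<bar>of_int (s * S div (2 * c')) / of_int S - sin (\<theta> / 2)\<bar> \<le> 4 * a + 8 / of_int S"
    using q a0 T0 unfolding T_def by linarith
qed

context
  fixes \<kappa> N :: nat and S :: int
  assumes \<kappa>: "4 \<le> \<kappa>" and N: "N = 2 ^ \<kappa>" and S: "S = 2 ^ (16 * \<kappa>)"
begin

lemma N16: "16 \<le> N"
  using power_increasing[OF \<kappa>, of "2 :: nat"] by (simp add: N)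

lemma S_eq: "real_of_int S = real N ^ 16" and S_pos: "0 < S"
  by (simp_all add: S N mult.commute flip: power_mult)

lemma N_square_ge: "1 \<le> real N ^ 2" "60 \<le> real N ^ 2"
  using power_mono[of 16 "real N" 2] N16 by simp_all

lemma rho_nonneg: "0 \<le> fst (rho S k)" "0 \<le> snd (rho S k)"
proof (induction k)
  case (Suc k)
  then show "0 \<le> fst (rho S (Suc k))" "0 \<le> snd (rho S (Suc k))"
    using S_pos by (auto simp: Let_def div_int_pos_iff)
qed (use S_pos in auto)

text \<open>The recursion a \<mapsto> 4 * a + 8 / S from 0 has the solution (4 ^ k - 1) * (8 / 3) /
  S, which is the origin of 8 / 3.\<close>

lemma rho_component:
  assumes "k \<le> \<kappa>"
  shows "\<bar>of_int (fst (rho S k)) / of_int S - cos (pi / 2 ^ (k + 1))\<bar> \<le> (4 ^ k - 1) * (8 / 3) / of_int S \<and>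
    \<bar>of_int (snd (rho S k)) / of_int S - sin (pi / 2 ^ (k + 1))\<bar> \<le> (4 ^ k - 1) * (8 / 3) / of_int S"
  using assms
proof (induction k)
  case 0
  then show ?case using S_pos by simp
next
  case (Suc k)
  define a where "a = (4 ^ k - 1) * (8 / 3) / real_of_int S"
  have "4 ^ k \<le> real N ^ 2"
    using power_increasing[of k \<kappa> "4 :: real"] Suc.prems power_mult[of "2 :: real" 2 \<kappa>] power_mult[of "2 :: real" \<kappa> 2]
    by (simp add: N mult.commute)
  then have "a + 3 / real_of_int S \<le> (3 * real N ^ 2 + 3 * real N ^ 2) / real_of_int S"
    using N_square_ge(1) S_pos unfolding a_def add_divide_distrib[symmetric]
    by (intro divide_right_mono quarter_bound(1)) auto
  also have "\<dots> \<le> 1 / 10"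
  proof -
    have "60 * real N ^ 2 \<le> real N ^ 2 * real N ^ 2" using N_square_ge by (intro mult_right_mono) auto
    also have "\<dots> \<le> real N ^ 16" unfolding power_add[symmetric] using N16 by (intro power_increasing) auto
    finally show ?thesis using N16 by (simp add: S_eq field_simps)
  qed
  finally have a: "a + 3 / real_of_int S \<le> 1 / 10" .
  have \<theta>: "pi / 2 ^ (k + 1) / 2 = pi / 2 ^ (Suc k + 1)" by simp
  have "(1 :: real) \<le> 2 ^ k" by simp
  then have \<theta>': "pi / 2 ^ (k + 1) \<le> pi / 2" by (simp add: field_simps)
  have e: "4 * a + 8 / of_int S = (4 ^ Suc k - 1) * (8 / 3) / of_int S"
    using S_pos by (simp add: a_def field_simps)
  show ?case
    using half_angle_error[OF S_pos _ \<theta>' rho_nonneg(1) _ _ a, of k "snd (rho S k)"] Suc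
    unfolding e \<theta> by (simp add: a_def Let_def)
qed

lemma rho_error:
  assumes "k \<le> \<kappa>"
  shows "norm (cx S (rho S k) - cis (pi / 2 ^ (k + 1))) \<le> 6 * real N ^ 2 / of_int S"
proof -
  have "4 ^ k \<le> real N ^ 2"
    using power_increasing[of k \<kappa> "4 :: real"] assms power_mult[of "2 :: real" 2 \<kappa>] power_mult[of "2 :: real" \<kappa> 2]
    by (simp add: N mult.commute)
  then have "(4 ^ k - 1) * (8 / 3) / real_of_int S \<le> 3 * real N ^ 2 / of_int S"
    using S_pos N_square_ge by (intro divide_right_mono quarter_bound(2)) auto
  then have "\<bar>Re (cx S (rho S k) - cis (pi / 2 ^ (k + 1)))\<bar> \<le> 3 * real N ^ 2 / of_int S"
    "\<bar>Im (cx S (rho S k) - cis (pi / 2 ^ (k + 1)))\<bar> \<le> 3 * real N ^ 2 / of_int S"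
    using rho_component[OF assms] by (auto simp: cx_def)
  then show ?thesis using cmod_le[of "cx S (rho S k) - cis (pi / 2 ^ (k + 1))"] by simp
qed

lemma six_N_square: "6 * real N ^ 2 / of_int S \<le> 1"
proof -
  have "6 * real N ^ 2 \<le> real N ^ 2 * real N ^ 2" using N_square_ge by (intro mult_right_mono) auto
  also have "\<dots> \<le> real N ^ 16" unfolding power_add[symmetric] using N16 by (intro power_increasing) auto
  finally show ?thesis using N16 by (simp add: S_eq field_simps)
qed

lemma rho_le:
  assumes "k \<le> \<kappa>"
  shows "fst (rho S k) \<le> 2 * S" "snd (rho S k) \<le> 2 * S"
proof -
  have "norm (cx S (rho S k)) \<le> 2"
    using norm_triangle_sub[of "cx S (rho S k)" "cis (pi / 2 ^ (k + 1))"] rho_error[OF assms] six_N_square by simp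
  from cx_component[OF this S_pos]
  have "real_of_int (fst (rho S k)) \<le> real_of_int (2 * S)" "real_of_int (snd (rho S k)) \<le> real_of_int (2 * S)" by auto
  then show "fst (rho S k) \<le> 2 * S" "snd (rho S k) \<le> 2 * S" by (simp_all only: of_int_le_iff)
qed

text \<open>A multiplication by a computed root, of norm at most 2, doubles the error and adds 6 * N
  ^ 2 / S for the root and 2 / S for rounding. With c = 8 * N ^ 2 / S the recursion x \<mapsto> 2 *
  x + c from 0 gives (2 ^ k - 1) * c.\<close>

lemma twtab_error:
  assumes "k \<le> \<kappa>" "b < 2 ^ k"
  shows "norm (cx S (twtab S k b) - tw b) \<le> (2 ^ k - 1) * (8 * real N ^ 2 / of_int S)"
  using assms
proof (induction k arbitrary: b)
  case 0
  then show ?case using S_pos by (simp add: cx_def complex_eq_iff)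
next
  case (Suc k)
  define e where "e = 8 * real N ^ 2 / of_int S"
  have e0: "0 \<le> e" using S_pos by (simp add: e_def)
  show ?case
  proof (cases "b < 2 ^ k")
    case True
    have "norm (cx S (twtab S (Suc k) b) - tw b) \<le> (2 ^ k - 1) * e" using Suc True by (simp add: e_def)
    also have "\<dots> \<le> (2 ^ Suc k - 1) * e" using e0 by (intro mult_right_mono) auto
    finally show ?thesis by (simp add: e_def)
  next
    case False
    define b' where "b' = b - 2 ^ k"
    have b': "b' < 2 ^ k" "b = b' + 2 ^ k" using False Suc.prems by (simp_all add: b'_def)
    have k: "k \<le> \<kappa>" using Suc.prems by simp
    have "norm (cx S (rho S k)) \<le> 2"
      using norm_triangle_sub[of "cx S (rho S k)" "cis (pi / 2 ^ (k + 1))"] rho_error[OF k] six_N_square by simp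
    moreover have "norm (cx S (twtab S k b') - tw b') \<le> (2 ^ k - 1) * e"
      using Suc.IH[OF k b'(1)] by (simp add: e_def)
    ultimately have "norm (cx S (fmul S (twtab S k b') (rho S k)) - tw b' * cis (pi / 2 ^ (k + 1))) \<le>
        (2 ^ k - 1) * e * 2 + 1 * (6 * real N ^ 2 / of_int S) + 2 / of_int S"
      using rho_error[OF k] S_pos e0 by (intro fmul_error) auto
    also have "\<dots> \<le> (2 ^ Suc k - 1) * e"
    proof -
      define x where "x = real N ^ 2 / real_of_int S"
      have "2 / real_of_int S \<le> 2 * x"
        using N_square_ge S_pos unfolding x_def times_divide_eq_right by (intro divide_right_mono) linarith+
      moreover have "e = 8 * x" "6 * real N ^ 2 / of_int S = 6 * x" by (simp_all add: e_def x_def)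
      ultimately show ?thesis by (simp add: algebra_simps)
    qed
    finally show ?thesis using b' by (simp add: tw_add e_def)
  qed
qed

text \<open>2 ^ \<kappa> - 1 \<le> N and 8 \<le> N bring the table error below N ^ 4 / S.\<close>

lemma fixed_point_twtab: "fixed_point \<kappa> (twtab S \<kappa>)"
proof (unfold_locales, fact \<kappa>)
  have "norm (cx S (twtab S \<kappa> b) - tw b) \<le> real N ^ 4 / of_int S" if "b < N" for b
  proof -
    have "norm (cx S (twtab S \<kappa> b) - tw b) \<le> (2 ^ \<kappa> - 1) * (8 * real N ^ 2 / of_int S)"
      using twtab_error[of \<kappa> b] that by (simp add: N)
    also have "\<dots> \<le> real N * (real N * real N ^ 2 / of_int S)"
    proof (intro mult_mono divide_right_mono)
      show "2 ^ \<kappa> - 1 \<le> real N" by (simp add: N)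
    qed (use N16 S_pos in auto)
    also have "\<dots> = real N ^ 4 / of_int S" by (simp add: power2_eq_square power4_eq_xxxx)
    finally show ?thesis .
  qed
  then show "near (2 ^ \<kappa>) (2 ^ (16 * \<kappa>)) (real (2 ^ \<kappa>) ^ 4 / real_of_int (2 ^ (16 * \<kappa>))) (twtab S \<kappa>) tw"
    by (simp add: near_def N S)
qed

end

section \<open>Code of the transform\<close>

lemma iexecs_append: "iexecs w (a @ b) \<rho> \<mu> f = iexecs w a \<rho> \<mu> (\<lambda>\<rho> \<mu>. iexecs w b \<rho> \<mu> f)"
proof (induction a arbitrary: \<rho> \<mu>)
  case (Cons i a)
  have "iexec w i \<rho> \<mu> (\<lambda>\<rho> \<mu>. iexecs w (a @ b) \<rho> \<mu> f) =
      iexec w i \<rho> \<mu> (\<lambda>\<rho> \<mu>. iexecs w a \<rho> \<mu> (\<lambda>\<rho> \<mu>. iexecs w b \<rho> \<mu> f))"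
    using Cons by presburger
  then show ?case by simp
qed simp

definition same :: "nat \<Rightarrow> rfile \<Rightarrow> rfile \<Rightarrow> bool" where
  "same k \<rho> \<rho>' \<longleftrightarrow> (\<forall>r < k. \<rho>' r = \<rho> r)"

lemma same_refl [simp]: "same k \<rho> \<rho>"
  by (simp add: same_def)

lemma same_mono: "same k \<rho> \<rho>' \<Longrightarrow> l \<le> k \<Longrightarrow> same l \<rho> \<rho>'"
  by (simp add: same_def)

lemma same_upd [simp]: "k \<le> r \<Longrightarrow> same k \<rho> (\<rho>'(r := x)) \<longleftrightarrow> same k \<rho> \<rho>'"
  by (auto simp: same_def)

text \<open>Arrays of complex numbers are stored with all real parts before all imaginary parts.\<close>

definition put :: "nat \<Rightarrow> memory \<Rightarrow> int \<Rightarrow> (nat \<Rightarrow> ipair) \<Rightarrow> memory" where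
  "put N \<mu> b F = (\<lambda>a. if b \<le> a \<and> a < b + int N then fst (F (nat (a - b)))
     else if b + int N \<le> a \<and> a < b + 2 * int N then snd (F (nat (a - b - int N))) else \<mu> a)"

lemma put_re: "p < N \<Longrightarrow> a = b + int p \<Longrightarrow> put N \<mu> b F a = fst (F p)"
  by (simp add: put_def)

lemma put_im: "p < N \<Longrightarrow> a = b + int p + int N \<Longrightarrow> put N \<mu> b F a = snd (F p)"
  by (simp add: put_def)

lemma put_other: "a < b \<or> b + 2 * int N \<le> a \<Longrightarrow> put N \<mu> b F a = \<mu> a"
  by (auto simp: put_def)

lemma put_upd:
  "p < N \<Longrightarrow> a = b + int p \<Longrightarrow> a' = b + int p + int N \<Longrightarrow>
    (put N \<mu> b F)(a := fst z, a' := snd z) = put N \<mu> b (F(p := z))"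
  by (rule ext) (auto simp: put_def)

lemma put_cong: "(\<And>p. p < N \<Longrightarrow> F p = G p) \<Longrightarrow> put N \<mu> b F = put N \<mu> b G"
  by (rule ext) (auto simp: put_def)

text \<open>Every memory already holds some array at any place. This starts loop invariants that
  claim a memory of the form \<open>put\<close>.\<close>

lemma put_self:
  "(\<And>p. p < N \<Longrightarrow> \<mu> (b + int p) = fst (F p)) \<Longrightarrow> (\<And>p. p < N \<Longrightarrow> \<mu> (b + int p + int N) = snd (F p)) \<Longrightarrow>
    put N \<mu> b F = \<mu>"
proof (rule ext)
  fix a assume *: "\<And>p. p < N \<Longrightarrow> \<mu> (b + int p) = fst (F p)" "\<And>p. p < N \<Longrightarrow> \<mu> (b + int p + int N) = snd (F p)"
  show "put N \<mu> b F a = \<mu> a"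
    using *(1)[of "nat (a - b)"] *(2)[of "nat (a - b - int N)"] by (auto simp: put_def)
qed

text \<open>The array in the middle of a level. \<open>p mod L\<close> is the same for the two
  partners of a butterfly, so both change at the same \<open>j\<close>.\<close>

definition partial :: "nat \<Rightarrow> nat \<Rightarrow> nat \<Rightarrow> (nat \<Rightarrow> ipair) \<Rightarrow> (nat \<Rightarrow> ipair) \<Rightarrow> nat \<Rightarrow> ipair" where
  "partial L b j F G p = (if p div (2 * L) < b \<or> p div (2 * L) = b \<and> p mod L < j then G p else F p)"

lemma block_position:
  fixes L b j :: nat
  assumes "j < L"
  shows "(2 * L * b + j) div (2 * L) = b" "(2 * L * b + j + L) div (2 * L) = b"
    "(2 * L * b + j) mod L = j" "(2 * L * b + j + L) mod L = j"
    "(2 * L * b + j) mod (2 * L) = j" "(2 * L * b + j + L) mod (2 * L) = j + L"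
proof -
  have L: "2 * L \<noteq> 0" using assms by auto
  have e: "2 * L * b + j = j + 2 * L * b" "j + 2 * L * b + L = (j + L) + 2 * L * b" by simp_all
  have e': "2 * L * b + j + L = j + L * (2 * b + 1)" "2 * L * b + j = j + L * (2 * b)" by simp_all
  show "(2 * L * b + j) div (2 * L) = b" "(2 * L * b + j + L) div (2 * L) = b"
    unfolding e div_mult_self2[OF L] using assms by simp_all
  show "(2 * L * b + j) mod (2 * L) = j" "(2 * L * b + j + L) mod (2 * L) = j + L"
    unfolding e mod_mult_self2 using assms by simp_all
  show "(2 * L * b + j) mod L = j" "(2 * L * b + j + L) mod L = j"
    unfolding e' mod_mult_self2 using assms by simp_all
qed

lemma position_cases:
  fixes p L :: nat
  assumes "0 < L" "p div (2 * L) = b" "p mod L = j"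
  shows "p = 2 * L * b + j \<or> p = 2 * L * b + j + L"
proof -
  have "p div L div 2 = b" using assms by (simp add: div_mult2_eq mult.commute)
  then have "p div L = 2 * b \<or> p div L = 2 * b + 1"
    using mult_div_mod_eq[of 2 "p div L"] mod_less_divisor[of 2 "p div L"] by linarith
  moreover have "p = L * (p div L) + j" using mult_div_mod_eq[of L p] assms(3) by simp
  ultimately show ?thesis by (auto simp: algebra_simps)
qed

lemma partial_Suc:
  assumes "j < L"
  shows "partial L b (Suc j) F G = (partial L b j F G)(2 * L * b + j := G (2 * L * b + j), 2 * L * b + j + L := G (2 * L * b + j + L))"
proof
  fix p
  show "partial L b (Suc j) F G p =
      ((partial L b j F G)(2 * L * b + j := G (2 * L * b + j), 2 * L * b + j + L := G (2 * L * b + j + L))) p"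
  proof (cases "p = 2 * L * b + j \<or> p = 2 * L * b + j + L")
    case True
    then show ?thesis using block_position[OF assms, of b] by (auto simp: partial_def)
  next
    case False
    then have "\<not> (p div (2 * L) = b \<and> p mod L = j)" using position_cases[of L p b j] assms by auto
    then show ?thesis using False by (auto simp: partial_def less_Suc_eq)
  qed
qed

lemma partial_start: "partial L 0 0 F G = F"
  by (rule ext) (simp add: partial_def)

lemma partial_block_end: "0 < L \<Longrightarrow> partial L b L F G = partial L (Suc b) 0 F G"
  by (rule ext) (auto simp: partial_def less_Suc_eq)

lemma partial_end: "0 < L \<Longrightarrow> p < 2 * L * b \<Longrightarrow> partial L b 0 F G p = G p"
  by (simp add: partial_def less_mult_imp_div_less mult.commute)

text \<open>Neither partner of the next butterfly has been touched yet, which makes the in-place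
  update legitimate.\<close>

lemma partial_unchanged:
  "j < L \<Longrightarrow> partial L b j F G (2 * L * b + j) = F (2 * L * b + j)"
  "j < L \<Longrightarrow> partial L b j F G (2 * L * b + j + L) = F (2 * L * b + j + L)"
  using block_position[of j L b] by (simp_all add: partial_def)

text \<open>
  Memory holds, in this order, the input, its hashed copy at \<open>HX\<close>, the output at \<open>OUT\<close>, the match counts
  of the current block at \<open>ACC\<close>, the complex arrays at \<open>AB\<close> (text block), \<open>GB\<close> (pattern) and \<open>TB\<close>
  (twiddle factors), and the hash table at \<open>TBL\<close>. Registers below 30 are constants; a loop only writes
  registers numbered at least as high as its own counter, so \<open>same\<close> serves as the frame condition.
\<close>

locale machine =
  fixes w n m \<sigma> E \<kappa> :: nat and N :: nat and S W HX OUT ACC AB GB TB TBL :: int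
  assumes \<kappa>: "4 \<le> \<kappa>" and m: "1 \<le> m" "m \<le> n" "2 * m \<le> 2 ^ \<kappa>" and E: "1 \<le> E" "2 * int E < 2 ^ w"
  defines "N \<equiv> 2 ^ \<kappa>" and "S \<equiv> 2 ^ (16 * \<kappa>)" and "W \<equiv> 2 ^ w"
    and "HX \<equiv> int n + int m"
    and "OUT \<equiv> 2 * (int n + int m)"
    and "ACC \<equiv> OUT + 2 * int n"
    and "AB \<equiv> ACC + int m"
    and "GB \<equiv> AB + 2 * int N"
    and "TB \<equiv> GB + 2 * int N"
    and "TBL \<equiv> TB + 2 * int N"
  assumes fits: "TBL + int \<sigma> < W" "2 * (S * S * S) \<le> W"
begin

definition twd :: "nat \<Rightarrow> ipair" where "twd = twtab S \<kappa>"

sublocale fixed_point \<kappa> N S twd "real N ^ 4 / of_int S" "4 * real N ^ 7 / of_int S"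
proof -
  show "fixed_point \<kappa> twd" unfolding twd_def S_def by (rule fixed_point_twtab[OF \<kappa> refl refl])
qed (simp_all add: N_def S_def)

text \<open>Besides sizes and base addresses: registers 10 and 11 shift signed dividends and their
  quotients, 22 and 23 serve the rounding by N * S, 25 is the number of bits of an integer root, and
  14 the number of text blocks.\<close>

definition consts_ok :: "rfile \<Rightarrow> bool" where
  "consts_ok \<rho> \<longleftrightarrow> \<rho> 0 = int n \<and> \<rho> 1 = int m \<and> \<rho> 4 = 0 \<and> \<rho> 5 = 1 \<and> \<rho> 6 = 2 \<and> \<rho> 7 = int N \<and> \<rho> 8 = int \<kappa> \<and>
     \<rho> 9 = S \<and> \<rho> 10 = S * S * S \<and> \<rho> 11 = S * S \<and> \<rho> 12 = 2 * int E \<and> \<rho> 14 = int (n div m) \<and>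
     \<rho> 15 = HX \<and> \<rho> 16 = OUT \<and> \<rho> 17 = ACC \<and> \<rho> 18 = AB \<and> \<rho> 19 = GB \<and> \<rho> 20 = TB \<and> \<rho> 21 = TBL \<and>
     \<rho> 22 = int N * S \<and> \<rho> 23 = int N * S div 2 \<and> \<rho> 24 = int n + int m \<and> \<rho> 25 = int (16 * \<kappa> + 1) \<and>
     \<rho> 26 = int (N div 2)"

lemma consts_ok_same: "consts_ok \<rho> \<Longrightarrow> same 30 \<rho> \<rho>' \<Longrightarrow> consts_ok \<rho>'"
  by (simp add: consts_ok_def same_def)

lemma S_powers: "16 \<le> S" "16 * S \<le> S * S" "16 * (S * S) \<le> S * S * S"
proof -
  have "(2 :: int) ^ 4 \<le> 2 ^ (16 * \<kappa>)" using \<kappa> by (intro power_increasing) auto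
  then show S: "16 \<le> S" by (simp add: S_def)
  then show "16 * S \<le> S * S" by (intro mult_right_mono) auto
  from S have "16 * (S * S) \<le> S * (S * S)" by (intro mult_right_mono) auto
  then show "16 * (S * S) \<le> S * S * S" by (simp add: mult.assoc)
qed

lemma modW: "0 \<le> x \<Longrightarrow> x < W \<Longrightarrow> x mod 2 ^ w = x"
  by (simp add: W_def)

text \<open>The shifted dividend lies between 1 and 2 * S ^ 3 - 1, so it is its own word; the shift
  is a multiple of the divisor and moves the quotient by exactly S ^ 2.\<close>

lemma fdiv:
  assumes "\<bar>x\<bar> \<le> S * S * S - 1"
  shows "(x + S * S * S) mod 2 ^ w div (S mod 2 ^ w) - S * S = x div S"
proof -
  have "(x + S * S * S) mod 2 ^ w = x + S * S * S" "S mod 2 ^ w = S"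
    using assms fits(2) S_powers by (intro modW; linarith)+
  moreover have "(x + S * S * S) div S = x div S + S * S"
    using S_powers div_mult_self2[of S x "S * S"] by (simp add: mult.assoc)
  ultimately show ?thesis by simp
qed

text \<open>Adding \<open>S ^ 3\<close> before and subtracting \<open>S ^ 2\<close> after the unsigned division makes it round towards \<open>-\<infinity>\<close>.\<close>

definition cmul :: "nat \<Rightarrow> nat \<Rightarrow> nat \<Rightarrow> nat \<Rightarrow> instr list" where
  "cmul x1 x2 y1 y2 =
    [Arith Mul 70 x1 y1, Arith Mul 71 x2 y2, Arith Sub 70 70 71, Arith Add 70 70 10, Arith Div 70 70 9,
     Arith Sub 70 70 11,
     Arith Mul 71 x1 y2, Arith Mul 76 x2 y1, Arith Add 71 71 76, Arith Add 71 71 10, Arith Div 71 71 9,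
     Arith Sub 71 71 11]"

lemma iexecs_cmul:
  assumes "{x1, x2, y1, y2} \<inter> {70, 71, 76} = {}" "\<rho> 9 = S" "\<rho> 10 = S * S * S" "\<rho> 11 = S * S"
    and "\<bar>\<rho> x1 * \<rho> y1 - \<rho> x2 * \<rho> y2\<bar> \<le> S * S * S - 1" "\<bar>\<rho> x1 * \<rho> y2 + \<rho> x2 * \<rho> y1\<bar> \<le> S * S * S - 1"
  shows "iexecs w (cmul x1 x2 y1 y2) \<rho> \<mu> f =
    f (\<rho>(70 := fst (fmul S (\<rho> x1, \<rho> x2) (\<rho> y1, \<rho> y2)), 76 := \<rho> x2 * \<rho> y1,
         71 := snd (fmul S (\<rho> x1, \<rho> x2) (\<rho> y1, \<rho> y2)))) \<mu>"
  using assms fdiv[OF assms(5)] fdiv[OF assms(6)]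
  by (simp add: cmul_def fmul_def fun_upd_twist)

section \<open>Butterflies and the loops over them\<close>

definition load_block :: "nat \<Rightarrow> instr list" where
  "load_block rb = [Arith Add 57 20 53, Arith Add 58 57 7, Load 57 57, Load 58 58, Arith Mul 56 54 53, Arith Add 56 56 rb]"

definition load_pair :: "instr list" where
  "load_pair = [Arith Add 61 56 60, Arith Add 62 61 55, Arith Add 63 61 7, Arith Add 64 62 7,
     Load 65 61, Load 66 63, Load 67 62, Load 68 64]"

definition store_pair :: "instr list" where
  "store_pair = [Store 61 72, Store 63 73, Store 62 74, Store 64 75]"

definition fwd_butterfly :: "instr list" where
  "fwd_butterfly = load_pair @ cmul 67 68 57 58 @
     [Arith Add 72 65 70, Arith Add 73 66 71, Arith Sub 74 65 70, Arith Sub 75 66 71] @ store_pair"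

definition bwd_butterfly :: "instr list" where
  "bwd_butterfly = load_pair @
     [Arith Add 72 65 67, Arith Add 73 66 68, Arith Sub 74 65 67, Arith Sub 75 66 68, Arith Sub 77 4 58] @
     cmul 74 75 57 77 @ [Arith Add 74 70 4, Arith Add 75 71 4] @ store_pair"

definition blocks :: "instr list \<Rightarrow> nat \<Rightarrow> com" where
  "blocks bf rb = For 53 52 (Blk (load_block rb) ;; For 60 55 (Blk bf))"

text \<open>Register 54 is the block length of the level, 55 its half and 52 the number of blocks.
  Blocks start at full length and are halved from level to level; \<open>bwd\<close> runs through
  the levels in the opposite order.\<close>

definition fwd :: "nat \<Rightarrow> com" where
  "fwd rb = Blk [Arith Add 54 7 4, Const 52 1] ;;
     For 50 8 (Blk [Arith Div 55 54 6] ;; blocks fwd_butterfly rb ;; Blk [Arith Add 54 55 4, Arith Add 52 52 52])"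

definition bwd :: "nat \<Rightarrow> com" where
  "bwd rb = Blk [Const 55 1, Arith Add 52 26 4] ;;
     For 50 8 (Blk [Arith Add 54 55 55] ;; blocks bwd_butterfly rb ;; Blk [Arith Add 55 54 4, Arith Div 52 52 6])"

lemma pair_address:
  assumes "0 \<le> b" "b + 2 * int N \<le> W" "q + j + L < N"
  shows "(b + int q + int j) mod 2 ^ w = b + int q + int j"
    "(b + int q + int j + int L) mod 2 ^ w = b + int q + int j + int L"
    "(b + int q + int j + int N) mod 2 ^ w = b + int q + int j + int N"
    "(b + int q + int j + int L + int N) mod 2 ^ w = b + int q + int j + int L + int N"
  using assms by (auto intro!: modW)

lemma put_pair:
  assumes "q + j + L < N"
  shows "put N \<mu> b F (b + int q + int j) = fst (F (q + j))"
    "put N \<mu> b F (b + int q + int j + int L) = fst (F (q + j + L))"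
    "put N \<mu> b F (b + int q + int j + int N) = snd (F (q + j))"
    "put N \<mu> b F (b + int q + int j + int L + int N) = snd (F (q + j + L))"
  using assms by (simp_all add: put_re[of "q + j"] put_re[of "q + j + L"] put_im[of "q + j"] put_im[of "q + j + L"])

lemma put_pair_upd:
  assumes "q + j + L < N"
  shows "(put N \<mu> b F)(b + int q + int j := x1, b + int q + int j + int N := x2,
      b + int q + int j + int L := y1, b + int q + int j + int L + int N := y2) =
    put N \<mu> b (F(q + j := (x1, x2), q + j + L := (y1, y2)))"
  using assms put_upd[of "q + j" N "b + int q + int j" b "b + int q + int j + int N" \<mu> F "(x1, x2)"]
    put_upd[of "q + j + L" N "b + int q + int j + int L" b "b + int q + int j + int L + int N" \<mu> "F(q + j := (x1, x2))" "(y1, y2)"]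
  by simp

lemma mult_bound:
  fixes a b c d :: int
  assumes "\<bar>x\<bar> \<le> c * S" "\<bar>y\<bar> \<le> d * S" "0 \<le> c"
  shows "\<bar>x * y\<bar> \<le> c * d * (S * S)"
proof -
  have "\<bar>x * y\<bar> \<le> (c * S) * (d * S)" unfolding abs_mult using assms S_powers by (intro mult_mono) auto
  then show ?thesis by (simp add: mult_ac)
qed

text \<open>Two products of size c * d * S ^ 2 add up to at most (S - 1) * S ^ 2 and so stay below S
  ^ 3, the range required by the signed division.\<close>

lemma two_products:
  assumes "\<bar>x1\<bar> \<le> c * S" "\<bar>x2\<bar> \<le> c * S" "\<bar>y1\<bar> \<le> d * S" "\<bar>y2\<bar> \<le> d * S" "0 \<le> c" "2 * c * d < S"
  shows "\<bar>x1 * y1 - x2 * y2\<bar> \<le> S * S * S - 1" "\<bar>x1 * y2 + x2 * y1\<bar> \<le> S * S * S - 1"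
proof -
  have "(2 * c * d) * (S * S) \<le> (S - 1) * (S * S)" using assms(6) S_powers by (intro mult_right_mono) auto
  moreover have "(S - 1) * (S * S) \<le> S * S * S - 1" using S_powers by (simp add: left_diff_distrib)
  ultimately have *: "c * d * (S * S) + c * d * (S * S) \<le> S * S * S - 1" by (simp add: algebra_simps)
  show "\<bar>x1 * y1 - x2 * y2\<bar> \<le> S * S * S - 1"
    using mult_bound[OF assms(1,3,5)] mult_bound[OF assms(2,4,5)] * by linarith
  show "\<bar>x1 * y2 + x2 * y1\<bar> \<le> S * S * S - 1"
    using mult_bound[OF assms(1,4,5)] mult_bound[OF assms(2,3,5)] * by linarith
qed

text \<open>Twiddle components are at most 2 * S, so \<open>two_products\<close> with d = 2 asks for
  4 * c < S. All loads precede the stores, hence both outputs refer to the old values.\<close>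

lemma fwd_butterfly_spec:
  assumes c: "consts_ok \<rho>" and \<rho>: "\<rho> 55 = int L" "\<rho> 56 = b + int q" "\<rho> 57 = fst z" "\<rho> 58 = snd z" "\<rho> 60 = int j"
    and addr: "0 \<le> b" "b + 2 * int N \<le> W" "q + j + L < N"
    and bd: "\<bar>fst (F (q + j + L))\<bar> \<le> c * S" "\<bar>snd (F (q + j + L))\<bar> \<le> c * S" "\<bar>fst z\<bar> \<le> 2 * S" "\<bar>snd z\<bar> \<le> 2 * S"
      "0 \<le> c" "4 * c < S"
  shows "hoare w (Blk fwd_butterfly) 28 \<rho> (put N \<mu> b F) (\<lambda>\<rho>' \<mu>'. same 61 \<rho> \<rho>' \<and>
      \<mu>' = put N \<mu> b (F(q + j := F (q + j) + fmul S (F (q + j + L)) z,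
        q + j + L := F (q + j) - fmul S (F (q + j + L)) z)))"
proof (rule hoare_Blk)
  note tp = two_products[OF bd(1,2,3,4,5)]
  have z: "z = (fst z, snd z)" "F (q + j + L) = (fst (F (q + j + L)), snd (F (q + j + L)))" by simp_all
  show "iexecs w fwd_butterfly \<rho> (put N \<mu> b F) (\<lambda>\<rho>' \<mu>'. same 61 \<rho> \<rho>' \<and>
      \<mu>' = put N \<mu> b (F(q + j := F (q + j) + fmul S (F (q + j + L)) z,
        q + j + L := F (q + j) - fmul S (F (q + j + L)) z)))"
    using c \<rho> tp bd(6)
    by (simp add: fwd_butterfly_def load_pair_def store_pair_def iexecs_append iexecs_cmul consts_ok_def
        pair_address[OF addr] put_pair[OF addr(3)] put_pair_upd[OF addr(3)] plus_prod_def minus_prod_def)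
qed (simp_all add: fwd_butterfly_def cmul_def load_pair_def store_pair_def)

lemma bwd_butterfly_spec:
  assumes c: "consts_ok \<rho>" and \<rho>: "\<rho> 55 = int L" "\<rho> 56 = b + int q" "\<rho> 57 = fst z" "\<rho> 58 = snd z" "\<rho> 60 = int j"
    and addr: "0 \<le> b" "b + 2 * int N \<le> W" "q + j + L < N"
    and bd: "\<bar>fst (F (q + j) - F (q + j + L))\<bar> \<le> c * S" "\<bar>snd (F (q + j) - F (q + j + L))\<bar> \<le> c * S" "\<bar>fst z\<bar> \<le> 2 * S" "\<bar>snd z\<bar> \<le> 2 * S"
      "0 \<le> c" "4 * c < S"
  shows "hoare w (Blk bwd_butterfly) 31 \<rho> (put N \<mu> b F) (\<lambda>\<rho>' \<mu>'. same 61 \<rho> \<rho>' \<and>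
      \<mu>' = put N \<mu> b (F(q + j := F (q + j) + F (q + j + L),
        q + j + L := fmul S (F (q + j) - F (q + j + L)) (cj z))))"
proof (rule hoare_Blk)
  note tp = two_products[OF bd(1,2,3) _ bd(5), of "- snd z"]
  show "iexecs w bwd_butterfly \<rho> (put N \<mu> b F) (\<lambda>\<rho>' \<mu>'. same 61 \<rho> \<rho>' \<and>
      \<mu>' = put N \<mu> b (F(q + j := F (q + j) + F (q + j + L),
        q + j + L := fmul S (F (q + j) - F (q + j + L)) (cj z))))"
    using c \<rho> tp bd(4,6)
    by (simp add: bwd_butterfly_def load_pair_def store_pair_def iexecs_append iexecs_cmul consts_ok_def
        pair_address[OF addr] put_pair[OF addr(3)] put_pair_upd[OF addr(3)] plus_prod_def minus_prod_def cj_def)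
qed (simp_all add: bwd_butterfly_def cmul_def load_pair_def store_pair_def)


text \<open>The loop nest common to both directions: \<open>G\<close> is the array that the level is
  meant to produce, and \<open>body\<close> says that one butterfly advances \<open>partial\<close>
  by one pair. The twiddle factor depends on the block only and is loaded once per block.\<close>

lemma blocks_spec:
  assumes c: "consts_ok \<rho>" and rb: "rb < 30" "\<rho> rb = b"
    and \<rho>: "\<rho> 52 = int nb" "\<rho> 54 = 2 * int L" "\<rho> 55 = int L"
    and L: "0 < L" "2 * L * nb = N" and b: "0 \<le> b" "b + 2 * int N \<le> TB"
    and tws: "\<And>q. q < N \<Longrightarrow> \<mu> (TB + int q) = fst (twd q)" "\<And>q. q < N \<Longrightarrow> \<mu> (TB + int q + int N) = snd (twd q)"
    and body: "\<And>\<rho>' k j. consts_ok \<rho>' \<Longrightarrow> \<rho>' 55 = int L \<Longrightarrow> \<rho>' 56 = b + int (2 * L * k) \<Longrightarrow>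
      \<rho>' 57 = fst (twd k) \<Longrightarrow> \<rho>' 58 = snd (twd k) \<Longrightarrow> \<rho>' 60 = int j \<Longrightarrow> j < L \<Longrightarrow> 2 * L * k + j + L < N \<Longrightarrow> k < N \<Longrightarrow>
      hoare w (Blk bf) tb \<rho>' (put N \<mu> b (partial L k j F G))
        (\<lambda>\<rho>'' \<mu>''. same 61 \<rho>' \<rho>'' \<and> \<mu>'' = put N \<mu> b (partial L k (Suc j) F G))"
  shows "hoare w (blocks bf rb) (nb * (L * (tb + 5) + 14) + 3) \<rho> (put N \<mu> b F)
    (\<lambda>\<rho>' \<mu>'. same 53 \<rho> \<rho>' \<and> \<rho>' 54 = \<rho> 54 \<and> \<rho>' 55 = \<rho> 55 \<and> \<mu>' = put N \<mu> b G)"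
proof -
  have nb: "0 < nb" using L N16 by (cases nb) auto
  have nbN: "nb \<le> N" "L \<le> N" using L(1) nb by (auto simp flip: L(2))
  have NW: "int N < W" using fits b N16 by (simp add: TBL_def)
  then have NW': "N < 2 ^ w" by (simp add: W_def)
  have TB: "TB + 2 * int N \<le> W" using fits by (simp add: TBL_def)
  show ?thesis
    unfolding blocks_def
  proof (rule hoare_mono[OF hoare_For[where n = nb and
        I = "\<lambda>k \<rho>' \<mu>'. same 53 \<rho> \<rho>' \<and> \<rho>' 54 = \<rho> 54 \<and> \<rho>' 55 = \<rho> 55 \<and> \<mu>' = put N \<mu> b (partial L k 0 F G)"] order_refl])
    fix k \<rho>' \<mu>'
    assume k: "k < nb" "\<rho>' 53 = int k" "\<rho>' 52 = int nb"
      and I: "same 53 \<rho> \<rho>' \<and> \<rho>' 54 = \<rho> 54 \<and> \<rho>' 55 = \<rho> 55 \<and> \<mu>' = put N \<mu> b (partial L k 0 F G)"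
    have c': "consts_ok \<rho>'" using consts_ok_same[OF c] I same_mono by force
    have rb': "\<rho>' rb = b" using I rb by (auto simp: same_def)
    have kN: "k < N" using k nbN by simp
    have "2 * L * Suc k \<le> 2 * L * nb" using k by (intro mult_le_mono) auto
    then have kL: "2 * L * k + 2 * L \<le> N" using L by simp
    show "hoare w (Blk (load_block rb) ;; For 60 55 (Blk bf)) (L * (tb + 5) + 9) \<rho>' \<mu>'
        (\<lambda>\<rho>'' \<mu>''. \<rho>'' 53 = int k \<and> \<rho>'' 52 = int nb \<and>
          same 53 \<rho> \<rho>'' \<and> \<rho>'' 54 = \<rho> 54 \<and> \<rho>'' 55 = \<rho> 55 \<and> \<mu>'' = put N \<mu> b (partial L (Suc k) 0 F G))"
    proof (rule hoare_Seq[where R = "\<lambda>\<rho>1 \<mu>1. same 56 \<rho>' \<rho>1 \<and> \<rho>1 56 = b + int (2 * L * k) \<and>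
        \<rho>1 57 = fst (twd k) \<and> \<rho>1 58 = snd (twd k) \<and> \<mu>1 = \<mu>'" and ?t1.0 = 6 and ?t2.0 = "L * (tb + 5) + 3"])
      show "hoare w (Blk (load_block rb)) 6 \<rho>' \<mu>' (\<lambda>\<rho>1 \<mu>1. same 56 \<rho>' \<rho>1 \<and> \<rho>1 56 = b + int (2 * L * k) \<and>
        \<rho>1 57 = fst (twd k) \<and> \<rho>1 58 = snd (twd k) \<and> \<mu>1 = \<mu>')"
      proof (rule hoare_Blk)
        have "(TB + int k) mod 2 ^ w = TB + int k" "(TB + int k + int N) mod 2 ^ w = TB + int k + int N"
          using TB b kN by (auto intro!: modW)
        \<comment> \<open>The twiddle table lies above the array being transformed, so its entries
          can be read off the original memory.\<close>
        moreover have "\<mu>' (TB + int k) = fst (twd k)" "\<mu>' (TB + int k + int N) = snd (twd k)"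
          using I b kN tws by (simp_all add: put_other)
        ultimately show "iexecs w (load_block rb) \<rho>' \<mu>' (\<lambda>\<rho>1 \<mu>1. same 56 \<rho>' \<rho>1 \<and> \<rho>1 56 = b + int (2 * L * k) \<and>
            \<rho>1 57 = fst (twd k) \<and> \<rho>1 58 = snd (twd k) \<and> \<mu>1 = \<mu>')"
          using c' rb rb' k I \<rho> by (simp add: load_block_def consts_ok_def)
      qed (simp_all add: load_block_def)
    next
      fix \<rho>1 \<mu>1
      assume R: "same 56 \<rho>' \<rho>1 \<and> \<rho>1 56 = b + int (2 * L * k) \<and>
        \<rho>1 57 = fst (twd k) \<and> \<rho>1 58 = snd (twd k) \<and> \<mu>1 = \<mu>'"
      show "hoare w (For 60 55 (Blk bf)) (L * (tb + 5) + 3) \<rho>1 \<mu>1 (\<lambda>\<rho>'' \<mu>''. \<rho>'' 53 = int k \<and> \<rho>'' 52 = int nb \<and>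
          same 53 \<rho> \<rho>'' \<and> \<rho>'' 54 = \<rho> 54 \<and> \<rho>'' 55 = \<rho> 55 \<and> \<mu>'' = put N \<mu> b (partial L (Suc k) 0 F G))"
      proof (rule hoare_mono[OF hoare_For[where n = L and
            I = "\<lambda>j \<rho>2 \<mu>2. same 60 \<rho>1 \<rho>2 \<and> \<mu>2 = put N \<mu> b (partial L k j F G)"] order_refl])
        show "\<rho>1 55 = int L" using R I \<rho> by (simp add: same_def)
        show "L < 2 ^ w" using NW' nbN by simp
        fix j \<rho>2 \<mu>2
        assume j: "j < L" "\<rho>2 60 = int j" "\<rho>2 55 = int L"
          and J: "same 60 \<rho>1 \<rho>2 \<and> \<mu>2 = put N \<mu> b (partial L k j F G)"
        have c2: "consts_ok \<rho>2"
          by (rule consts_ok_same[OF c']) (use J R in \<open>auto simp: same_def\<close>)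
        have "hoare w (Blk bf) tb \<rho>2 (put N \<mu> b (partial L k j F G))
            (\<lambda>\<rho>'' \<mu>''. same 61 \<rho>2 \<rho>'' \<and> \<mu>'' = put N \<mu> b (partial L k (Suc j) F G))"
          by (rule body[OF c2]) (use J R j kL kN in \<open>auto simp: same_def\<close>)
        then show "hoare w (Blk bf) tb \<rho>2 \<mu>2 (\<lambda>\<rho>3 \<mu>3. \<rho>3 60 = int j \<and> \<rho>3 55 = int L \<and>
            same 60 \<rho>1 \<rho>3 \<and> \<mu>3 = put N \<mu> b (partial L k (Suc j) F G))"
          using J by (elim conjE, simp only:, elim hoare_mono) (use j in \<open>auto simp: same_def\<close>)
      qed (use R I k L in \<open>auto simp: same_def partial_block_end\<close>)
    qed simp
  qed (use \<rho> NW' nbN L in \<open>auto simp: partial_start partial_end intro!: put_cong simp: same_def\<close>)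
qed

text \<open>The machine computes \<open>iforward\<close> exactly; accuracy plays no part at this
  point. \<open>bd\<close> supplies, for every level, the range in which the signed division is
  faithful.\<close>

lemma fwd_spec:
  assumes c: "consts_ok \<rho>" and rb: "rb < 30" "\<rho> rb = b" and b: "0 \<le> b" "b + 2 * int N \<le> TB"
    and tws: "\<And>q. q < N \<Longrightarrow> \<mu> (TB + int q) = fst (twd q)" "\<And>q. q < N \<Longrightarrow> \<mu> (TB + int q + int N) = snd (twd q)"
    and bd: "\<And>d. d \<le> \<kappa> \<Longrightarrow> small (2 * int N) (iforward S twd \<kappa> d F)"
  shows "hoare w (fwd rb) (26 * N * \<kappa>) \<rho> (put N \<mu> b F)
    (\<lambda>\<rho>' \<mu>'. same 50 \<rho> \<rho>' \<and> \<mu>' = put N \<mu> b (iforward S twd \<kappa> \<kappa> F))"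
  unfolding fwd_def
proof (rule hoare_Seq[where R = "\<lambda>\<rho>1 \<mu>1. same 50 \<rho> \<rho>1 \<and> \<rho>1 54 = int N \<and> \<rho>1 52 = 1 \<and> \<mu>1 = put N \<mu> b F"
      and ?t1.0 = 2 and ?t2.0 = "\<kappa> * (25 * N + 5) + 3"])
  show "hoare w (Blk [Arith Add 54 7 4, Const 52 1]) 2 \<rho> (put N \<mu> b F)
      (\<lambda>\<rho>1 \<mu>1. same 50 \<rho> \<rho>1 \<and> \<rho>1 54 = int N \<and> \<rho>1 52 = 1 \<and> \<mu>1 = put N \<mu> b F)"
    by (rule hoare_Blk) (use c in \<open>simp_all add: consts_ok_def\<close>)
next
  fix \<rho>1 \<mu>1
  assume R: "same 50 \<rho> \<rho>1 \<and> \<rho>1 54 = int N \<and> \<rho>1 52 = 1 \<and> \<mu>1 = put N \<mu> b F"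
  have c1: "consts_ok \<rho>1" by (rule consts_ok_same[OF c]) (use R in \<open>auto simp: same_def\<close>)
  have \<kappa>w: "\<kappa> < 2 ^ w"
  proof -
    have "\<kappa> < N" by (simp add: N_def)
    moreover have "int N < W" using fits b N16 by (simp add: TBL_def)
    ultimately have "int \<kappa> < 2 ^ w" by (simp add: W_def)
    then show ?thesis by (metis of_nat_less_iff of_nat_numeral of_nat_power)
  qed
  have NW: "int N < W" using fits b N16 by (simp add: TBL_def)
  show "hoare w (For 50 8 (Blk [Arith Div 55 54 6] ;; blocks fwd_butterfly rb ;; Blk [Arith Add 54 55 4, Arith Add 52 52 52]))
      (\<kappa> * (25 * N + 5) + 3) \<rho>1 \<mu>1
      (\<lambda>\<rho>' \<mu>'. same 50 \<rho> \<rho>' \<and> \<mu>' = put N \<mu> b (iforward S twd \<kappa> \<kappa> F))"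
  proof (rule hoare_mono[OF hoare_For[where n = \<kappa> and
      I = "\<lambda>d \<rho>' \<mu>'. same 50 \<rho> \<rho>' \<and> \<rho>' 54 = 2 ^ (\<kappa> - d) \<and> \<rho>' 52 = 2 ^ d \<and>
        \<mu>' = put N \<mu> b (iforward S twd \<kappa> d F)"] order_refl])
    show "\<rho>1 8 = int \<kappa>" using c1 by (simp add: consts_ok_def)
    fix d \<rho>2 \<mu>2
    assume d: "d < \<kappa>" "\<rho>2 50 = int d" "\<rho>2 8 = int \<kappa>"
      and I: "same 50 \<rho> \<rho>2 \<and> \<rho>2 54 = 2 ^ (\<kappa> - d) \<and> \<rho>2 52 = 2 ^ d \<and> \<mu>2 = put N \<mu> b (iforward S twd \<kappa> d F)"
    define L :: nat where "L = 2 ^ (\<kappa> - Suc d)"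
    have L: "0 < L" "2 * L * 2 ^ d = N"
      using d(1) by (simp_all add: L_def N_def flip: power_add power_Suc)
    have L2: "2 ^ (\<kappa> - d) = 2 * int L"
      using d(1) by (simp add: L_def Suc_diff_Suc flip: power_Suc)
    define F' where "F' = iforward S twd \<kappa> d F"
    have sF: "small (2 * int N) F'" using bd d by (simp add: F'_def)
    have c2: "consts_ok \<rho>2" by (rule consts_ok_same[OF c]) (use I in \<open>auto simp: same_def\<close>)
    have LN: "L * 2 ^ d * 2 = N" "2 * int L \<le> int N"
    proof -
      show "L * 2 ^ d * 2 = N" using L by (simp add: mult_ac)
      have "2 * L * 1 \<le> 2 * L * 2 ^ d" by (intro mult_le_mono) auto
      then show "2 * int L \<le> int N" using L(2) by linarith
    qed
    show "hoare w (Blk [Arith Div 55 54 6] ;; blocks fwd_butterfly rb ;; Blk [Arith Add 54 55 4, Arith Add 52 52 52])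
       (25 * N) \<rho>2 \<mu>2
       (\<lambda>\<rho>' \<mu>'. \<rho>' 50 = int d \<and> \<rho>' 8 = int \<kappa> \<and> same 50 \<rho> \<rho>' \<and> \<rho>' 54 = 2 ^ (\<kappa> - Suc d) \<and> \<rho>' 52 = 2 ^ Suc d \<and>
          \<mu>' = put N \<mu> b (iforward S twd \<kappa> (Suc d) F))"
    proof (rule hoare_Seq[where R = "\<lambda>\<rho>3 \<mu>3. same 55 \<rho>2 \<rho>3 \<and> \<rho>3 55 = int L \<and> \<mu>3 = \<mu>2"
          and ?t1.0 = 1 and ?t2.0 = "24 * N + 2"])
      show "hoare w (Blk [Arith Div 55 54 6]) 1 \<rho>2 \<mu>2 (\<lambda>\<rho>3 \<mu>3. same 55 \<rho>2 \<rho>3 \<and> \<rho>3 55 = int L \<and> \<mu>3 = \<mu>2)"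
      proof (rule hoare_Blk)
        have "2 * int L mod 2 ^ w = 2 * int L" "2 mod 2 ^ w = (2 :: int)"
          using LN NW N16 by (intro modW; linarith)+
        then show "iexecs w [Arith Div 55 54 6] \<rho>2 \<mu>2 (\<lambda>\<rho>3 \<mu>3. same 55 \<rho>2 \<rho>3 \<and> \<rho>3 55 = int L \<and> \<mu>3 = \<mu>2)"
          using I c2 unfolding L2 by (simp add: consts_ok_def)
      qed simp_all
    next
      fix \<rho>3 \<mu>3 assume R3: "same 55 \<rho>2 \<rho>3 \<and> \<rho>3 55 = int L \<and> \<mu>3 = \<mu>2"
      have \<mu>3: "\<mu>3 = put N \<mu> b F'" using R3 I by (simp add: F'_def)
      have c3: "consts_ok \<rho>3" by (rule consts_ok_same[OF c2]) (use R3 in \<open>auto simp: same_def\<close>)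
      show "hoare w (blocks fwd_butterfly rb ;; Blk [Arith Add 54 55 4, Arith Add 52 52 52]) (24 * N + 2) \<rho>3 \<mu>3
          (\<lambda>\<rho>' \<mu>'. \<rho>' 50 = int d \<and> \<rho>' 8 = int \<kappa> \<and> same 50 \<rho> \<rho>' \<and> \<rho>' 54 = 2 ^ (\<kappa> - Suc d) \<and> \<rho>' 52 = 2 ^ Suc d \<and>
            \<mu>' = put N \<mu> b (iforward S twd \<kappa> (Suc d) F))"
        unfolding \<mu>3
      proof (rule hoare_Seq[OF blocks_spec[where nb = "2 ^ d" and L = L and F = F' and G = "ifstep S twd L F'"
            and tb = 28 and b = b and \<mu> = \<mu> and \<rho> = \<rho>3]])
        show "consts_ok \<rho>3" by (fact c3)
        show "\<rho>3 rb = b" using R3 I rb by (auto simp: same_def)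
        show "\<rho>3 52 = int (2 ^ d)" "\<rho>3 54 = 2 * int L" "\<rho>3 55 = int L"
          using R3 I L2 by (simp_all add: same_def)
        fix \<rho>4 :: rfile and k j
        assume a: "consts_ok \<rho>4" "\<rho>4 55 = int L" "\<rho>4 56 = b + int (2 * L * k)" "\<rho>4 57 = fst (twd k)"
          "\<rho>4 58 = snd (twd k)" "\<rho>4 60 = int j" "j < L" "2 * L * k + j + L < N" "k < N"
        show "hoare w (Blk fwd_butterfly) 28 \<rho>4 (put N \<mu> b (partial L k j F' (ifstep S twd L F')))
          (\<lambda>\<rho>'' \<mu>''. same 61 \<rho>4 \<rho>'' \<and> \<mu>'' = put N \<mu> b (partial L k (Suc j) F' (ifstep S twd L F')))"
        proof (rule hoare_mono[OF fwd_butterfly_spec[where c = "2 * int N" and z = "twd k" and L = L and q = "2 * L * k" and j = j]])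
          let ?P = "partial L k j F' (ifstep S twd L F')"
          show "\<bar>fst (?P (2 * L * k + j + L))\<bar> \<le> 2 * int N * S" "\<bar>snd (?P (2 * L * k + j + L))\<bar> \<le> 2 * int N * S"
            using sF a by (simp_all add: partial_unchanged small_def)
          show "\<bar>fst (twd k)\<bar> \<le> 2 * S" "\<bar>snd (twd k)\<bar> \<le> 2 * S"
            using small_t a by (simp_all add: small_def)
          show "4 * (2 * int N) < S"
          proof -
            have "int N ^ 2 \<le> int N ^ 16" using N16 by (intro power_increasing) auto
            moreover have "16 * int N \<le> int N ^ 2" using N16 by (simp add: power2_eq_square mult_right_mono)
            ultimately show ?thesis using N16 unfolding S_eq(1) by linarith
          qed
          show "b + 2 * int N \<le> W" using b fits N16 by (simp add: TBL_def)
          fix \<rho>'' \<mu>''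
          assume "same 61 \<rho>4 \<rho>'' \<and> \<mu>'' = put N \<mu> b (?P(2 * L * k + j := ?P (2 * L * k + j) + fmul S (?P (2 * L * k + j + L)) (twd k),
             2 * L * k + j + L := ?P (2 * L * k + j) - fmul S (?P (2 * L * k + j + L)) (twd k)))"
          then show "same 61 \<rho>4 \<rho>'' \<and> \<mu>'' = put N \<mu> b (partial L k (Suc j) F' (ifstep S twd L F'))"
            using block_position[OF a(7), of k] a(7)
            by (simp add: partial_Suc partial_unchanged ifstep_def)
        qed (use a b in auto)
      next
        fix \<rho>4 \<mu>4
        assume "same 53 \<rho>3 \<rho>4 \<and> \<rho>4 54 = \<rho>3 54 \<and> \<rho>4 55 = \<rho>3 55 \<and> \<mu>4 = put N \<mu> b (ifstep S twd L F')"
        then show "hoare w (Blk [Arith Add 54 55 4, Arith Add 52 52 52]) 2 \<rho>4 \<mu>4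
          (\<lambda>\<rho>' \<mu>'. \<rho>' 50 = int d \<and> \<rho>' 8 = int \<kappa> \<and> same 50 \<rho> \<rho>' \<and> \<rho>' 54 = 2 ^ (\<kappa> - Suc d) \<and> \<rho>' 52 = 2 ^ Suc d \<and>
            \<mu>' = put N \<mu> b (iforward S twd \<kappa> (Suc d) F))"
          using R3 I c3 d by (intro hoare_Blk) (auto simp: same_def consts_ok_def L_def F'_def)
      next
        \<comment> \<open>There are 2 ^ d blocks and L * 2 ^ d = N / 2 butterflies, so 33 * N / 2 +
          14 * N / 2 steps and a constant fit into 24 * N.\<close>
        have "2 ^ d \<le> L * 2 ^ d" using L by simp
        moreover have "2 ^ d * (L * (28 + 5) + 14) = 33 * (L * 2 ^ d) + 14 * 2 ^ d" by (simp add: algebra_simps)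
        ultimately show "2 ^ d * (L * (28 + 5) + 14) + 3 + 2 \<le> 24 * N + 2"
          using LN(1) N16 by linarith
      qed (use R3 I rb b L tws in \<open>auto simp: F'_def\<close>)
    qed (use N16 in simp)
  qed (use R \<kappa>w in \<open>auto simp: same_def N_def\<close>)
next
  show "2 + (\<kappa> * (25 * N + 5) + 3) \<le> 26 * N * \<kappa>"
  proof -
    have "\<kappa> * (25 * N + 5) = 25 * (N * \<kappa>) + 5 * \<kappa>" by (simp add: algebra_simps)
    moreover have "10 * \<kappa> \<le> N * \<kappa>" using N16 by (intro mult_right_mono) auto
    ultimately show ?thesis using \<kappa> by linarith
  qed
qed

lemma bwd_spec:
  assumes c: "consts_ok \<rho>" and rb: "rb < 30" "\<rho> rb = b" and b: "0 \<le> b" "b + 2 * int N \<le> TB"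
    and tws: "\<And>q. q < N \<Longrightarrow> \<mu> (TB + int q) = fst (twd q)" "\<And>q. q < N \<Longrightarrow> \<mu> (TB + int q + int N) = snd (twd q)"
    and bd: "\<And>d. d \<le> \<kappa> \<Longrightarrow> small (2 * int N ^ 3) (ibackward S twd d F)"
  shows "hoare w (bwd rb) (28 * N * \<kappa>) \<rho> (put N \<mu> b F)
    (\<lambda>\<rho>' \<mu>'. same 50 \<rho> \<rho>' \<and> \<mu>' = put N \<mu> b (ibackward S twd \<kappa> F))"
  unfolding bwd_def
proof (rule hoare_Seq[where R = "\<lambda>\<rho>1 \<mu>1. same 50 \<rho> \<rho>1 \<and> \<rho>1 55 = 1 \<and> \<rho>1 52 = int (N div 2) \<and> \<mu>1 = put N \<mu> b F"
      and ?t1.0 = 2 and ?t2.0 = "\<kappa> * (27 * N + 5) + 3"])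
  show "hoare w (Blk [Const 55 1, Arith Add 52 26 4]) 2 \<rho> (put N \<mu> b F)
      (\<lambda>\<rho>1 \<mu>1. same 50 \<rho> \<rho>1 \<and> \<rho>1 55 = 1 \<and> \<rho>1 52 = int (N div 2) \<and> \<mu>1 = put N \<mu> b F)"
    by (rule hoare_Blk) (use c in \<open>simp_all add: consts_ok_def\<close>)
next
  fix \<rho>1 \<mu>1
  assume R: "same 50 \<rho> \<rho>1 \<and> \<rho>1 55 = 1 \<and> \<rho>1 52 = int (N div 2) \<and> \<mu>1 = put N \<mu> b F"
  have c1: "consts_ok \<rho>1" by (rule consts_ok_same[OF c]) (use R in \<open>auto simp: same_def\<close>)
  have \<kappa>w: "\<kappa> < 2 ^ w"
  proof -
    have "\<kappa> < N" by (simp add: N_def)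
    moreover have "int N < W" using fits b N16 by (simp add: TBL_def)
    ultimately have "int \<kappa> < 2 ^ w" by (simp add: W_def)
    then show ?thesis by (metis of_nat_less_iff of_nat_numeral of_nat_power)
  qed
  have NW: "int N < W" using fits b N16 by (simp add: TBL_def)
  show "hoare w (For 50 8 (Blk [Arith Add 54 55 55] ;; blocks bwd_butterfly rb ;; Blk [Arith Add 55 54 4, Arith Div 52 52 6]))
      (\<kappa> * (27 * N + 5) + 3) \<rho>1 \<mu>1
      (\<lambda>\<rho>' \<mu>'. same 50 \<rho> \<rho>' \<and> \<mu>' = put N \<mu> b (ibackward S twd \<kappa> F))"
  \<comment> \<open>The block count is written as a quotient of natural numbers because it drops to
    0 after the last level.\<close>
  proof (rule hoare_mono[OF hoare_For[where n = \<kappa> and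
      I = "\<lambda>d \<rho>' \<mu>'. same 50 \<rho> \<rho>' \<and> \<rho>' 55 = 2 ^ d \<and> \<rho>' 52 = int (N div 2 ^ Suc d) \<and>
        \<mu>' = put N \<mu> b (ibackward S twd d F)"] order_refl])
    show "\<rho>1 8 = int \<kappa>" using c1 by (simp add: consts_ok_def)
    fix d \<rho>2 \<mu>2
    assume d: "d < \<kappa>" "\<rho>2 50 = int d" "\<rho>2 8 = int \<kappa>"
      and I: "same 50 \<rho> \<rho>2 \<and> \<rho>2 55 = 2 ^ d \<and> \<rho>2 52 = int (N div 2 ^ Suc d) \<and> \<mu>2 = put N \<mu> b (ibackward S twd d F)"
    define L :: nat where "L = 2 ^ d"
    define nb :: nat where "nb = 2 ^ (\<kappa> - Suc d)"
    have nb: "N div 2 ^ Suc d = nb" unfolding N_def nb_def using d(1) by (subst power_diff) auto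
    have L: "0 < L" "2 * L * nb = N"
      using d(1) by (simp_all add: L_def nb_def N_def flip: power_add power_Suc)
    define F' where "F' = ibackward S twd d F"
    have sF: "small (2 * int N ^ 3) F'" using bd d by (simp add: F'_def)
    have c2: "consts_ok \<rho>2" by (rule consts_ok_same[OF c]) (use I in \<open>auto simp: same_def\<close>)
    have LN: "L * nb * 2 = N" using L by (simp add: mult_ac)
    show "hoare w (Blk [Arith Add 54 55 55] ;; blocks bwd_butterfly rb ;; Blk [Arith Add 55 54 4, Arith Div 52 52 6])
       (27 * N) \<rho>2 \<mu>2
       (\<lambda>\<rho>' \<mu>'. \<rho>' 50 = int d \<and> \<rho>' 8 = int \<kappa> \<and> same 50 \<rho> \<rho>' \<and> \<rho>' 55 = 2 ^ Suc d \<and> \<rho>' 52 = int (N div 2 ^ Suc (Suc d)) \<and>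
          \<mu>' = put N \<mu> b (ibackward S twd (Suc d) F))"
    proof (rule hoare_Seq[where R = "\<lambda>\<rho>3 \<mu>3. same 54 \<rho>2 \<rho>3 \<and> \<rho>3 55 = int L \<and> \<rho>3 54 = 2 * int L \<and> \<mu>3 = \<mu>2"
          and ?t1.0 = 1 and ?t2.0 = "26 * N + 2"])
      show "hoare w (Blk [Arith Add 54 55 55]) 1 \<rho>2 \<mu>2 (\<lambda>\<rho>3 \<mu>3. same 54 \<rho>2 \<rho>3 \<and> \<rho>3 55 = int L \<and> \<rho>3 54 = 2 * int L \<and> \<mu>3 = \<mu>2)"
        by (rule hoare_Blk) (use I in \<open>simp_all add: L_def\<close>)
    next
      fix \<rho>3 \<mu>3 assume R3: "same 54 \<rho>2 \<rho>3 \<and> \<rho>3 55 = int L \<and> \<rho>3 54 = 2 * int L \<and> \<mu>3 = \<mu>2"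
      have \<mu>3: "\<mu>3 = put N \<mu> b F'" using R3 I by (simp add: F'_def)
      have c3: "consts_ok \<rho>3" by (rule consts_ok_same[OF c2]) (use R3 in \<open>auto simp: same_def\<close>)
      show "hoare w (blocks bwd_butterfly rb ;; Blk [Arith Add 55 54 4, Arith Div 52 52 6]) (26 * N + 2) \<rho>3 \<mu>3
          (\<lambda>\<rho>' \<mu>'. \<rho>' 50 = int d \<and> \<rho>' 8 = int \<kappa> \<and> same 50 \<rho> \<rho>' \<and> \<rho>' 55 = 2 ^ Suc d \<and> \<rho>' 52 = int (N div 2 ^ Suc (Suc d)) \<and>
            \<mu>' = put N \<mu> b (ibackward S twd (Suc d) F))"
        unfolding \<mu>3
      proof (rule hoare_Seq[OF blocks_spec[where nb = nb and L = L and F = F' and G = "ibstep S twd L F'"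
            and tb = 31 and b = b and \<mu> = \<mu> and \<rho> = \<rho>3]])
        show "consts_ok \<rho>3" by (fact c3)
        show "\<rho>3 rb = b" using R3 I rb by (auto simp: same_def)
        show "\<rho>3 52 = int nb" "\<rho>3 54 = 2 * int L" "\<rho>3 55 = int L"
          using R3 I nb by (simp_all add: same_def)
        fix \<rho>4 :: rfile and k j
        assume a: "consts_ok \<rho>4" "\<rho>4 55 = int L" "\<rho>4 56 = b + int (2 * L * k)" "\<rho>4 57 = fst (twd k)"
          "\<rho>4 58 = snd (twd k)" "\<rho>4 60 = int j" "j < L" "2 * L * k + j + L < N" "k < N"
        show "hoare w (Blk bwd_butterfly) 31 \<rho>4 (put N \<mu> b (partial L k j F' (ibstep S twd L F')))
          (\<lambda>\<rho>'' \<mu>''. same 61 \<rho>4 \<rho>'' \<and> \<mu>'' = put N \<mu> b (partial L k (Suc j) F' (ibstep S twd L F')))"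
        proof (rule hoare_mono[OF bwd_butterfly_spec[where c = "4 * int N ^ 3" and z = "twd k" and L = L and q = "2 * L * k" and j = j]])
          let ?P = "partial L k j F' (ibstep S twd L F')"
          have p: "2 * L * k + j < N" using a(8) by simp
          have "\<bar>fst (F' (2 * L * k + j))\<bar> \<le> 2 * int N ^ 3 * S" "\<bar>snd (F' (2 * L * k + j))\<bar> \<le> 2 * int N ^ 3 * S"
            "\<bar>fst (F' (2 * L * k + j + L))\<bar> \<le> 2 * int N ^ 3 * S" "\<bar>snd (F' (2 * L * k + j + L))\<bar> \<le> 2 * int N ^ 3 * S"
            using sF[unfolded small_def, rule_format, OF p] sF[unfolded small_def, rule_format, OF a(8)] by auto
          \<comment> \<open>A difference of two entries, hence twice the bound 2 * N ^ 3 *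
            S.\<close>
          then show "\<bar>fst (?P (2 * L * k + j) - ?P (2 * L * k + j + L))\<bar> \<le> 4 * int N ^ 3 * S"
            "\<bar>snd (?P (2 * L * k + j) - ?P (2 * L * k + j + L))\<bar> \<le> 4 * int N ^ 3 * S"
            unfolding partial_unchanged(1)[OF a(7)] partial_unchanged(2)[OF a(7)] fst_diff snd_diff by linarith+
          show "\<bar>fst (twd k)\<bar> \<le> 2 * S" "\<bar>snd (twd k)\<bar> \<le> 2 * S"
            using small_t a by (simp_all add: small_def)
          show "4 * (4 * int N ^ 3) < S"
          proof -
            have "int N ^ 5 \<le> int N ^ 16" using N16 by (intro power_increasing) auto
            moreover have "256 * int N ^ 3 \<le> int N ^ 2 * int N ^ 3"
              using N16 power_mono[of 16 "int N" 2] by (intro mult_right_mono) auto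
            moreover have "int N ^ 2 * int N ^ 3 = int N ^ 5" by (simp flip: power_add)
            moreover have "0 < int N ^ 3" using N16 by simp
            ultimately show ?thesis unfolding S_eq(1) by linarith
          qed
          show "b + 2 * int N \<le> W" using b fits N16 by (simp add: TBL_def)
          fix \<rho>'' \<mu>''
          assume "same 61 \<rho>4 \<rho>'' \<and> \<mu>'' = put N \<mu> b (?P(2 * L * k + j := ?P (2 * L * k + j) + ?P (2 * L * k + j + L),
             2 * L * k + j + L := fmul S (?P (2 * L * k + j) - ?P (2 * L * k + j + L)) (cj (twd k))))"
          then show "same 61 \<rho>4 \<rho>'' \<and> \<mu>'' = put N \<mu> b (partial L k (Suc j) F' (ibstep S twd L F'))"
            using block_position[OF a(7), of k] a(7)
            by (simp add: partial_Suc partial_unchanged ibstep_def)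
        qed (use a b in auto)
      next
        fix \<rho>4 \<mu>4
        assume R4: "same 53 \<rho>3 \<rho>4 \<and> \<rho>4 54 = \<rho>3 54 \<and> \<rho>4 55 = \<rho>3 55 \<and> \<mu>4 = put N \<mu> b (ibstep S twd L F')"
        have dvn: "N div 2 ^ Suc (Suc d) = nb div 2"
          by (subst nb[symmetric], subst power_Suc2, rule div_mult2_eq)
        have "int nb mod 2 ^ w = int nb" "2 mod 2 ^ w = (2 :: int)"
        proof -
          have "nb \<le> N" using L(1) N16 LN by (cases L) (auto simp: algebra_simps)
          then show "int nb mod 2 ^ w = int nb" using NW by (intro modW) auto
          show "2 mod 2 ^ w = (2 :: int)" using NW N16 by (intro modW; linarith)
        qed
        then show "hoare w (Blk [Arith Add 55 54 4, Arith Div 52 52 6]) 2 \<rho>4 \<mu>4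
          (\<lambda>\<rho>' \<mu>'. \<rho>' 50 = int d \<and> \<rho>' 8 = int \<kappa> \<and> same 50 \<rho> \<rho>' \<and> \<rho>' 55 = 2 ^ Suc d \<and> \<rho>' 52 = int (N div 2 ^ Suc (Suc d)) \<and>
            \<mu>' = put N \<mu> b (ibackward S twd (Suc d) F))"
          using R3 I[unfolded nb] c3 d R4 unfolding dvn
          by (intro hoare_Blk) (auto simp: same_def consts_ok_def L_def F'_def zdiv_int)
      next
        have "nb \<le> L * nb" using L by simp
        moreover have "nb * (L * (31 + 5) + 14) = 36 * (L * nb) + 14 * nb" by (simp add: algebra_simps)
        ultimately show "nb * (L * (31 + 5) + 14) + 3 + 2 \<le> 26 * N + 2"
          using LN(1) N16 by linarith
      qed (use R3 I rb b L tws in \<open>auto simp: F'_def\<close>)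
    qed (use N16 in simp)
  qed (use R \<kappa>w in \<open>auto simp: same_def N_def\<close>)
next
  show "2 + (\<kappa> * (27 * N + 5) + 3) \<le> 28 * N * \<kappa>"
  proof -
    have "\<kappa> * (27 * N + 5) = 27 * (N * \<kappa>) + 5 * \<kappa>" by (simp add: algebra_simps)
    moreover have "10 * \<kappa> \<le> N * \<kappa>" using N16 by (intro mult_right_mono) auto
    ultimately show ?thesis using \<kappa> by linarith
  qed
qed

end

definition frame :: "int \<Rightarrow> int \<Rightarrow> memory \<Rightarrow> memory \<Rightarrow> bool" where
  "frame lo hi \<mu> \<mu>' \<longleftrightarrow> (\<forall>a. a < lo \<or> hi \<le> a \<longrightarrow> \<mu>' a = \<mu> a)"

lemma frame_refl [simp]: "frame lo hi \<mu> \<mu>"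
  by (simp add: frame_def)

lemma frame_trans: "frame lo hi \<mu> \<mu>' \<Longrightarrow> frame lo hi \<mu>' \<mu>'' \<Longrightarrow> frame lo hi \<mu> \<mu>''"
  by (simp add: frame_def)

lemma frame_mono: "frame lo hi \<mu> \<mu>' \<Longrightarrow> lo' \<le> lo \<Longrightarrow> hi \<le> hi' \<Longrightarrow> frame lo' hi' \<mu> \<mu>'"
  by (simp add: frame_def)

lemma frame_upd: "frame lo hi \<mu> \<mu>' \<Longrightarrow> lo \<le> a \<Longrightarrow> a < hi \<Longrightarrow> frame lo hi \<mu> (\<mu>'(a := x))"
  by (auto simp: frame_def)

lemma put_commute:
  "b + 2 * int N \<le> c \<Longrightarrow> put N (put N \<mu> b F) c G = put N (put N \<mu> c G) b F"
  by (rule ext) (auto simp: put_def)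

lemma frame_put: "lo \<le> b \<Longrightarrow> b + 2 * int N \<le> hi \<Longrightarrow> frame lo hi \<mu> (put N \<mu> b F)"
  by (auto simp: frame_def put_def)

context machine
begin

lemma layout: "0 \<le> HX" "HX + int (n + m) = OUT" "OUT + 2 * int n = ACC" "ACC + int m = AB"
  "AB + 2 * int N = GB" "GB + 2 * int N = TB" "TB + 2 * int N = TBL" "TBL + int \<sigma> < W" "HX = int (n + m)"
  using fits by (simp_all add: HX_def OUT_def ACC_def AB_def GB_def TB_def TBL_def)

lemma nat_less_W: "int x < W \<Longrightarrow> x < 2 ^ w"
  by (simp add: W_def)

lemma two_m: "2 * m \<le> N"
  using m by (simp add: N_def)

text \<open>
  Positions past the end of the text read foreign memory. The comparison turns whatever is found there
  into 0 or 1, and only locations that are never output depend on it.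
\<close>

definition build_text :: "instr list" where
  "build_text = [Arith Add 61 35 40, Load 61 61, Arith Equal 61 61 37, Arith Mul 61 61 9,
     Arith Add 62 18 40, Store 62 61, Arith Add 63 62 7, Store 63 4]"

text \<open>The comparison with register 1 pads the pattern with zeros up to length N, so positions
  from \<open>m\<close> on contribute nothing to a correlation.\<close>

definition build_pattern :: "instr list" where
  "build_pattern = [Arith Add 61 36 40, Load 61 61, Arith Equal 61 61 37, Arith Less 64 40 1, Arith Mul 61 61 64,
     Arith Mul 61 61 9, Arith Add 62 19 40, Store 62 61, Arith Add 63 62 7, Store 63 4]"

definition build :: com where
  "build = For 40 7 (Blk (build_text @ build_pattern))"

definition flag :: "bool \<Rightarrow> ipair" where
  "flag b = (of_bool b * S, 0)"

text \<open>For positions beyond the text only membership in \<open>range flag\<close> is claimed: a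
  flag of either value satisfies the magnitude bounds of the error analysis.\<close>

definition built :: "nat \<Rightarrow> (nat \<Rightarrow> int) \<Rightarrow> nat \<Rightarrow> nat \<Rightarrow> (nat \<Rightarrow> ipair) \<Rightarrow> (nat \<Rightarrow> ipair) \<Rightarrow> bool" where
  "built j hx s k F G \<longleftrightarrow> (\<forall>p < j. F p \<in> range flag \<and> (s + p < n \<longrightarrow> F p = flag (hx (s + p) = int k)) \<and>
     G p = flag (p < m \<and> hx (n + p) = int k))"

lemma build_spec:
  assumes c: "consts_ok \<rho>" and \<rho>: "\<rho> 35 = HX + int s" "\<rho> 36 = HX + int n" "\<rho> 37 = int k"
    and s: "s < n" and k: "int k < W"
    and hx: "\<And>q. q < n + m \<Longrightarrow> \<mu> (HX + int q) = hx q \<and> 0 \<le> hx q \<and> hx q < W"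
  shows "hoare w build (23 * N + 3) \<rho> \<mu> (\<lambda>\<rho>' \<mu>'. same 40 \<rho> \<rho>' \<and>
    (\<exists>F G. \<mu>' = put N (put N \<mu> AB F) GB G \<and> built N hx s k F G))"
  unfolding build_def
proof (rule hoare_mono[OF hoare_For[where n = N and tb = 18 and
      I = "\<lambda>j \<rho>' \<mu>'. same 40 \<rho> \<rho>' \<and> (\<exists>F G. \<mu>' = put N (put N \<mu> AB F) GB G \<and> built j hx s k F G)"]])
  show "\<rho> 7 = int N" using c by (simp add: consts_ok_def)
  show "N < 2 ^ w" using layout N16 by (intro nat_less_W) linarith
  show "same 40 \<rho> \<rho> \<and> (\<exists>F G. \<mu> = put N (put N \<mu> AB F) GB G \<and> built 0 hx s k F G)"
  proof (intro conjI exI)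
    \<comment> \<open>Before the first round the two arrays are whatever the memory
      contains.\<close>
    show "\<mu> = put N (put N \<mu> AB (\<lambda>p. (\<mu> (AB + int p), \<mu> (AB + int p + int N))))
        GB (\<lambda>p. (\<mu> (GB + int p), \<mu> (GB + int p + int N)))"
      by (subst put_self[of N \<mu> AB]) (auto simp: put_self)
  qed (auto simp: built_def)
  fix j \<rho>' \<mu>'
  assume j: "j < N" "\<rho>' 40 = int j" "\<rho>' 7 = int N"
    and I: "same 40 \<rho> \<rho>' \<and> (\<exists>F G. \<mu>' = put N (put N \<mu> AB F) GB G \<and> built j hx s k F G)"
  then obtain F G where F: "\<mu>' = put N (put N \<mu> AB F) GB G" and B: "built j hx s k F G" by blast
  have c': "consts_ok \<rho>'" by (rule consts_ok_same[OF c]) (use I in \<open>auto simp: same_def\<close>)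
  have \<rho>': "\<rho>' 35 = HX + int s" "\<rho>' 36 = HX + int n" "\<rho>' 37 = int k" using I \<rho> by (simp_all add: same_def)
  define x where "x = \<mu>' (HX + int s + int j)"
  define a where "a = (x mod 2 ^ w = int k)"
  define \<mu>1 where "\<mu>1 = put N (put N \<mu> AB (F(j := flag a))) GB G"
  \<comment> \<open>Read after the text flag has been stored. For \<open>j \<ge> m\<close> the
    address may fall into an array that is being filled, so it is the intermediate memory that
    counts.\<close>
  define y where "y = \<mu>1 (HX + int n + int j)"
  define b where "b = (y mod 2 ^ w = int k \<and> j < m)"
  have "int j < int N" using j by simp
  note lay = layout this s m(2)
  have mod1: "(HX + int s + int j) mod 2 ^ w = HX + int s + int j" "(HX + int n + int j) mod 2 ^ w = HX + int n + int j"
    "(AB + int j) mod 2 ^ w = AB + int j" "(AB + int j + int N) mod 2 ^ w = AB + int j + int N"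
    "(GB + int j) mod 2 ^ w = GB + int j" "(GB + int j + int N) mod 2 ^ w = GB + int j + int N"
    "int k mod 2 ^ w = int k" "int m mod 2 ^ w = int m" "int j mod 2 ^ w = int j"
    using lay k by (intro modW; linarith)+
  have pc: "put N (put N \<mu> AB F) GB G = put N (put N \<mu> GB G) AB F" for F
    by (rule put_commute) (use layout in simp)
  have u1: "\<mu>'(AB + int j := of_bool a * S, AB + int j + int N := 0) = \<mu>1"
    unfolding F \<mu>1_def pc using put_upd[OF j(1) refl refl, of "put N \<mu> GB G" AB F "flag a"]
    by (simp only: flag_def fst_conv snd_conv)
  have u2: "\<mu>1(GB + int j := of_bool b * S, GB + int j + int N := 0) = put N (put N \<mu> AB (F(j := flag a))) GB (G(j := flag b))"
    unfolding \<mu>1_def using put_upd[OF j(1) refl refl, of _ GB G "flag b"] by (simp add: flag_def)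
  show "hoare w (Blk (build_text @ build_pattern)) 18 \<rho>' \<mu>'
     (\<lambda>\<rho>'' \<mu>''. \<rho>'' 40 = int j \<and> \<rho>'' 7 = int N \<and> same 40 \<rho> \<rho>'' \<and>
        (\<exists>F G. \<mu>'' = put N (put N \<mu> AB F) GB G \<and> built (Suc j) hx s k F G))"
  proof (rule hoare_mono[OF hoare_Blk[where Q = "\<lambda>\<rho>'' \<mu>''. same 41 \<rho>' \<rho>'' \<and>
        \<mu>'' = put N (put N \<mu> AB (F(j := flag a))) GB (G(j := flag b))"] order_refl])
    have ab: "of_bool (x mod 2 ^ w = int k) = (of_bool a :: int)"
      "of_bool (y mod 2 ^ w = int k) * of_bool (j < m) = (of_bool b :: int)" by (auto simp: a_def b_def)
    show "iexecs w (build_text @ build_pattern) \<rho>' \<mu>'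
     (\<lambda>\<rho>'' \<mu>''. same 41 \<rho>' \<rho>'' \<and> \<mu>'' = put N (put N \<mu> AB (F(j := flag a))) GB (G(j := flag b)))"
    proof -
      define \<rho>1 where "\<rho>1 = \<rho>'(61 := of_bool a * S, 62 := AB + int j, 63 := AB + int j + int N)"
      have 1: "iexecs w build_text \<rho>' \<mu>' f = f \<rho>1 \<mu>1" for f :: "rfile \<Rightarrow> memory \<Rightarrow> bool"
        unfolding u1[symmetric] \<rho>1_def ab(1)[symmetric] x_def
        using c' \<rho>' j mod1 by (simp add: build_text_def consts_ok_def fun_upd_twist)
      have "same 41 \<rho>' \<rho>1" by (simp add: \<rho>1_def)
      then have 2: "same 41 \<rho>' \<rho>1" "consts_ok \<rho>1" "\<rho>1 36 = HX + int n" "\<rho>1 37 = int k" "\<rho>1 40 = int j"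
        using c' \<rho>' j by (auto simp: same_def consts_ok_def)
      show ?thesis
        unfolding iexecs_append 1 u2[symmetric] ab(2)[symmetric] y_def
        using 2 mod1 by (simp add: build_pattern_def consts_ok_def)
    qed
  next
    fix \<rho>'' \<mu>''
    assume Q: "same 41 \<rho>' \<rho>'' \<and> \<mu>'' = put N (put N \<mu> AB (F(j := flag a))) GB (G(j := flag b))"
    have x: "x = hx (s + j)" if "s + j < n"
    proof -
      have "x = \<mu> (HX + int (s + j))" unfolding x_def F using lay that by (simp add: put_other add.assoc)
      then show ?thesis using hx[of "s + j"] that by simp
    qed
    have y: "y = hx (n + j)" if "j < m"
    proof -
      have "y = \<mu> (HX + int (n + j))" unfolding y_def \<mu>1_def using lay that by (simp add: put_other add.assoc)
      then show ?thesis using hx[of "n + j"] that by simp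
    qed
    have "a = (hx (s + j) = int k)" if "s + j < n"
      using x[OF that] hx[of "s + j"] that by (simp add: a_def modW)
    moreover have "b = (j < m \<and> hx (n + j) = int k)"
      using y hx[of "n + j"] by (auto simp add: b_def modW)
    ultimately have "built (Suc j) hx s k (F(j := flag a)) (G(j := flag b))"
      using B by (auto simp: built_def less_Suc_eq)
    then show "\<rho>'' 40 = int j \<and> \<rho>'' 7 = int N \<and> same 40 \<rho> \<rho>'' \<and>
        (\<exists>F G. \<mu>'' = put N (put N \<mu> AB F) GB G \<and> built (Suc j) hx s k F G)"
      using Q I j by (auto simp: same_def)
  qed (simp_all add: build_text_def build_pattern_def)
qed (auto simp: same_def)

section \<open>Products of spectra and rounding\<close>

definition pointwise :: com where
  "pointwise = For 40 7 (Blk ([Arith Add 61 18 40, Arith Add 62 19 40, Arith Add 63 61 7, Arith Add 64 62 7,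
     Load 65 61, Load 66 63, Load 67 62, Load 68 64, Arith Sub 77 4 68] @ cmul 65 66 67 77 @ [Store 61 70, Store 63 71]))"

lemma pointwise_spec:
  assumes c: "consts_ok \<rho>" and bd: "small (2 * int N) F" "small (2 * int N) G"
  shows "hoare w pointwise (28 * N + 3) \<rho> (put N (put N \<mu> GB G) AB F) (\<lambda>\<rho>' \<mu>'. same 40 \<rho> \<rho>' \<and>
    \<mu>' = put N (put N \<mu> GB G) AB (imult F G))"
  unfolding pointwise_def
proof (rule hoare_mono[OF hoare_For[where n = N and tb = 23 and
      I = "\<lambda>j \<rho>' \<mu>'. same 40 \<rho> \<rho>' \<and> \<mu>' = put N (put N \<mu> GB G) AB (\<lambda>p. if p < j then imult F G p else F p)"]])
  show "\<rho> 7 = int N" using c by (simp add: consts_ok_def)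
  show "N < 2 ^ w" using layout N16 by (intro nat_less_W) linarith
  fix j \<rho>' \<mu>'
  assume j: "j < N" "\<rho>' 40 = int j" "\<rho>' 7 = int N"
    and I: "same 40 \<rho> \<rho>' \<and> \<mu>' = put N (put N \<mu> GB G) AB (\<lambda>p. if p < j then imult F G p else F p)"
  define H where "H = (\<lambda>p. if p < j then imult F G p else F p)"
  have \<mu>': "\<mu>' = put N (put N \<mu> GB G) AB H" using I by (simp add: H_def)
  have c': "consts_ok \<rho>'" by (rule consts_ok_same[OF c]) (use I in \<open>auto simp: same_def\<close>)
  have "int j < int N" using j by simp
  note lay = layout this
  have mod1: 
    "(AB + int j) mod 2 ^ w = AB + int j" "(AB + int j + int N) mod 2 ^ w = AB + int j + int N"
    "(GB + int j) mod 2 ^ w = GB + int j" "(GB + int j + int N) mod 2 ^ w = GB + int j + int N"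
    using lay by (intro modW; linarith)+
  have ld: "\<mu>' (AB + int j) = fst (F j)" "\<mu>' (AB + int j + int N) = snd (F j)"
    "\<mu>' (GB + int j) = fst (G j)" "\<mu>' (GB + int j + int N) = snd (G j)"
    unfolding \<mu>' using j lay by (simp_all add: put_re[of j] put_im[of j] put_other H_def)
  \<comment> \<open>Both spectra have components up to 2 * N * S, so the condition of
    \<open>two_products\<close> becomes 8 * N ^ 2 < S.\<close>
  have "2 * (2 * int N) * (2 * int N) < S"
  proof -
    have "int N ^ 3 \<le> int N ^ 16" using N16 by (intro power_increasing) auto
    moreover have "16 * int N ^ 2 \<le> int N * int N ^ 2" using N16 by (intro mult_right_mono) auto
    moreover have "0 < int N ^ 2" using N16 by simp
    ultimately show ?thesis unfolding S_eq(1) by (simp add: power2_eq_square power3_eq_cube)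
  qed
  then have tp: "\<bar>fst (F j) * fst (G j) - snd (F j) * - snd (G j)\<bar> \<le> S * S * S - 1"
    "\<bar>fst (F j) * - snd (G j) + snd (F j) * fst (G j)\<bar> \<le> S * S * S - 1"
    using bd j by (intro two_products[where c = "2 * int N" and d = "2 * int N"]; simp add: small_def)+
  have u: "\<mu>'(AB + int j := fst (imult F G j), AB + int j + int N := snd (imult F G j)) =
      put N (put N \<mu> GB G) AB (\<lambda>p. if p < Suc j then imult F G p else F p)"
    unfolding \<mu>' put_upd[OF j(1) refl refl, of _ AB H "imult F G j"]
    by (rule put_cong) (auto simp: H_def less_Suc_eq)
  have im: "imult F G j = fmul S (fst (F j), snd (F j)) (fst (G j), - snd (G j))"
    by (simp add: imult_def cj_def)
  show "hoare w (Blk ([Arith Add 61 18 40, Arith Add 62 19 40, Arith Add 63 61 7, Arith Add 64 62 7,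
     Load 65 61, Load 66 63, Load 67 62, Load 68 64, Arith Sub 77 4 68] @ cmul 65 66 67 77 @ [Store 61 70, Store 63 71])) 23 \<rho>' \<mu>'
     (\<lambda>\<rho>'' \<mu>''. \<rho>'' 40 = int j \<and> \<rho>'' 7 = int N \<and> same 40 \<rho> \<rho>'' \<and>
        \<mu>'' = put N (put N \<mu> GB G) AB (\<lambda>p. if p < Suc j then imult F G p else F p))"
  proof (rule hoare_mono[OF hoare_Blk[where Q = "\<lambda>\<rho>'' \<mu>''. same 41 \<rho>' \<rho>'' \<and>
        \<mu>'' = put N (put N \<mu> GB G) AB (\<lambda>p. if p < Suc j then imult F G p else F p)"] order_refl])
    show "iexecs w ([Arith Add 61 18 40, Arith Add 62 19 40, Arith Add 63 61 7, Arith Add 64 62 7,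
     Load 65 61, Load 66 63, Load 67 62, Load 68 64, Arith Sub 77 4 68] @ cmul 65 66 67 77 @ [Store 61 70, Store 63 71]) \<rho>' \<mu>'
     (\<lambda>\<rho>'' \<mu>''. same 41 \<rho>' \<rho>'' \<and> \<mu>'' = put N (put N \<mu> GB G) AB (\<lambda>p. if p < Suc j then imult F G p else F p))"
      using c' j mod1 tp ld
      by (simp add: consts_ok_def iexecs_append iexecs_cmul u[symmetric] im del: append.simps append_Cons)
  next
    fix \<rho>'' \<mu>''
    assume "same 41 \<rho>' \<rho>'' \<and> \<mu>'' = put N (put N \<mu> GB G) AB (\<lambda>p. if p < Suc j then imult F G p else F p)"
    then show "\<rho>'' 40 = int j \<and> \<rho>'' 7 = int N \<and> same 40 \<rho> \<rho>'' \<and>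
        \<mu>'' = put N (put N \<mu> GB G) AB (\<lambda>p. if p < Suc j then imult F G p else F p)"
      using I j by (auto simp: same_def)
  qed (simp_all add: cmul_def)
qed (auto simp: same_def intro!: put_cong)

definition accumulate :: com where
  "accumulate = For 40 1 (Blk [Arith Add 61 18 40, Load 61 61, Arith Add 61 61 23, Arith Div 61 61 22,
     Arith Add 62 17 40, Load 63 62, Arith Add 63 63 61, Store 62 63])"

lemma accumulate_spec:
  assumes c: "consts_ok \<rho>"
    and h: "\<And>i. i < m \<Longrightarrow> 0 \<le> \<mu> (AB + int i) + int N * S div 2 \<and> \<mu> (AB + int i) + int N * S div 2 < W"
      "int N * S < W"
  shows "hoare w accumulate (13 * m + 3) \<rho> \<mu> (\<lambda>\<rho>' \<mu>'. same 40 \<rho> \<rho>' \<and> frame ACC AB \<mu> \<mu>' \<and>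
    (\<forall>i < m. \<mu>' (ACC + int i) = \<mu> (ACC + int i) + (\<mu> (AB + int i) + int N * S div 2) div (int N * S)))"
  unfolding accumulate_def
proof (rule hoare_mono[OF hoare_For[where n = m and tb = 8 and
      I = "\<lambda>j \<rho>' \<mu>'. same 40 \<rho> \<rho>' \<and> frame ACC AB \<mu> \<mu>' \<and>
    (\<forall>i < m. \<mu>' (ACC + int i) = \<mu> (ACC + int i) + (if i < j then (\<mu> (AB + int i) + int N * S div 2) div (int N * S) else 0))"]])
  show "\<rho> 1 = int m" using c by (simp add: consts_ok_def)
  show "m < 2 ^ w" using layout two_m N16 by (intro nat_less_W) linarith
  fix j \<rho>' \<mu>'
  assume j: "j < m" "\<rho>' 40 = int j" "\<rho>' 1 = int m"
    and I: "same 40 \<rho> \<rho>' \<and> frame ACC AB \<mu> \<mu>' \<and>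
    (\<forall>i < m. \<mu>' (ACC + int i) = \<mu> (ACC + int i) + (if i < j then (\<mu> (AB + int i) + int N * S div 2) div (int N * S) else 0))"
  have c': "consts_ok \<rho>'" by (rule consts_ok_same[OF c]) (use I in \<open>auto simp: same_def\<close>)
  have "int j < int m" using j by simp
  note lay = layout this two_m
  have mod1: "(AB + int j) mod 2 ^ w = AB + int j" "(ACC + int j) mod 2 ^ w = ACC + int j"
    "int N * S mod 2 ^ w = int N * S"
    "(\<mu> (AB + int j) + int N * S div 2) mod 2 ^ w = \<mu> (AB + int j) + int N * S div 2"
    using lay h h(1)[OF j(1)] N16 S_pos by (auto intro!: modW)
  have ld: "\<mu>' (AB + int j) = \<mu> (AB + int j)" "\<mu>' (ACC + int j) = \<mu> (ACC + int j)"
    using I j by (auto simp: frame_def)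
  have fr: "frame ACC AB \<mu> (\<mu>'(ACC + int j := x))" for x
    using I lay by (auto intro!: frame_upd)
  show "hoare w (Blk [Arith Add 61 18 40, Load 61 61, Arith Add 61 61 23, Arith Div 61 61 22,
     Arith Add 62 17 40, Load 63 62, Arith Add 63 63 61, Store 62 63]) 8 \<rho>' \<mu>'
     (\<lambda>\<rho>'' \<mu>''. \<rho>'' 40 = int j \<and> \<rho>'' 1 = int m \<and> same 40 \<rho> \<rho>'' \<and> frame ACC AB \<mu> \<mu>'' \<and>
    (\<forall>i < m. \<mu>'' (ACC + int i) = \<mu> (ACC + int i) + (if i < Suc j then (\<mu> (AB + int i) + int N * S div 2) div (int N * S) else 0)))"
    by (rule hoare_Blk) (use c' j mod1 ld fr I in \<open>auto simp: consts_ok_def less_Suc_eq\<close>)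
qed (auto simp: same_def)

end

section \<open>Counting mismatches of a hashed text\<close>

context machine
begin

definition letter :: com where
  "letter = build ;; fwd 18 ;; fwd 19 ;; pointwise ;; bwd 18 ;; accumulate"

definition twiddles_at :: "memory \<Rightarrow> bool" where
  "twiddles_at \<mu> \<longleftrightarrow> (\<forall>q < N. \<mu> (TB + int q) = fst (twd q) \<and> \<mu> (TB + int q + int N) = snd (twd q))"

lemma twiddles_at_frame: "twiddles_at \<mu> \<Longrightarrow> frame lo hi \<mu> \<mu>' \<Longrightarrow> hi \<le> TB \<Longrightarrow> twiddles_at \<mu>'"
  by (auto simp: twiddles_at_def frame_def)

definition hashed :: "memory \<Rightarrow> (nat \<Rightarrow> int) \<Rightarrow> bool" where
  "hashed \<mu> hx \<longleftrightarrow> (\<forall>q < n + m. \<mu> (HX + int q) = hx q \<and> 0 \<le> hx q \<and> hx q < 2 * int E)"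

lemma hashed_frame: "hashed \<mu> hx \<Longrightarrow> frame lo hi \<mu> \<mu>' \<Longrightarrow> OUT \<le> lo \<Longrightarrow> hashed \<mu>' hx"
  using layout by (auto simp: hashed_def frame_def)

lemma rounding_range: "2 * int N ^ 3 * S + int N * S < W"
proof -
  have "int N ^ 5 \<le> int N ^ 16" using N16 by (intro power_increasing) auto
  moreover have "256 * int N ^ 3 \<le> int N ^ 2 * int N ^ 3"
    using N16 power_mono[of 16 "int N" 2] by (intro mult_right_mono) auto
  moreover have "int N ^ 2 * int N ^ 3 = int N ^ 5" by (simp flip: power_add)
  moreover have "int N \<le> int N ^ 3" using N16 by (intro self_le_power) auto
  moreover have "0 < int N ^ 3" using N16 by simp
  ultimately have "2 * int N ^ 3 + int N \<le> S" unfolding S_eq(1) by linarith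
  then have "(2 * int N ^ 3 + int N) * S \<le> S * S" using S_pos by (intro mult_right_mono) auto
  then have "2 * int N ^ 3 * S + int N * S \<le> S * S" by (simp add: distrib_right)
  then show ?thesis using fits(2) S_powers by linarith
qed

text \<open>For \<open>i < m\<close> and pattern positions \<open>j < m\<close> one has i + j < 2 *
  m \<le> N, so no index wraps around and the cyclic correlation of the indicator vectors counts
  genuine coincidences of letter \<open>k\<close>. The condition \<open>s + i + m \<le> n\<close>
  singles out the locations whose window lies inside the text.\<close>

lemma letter_spec:
  assumes c: "consts_ok \<rho>" and \<rho>: "\<rho> 35 = HX + int s" "\<rho> 36 = HX + int n" "\<rho> 37 = int k"
    and s: "s < n" and k: "k < 2 * E" and hx: "hashed \<mu> hx" and tws: "twiddles_at \<mu>"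
  shows "hoare w letter (100 * N * \<kappa>) \<rho> \<mu> (\<lambda>\<rho>' \<mu>'. same 38 \<rho> \<rho>' \<and> frame ACC TB \<mu> \<mu>' \<and>
    (\<forall>i < m. s + i + m \<le> n \<longrightarrow> \<mu>' (ACC + int i) = \<mu> (ACC + int i) +
       int (card {j. j < m \<and> hx (s + i + j) = int k \<and> hx (n + j) = int k})))"
  unfolding letter_def
proof (rule hoare_Seq[OF build_spec[OF c \<rho> s]])
  have kW: "int k < W" using k E(2) unfolding W_def by linarith
  show "int k < W" by (fact kW)
  show "\<mu> (HX + int q) = hx q \<and> 0 \<le> hx q \<and> hx q < W" if "q < n + m" for q
    using hx that E(2) by (auto simp: hashed_def W_def intro: less_trans)
  fix \<rho>1 \<mu>1
  assume R1: "same 40 \<rho> \<rho>1 \<and> (\<exists>F G. \<mu>1 = put N (put N \<mu> AB F) GB G \<and> built N hx s k F G)"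
  then obtain F G where \<mu>1: "\<mu>1 = put N (put N \<mu> AB F) GB G" and built: "built N hx s k F G" by blast
  have "\<forall>p. \<exists>b. p < N \<longrightarrow> F p = flag b" using built by (auto simp: built_def)
  \<comment> \<open>\<open>fb\<close> also records the arbitrary flags past the end of the text, so
    that the error analysis applies to the whole array.\<close>
  then obtain fb where fb: "\<And>p. p < N \<Longrightarrow> F p = flag (fb p)" by metis
  define f :: "nat \<Rightarrow> nat" where "f p = of_bool (fb p)" for p
  define g :: "nat \<Rightarrow> nat" where "g p = of_bool (p < m \<and> hx (n + p) = int k)" for p
  have F: "F p = (int (f p) * S, 0)" and G: "G p = (int (g p) * S, 0)" if "p < N" for p
    using fb[OF that] built that by (simp_all add: f_def g_def flag_def built_def)
  have fg: "f p \<le> 1" "g p \<le> 1" for p by (simp_all add: f_def g_def)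
  have near: "near N S 0 F (\<lambda>p. of_nat (f p))" "near N S 0 G (\<lambda>p. of_nat (g p))"
    by (rule near_input[of F f G g]; use F G fg in simp)+
  have nrm: "norm (of_nat (f p) :: complex) \<le> 1" "norm (of_nat (g p) :: complex) \<le> 1" for p
    using fg[of p] by simp_all
  have smF: "small (2 * int N) (iforward S twd \<kappa> d F)" if "d \<le> \<kappa>" for d
    by (rule small_iforward[OF near(1) nrm(1) that])
  have smG: "small (2 * int N) (iforward S twd \<kappa> d G)" if "d \<le> \<kappa>" for d
    by (rule small_iforward[OF near(2) nrm(2) that])
  define FF where "FF = iforward S twd \<kappa> \<kappa> F"
  define GG where "GG = iforward S twd \<kappa> \<kappa> G"
  define A where "A = ibackward S twd \<kappa> (imult FF GG)"
  define h where "h i = (\<Sum>j<N. f ((i + j) mod N) * g j)" for i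
  have smB: "small (2 * int N ^ 3) (ibackward S twd d (imult FF GG))" if "d \<le> \<kappa>" for d
    unfolding FF_def GG_def by (rule small_ibackward[OF F G fg that])
  have round: "(fst (A i) + int N * S div 2) div (int N * S) = int (h i)" "0 \<le> fst (A i) + int N * S div 2"
    "fst (A i) + int N * S div 2 < W" if "i < N" for i
    using correlation_rounding[of F f G g, OF F G fg that] rounding_range
    unfolding A_def FF_def GG_def h_def by auto
  have hcard: "h i = card {j. j < m \<and> hx (s + i + j) = int k \<and> hx (n + j) = int k}" if "i < m" "s + i + m \<le> n" for i
  proof -
    \<comment> \<open>The padding of the pattern removes all summands from \<open>m\<close>
      on.\<close>
    have "h i = (\<Sum>j<m. f ((i + j) mod N) * g j)"
      unfolding h_def using two_m by (intro sum.mono_neutral_right) (auto simp: g_def)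
    also have "\<dots> = (\<Sum>j<m. of_bool (hx (s + i + j) = int k \<and> hx (n + j) = int k))"
    proof (rule sum.cong)
      fix j assume "j \<in> {..<m}"
      then have j: "j < m" "i + j < N" "s + (i + j) < n" using that two_m by auto
      then have "flag (fb (i + j)) = flag (hx (s + (i + j)) = int k)"
        using built fb[OF j(2)] by (auto simp: built_def)
      then have "fb (i + j) = (hx (s + (i + j)) = int k)" using S_pos by (auto simp: flag_def split: if_splits)
      then show "f ((i + j) mod N) * g j = of_bool (hx (s + i + j) = int k \<and> hx (n + j) = int k)"
        using j by (simp add: f_def g_def add.assoc)
    qed simp
    also have "\<dots> = card ({..<m} \<inter> {j. hx (s + i + j) = int k \<and> hx (n + j) = int k})" by (simp add: sum_of_bool_eq)
    also have "{..<m} \<inter> {j. hx (s + i + j) = int k \<and> hx (n + j) = int k} =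
        {j. j < m \<and> hx (s + i + j) = int k \<and> hx (n + j) = int k}" by auto
    finally show ?thesis .
  qed
  have pc: "put N (put N \<mu> AB F) GB G = put N (put N \<mu> GB G) AB F" for F G
    by (rule put_commute) (use layout in simp)
  have tw': "put N \<mu> GB G (TB + int q) = fst (twd q)" "put N \<mu> GB G (TB + int q + int N) = snd (twd q)"
    "put N \<mu> AB G (TB + int q) = fst (twd q)" "put N \<mu> AB G (TB + int q + int N) = snd (twd q)" if "q < N" for q G
    using tws that layout by (auto simp: put_other twiddles_at_def)
  have c1: "consts_ok \<rho>1" by (rule consts_ok_same[OF c]) (use R1 in \<open>auto simp: same_def\<close>)
  have AB0: "0 \<le> AB" "AB + 2 * int N \<le> TB" "0 \<le> GB" "GB + 2 * int N \<le> TB" using layout by simp_all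
  let ?t5 = "28 * N * \<kappa> + (13 * m + 3)"
  let ?t4 = "28 * N + 3 + ?t5"
  let ?t3 = "26 * N * \<kappa> + ?t4"
  let ?Q = "\<lambda>\<rho>' \<mu>'. same 38 \<rho> \<rho>' \<and> frame ACC TB \<mu> \<mu>' \<and>
    (\<forall>i < m. s + i + m \<le> n \<longrightarrow> \<mu>' (ACC + int i) = \<mu> (ACC + int i) +
       int (card {j. j < m \<and> hx (s + i + j) = int k \<and> hx (n + j) = int k}))"
  show "hoare w (fwd 18 ;; fwd 19 ;; pointwise ;; bwd 18 ;; accumulate) (26 * N * \<kappa> + ?t3) \<rho>1 \<mu>1 ?Q"
    unfolding \<mu>1 pc
  proof (rule hoare_Seq[OF fwd_spec[OF c1 _ _ AB0(1,2) tw'(1,2) smF] _ order_refl])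
    show "\<rho>1 18 = AB" using c1 by (simp add: consts_ok_def)
    fix \<rho>2 \<mu>2
    assume R2: "same 50 \<rho>1 \<rho>2 \<and> \<mu>2 = put N (put N \<mu> GB G) AB (iforward S twd \<kappa> \<kappa> F)"
    then have \<mu>2: "\<mu>2 = put N (put N \<mu> AB FF) GB G" by (simp add: pc FF_def)
    have c2: "consts_ok \<rho>2" by (rule consts_ok_same[OF c1]) (use R2 in \<open>auto simp: same_def\<close>)
    show "hoare w (fwd 19 ;; pointwise ;; bwd 18 ;; accumulate) ?t3 \<rho>2 \<mu>2 ?Q"
      unfolding \<mu>2
    proof (rule hoare_Seq[OF fwd_spec[OF c2 _ _ AB0(3,4) tw'(3,4) smG] _ order_refl])
      show "\<rho>2 19 = GB" using c2 by (simp add: consts_ok_def)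
      fix \<rho>3 \<mu>3
      assume R3: "same 50 \<rho>2 \<rho>3 \<and> \<mu>3 = put N (put N \<mu> AB FF) GB (iforward S twd \<kappa> \<kappa> G)"
      then have \<mu>3: "\<mu>3 = put N (put N \<mu> GB GG) AB FF" by (simp add: pc GG_def)
      have c3: "consts_ok \<rho>3" by (rule consts_ok_same[OF c2]) (use R3 in \<open>auto simp: same_def\<close>)
      show "hoare w (pointwise ;; bwd 18 ;; accumulate) ?t4 \<rho>3 \<mu>3 ?Q"
        unfolding \<mu>3
      proof (rule hoare_Seq[OF pointwise_spec[OF c3] _ order_refl])
        show "small (2 * int N) FF" "small (2 * int N) GG" using smF smG by (simp_all add: FF_def GG_def)
        fix \<rho>4 \<mu>4
        assume R4: "same 40 \<rho>3 \<rho>4 \<and> \<mu>4 = put N (put N \<mu> GB GG) AB (imult FF GG)"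
        then have \<mu>4: "\<mu>4 = put N (put N \<mu> GB GG) AB (imult FF GG)" by simp
        have c4: "consts_ok \<rho>4" by (rule consts_ok_same[OF c3]) (use R4 in \<open>auto simp: same_def\<close>)
        show "hoare w (bwd 18 ;; accumulate) ?t5 \<rho>4 \<mu>4 ?Q"
          unfolding \<mu>4
        proof (rule hoare_Seq[OF bwd_spec[OF c4 _ _ AB0(1,2) tw'(1,2) smB] _ order_refl])
          show "\<rho>4 18 = AB" using c4 by (simp add: consts_ok_def)
          fix \<rho>5 \<mu>5
          assume R5: "same 50 \<rho>4 \<rho>5 \<and> \<mu>5 = put N (put N \<mu> GB GG) AB (ibackward S twd \<kappa> (imult FF GG))"
          then have \<mu>5: "\<mu>5 = put N (put N \<mu> GB GG) AB A" by (simp add: A_def)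
          have c5: "consts_ok \<rho>5" by (rule consts_ok_same[OF c4]) (use R5 in \<open>auto simp: same_def\<close>)
          have A: "\<mu>5 (AB + int i) = fst (A i)" if "i < N" for i
            unfolding \<mu>5 by (rule put_re[OF that refl])
          have acc: "\<mu>5 (ACC + int i) = \<mu> (ACC + int i)" if "i < m" for i
            unfolding \<mu>5 using layout that by (simp add: put_other)
          have fr: "frame ACC TB \<mu> \<mu>5"
            unfolding \<mu>5 by (rule frame_trans[OF frame_put frame_put]) (use layout in auto)
          show "hoare w accumulate (13 * m + 3) \<rho>5 \<mu>5 ?Q"
          proof (rule hoare_mono[OF accumulate_spec[OF c5] order_refl])
            show "0 \<le> \<mu>5 (AB + int i) + int N * S div 2 \<and> \<mu>5 (AB + int i) + int N * S div 2 < W" if "i < m" for i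
              using A[of i] round[of i] that two_m by simp
            show "int N * S < W" using rounding_range S_pos N16 by (smt (verit) mult_nonneg_nonneg of_nat_0_le_iff zero_le_power)
            fix \<rho>6 \<mu>6
            assume R6: "same 40 \<rho>5 \<rho>6 \<and> frame ACC AB \<mu>5 \<mu>6 \<and> (\<forall>i<m. \<mu>6 (ACC + int i) =
                \<mu>5 (ACC + int i) + (\<mu>5 (AB + int i) + int N * S div 2) div (int N * S))"
            have "same 38 \<rho> \<rho>6" using R1 R2 R3 R4 R5 R6 by (auto simp: same_def)
            moreover have "frame ACC TB \<mu> \<mu>6"
              by (rule frame_trans[OF fr frame_mono[of ACC AB]]) (use R6 layout in auto)
            moreover have "\<mu>6 (ACC + int i) = \<mu> (ACC + int i) +
               int (card {j. j < m \<and> hx (s + i + j) = int k \<and> hx (n + j) = int k})" if "i < m" "s + i + m \<le> n" for i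
              using R6 that A[of i] acc[of i] round(1)[of i] two_m hcard[OF that] by simp
            ultimately show "?Q \<rho>6 \<mu>6" by blast
          qed
        qed simp_all
      qed
    qed simp_all
  qed simp_all
next
  have "4 * N \<le> N * \<kappa>" using \<kappa> by (simp add: mult.commute)
  moreover have "13 * m \<le> 7 * N" using two_m by linarith
  ultimately show "23 * N + 3 + (26 * N * \<kappa> + (26 * N * \<kappa> + (28 * N + 3 + (28 * N * \<kappa> + (13 * m + 3))))) \<le> 100 * N * \<kappa>"
    using N16 by (simp only: mult.assoc)
qed

definition zero_acc :: com where
  "zero_acc = For 40 1 (Blk [Arith Add 61 17 40, Store 61 4])"

lemma zero_acc_spec:
  assumes c: "consts_ok \<rho>"
  shows "hoare w zero_acc (7 * m + 3) \<rho> \<mu> (\<lambda>\<rho>' \<mu>'. same 40 \<rho> \<rho>' \<and> frame ACC AB \<mu> \<mu>' \<and> (\<forall>i < m. \<mu>' (ACC + int i) = 0))"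
  unfolding zero_acc_def
proof (rule hoare_mono[OF hoare_For[where n = m and tb = 2 and
      I = "\<lambda>j \<rho>' \<mu>'. same 40 \<rho> \<rho>' \<and> frame ACC AB \<mu> \<mu>' \<and> (\<forall>i < j. \<mu>' (ACC + int i) = 0)"]])
  show "\<rho> 1 = int m" using c by (simp add: consts_ok_def)
  show "m < 2 ^ w" using layout two_m N16 by (intro nat_less_W) linarith
  fix j \<rho>' \<mu>'
  assume j: "j < m" "\<rho>' 40 = int j" "\<rho>' 1 = int m"
    and I: "same 40 \<rho> \<rho>' \<and> frame ACC AB \<mu> \<mu>' \<and> (\<forall>i < j. \<mu>' (ACC + int i) = 0)"
  have c': "consts_ok \<rho>'" by (rule consts_ok_same[OF c]) (use I in \<open>auto simp: same_def\<close>)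
  have "int j < int m" using j by simp
  note lay = layout this two_m
  have mod1: "(ACC + int j) mod 2 ^ w = ACC + int j"
    using lay by (intro modW; linarith)
  have fr: "frame ACC AB \<mu> (\<mu>'(ACC + int j := x))" for x
    using I lay by (auto intro!: frame_upd)
  show "hoare w (Blk [Arith Add 61 17 40, Store 61 4]) 2 \<rho>' \<mu>'
     (\<lambda>\<rho>'' \<mu>''. \<rho>'' 40 = int j \<and> \<rho>'' 1 = int m \<and> same 40 \<rho> \<rho>'' \<and> frame ACC AB \<mu> \<mu>'' \<and> (\<forall>i < Suc j. \<mu>'' (ACC + int i) = 0))"
    by (rule hoare_Blk) (use c' j mod1 fr I in \<open>auto simp: consts_ok_def less_Suc_eq\<close>)
qed (auto simp: same_def)

section \<open>From match counts to estimates\<close>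

definition update :: com where
  "update = For 40 1 (Blk [Arith Mul 61 31 1, Arith Add 61 61 40, Arith Add 61 61 61, Arith Add 61 61 16, Load 62 61,
     Arith Add 63 17 40, Load 63 63, Arith Sub 63 1 63, Arith Less 64 62 63, Arith Sub 65 63 62, Arith Mul 65 65 64,
     Arith Add 62 62 65, Store 61 62])"

text \<open>Positions of the block past the last window are overwritten too, with unspecified
  values; for them only the addresses of the cells that may change are recorded.\<close>

definition updated :: "nat \<Rightarrow> nat \<Rightarrow> memory \<Rightarrow> memory \<Rightarrow> bool" where
  "updated s j \<mu> \<mu>' \<longleftrightarrow> (\<forall>a. (\<forall>i < j. a \<noteq> OUT + 2 * int (s + i)) \<longrightarrow> \<mu>' a = \<mu> a) \<and>
     (\<forall>i < j. s + i + m \<le> n \<longrightarrow>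
        \<mu>' (OUT + 2 * int (s + i)) = max (\<mu> (OUT + 2 * int (s + i))) (int m - \<mu> (ACC + int i)))"

lemma update_spec:
  assumes c: "consts_ok \<rho>" and b: "\<rho> 31 = int b" and s: "s = b * m" "s + m \<le> n"
    and out: "\<And>i. i < m \<Longrightarrow> s + i + m \<le> n \<Longrightarrow> 0 \<le> \<mu> (OUT + 2 * int (s + i)) \<and> \<mu> (OUT + 2 * int (s + i)) < W"
    and acc: "\<And>i. i < m \<Longrightarrow> s + i + m \<le> n \<Longrightarrow> 0 \<le> \<mu> (ACC + int i) \<and> \<mu> (ACC + int i) \<le> int m"
  shows "hoare w update (18 * m + 3) \<rho> \<mu> (\<lambda>\<rho>' \<mu>'. same 40 \<rho> \<rho>' \<and> updated s m \<mu> \<mu>')"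
  unfolding update_def
proof (rule hoare_mono[OF hoare_For[where n = m and tb = 13 and
      I = "\<lambda>j \<rho>' \<mu>'. same 40 \<rho> \<rho>' \<and> updated s j \<mu> \<mu>'"]])
  show "\<rho> 1 = int m" using c by (simp add: consts_ok_def)
  show "m < 2 ^ w" using layout two_m N16 by (intro nat_less_W) linarith
  fix j \<rho>' \<mu>'
  assume j: "j < m" "\<rho>' 40 = int j" "\<rho>' 1 = int m" and I: "same 40 \<rho> \<rho>' \<and> updated s j \<mu> \<mu>'"
  have c': "consts_ok \<rho>'" by (rule consts_ok_same[OF c]) (use I in \<open>auto simp: same_def\<close>)
  have b': "\<rho>' 31 = int b" using I b by (simp add: same_def)
  have "int j < int m" "int s + int m \<le> int n" using j s(2) by linarith+
  note lay = layout this two_m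
  have a: "2 * (int b * int m) + 2 * int j + OUT = OUT + 2 * int (s + j)" by (simp add: s)
  have mod1: "(OUT + 2 * int (s + j)) mod 2 ^ w = OUT + 2 * int (s + j)" "(ACC + int j) mod 2 ^ w = ACC + int j"
  proof -
    have lo: "0 \<le> OUT" "0 \<le> int s" "0 \<le> int j" using lay by linarith+
    have hi: "int s + int j < int n" "ACC < W" "ACC + int j < W" using lay by linarith+
    show "(OUT + 2 * int (s + j)) mod 2 ^ w = OUT + 2 * int (s + j)"
      using lo hi lay by (intro modW) auto
    show "(ACC + int j) mod 2 ^ w = ACC + int j"
      using lo hi lay by (intro modW) auto
  qed
  have ld: "\<mu>' (OUT + 2 * int (s + j)) = \<mu> (OUT + 2 * int (s + j))" "\<mu>' (ACC + int j) = \<mu> (ACC + int j)"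
    using I lay by (auto simp: updated_def)
  define x where "x = \<mu> (OUT + 2 * int (s + j))"
  define v where "v = int m - \<mu> (ACC + int j)"
  \<comment> \<open>A maximum without a branch. The comparison is between words and agrees with the
    integer comparison only at locations where both values are in range.\<close>
  define z where "z = x + (v - x) * of_bool (x mod 2 ^ w < v mod 2 ^ w)"
  have z: "z = max x v" if "s + j + m \<le> n"
    using out[OF j(1) that] acc[OF j(1) that] lay by (simp add: z_def x_def v_def modW)
  define y where "y = OUT + 2 * int (s + j)"
  have upd: "updated s (Suc j) \<mu> (\<mu>'(y := z))"
    using I z lay by (auto simp: updated_def less_Suc_eq x_def v_def y_def)
  have yx: "\<mu>' y = x" and yw: "y mod 2 ^ w = y" using ld mod1 by (simp_all add: x_def y_def)
  have "updated s (Suc j) \<mu> (\<mu>'(y := x))" if "\<not> x mod 2 ^ w < v mod 2 ^ w"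
    using upd that by (simp add: z_def)
  moreover have "updated s (Suc j) \<mu> (\<mu>'(y := v))" if "x mod 2 ^ w < v mod 2 ^ w"
    using upd that by (simp add: z_def)
  ultimately show "hoare w (Blk [Arith Mul 61 31 1, Arith Add 61 61 40, Arith Add 61 61 61, Arith Add 61 61 16, Load 62 61,
     Arith Add 63 17 40, Load 63 63, Arith Sub 63 1 63, Arith Less 64 62 63, Arith Sub 65 63 62, Arith Mul 65 65 64,
     Arith Add 62 62 65, Store 61 62]) 13 \<rho>' \<mu>'
     (\<lambda>\<rho>'' \<mu>''. \<rho>'' 40 = int j \<and> \<rho>'' 1 = int m \<and> same 40 \<rho> \<rho>'' \<and> updated s (Suc j) \<mu> \<mu>'')"
    using c' j I b' mod1(2) ld(2) yx yw
    by (intro hoare_Blk) (simp_all add: consts_ok_def a[folded y_def] v_def[symmetric])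
qed (auto simp: same_def updated_def)

definition block :: com where
  "block = Blk [Arith Mul 35 31 1, Arith Add 35 35 15, Arith Add 36 15 0] ;; zero_acc ;; For 37 12 letter ;; update"

definition mismatches :: "(nat \<Rightarrow> int) \<Rightarrow> nat \<Rightarrow> nat" where
  "mismatches hx l = card {j. j < m \<and> hx (l + j) \<noteq> hx (n + j)}"

text \<open>A matching position has exactly one common hash letter below 2 * E, so the match sets of
  the single letters partition the set of all matches.\<close>

lemma sum_letters:
  assumes "\<And>q. q < n + m \<Longrightarrow> 0 \<le> hx q \<and> hx q < 2 * int E" "l + m \<le> n"
  shows "(\<Sum>k<2 * E. int (card {j. j < m \<and> hx (l + j) = int k \<and> hx (n + j) = int k})) = int m - int (mismatches hx l)"
proof -
  let ?M = "{j. j < m \<and> hx (l + j) = hx (n + j)}"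
  have "(\<Sum>k<2 * E. card {j. j < m \<and> hx (l + j) = int k \<and> hx (n + j) = int k}) =
      card (\<Union>k<2 * E. {j. j < m \<and> hx (l + j) = int k \<and> hx (n + j) = int k})"
    by (subst card_UN_disjoint) auto
  also have "(\<Union>k<2 * E. {j. j < m \<and> hx (l + j) = int k \<and> hx (n + j) = int k}) = ?M"
  proof (intro equalityI subsetI)
    fix j assume "j \<in> ?M"
    then have j: "j < m" "hx (l + j) = hx (n + j)" by auto
    define k where "k = nat (hx (n + j))"
    have "hx (n + j) = int k" "k < 2 * E"
      using assms(1)[of "n + j"] j by (auto simp: k_def nat_less_iff)
    then show "j \<in> (\<Union>k<2 * E. {j. j < m \<and> hx (l + j) = int k \<and> hx (n + j) = int k})" using j by auto
  qed auto
  finally have 1: "(\<Sum>k<2 * E. card {j. j < m \<and> hx (l + j) = int k \<and> hx (n + j) = int k}) = card ?M" .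
  have "card (?M \<union> {j. j < m \<and> hx (l + j) \<noteq> hx (n + j)}) = card ?M + mismatches hx l"
    unfolding mismatches_def by (rule card_Un_disjoint) auto
  moreover have "?M \<union> {j. j < m \<and> hx (l + j) \<noteq> hx (n + j)} = {..<m}" by auto
  ultimately have "int (card ?M) = int m - int (mismatches hx l)" by simp
  then show ?thesis using 1 by (simp only: of_nat_sum[symmetric])
qed

definition out_range :: "memory \<Rightarrow> bool" where
  "out_range \<mu> \<longleftrightarrow> (\<forall>l. l + m \<le> n \<longrightarrow> 0 \<le> \<mu> (OUT + 2 * int l) \<and> \<mu> (OUT + 2 * int l) \<le> int m)"

definition scanned :: "nat \<Rightarrow> nat \<Rightarrow> (nat \<Rightarrow> int) \<Rightarrow> memory \<Rightarrow> memory \<Rightarrow> bool" where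
  "scanned lo hi hx \<mu> \<mu>' \<longleftrightarrow> frame OUT TB \<mu> \<mu>' \<and>
     (\<forall>l < n. \<mu>' (OUT + 2 * int l + 1) = \<mu> (OUT + 2 * int l + 1)) \<and>
     (\<forall>l. l + m \<le> n \<longrightarrow> \<mu>' (OUT + 2 * int l) =
        (if lo \<le> l \<and> l < hi then max (\<mu> (OUT + 2 * int l)) (int (mismatches hx l)) else \<mu> (OUT + 2 * int l)))"

text \<open>The sum over the letters is \<open>m\<close> minus the number of mismatches, which
  \<open>update\<close> subtracts from \<open>m\<close> once more. The time is dominated by 2 * E
  letters at 100 * N * \<kappa> steps.\<close>

lemma block_spec:
  assumes c: "consts_ok \<rho>" and b: "\<rho> 31 = int b" "b < n div m"
    and hx: "hashed \<mu> hx" and tws: "twiddles_at \<mu>" and out: "out_range \<mu>"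
  shows "hoare w block (220 * E * N * \<kappa>) \<rho> \<mu> (\<lambda>\<rho>' \<mu>'. same 32 \<rho> \<rho>' \<and> scanned (b * m) (Suc b * m) hx \<mu> \<mu>')"
proof -
  define s where "s = b * m"
  have sm: "s + m \<le> n"
  proof -
    have "Suc b * m \<le> n div m * m" using b(2) by (intro mult_right_mono) auto
    also have "\<dots> \<le> n" by simp
    finally show ?thesis by (simp add: s_def)
  qed
  let ?Q = "\<lambda>\<rho>' \<mu>'. same 32 \<rho> \<rho>' \<and> scanned (b * m) (Suc b * m) hx \<mu> \<mu>'"
  let ?t3 = "2 * E * (100 * N * \<kappa> + 5) + 3 + (18 * m + 3)"
  show ?thesis
    unfolding block_def
  proof (rule hoare_Seq[where R = "\<lambda>\<rho>1 \<mu>1. same 35 \<rho> \<rho>1 \<and> \<rho>1 35 = HX + int s \<and> \<rho>1 36 = HX + int n \<and> \<mu>1 = \<mu>"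
        and ?t1.0 = 3 and ?t2.0 = "7 * m + 3 + ?t3"])
    show "hoare w (Blk [Arith Mul 35 31 1, Arith Add 35 35 15, Arith Add 36 15 0]) 3 \<rho> \<mu>
        (\<lambda>\<rho>1 \<mu>1. same 35 \<rho> \<rho>1 \<and> \<rho>1 35 = HX + int s \<and> \<rho>1 36 = HX + int n \<and> \<mu>1 = \<mu>)"
      by (rule hoare_Blk) (use c b in \<open>simp_all add: consts_ok_def s_def\<close>)
    fix \<rho>1 \<mu>1
    assume R1: "same 35 \<rho> \<rho>1 \<and> \<rho>1 35 = HX + int s \<and> \<rho>1 36 = HX + int n \<and> \<mu>1 = \<mu>"
    have c1: "consts_ok \<rho>1" by (rule consts_ok_same[OF c]) (use R1 in \<open>auto simp: same_def\<close>)
    show "hoare w (zero_acc ;; For 37 12 letter ;; update) (7 * m + 3 + ?t3) \<rho>1 \<mu>1 ?Q"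
    proof (rule hoare_Seq[OF zero_acc_spec[OF c1] _ order_refl])
      fix \<rho>2 \<mu>2
      assume R2: "same 40 \<rho>1 \<rho>2 \<and> frame ACC AB \<mu>1 \<mu>2 \<and> (\<forall>i<m. \<mu>2 (ACC + int i) = 0)"
      have c2: "consts_ok \<rho>2" by (rule consts_ok_same[OF c1]) (use R2 in \<open>auto simp: same_def\<close>)
      have fr2: "frame ACC TB \<mu> \<mu>2"
        by (rule frame_mono[of ACC AB]) (use R1 R2 layout in auto)
      let ?c = "\<lambda>k i. int (card {j. j < m \<and> hx (s + i + j) = int k \<and> hx (n + j) = int k})"
      have "hoare w (For 37 12 letter) (2 * E * (100 * N * \<kappa> + 5) + 3) \<rho>2 \<mu>2 (\<lambda>\<rho>3 \<mu>3. same 37 \<rho>2 \<rho>3 \<and> frame ACC TB \<mu> \<mu>3 \<and>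
          (\<forall>i < m. s + i + m \<le> n \<longrightarrow> \<mu>3 (ACC + int i) = (\<Sum>k<2 * E. ?c k i)))"
      proof (rule hoare_mono[OF hoare_For[where n = "2 * E" and tb = "100 * N * \<kappa>" and
            I = "\<lambda>k \<rho>3 \<mu>3. same 37 \<rho>2 \<rho>3 \<and> frame ACC TB \<mu> \<mu>3 \<and>
          (\<forall>i < m. s + i + m \<le> n \<longrightarrow> \<mu>3 (ACC + int i) = (\<Sum>k<k. ?c k i))"]])
        show "\<rho>2 12 = int (2 * E)" using c2 by (simp add: consts_ok_def)
        show "2 * E < 2 ^ w" using E by (intro nat_less_W) (simp add: W_def)
        fix k \<rho>3 \<mu>3
        assume k: "k < 2 * E" "\<rho>3 37 = int k" "\<rho>3 12 = int (2 * E)"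
          and I: "same 37 \<rho>2 \<rho>3 \<and> frame ACC TB \<mu> \<mu>3 \<and>
          (\<forall>i < m. s + i + m \<le> n \<longrightarrow> \<mu>3 (ACC + int i) = (\<Sum>k<k. ?c k i))"
        have c3: "consts_ok \<rho>3" by (rule consts_ok_same[OF c2]) (use I in \<open>auto simp: same_def\<close>)
        show "hoare w letter (100 * N * \<kappa>) \<rho>3 \<mu>3 (\<lambda>\<rho>4 \<mu>4. \<rho>4 37 = int k \<and> \<rho>4 12 = int (2 * E) \<and>
            same 37 \<rho>2 \<rho>4 \<and> frame ACC TB \<mu> \<mu>4 \<and>
            (\<forall>i < m. s + i + m \<le> n \<longrightarrow> \<mu>4 (ACC + int i) = (\<Sum>k<Suc k. ?c k i)))"
        proof (rule hoare_mono[OF letter_spec[OF c3 _ _ k(2) _ k(1)] order_refl])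
          show "\<rho>3 35 = HX + int s" "\<rho>3 36 = HX + int n" using I R1 R2 by (simp_all add: same_def)
          show "s < n" using sm m by linarith
          show "hashed \<mu>3 hx" by (rule hashed_frame[OF hx]) (use I layout in auto)
          show "twiddles_at \<mu>3" by (rule twiddles_at_frame[OF tws]) (use I in auto)
        qed (use I k in \<open>auto simp: same_def frame_def\<close>)
      qed (use R1 R2 fr2 in \<open>auto simp: same_def\<close>)
      then show "hoare w (For 37 12 letter ;; update) ?t3 \<rho>2 \<mu>2 ?Q"
      proof (rule hoare_Seq[OF _ _ order_refl])
        fix \<rho>3 \<mu>3
        assume R3: "same 37 \<rho>2 \<rho>3 \<and> frame ACC TB \<mu> \<mu>3 \<and>
          (\<forall>i < m. s + i + m \<le> n \<longrightarrow> \<mu>3 (ACC + int i) = (\<Sum>k<2 * E. ?c k i))"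
        have c3: "consts_ok \<rho>3" by (rule consts_ok_same[OF c2]) (use R3 in \<open>auto simp: same_def\<close>)
        have hr: "0 \<le> hx q \<and> hx q < 2 * int E" if "q < n + m" for q using hx that by (simp add: hashed_def)
        have acc: "\<mu>3 (ACC + int i) = int m - int (mismatches hx (s + i))" if "i < m" "s + i + m \<le> n" for i
          using R3 sum_letters[of hx "s + i", OF hr that(2)] that by simp
        have mm: "mismatches hx l \<le> m" for l
          unfolding mismatches_def by (rule order_trans[OF card_mono[of "{..<m}"]]) auto
        have out3: "\<mu>3 (OUT + 2 * int l) = \<mu> (OUT + 2 * int l)" "\<mu>3 (OUT + 2 * int l + 1) = \<mu> (OUT + 2 * int l + 1)" if "l < n" for l
          using R3 that layout by (auto simp: frame_def)
        show "hoare w update (18 * m + 3) \<rho>3 \<mu>3 ?Q"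
        proof (rule hoare_mono[OF update_spec[OF c3 _ s_def sm] order_refl])
          show "\<rho>3 31 = int b" using R1 R2 R3 b by (simp add: same_def)
          show "0 \<le> \<mu>3 (OUT + 2 * int (s + i)) \<and> \<mu>3 (OUT + 2 * int (s + i)) < W" if "i < m" "s + i + m \<le> n" for i
            using out[unfolded out_range_def, rule_format, OF that(2)] out3[of "s + i"] that layout two_m m(1) by (auto simp: W_def)
          show "0 \<le> \<mu>3 (ACC + int i) \<and> \<mu>3 (ACC + int i) \<le> int m" if "i < m" "s + i + m \<le> n" for i
            using acc[OF that] mm[of "s + i"] by simp
          fix \<rho>4 \<mu>4 assume R4: "same 40 \<rho>3 \<rho>4 \<and> updated s m \<mu>3 \<mu>4"
          have same: "same 32 \<rho> \<rho>4" using R1 R2 R3 R4 by (auto simp: same_def)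
          have other: "\<mu>4 a = \<mu>3 a" if "\<And>i. i < m \<Longrightarrow> a \<noteq> OUT + 2 * int (s + i)" for a
            using R4 that by (auto simp: updated_def)
          have "frame OUT TB \<mu> \<mu>4"
            unfolding frame_def
          proof (intro allI impI)
            fix a assume a: "a < OUT \<or> TB \<le> a"
            have "\<mu>4 a = \<mu>3 a" using a layout sm by (intro other) auto
            also have "\<dots> = \<mu> a" using R3 a layout by (auto simp: frame_def)
            finally show "\<mu>4 a = \<mu> a" .
          qed
          moreover have "\<mu>4 (OUT + 2 * int l + 1) = \<mu> (OUT + 2 * int l + 1)" if "l < n" for l
          proof -
            \<comment> \<open>Denominators sit at odd offsets from \<open>OUT\<close>, numerators at
              even ones.\<close>
            have "\<mu>4 (OUT + 2 * int l + 1) = \<mu>3 (OUT + 2 * int l + 1)" by (rule other) presburger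
            then show ?thesis using out3 that by simp
          qed
          moreover have "\<mu>4 (OUT + 2 * int l) = (if b * m \<le> l \<and> l < Suc b * m then
              max (\<mu> (OUT + 2 * int l)) (int (mismatches hx l)) else \<mu> (OUT + 2 * int l))" if l: "l + m \<le> n" for l
          proof (cases "b * m \<le> l \<and> l < Suc b * m")
            case True
            define i where "i = l - s"
            have i: "l = s + i" "i < m" using True by (auto simp: i_def s_def)
            have "\<mu>4 (OUT + 2 * int (s + i)) = max (\<mu>3 (OUT + 2 * int (s + i))) (int m - \<mu>3 (ACC + int i))"
              using R4 i l by (auto simp: updated_def)
            then show ?thesis using True acc[of i] i l out3[of l] m(1) by simp
          next
            case False
            have "\<mu>4 (OUT + 2 * int l) = \<mu>3 (OUT + 2 * int l)"
            proof (rule other, rule notI)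
              fix i assume "i < m" "OUT + 2 * int l = OUT + 2 * int (s + i)"
              then show "i < m \<Longrightarrow> False" using False by (simp add: s_def flip: of_nat_add of_nat_mult)
            qed
            then show ?thesis using False out3[of l] l m(1) by auto
          qed
          ultimately show "?Q \<rho>4 \<mu>4" using same by (simp add: scanned_def)
        qed
      qed
    qed
  next
    have "4 * 16 \<le> N * \<kappa>" using \<kappa> N16 mult_le_mono[of 16 N 4 \<kappa>] by simp
    then have k1: "64 * E \<le> E * N * \<kappa>" using mult_le_mono[of E E 64 "N * \<kappa>"] by (simp add: mult_ac)
    have "4 * N \<le> N * \<kappa>" using \<kappa> by simp
    moreover have "1 * (N * \<kappa>) \<le> E * (N * \<kappa>)" using E by (intro mult_le_mono) auto
    ultimately have k2: "4 * N \<le> E * N * \<kappa>" unfolding mult.assoc by linarith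
    have e: "2 * E * (100 * N * \<kappa> + 5) = 200 * (E * N * \<kappa>) + 10 * E" "220 * E * N * \<kappa> = 220 * (E * N * \<kappa>)"
      by (simp_all add: algebra_simps)
    show "3 + (7 * m + 3 + (2 * E * (100 * N * \<kappa> + 5) + 3 + (18 * m + 3))) \<le> 220 * E * N * \<kappa>"
      unfolding e using k1 k2 two_m N16 by linarith
  qed
qed

definition scan :: com where
  "scan = For 31 14 block"

lemma scan_spec:
  assumes c: "consts_ok \<rho>" and hx: "hashed \<mu> hx" and tws: "twiddles_at \<mu>" and out: "out_range \<mu>"
  shows "hoare w scan (n div m * (220 * E * N * \<kappa> + 5) + 3) \<rho> \<mu>
    (\<lambda>\<rho>' \<mu>'. same 31 \<rho> \<rho>' \<and> scanned 0 n hx \<mu> \<mu>')"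
  unfolding scan_def
proof (rule hoare_mono[OF hoare_For[where n = "n div m" and tb = "220 * E * N * \<kappa>" and
      I = "\<lambda>b \<rho>' \<mu>'. same 31 \<rho> \<rho>' \<and> scanned 0 (b * m) hx \<mu> \<mu>'"]])
  show "\<rho> 14 = int (n div m)" using c by (simp add: consts_ok_def)
  have "n div m \<le> n" by simp
  then show "n div m < 2 ^ w" using layout by (intro nat_less_W) linarith
  show "same 31 \<rho> \<rho> \<and> scanned 0 (0 * m) hx \<mu> \<mu>" by (simp add: scanned_def)
  have mm: "mismatches hx l \<le> m" for l
    unfolding mismatches_def by (rule order_trans[OF card_mono[of "{..<m}"]]) auto
  fix b \<rho>' \<mu>'
  assume b: "b < n div m" "\<rho>' 31 = int b" "\<rho>' 14 = int (n div m)"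
    and I: "same 31 \<rho> \<rho>' \<and> scanned 0 (b * m) hx \<mu> \<mu>'"
  have c': "consts_ok \<rho>'" by (rule consts_ok_same[OF c]) (use I in \<open>auto simp: same_def\<close>)
  have fr: "frame OUT TB \<mu> \<mu>'" using I by (simp add: scanned_def)
  show "hoare w block (220 * E * N * \<kappa>) \<rho>' \<mu>' (\<lambda>\<rho>'' \<mu>''. \<rho>'' 31 = int b \<and> \<rho>'' 14 = int (n div m) \<and>
      same 31 \<rho> \<rho>'' \<and> scanned 0 (Suc b * m) hx \<mu> \<mu>'')"
  proof (rule hoare_mono[OF block_spec[OF c' b(2,1)] order_refl])
    show "hashed \<mu>' hx" by (rule hashed_frame[OF hx fr]) simp
    show "twiddles_at \<mu>'" by (rule twiddles_at_frame[OF tws fr]) simp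
    show "out_range \<mu>'" using out I mm by (auto simp: out_range_def scanned_def)
    fix \<rho>'' \<mu>''
    assume R: "same 32 \<rho>' \<rho>'' \<and> scanned (b * m) (Suc b * m) hx \<mu>' \<mu>''"
    have "scanned 0 (Suc b * m) hx \<mu> \<mu>''"
      using I R by (auto simp: scanned_def frame_def)
    then show "\<rho>'' 31 = int b \<and> \<rho>'' 14 = int (n div m) \<and> same 31 \<rho> \<rho>'' \<and> scanned 0 (Suc b * m) hx \<mu> \<mu>''"
      using R I b by (auto simp: same_def)
  qed
next
  fix \<rho>' \<mu>'
  assume *: "same 31 \<rho> \<rho>' \<and> scanned 0 (n div m * m) hx \<mu> \<mu>'"
  \<comment> \<open>Locations stop at n - m, which is below (n div m) * m because n mod m < m; the
    incomplete block at the end contains none.\<close>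
  have "l < n div m * m" if "l + m \<le> n" for l
    using that m(1) div_mult_mod_eq[of n m] mod_less_divisor[of m n] by linarith
  then show "same 31 \<rho> \<rho>' \<and> scanned 0 n hx \<mu> \<mu>'" using * m(1) by (auto simp: scanned_def)
qed (auto simp: same_def)

end

section \<open>Set-up\<close>

context machine
begin

text \<open>There are only counted loops, so both exponents are found in a fixed number of rounds in
  which the doubling is multiplied by the outcome of a comparison. Here m and n rounds suffice, as
  \<kappa> \<le> 4 + m and logn \<le> n.\<close>

definition sizing :: com where
  "sizing = Blk [Const 5 1, Const 6 2, Const 7 16, Const 8 4, Arith Add 24 0 1, Arith Add 27 1 1] ;;
    For 30 1 (Blk [Arith Less 32 7 27, Arith Mul 33 7 32, Arith Add 7 7 33, Arith Add 8 8 32]) ;;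
    Blk [Const 31 1, Const 13 0] ;;
    For 30 0 (Blk [Arith Less 32 31 0, Arith Mul 33 31 32, Arith Add 31 31 33, Arith Add 13 13 32])"

text \<open>Four squarings of N give the scale. Register 13 is doubled because 2 * logn repetitions
  are made: one factor 1 / n pays for the union over locations, the other is the failure
  probability.\<close>

definition constants :: com where
  "constants = Blk [Arith Add 13 13 13,
     Arith Mul 9 7 7, Arith Mul 9 9 9, Arith Mul 9 9 9, Arith Mul 9 9 9, Arith Mul 11 9 9, Arith Mul 10 11 9,
     Arith Add 12 3 3, Arith Div 14 0 1, Arith Add 15 24 4, Arith Add 16 24 24, Arith Add 17 16 0, Arith Add 17 17 0,
     Arith Add 18 17 1, Arith Add 19 18 7, Arith Add 19 19 7, Arith Add 20 19 7, Arith Add 20 20 7,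
     Arith Add 21 20 7, Arith Add 21 21 7, Arith Mul 22 7 9, Arith Div 23 22 6, Arith Div 26 7 6,
     Const 28 16, Arith Mul 25 8 28, Arith Add 25 25 5]"

text \<open>Binary search for the bits of an integer root: register 42 holds the root found so far,
  43 the bit on trial.\<close>

definition sqrt_loop :: com where
  "sqrt_loop = For 44 25 (Blk [Arith Add 45 42 43, Arith Mul 46 45 45, Arith Less 47 41 46, Arith Sub 47 5 47,
     Arith Mul 48 43 47, Arith Add 42 42 48, Arith Div 43 43 6])"

definition double_table :: com where
  "double_table = For 40 33 (Blk ([Arith Add 61 20 40, Arith Add 62 61 7, Load 65 61, Load 66 62] @
     cmul 65 66 31 32 @ [Arith Add 61 61 33, Arith Add 62 62 33, Store 61 70, Store 62 71]))"

definition twiddles :: com where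
  "twiddles = Blk [Store 20 9, Arith Add 30 20 7, Store 30 4, Const 31 0, Arith Add 32 9 4, Const 33 1] ;;
    For 34 8 (double_table ;;
      Blk [Arith Add 41 9 31, Arith Mul 41 41 9, Arith Div 41 41 6, Const 42 0, Arith Add 43 9 4] ;;
      sqrt_loop ;;
      Blk [Arith Mul 46 32 9, Arith Add 47 42 42, Arith Div 32 46 47, Arith Add 31 42 4, Arith Add 33 33 33])"

text \<open>Only the denominators are written; the numerators start from the zeros of the initial
  memory.\<close>

definition init_out :: com where
  "init_out = For 30 0 (Blk [Arith Add 31 30 30, Arith Add 31 31 16, Arith Add 31 31 5, Store 31 5])"

definition setup_code :: com where
  "setup_code = sizing ;; constants ;; twiddles ;; init_out"

end

locale algorithm = machine +
  fixes logn :: nat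
  assumes \<kappa>_least: "\<kappa> = (LEAST k. 4 \<le> k \<and> 2 * m \<le> 2 ^ k)"
    and logn_least: "logn = (LEAST k. n \<le> 2 ^ k)"
begin

lemma logn_bounds: "n \<le> 2 ^ logn" "k < logn \<Longrightarrow> 2 ^ k < n"
proof -
  have "n \<le> 2 ^ n" by (simp add: less_imp_le)
  then show "n \<le> 2 ^ logn" unfolding logn_least by (rule LeastI)
  show "k < logn \<Longrightarrow> 2 ^ k < n" unfolding logn_least using not_less_Least[of k "\<lambda>k. n \<le> 2 ^ k"] by simp
qed

lemma \<kappa>_le: "\<kappa> \<le> 4 + m"
proof -
  have "m \<le> 8 * 2 ^ m" using less_exp[of m] by linarith
  then have "2 * m \<le> 2 ^ (4 + m)" by (simp only: power_add) simp
  then show ?thesis unfolding \<kappa>_least by (intro Least_le) simp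
qed

lemma \<kappa>_minimal: "4 \<le> k \<Longrightarrow> k < \<kappa> \<Longrightarrow> 2 ^ k < 2 * m"
  unfolding \<kappa>_least using not_less_Least[of k "\<lambda>k. 4 \<le> k \<and> 2 * m \<le> 2 ^ k"] by simp

lemma small_mod: "x \<le> 2 * int n \<Longrightarrow> 0 \<le> x \<Longrightarrow> x mod 2 ^ w = x"
  using layout m by (intro modW) auto

lemma sizing_spec:
  assumes "\<rho> 0 = int n" "\<rho> 1 = int m" "\<rho> 3 = int E" "\<rho> 4 = 0"
  shows "hoare w sizing (18 * n + 14) \<rho> \<mu> (\<lambda>\<rho>' \<mu>'. \<mu>' = \<mu> \<and> \<rho>' 0 = int n \<and> \<rho>' 1 = int m \<and> \<rho>' 3 = int E \<and>
    \<rho>' 4 = 0 \<and> \<rho>' 5 = 1 \<and> \<rho>' 6 = 2 \<and> \<rho>' 7 = int N \<and> \<rho>' 8 = int \<kappa> \<and> \<rho>' 24 = int n + int m \<and> \<rho>' 13 = int logn)"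
  unfolding sizing_def
proof (rule hoare_Seq[where ?t1.0 = 6 and ?t2.0 = "18 * n + 8" and R = "\<lambda>\<rho>' \<mu>'. \<mu>' = \<mu> \<and> \<rho>' 0 = int n \<and> \<rho>' 1 = int m \<and> \<rho>' 3 = int E \<and>
    \<rho>' 4 = 0 \<and> \<rho>' 5 = 1 \<and> \<rho>' 6 = 2 \<and> \<rho>' 7 = 16 \<and> \<rho>' 8 = 4 \<and> \<rho>' 24 = int n + int m \<and> \<rho>' 27 = 2 * int m"])
  show "hoare w (Blk [Const 5 1, Const 6 2, Const 7 16, Const 8 4, Arith Add 24 0 1, Arith Add 27 1 1]) 6 \<rho> \<mu>
    (\<lambda>\<rho>' \<mu>'. \<mu>' = \<mu> \<and> \<rho>' 0 = int n \<and> \<rho>' 1 = int m \<and> \<rho>' 3 = int E \<and>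
    \<rho>' 4 = 0 \<and> \<rho>' 5 = 1 \<and> \<rho>' 6 = 2 \<and> \<rho>' 7 = 16 \<and> \<rho>' 8 = 4 \<and> \<rho>' 24 = int n + int m \<and> \<rho>' 27 = 2 * int m)"
    by (rule hoare_Blk) (use assms in simp_all)
next
  fix \<rho>1 :: rfile and \<mu>1
  let ?F = "\<lambda>(\<rho>' :: rfile) \<mu>'. \<mu>' = \<mu> \<and> \<rho>' 0 = int n \<and> \<rho>' 1 = int m \<and> \<rho>' 3 = int E \<and>
    \<rho>' 4 = 0 \<and> \<rho>' 5 = 1 \<and> \<rho>' 6 = 2 \<and> \<rho>' 24 = int n + int m"
  assume R: "\<mu>1 = \<mu> \<and> \<rho>1 0 = int n \<and> \<rho>1 1 = int m \<and> \<rho>1 3 = int E \<and>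
    \<rho>1 4 = 0 \<and> \<rho>1 5 = 1 \<and> \<rho>1 6 = 2 \<and> \<rho>1 7 = 16 \<and> \<rho>1 8 = 4 \<and> \<rho>1 24 = int n + int m \<and> \<rho>1 27 = 2 * int m"
  \<comment> \<open>Either \<kappa> has been reached or the exponent has grown in every round so
    far. After \<open>m\<close> rounds both alternatives give k = \<kappa>, because k \<le> \<kappa>
    \<le> 4 + m.\<close>
  let ?I = "\<lambda>j (\<rho>' :: rfile) \<mu>'. ?F \<rho>' \<mu>' \<and> \<rho>' 27 = 2 * int m \<and>
    (\<exists>k. 4 \<le> k \<and> k \<le> \<kappa> \<and> (k = \<kappa> \<or> 4 + j \<le> k) \<and> \<rho>' 7 = 2 ^ k \<and> \<rho>' 8 = int k)"
  let ?J = "\<lambda>j (\<rho>' :: rfile) \<mu>'. ?F \<rho>' \<mu>' \<and> \<rho>' 7 = int N \<and> \<rho>' 8 = int \<kappa> \<and>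
    (\<exists>k. k \<le> logn \<and> (k = logn \<or> j \<le> k) \<and> \<rho>' 31 = 2 ^ k \<and> \<rho>' 13 = int k)"
  have mW: "m < 2 ^ w" "n < 2 ^ w" using layout m by (intro nat_less_W; linarith)+
  have loop1: "hoare w (For 30 1 (Blk [Arith Less 32 7 27, Arith Mul 33 7 32, Arith Add 7 7 33, Arith Add 8 8 32]))
      (9 * m + 3) \<rho>1 \<mu>1 (?I m)"
  proof (rule hoare_For[where tb = 4 and n = m and I = ?I])
    show "?I 0 \<rho>1 \<mu>1" using R \<kappa> by (intro conjI exI[of _ 4]) auto
    fix j and \<rho>' :: rfile and \<mu>'
    assume j: "j < m" "\<rho>' 30 = int j" "\<rho>' 1 = int m" and I: "?I j \<rho>' \<mu>'"
    then obtain k where k: "4 \<le> k" "k \<le> \<kappa>" "k = \<kappa> \<or> 4 + j \<le> k" "\<rho>' 7 = 2 ^ k" "\<rho>' 8 = int k" by blast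
    have kN: "(2 :: int) ^ k \<le> int N" using power_increasing[OF k(2), of "2 :: int"] by (simp add: N_def)
    have "(2 :: int) ^ k < W" "(0 :: int) \<le> 2 ^ k" using kN layout by (linarith, simp)
    then have mods: "2 ^ k mod 2 ^ w = (2 :: int) ^ k" "2 * int m mod 2 ^ w = 2 * int m"
      using m(2) by (auto intro: modW small_mod)
    have kk: "(2 :: int) ^ k < 2 * int m \<longleftrightarrow> k < \<kappa>"
    proof
      have "int (2 ^ k) < int (2 * m) \<longleftrightarrow> (2 :: nat) ^ k < 2 * m" by (rule of_nat_less_iff)
      then have e: "(2 :: int) ^ k < 2 * int m \<longleftrightarrow> (2 :: nat) ^ k < 2 * m" by simp
      show "k < \<kappa>" if "(2 :: int) ^ k < 2 * int m"
        using that m(3) k(2) unfolding e by (cases "k = \<kappa>") auto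
      show "(2 :: int) ^ k < 2 * int m" if "k < \<kappa>" unfolding e by (rule \<kappa>_minimal[OF k(1) that])
    qed
    let ?k = "if k < \<kappa> then Suc k else k"
    have "4 \<le> ?k \<and> ?k \<le> \<kappa> \<and> (?k = \<kappa> \<or> 4 + Suc j \<le> ?k)" using k by auto
    then have ex: "\<exists>l\<ge>4. l \<le> \<kappa> \<and> (l = \<kappa> \<or> 4 + Suc j \<le> l) \<and>
        (2 :: int) ^ ?k = 2 ^ l \<and> int k + of_bool (k < \<kappa>) = int l"
      by (intro exI[of _ ?k]) simp
    show "hoare w (Blk [Arith Less 32 7 27, Arith Mul 33 7 32, Arith Add 7 7 33, Arith Add 8 8 32]) 4 \<rho>' \<mu>'
      (\<lambda>\<rho>'' \<mu>''. \<rho>'' 30 = int j \<and> \<rho>'' 1 = int m \<and> ?I (Suc j) \<rho>'' \<mu>'')"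
    proof (rule hoare_Blk)
      show "iexecs w [Arith Less 32 7 27, Arith Mul 33 7 32, Arith Add 7 7 33, Arith Add 8 8 32] \<rho>' \<mu>'
        (\<lambda>\<rho>'' \<mu>''. \<rho>'' 30 = int j \<and> \<rho>'' 1 = int m \<and> ?I (Suc j) \<rho>'' \<mu>'')"
        using I j k(4,5) mods kk ex by (cases "k < \<kappa>") simp_all
    qed simp_all
  qed (use R mW in auto)
  show "hoare w (For 30 1 (Blk [Arith Less 32 7 27, Arith Mul 33 7 32, Arith Add 7 7 33, Arith Add 8 8 32]) ;;
    Blk [Const 31 1, Const 13 0] ;;
    For 30 0 (Blk [Arith Less 32 31 0, Arith Mul 33 31 32, Arith Add 31 31 33, Arith Add 13 13 32])) (18 * n + 8) \<rho>1 \<mu>1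
    (\<lambda>\<rho>' \<mu>'. \<mu>' = \<mu> \<and> \<rho>' 0 = int n \<and> \<rho>' 1 = int m \<and> \<rho>' 3 = int E \<and>
    \<rho>' 4 = 0 \<and> \<rho>' 5 = 1 \<and> \<rho>' 6 = 2 \<and> \<rho>' 7 = int N \<and> \<rho>' 8 = int \<kappa> \<and> \<rho>' 24 = int n + int m \<and> \<rho>' 13 = int logn)"
  proof (rule hoare_Seq[OF loop1, where ?t2.0 = "9 * n + 5"])
    fix \<rho>2 :: rfile and \<mu>2
    assume R2: "?I m \<rho>2 \<mu>2"
    then have R2': "?F \<rho>2 \<mu>2" "\<rho>2 7 = int N" "\<rho>2 8 = int \<kappa>"
      using \<kappa>_le by (auto simp: N_def)
    show "hoare w (Blk [Const 31 1, Const 13 0] ;;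
      For 30 0 (Blk [Arith Less 32 31 0, Arith Mul 33 31 32, Arith Add 31 31 33, Arith Add 13 13 32])) (9 * n + 5) \<rho>2 \<mu>2
      (\<lambda>\<rho>' \<mu>'. \<mu>' = \<mu> \<and> \<rho>' 0 = int n \<and> \<rho>' 1 = int m \<and> \<rho>' 3 = int E \<and>
      \<rho>' 4 = 0 \<and> \<rho>' 5 = 1 \<and> \<rho>' 6 = 2 \<and> \<rho>' 7 = int N \<and> \<rho>' 8 = int \<kappa> \<and> \<rho>' 24 = int n + int m \<and> \<rho>' 13 = int logn)"
    proof (rule hoare_Seq[where R = "?J 0" and ?t1.0 = 2 and ?t2.0 = "9 * n + 3"])
      have ex0: "\<exists>k\<le>logn. (k = logn \<or> 0 \<le> k) \<and> (1 :: int) = 2 ^ k \<and> k = 0" by (intro exI[of _ 0]) simp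
      show "hoare w (Blk [Const 31 1, Const 13 0]) 2 \<rho>2 \<mu>2 (?J 0)"
        by (rule hoare_Blk) (use R2' ex0 in auto)
      fix \<rho>3 :: rfile and \<mu>3
      assume R3: "?J 0 \<rho>3 \<mu>3"
      show "hoare w (For 30 0 (Blk [Arith Less 32 31 0, Arith Mul 33 31 32, Arith Add 31 31 33, Arith Add 13 13 32])) (9 * n + 3) \<rho>3 \<mu>3
        (\<lambda>\<rho>' \<mu>'. \<mu>' = \<mu> \<and> \<rho>' 0 = int n \<and> \<rho>' 1 = int m \<and> \<rho>' 3 = int E \<and>
        \<rho>' 4 = 0 \<and> \<rho>' 5 = 1 \<and> \<rho>' 6 = 2 \<and> \<rho>' 7 = int N \<and> \<rho>' 8 = int \<kappa> \<and> \<rho>' 24 = int n + int m \<and> \<rho>' 13 = int logn)"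
      proof (rule hoare_mono[OF hoare_For[where tb = 4 and n = n and I = ?J] order_refl])
        fix j and \<rho>' :: rfile and \<mu>'
        assume j: "j < n" "\<rho>' 30 = int j" "\<rho>' 0 = int n" and I: "?J j \<rho>' \<mu>'"
        then obtain k where k: "k \<le> logn" "k = logn \<or> j \<le> k" "\<rho>' 31 = 2 ^ k" "\<rho>' 13 = int k" by blast
        have kn: "(2 :: nat) ^ k < 2 * n"
        proof (cases k)
          case (Suc l)
          then show ?thesis using logn_bounds(2)[of l] k by simp
        qed (use m in simp)
        then have "int (2 ^ k) < int (2 * n)" by (simp only: of_nat_less_iff)
        then have mods: "2 ^ k mod 2 ^ w = (2 :: int) ^ k" "int n mod 2 ^ w = int n" by (intro small_mod; simp)+
        have kk: "(2 :: int) ^ k < int n \<longleftrightarrow> k < logn"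
        proof
          have "int (2 ^ k) < int n \<longleftrightarrow> (2 :: nat) ^ k < n" by (rule of_nat_less_iff)
          then have e: "(2 :: int) ^ k < int n \<longleftrightarrow> (2 :: nat) ^ k < n" by simp
          show "k < logn" if "(2 :: int) ^ k < int n"
            using that logn_bounds(1) k(1) unfolding e by (cases "k = logn") auto
          show "(2 :: int) ^ k < int n" if "k < logn" unfolding e by (rule logn_bounds(2)[OF that])
        qed
        let ?k = "if k < logn then Suc k else k"
        have "?k \<le> logn \<and> (?k = logn \<or> Suc j \<le> ?k)" using k by auto
        then have ex: "\<exists>l\<le>logn. (l = logn \<or> Suc j \<le> l) \<and> (2 :: int) ^ ?k = 2 ^ l \<and> int k + of_bool (k < logn) = int l"
          by (intro exI[of _ ?k]) simp
        show "hoare w (Blk [Arith Less 32 31 0, Arith Mul 33 31 32, Arith Add 31 31 33, Arith Add 13 13 32]) 4 \<rho>' \<mu>'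
          (\<lambda>\<rho>'' \<mu>''. \<rho>'' 30 = int j \<and> \<rho>'' 0 = int n \<and> ?J (Suc j) \<rho>'' \<mu>'')"
        proof (rule hoare_Blk)
          show "iexecs w [Arith Less 32 31 0, Arith Mul 33 31 32, Arith Add 31 31 33, Arith Add 13 13 32] \<rho>' \<mu>'
            (\<lambda>\<rho>'' \<mu>''. \<rho>'' 30 = int j \<and> \<rho>'' 0 = int n \<and> ?J (Suc j) \<rho>'' \<mu>'')"
            using I j k(3,4) mods kk ex by (cases "k < logn") simp_all
        qed simp_all
      next
        fix \<rho>' :: rfile and \<mu>' assume "?J n \<rho>' \<mu>'"
        moreover have "logn \<le> n" unfolding logn_least by (rule Least_le) (simp add: less_imp_le)
        ultimately show "\<mu>' = \<mu> \<and> \<rho>' 0 = int n \<and> \<rho>' 1 = int m \<and> \<rho>' 3 = int E \<and>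
          \<rho>' 4 = 0 \<and> \<rho>' 5 = 1 \<and> \<rho>' 6 = 2 \<and> \<rho>' 7 = int N \<and> \<rho>' 8 = int \<kappa> \<and> \<rho>' 24 = int n + int m \<and> \<rho>' 13 = int logn"
          by auto
      qed (use R3 mW in auto)
    qed simp
  qed (use m in simp)
qed simp

lemma constants_spec:
  assumes "\<rho> 0 = int n" "\<rho> 1 = int m" "\<rho> 3 = int E" "\<rho> 4 = 0" "\<rho> 5 = 1" "\<rho> 6 = 2" "\<rho> 7 = int N" "\<rho> 8 = int \<kappa>"
    "\<rho> 24 = int n + int m" "\<rho> 13 = int logn"
  shows "hoare w constants 26 \<rho> \<mu> (\<lambda>\<rho>' \<mu>'. \<mu>' = \<mu> \<and> consts_ok \<rho>' \<and> \<rho>' 13 = 2 * int logn)"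
proof -
  \<comment> \<open>The shape in which simplification leaves the four squarings.\<close>
  have S: "int N * int N * (int N * int N) * (int N * int N * (int N * int N)) *
      (int N * int N * (int N * int N) * (int N * int N * (int N * int N))) = S"
    unfolding S_eq(1) by (simp add: power_numeral_reduce mult.assoc)
  have "int N * S < W" using rounding_range S_pos N16 by (smt (verit) mult_nonneg_nonneg of_nat_0_le_iff zero_le_power)
  moreover have "0 \<le> int N * S" using S_pos by simp
  ultimately have mods: "int n mod 2 ^ w = int n" "int m mod 2 ^ w = int m" "int N * S mod 2 ^ w = int N * S"
    "2 mod 2 ^ w = (2 :: int)" "int N mod 2 ^ w = int N"
    using layout m N16 by (intro modW; linarith)+
  show ?thesis
    unfolding constants_def
    by (rule hoare_Blk) (use assms in \<open>simp_all add: S mods consts_ok_def HX_def OUT_def ACC_def AB_def GB_def TB_def TBL_def zdiv_int\<close>)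
qed

lemma word_bounds: "16 * (S * S) < W" "2 < W" "int N < W"
  using S_powers fits(2) layout N16 by linarith+

section \<open>Integer square roots\<close>

lemma sqrt_step:
  fixes r q X :: int
  assumes "0 \<le> r" "r * r \<le> X" "0 \<le> q" "X < (r + 2 * q) * (r + 2 * q)"
  defines "r' \<equiv> r + q * (1 - of_bool (X < (r + q) * (r + q)))"
  shows "0 \<le> r'" "r' * r' \<le> X" "X < (r' + q) * (r' + q)"
proof -
  have "0 \<le> r' \<and> r' * r' \<le> X \<and> X < (r' + q) * (r' + q)"
  proof (cases "X < (r + q) * (r + q)")
    case True
    then have "r' = r" by (simp add: r'_def)
    then show ?thesis using assms(1,2) True by blast
  next
    case False
    then have r': "r' = r + q" by (simp add: r'_def)
    have "r + q + q = r + 2 * q" by simp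
    then show ?thesis unfolding r' using assms(1,3,4) False by (metis add_nonneg_nonneg not_less)
  qed
  then show "0 \<le> r'" "r' * r' \<le> X" "X < (r' + q) * (r' + q)" by blast+
qed

text \<open>A root below 2 * S = 2 ^ (16 * \<kappa> + 1) has at most 16 * \<kappa> + 1 bits, tried
  from \<open>S\<close> down to 1; each trial halves the interval that contains the root. The guard
  on register 43 in the invariant is due to the last halving, which yields 0.\<close>

lemma sqrt_loop_spec:
  assumes c: "consts_ok \<rho>" and \<rho>: "\<rho> 41 = X" "\<rho> 42 = 0" "\<rho> 43 = S" and X: "0 \<le> X" "X < (2 * S) * (2 * S)"
  shows "hoare w sqrt_loop ((16 * \<kappa> + 1) * 12 + 3) \<rho> \<mu>
    (\<lambda>\<rho>' \<mu>'. same 42 \<rho> \<rho>' \<and> \<rho>' 42 = \<lfloor>sqrt (real_of_int X)\<rfloor> \<and> \<mu>' = \<mu>)"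
proof -
  let ?I = "\<lambda>j \<rho>' \<mu>'. same 42 \<rho> \<rho>' \<and> \<mu>' = \<mu> \<and> 0 \<le> \<rho>' 42 \<and> \<rho>' 42 * \<rho>' 42 \<le> X \<and>
    X < (\<rho>' 42 + 2 ^ (16 * \<kappa> + 1 - j)) * (\<rho>' 42 + 2 ^ (16 * \<kappa> + 1 - j)) \<and>
    (j \<le> 16 * \<kappa> \<longrightarrow> \<rho>' 43 = 2 ^ (16 * \<kappa> - j))"
  show ?thesis
    unfolding sqrt_loop_def
  proof (rule hoare_mono[OF hoare_For[where tb = 7 and n = "16 * \<kappa> + 1" and I = ?I] order_refl])
    show "\<rho> 25 = int (16 * \<kappa> + 1)" using c by (simp add: consts_ok_def)
    show "16 * \<kappa> + 1 < 2 ^ w"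
    proof (rule nat_less_W)
      have "16 * \<kappa> < 2 ^ (16 * \<kappa>)" by (rule less_exp)
      then have "int (16 * \<kappa>) < int (2 ^ (16 * \<kappa>))" by (simp only: of_nat_less_iff)
      then have "int (16 * \<kappa>) < S" by (simp add: S_def)
      then show "int (16 * \<kappa> + 1) < W" using S_powers word_bounds by linarith
    qed
    show "?I 0 \<rho> \<mu>" using \<rho> X by (simp add: S_def mult_ac)
    fix j and \<rho>' :: rfile and \<mu>'
    assume j: "j < 16 * \<kappa> + 1" "\<rho>' 44 = int j" "\<rho>' 25 = int (16 * \<kappa> + 1)" and I: "?I j \<rho>' \<mu>'"
    have c': "consts_ok \<rho>'" by (rule consts_ok_same[OF c]) (use I in \<open>auto simp: same_def\<close>)
    define r where "r = \<rho>' 42"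
    define q :: int where "q = 2 ^ (16 * \<kappa> - j)"
    have q: "\<rho>' 43 = q" using I j by (simp add: q_def)
    have Q: "2 ^ (16 * \<kappa> + 1 - j) = 2 * q" using j by (simp add: q_def Suc_diff_le flip: power_Suc)
    have qS: "1 \<le> q" "q \<le> S" by (simp_all add: q_def S_def)
    have r: "0 \<le> r" "r * r \<le> X" "X < (r + 2 * q) * (r + 2 * q)" using I unfolding Q by (simp_all add: r_def)
    \<comment> \<open>Keeps (r + q) * (r + q) below 9 * S * S and thus inside a word, so that the
      comparison is faithful.\<close>
    have "r < 2 * S"
    proof (rule ccontr)
      assume "\<not> r < 2 * S"
      then have "(2 * S) * (2 * S) \<le> r * r" using S_pos by (intro mult_mono) auto
      then show False using r X by linarith
    qed
    then have "(r + q) * (r + q) \<le> (3 * S) * (3 * S)" using r qS by (intro mult_mono) auto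
    then have mods: "X mod 2 ^ w = X" "(r + q) * (r + q) mod 2 ^ w = (r + q) * (r + q)" "q mod 2 ^ w = q" "2 mod 2 ^ w = (2 :: int)"
      using word_bounds S_powers X qS r by (intro modW; simp; linarith)+
    have q2: "q div 2 = 2 ^ (16 * \<kappa> - Suc j)" if "Suc j \<le> 16 * \<kappa>"
    proof -
      have "16 * \<kappa> - j = Suc (16 * \<kappa> - Suc j)" using that by simp
      then show ?thesis by (simp add: q_def)
    qed
    have Q': "2 ^ (16 * \<kappa> + 1 - Suc j) = q" using j by (simp add: q_def)
    have r': "\<rho>' 42 = r" "\<rho>' 41 = X" using I \<rho> by (simp_all add: r_def same_def)
    show "hoare w (Blk [Arith Add 45 42 43, Arith Mul 46 45 45, Arith Less 47 41 46, Arith Sub 47 5 47,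
     Arith Mul 48 43 47, Arith Add 42 42 48, Arith Div 43 43 6]) 7 \<rho>' \<mu>'
     (\<lambda>\<rho>'' \<mu>''. \<rho>'' 44 = int j \<and> \<rho>'' 25 = int (16 * \<kappa> + 1) \<and> ?I (Suc j) \<rho>'' \<mu>'')"
      unfolding Q'
    proof (rule hoare_Blk)
      define p where "p = (r + q) * (r + q)"
      define g :: int where "g = 1 - of_bool (X < p)"
      have gm: "1 - of_bool (X mod 2 ^ w < p mod 2 ^ w) = g"
        unfolding g_def mods(1) mods(2)[folded p_def] by (rule refl)
      define \<rho>1 where "\<rho>1 = \<rho>'(45 := r + q, 46 := p, 47 := g, 48 := q * g, 42 := r + q * g, 43 := q div 2)"
      have ex: "iexecs w [Arith Add 45 42 43, Arith Mul 46 45 45, Arith Less 47 41 46, Arith Sub 47 5 47,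
         Arith Mul 48 43 47, Arith Add 42 42 48, Arith Div 43 43 6] \<rho>' \<mu>' f = f \<rho>1 \<mu>'" for f :: "rfile \<Rightarrow> memory \<Rightarrow> bool"
        using c' r' q mods(3,4) gm by (simp add: consts_ok_def p_def[symmetric] \<rho>1_def fun_upd_twist)
      have r1: "\<rho>1 42 = r + q * g" by (simp add: \<rho>1_def)
      have r2: "\<rho>1 43 = q div 2" by (simp add: \<rho>1_def)
      have r3: "\<rho>1 44 = int j" unfolding \<rho>1_def using j(2) by simp
      have r4: "\<rho>1 25 = int (16 * \<kappa> + 1)" unfolding \<rho>1_def using j(3) by simp
      have r5: "same 42 \<rho> \<rho>1" unfolding \<rho>1_def using I[THEN conjunct1] by simp
      have r6: "\<mu>' = \<mu>" by (rule I[THEN conjunct2, THEN conjunct1])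
      have g: "0 \<le> r + q * g" "(r + q * g) * (r + q * g) \<le> X" "X < (r + q * g + q) * (r + q * g + q)"
        unfolding g_def p_def by (rule sqrt_step[OF r(1,2) order_trans[OF zero_le_one qS(1)] r(3)])+
      show "iexecs w [Arith Add 45 42 43, Arith Mul 46 45 45, Arith Less 47 41 46, Arith Sub 47 5 47,
         Arith Mul 48 43 47, Arith Add 42 42 48, Arith Div 43 43 6] \<rho>' \<mu>'
       (\<lambda>\<rho>'' \<mu>''. \<rho>'' 44 = int j \<and> \<rho>'' 25 = int (16 * \<kappa> + 1) \<and> same 42 \<rho> \<rho>'' \<and> \<mu>'' = \<mu> \<and> 0 \<le> \<rho>'' 42 \<and>
         \<rho>'' 42 * \<rho>'' 42 \<le> X \<and> X < (\<rho>'' 42 + q) * (\<rho>'' 42 + q) \<and> (Suc j \<le> 16 * \<kappa> \<longrightarrow> \<rho>'' 43 = 2 ^ (16 * \<kappa> - Suc j)))"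
        unfolding ex r1 r2 using r3 r4 r5 r6 g q2 by blast
    qed simp_all
  next
    fix \<rho>' :: rfile and \<mu>' assume "?I (16 * \<kappa> + 1) \<rho>' \<mu>'"
    then show "same 42 \<rho> \<rho>' \<and> \<rho>' 42 = \<lfloor>sqrt (real_of_int X)\<rfloor> \<and> \<mu>' = \<mu>"
      using floor_sqrt_unique[of "\<rho>' 42" X] by simp
  qed (auto simp: same_def)
qed

lemma rho_range: "k \<le> \<kappa> \<Longrightarrow> 0 \<le> fst (rho S k) \<and> fst (rho S k) \<le> 2 * S \<and> 0 \<le> snd (rho S k) \<and> snd (rho S k) \<le> 2 * S"
  using rho_nonneg[OF \<kappa> N_def[THEN meta_eq_to_obj_eq] S_def[THEN meta_eq_to_obj_eq], of k] rho_le[OF \<kappa> N_def[THEN meta_eq_to_obj_eq] S_def[THEN meta_eq_to_obj_eq], of k] by blast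

lemma twd_Suc:
  assumes "j < 2 ^ k" "k < \<kappa>"
  shows "twd (2 ^ k + j) = fmul S (twd j) (rho S k)"
proof -
  have "twd (2 ^ k + j) = twtab S (Suc k) (2 ^ k + j)"
    unfolding twd_def using assms by (intro twtab_eq) auto
  also have "\<dots> = fmul S (twtab S k j) (rho S k)" by simp
  also have "twtab S k j = twd j"
    unfolding twd_def using assms by (intro twtab_eq[symmetric]) auto
  finally show ?thesis .
qed

definition table_upto :: "memory \<Rightarrow> nat \<Rightarrow> memory \<Rightarrow> bool" where
  "table_upto \<mu> l \<mu>' \<longleftrightarrow> (\<exists>F. \<mu>' = put N \<mu> TB F \<and> (\<forall>p < l. F p = twd p))"

text \<open>Entries are read below \<open>2 ^ k\<close> and written at distance \<open>2 ^ k\<close>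
  above, so nothing is read after it has been changed.\<close>

lemma double_table_spec:
  assumes c: "consts_ok \<rho>" and \<rho>: "\<rho> 31 = fst (rho S k)" "\<rho> 32 = snd (rho S k)" "\<rho> 33 = 2 ^ k" and k: "k < \<kappa>"
    and tab: "table_upto \<mu> (2 ^ k) \<mu>1"
  shows "hoare w double_table (25 * N + 3) \<rho> \<mu>1 (\<lambda>\<rho>' \<mu>'. same 40 \<rho> \<rho>' \<and> table_upto \<mu> (2 ^ Suc k) \<mu>')"
proof -
  have kN: "2 * 2 ^ k \<le> N"
    using k power_increasing[of "Suc k" \<kappa> "2 :: nat"] by (simp add: N_def)
  show ?thesis
    unfolding double_table_def
  proof (rule hoare_mono[OF hoare_For[where tb = 20 and n = "2 ^ k" and
        I = "\<lambda>j \<rho>' \<mu>'. same 40 \<rho> \<rho>' \<and> table_upto \<mu> (2 ^ k + j) \<mu>'"]])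
    show "\<rho> 33 = int (2 ^ k)" using \<rho> by simp
    show "2 ^ k < (2 :: nat) ^ w" using kN word_bounds by (intro nat_less_W) linarith
    fix j \<rho>' \<mu>'
    assume j: "j < 2 ^ k" "\<rho>' 40 = int j" "\<rho>' 33 = int (2 ^ k)" and I: "same 40 \<rho> \<rho>' \<and> table_upto \<mu> (2 ^ k + j) \<mu>'"
    then obtain F where F: "\<mu>' = put N \<mu> TB F" "\<forall>p < 2 ^ k + j. F p = twd p" by (auto simp: table_upto_def)
    have c': "consts_ok \<rho>'" by (rule consts_ok_same[OF c]) (use I in \<open>auto simp: same_def\<close>)
    have \<rho>': "\<rho>' 31 = fst (rho S k)" "\<rho>' 32 = snd (rho S k)" using I \<rho> by (simp_all add: same_def)
    define l where "l = (2 :: nat) ^ k"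
    have l: "int l = 2 ^ k" "j < l" "l + j < N" "j < N" using kN j by (simp_all add: l_def)
    have lz: "int l + int j < int N" "int j < int N" using l(3,4) by linarith+
    have mods: "(TB + int j) mod 2 ^ w = TB + int j" "(TB + int j + int N) mod 2 ^ w = TB + int j + int N"
      "(TB + int j + int l) mod 2 ^ w = TB + int j + int l" "(TB + int j + int N + int l) mod 2 ^ w = TB + int j + int N + int l"
      using layout lz by (intro modW; linarith)+
    have ld: "\<mu>' (TB + int j) = fst (twd j)" "\<mu>' (TB + int j + int N) = snd (twd j)"
      unfolding F(1) using put_re[OF l(4) refl] put_im[OF l(4) refl] F(2) j by simp_all
    have bd: "\<bar>fst (twd j)\<bar> \<le> 2 * S" "\<bar>snd (twd j)\<bar> \<le> 2 * S" using small_t l by (auto simp: small_def)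
    have rr: "\<bar>fst (rho S k)\<bar> \<le> 2 * S" "\<bar>snd (rho S k)\<bar> \<le> 2 * S" using rho_range[of k] k by auto
    have tp: "\<bar>fst (twd j) * fst (rho S k) - snd (twd j) * snd (rho S k)\<bar> \<le> S * S * S - 1"
      "\<bar>fst (twd j) * snd (rho S k) + snd (twd j) * fst (rho S k)\<bar> \<le> S * S * S - 1"
      using two_products[OF bd rr] S_powers by simp_all
    have sw: "twd (l + j) = fmul S (twd j) (rho S k)" unfolding l_def by (rule twd_Suc) (use j k in auto)
    have st: "\<mu>'(TB + int j + int l := fst (fmul S (twd j) (rho S k)), TB + int j + int N + int l := snd (fmul S (twd j) (rho S k))) =
        put N \<mu> TB (F(l + j := twd (l + j)))"
      unfolding F(1) sw[symmetric] by (rule put_upd) (use l in auto)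
    have "table_upto \<mu> (l + Suc j) (put N \<mu> TB (F(l + j := twd (l + j))))"
      unfolding table_upto_def using F(2) by (auto simp: l_def less_Suc_eq intro!: exI[of _ "F(l + j := twd (l + j))"])
    then show "hoare w (Blk ([Arith Add 61 20 40, Arith Add 62 61 7, Load 65 61, Load 66 62] @
     cmul 65 66 31 32 @ [Arith Add 61 61 33, Arith Add 62 62 33, Store 61 70, Store 62 71])) 20 \<rho>' \<mu>'
     (\<lambda>\<rho>'' \<mu>''. \<rho>'' 40 = int j \<and> \<rho>'' 33 = int (2 ^ k) \<and> same 40 \<rho> \<rho>'' \<and> table_upto \<mu> (2 ^ k + Suc j) \<mu>'')"
      unfolding l_def[symmetric] using c' j(2,3) \<rho>' mods ld tp I
      by (intro hoare_Blk) (simp_all add: l_def[symmetric] l(1)[symmetric] consts_ok_def iexecs_append iexecs_cmul st cmul_def[of 65 66 31 32, THEN arg_cong[of _ _ "list_all simple"]] cmul_def[of 65 66 31 32, THEN arg_cong[of _ _ length]] del: append.simps append_Cons)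
  qed (use tab kN in \<open>auto simp: same_def mult_2\<close>)
qed

end

context algorithm
begin

lemma table_upto_1: "table_upto \<mu> 1 (\<mu>(TB := S, TB + int N := 0))"
proof -
  define F where "F = (\<lambda>p. (\<mu> (TB + int p), \<mu> (TB + int p + int N)))"
  have \<mu>: "put N \<mu> TB F = \<mu>" by (rule put_self) (simp_all add: F_def)
  have t0: "twd 0 = (S, 0)" using twtab_eq[of 0 0 \<kappa> S] by (simp add: twd_def)
  have "\<mu>(TB := S, TB + int N := 0) = put N \<mu> TB (F(0 := twd 0))"
    using put_upd[of 0 N TB TB "TB + int N" \<mu> F "twd 0"] N16 by (simp add: \<mu> t0)
  then show ?thesis by (auto simp: table_upto_def intro!: exI[of _ "F(0 := twd 0)"])
qed

lemma table_upto_end: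
  assumes "table_upto \<mu> N \<mu>'"
  shows "twiddles_at \<mu>'" "frame TB TBL \<mu> \<mu>'"
proof -
  obtain F where F: "\<mu>' = put N \<mu> TB F" "\<forall>p < N. F p = twd p" using assms by (auto simp: table_upto_def)
  show "twiddles_at \<mu>'"
    unfolding twiddles_at_def F(1) using F(2) put_re put_im by simp
  show "frame TB TBL \<mu> \<mu>'" unfolding F(1) by (rule frame_put) (use layout in auto)
qed

text \<open>Doubling costs O(N) per round, while the \<kappa> integer roots cost O(\<kappa>) each;
  \<kappa> < N absorbs their total.\<close>

lemma twiddles_spec:
  assumes c: "consts_ok \<rho>"
  shows "hoare w twiddles (300 * N * \<kappa>) \<rho> \<mu> (\<lambda>\<rho>' \<mu>'. same 30 \<rho> \<rho>' \<and> twiddles_at \<mu>' \<and> frame TB TBL \<mu> \<mu>')"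
  unfolding twiddles_def
proof (rule hoare_Seq[where ?t1.0 = 6 and ?t2.0 = "\<kappa> * (25 * N + 192 * \<kappa> + 28 + 5) + 3" and
      R = "\<lambda>\<rho>1 \<mu>1. same 30 \<rho> \<rho>1 \<and> \<rho>1 31 = 0 \<and> \<rho>1 32 = S \<and> \<rho>1 33 = 1 \<and> table_upto \<mu> 1 \<mu>1"])
  show "hoare w (Blk [Store 20 9, Arith Add 30 20 7, Store 30 4, Const 31 0, Arith Add 32 9 4, Const 33 1]) 6 \<rho> \<mu>
    (\<lambda>\<rho>1 \<mu>1. same 30 \<rho> \<rho>1 \<and> \<rho>1 31 = 0 \<and> \<rho>1 32 = S \<and> \<rho>1 33 = 1 \<and> table_upto \<mu> 1 \<mu>1)"
  proof (rule hoare_Blk)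
    have "TB mod 2 ^ w = TB" "(TB + int N) mod 2 ^ w = TB + int N" using layout N16 by (intro modW; linarith)+
    then show "iexecs w [Store 20 9, Arith Add 30 20 7, Store 30 4, Const 31 0, Arith Add 32 9 4, Const 33 1] \<rho> \<mu>
      (\<lambda>\<rho>1 \<mu>1. same 30 \<rho> \<rho>1 \<and> \<rho>1 31 = 0 \<and> \<rho>1 32 = S \<and> \<rho>1 33 = 1 \<and> table_upto \<mu> 1 \<mu>1)"
      using c table_upto_1[of \<mu>] by (simp add: consts_ok_def)
  qed simp_all
next
  fix \<rho>1 :: rfile and \<mu>1
  assume R1: "same 30 \<rho> \<rho>1 \<and> \<rho>1 31 = 0 \<and> \<rho>1 32 = S \<and> \<rho>1 33 = 1 \<and> table_upto \<mu> 1 \<mu>1"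
  let ?I = "\<lambda>k \<rho>' \<mu>'. same 30 \<rho> \<rho>' \<and> \<rho>' 31 = fst (rho S k) \<and> \<rho>' 32 = snd (rho S k) \<and> \<rho>' 33 = 2 ^ k \<and> table_upto \<mu> (2 ^ k) \<mu>'"
  let ?mid = "Blk [Arith Add 41 9 31, Arith Mul 41 41 9, Arith Div 41 41 6, Const 42 0, Arith Add 43 9 4]"
  let ?end = "Blk [Arith Mul 46 32 9, Arith Add 47 42 42, Arith Div 32 46 47, Arith Add 31 42 4, Arith Add 33 33 33]"
  have c1: "consts_ok \<rho>1" by (rule consts_ok_same[OF c]) (use R1 in auto)
  show "hoare w (For 34 8 (double_table ;; ?mid ;; sqrt_loop ;; ?end)) (\<kappa> * (25 * N + 192 * \<kappa> + 28 + 5) + 3) \<rho>1 \<mu>1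
    (\<lambda>\<rho>' \<mu>'. same 30 \<rho> \<rho>' \<and> twiddles_at \<mu>' \<and> frame TB TBL \<mu> \<mu>')"
  proof (rule hoare_mono[OF hoare_For[where n = \<kappa> and tb = "25 * N + 192 * \<kappa> + 28" and I = ?I] order_refl])
    show "\<rho>1 8 = int \<kappa>" using c1 by (simp add: consts_ok_def)
    show "\<kappa> < 2 ^ w"
    proof (rule nat_less_W)
      have "\<kappa> < N" by (simp add: N_def)
      then show "int \<kappa> < W" using word_bounds(3) by linarith
    qed
    fix k and \<rho>2 :: rfile and \<mu>2
    assume k: "k < \<kappa>" "\<rho>2 34 = int k" "\<rho>2 8 = int \<kappa>" and I: "?I k \<rho>2 \<mu>2"
    have c2: "consts_ok \<rho>2" by (rule consts_ok_same[OF c]) (use I in auto)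
    note rr = rho_range[of k, OF less_imp_le[OF k(1)]]
    define X where "X = (S + fst (rho S k)) * S div 2"
    define r where "r = \<lfloor>sqrt (real_of_int X)\<rfloor>"
    have rS: "rho S (Suc k) = (r, snd (rho S k) * S div (2 * r))" by (simp add: Let_def r_def X_def)
    let ?Q = "\<lambda>\<rho>' \<mu>'. \<rho>' 34 = int k \<and> \<rho>' 8 = int \<kappa> \<and> ?I (Suc k) \<rho>' \<mu>'"
    let ?t2 = "(16 * \<kappa> + 1) * 12 + 3 + 5"
    show "hoare w (double_table ;; ?mid ;; sqrt_loop ;; ?end) (25 * N + 192 * \<kappa> + 28) \<rho>2 \<mu>2 ?Q"
    proof (rule hoare_Seq[OF double_table_spec[OF c2 _ _ _ k(1), of \<mu>], where ?t2.0 = "5 + ?t2"])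
      show "\<rho>2 31 = fst (rho S k)" "\<rho>2 32 = snd (rho S k)" "\<rho>2 33 = 2 ^ k" "table_upto \<mu> (2 ^ k) \<mu>2" using I by blast+
      fix \<rho>3 :: rfile and \<mu>3
      assume R3: "same 40 \<rho>2 \<rho>3 \<and> table_upto \<mu> (2 ^ Suc k) \<mu>3"
      have c3: "consts_ok \<rho>3" by (rule consts_ok_same[OF c2]) (use R3 in \<open>auto simp: same_def\<close>)
      have r3: "\<rho>3 31 = fst (rho S k)" "\<rho>3 32 = snd (rho S k)" "\<rho>3 33 = 2 ^ k" "same 30 \<rho> \<rho>3" "\<rho>3 34 = int k"
        using R3 I k by (auto simp: same_def)
      have X0: "0 \<le> (S + fst (rho S k)) * S" "(S + fst (rho S k)) * S \<le> 3 * (S * S)"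
      proof -
        show "0 \<le> (S + fst (rho S k)) * S" using rr S_pos by simp
        have "(S + fst (rho S k)) * S \<le> (3 * S) * S" using rr S_pos by (intro mult_right_mono) auto
        then show "(S + fst (rho S k)) * S \<le> 3 * (S * S)" by simp
      qed
      show "hoare w (?mid ;; sqrt_loop ;; ?end) (5 + ?t2) \<rho>3 \<mu>3 ?Q"
      proof (rule hoare_Seq[where ?t1.0 = 5 and ?t2.0 = ?t2 and R = "\<lambda>\<rho>4 \<mu>4. same 41 \<rho>3 \<rho>4 \<and> \<rho>4 41 = X \<and> \<rho>4 42 = 0 \<and> \<rho>4 43 = S \<and> \<mu>4 = \<mu>3"])
        show "hoare w ?mid 5 \<rho>3 \<mu>3 (\<lambda>\<rho>4 \<mu>4. same 41 \<rho>3 \<rho>4 \<and> \<rho>4 41 = X \<and> \<rho>4 42 = 0 \<and> \<rho>4 43 = S \<and> \<mu>4 = \<mu>3)"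
        proof (rule hoare_Blk)
          have "(S + fst (rho S k)) * S mod 2 ^ w = (S + fst (rho S k)) * S" "2 mod 2 ^ w = (2 :: int)"
            using X0 word_bounds S_powers by (intro modW; linarith)+
          then show "iexecs w [Arith Add 41 9 31, Arith Mul 41 41 9, Arith Div 41 41 6, Const 42 0, Arith Add 43 9 4] \<rho>3 \<mu>3
              (\<lambda>\<rho>4 \<mu>4. same 41 \<rho>3 \<rho>4 \<and> \<rho>4 41 = X \<and> \<rho>4 42 = 0 \<and> \<rho>4 43 = S \<and> \<mu>4 = \<mu>3)"
            using c3 r3 by (simp add: consts_ok_def X_def)
        qed simp_all
        fix \<rho>4 :: rfile and \<mu>4
        assume R4: "same 41 \<rho>3 \<rho>4 \<and> \<rho>4 41 = X \<and> \<rho>4 42 = 0 \<and> \<rho>4 43 = S \<and> \<mu>4 = \<mu>3"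
        have c4: "consts_ok \<rho>4" by (rule consts_ok_same[OF c3]) (use R4 in \<open>auto simp: same_def\<close>)
        have half: "0 \<le> a div 2 \<and> a div 2 \<le> a" if "0 \<le> a" for a :: int using that by arith
        have X: "0 \<le> X" "X < 2 * S * (2 * S)"
        proof -
          have "X \<le> 3 * (S * S)" using half[OF X0(1)] X0(2) unfolding X_def by linarith
          moreover have "2 * S * (2 * S) = 4 * (S * S)" by simp
          ultimately show "X < 2 * S * (2 * S)" using S_powers by linarith
          show "0 \<le> X" using half[OF X0(1)] unfolding X_def by linarith
        qed
        show "hoare w (sqrt_loop ;; ?end) ?t2 \<rho>4 \<mu>4 ?Q"
        proof (rule hoare_Seq[OF sqrt_loop_spec[OF c4 _ _ _ X(1,2)], where ?t2.0 = 5])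
          show "\<rho>4 41 = X" "\<rho>4 42 = 0" "\<rho>4 43 = S" using R4 by auto
          fix \<rho>5 :: rfile and \<mu>5
          assume R5: "same 42 \<rho>4 \<rho>5 \<and> \<rho>5 42 = \<lfloor>sqrt (real_of_int X)\<rfloor> \<and> \<mu>5 = \<mu>4"
          have c5: "consts_ok \<rho>5" by (rule consts_ok_same[OF c4]) (use R5 in \<open>auto simp: same_def\<close>)
          have r5: "\<rho>5 32 = snd (rho S k)" "\<rho>5 33 = 2 ^ k" "same 30 \<rho> \<rho>5" "\<rho>5 34 = int k" "\<rho>5 42 = r" "table_upto \<mu> (2 ^ Suc k) \<mu>5"
            using R5 R4 R3 r3 by (auto simp: same_def r_def)
          have "0 \<le> fst (rho S (Suc k)) \<and> fst (rho S (Suc k)) \<le> 2 * S" using rho_range[of "Suc k"] k by auto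
          then have r2: "0 \<le> r" "r \<le> 2 * S" unfolding rS by simp_all
          have "snd (rho S k) * S \<le> (2 * S) * S" using rr S_pos by (intro mult_right_mono) auto
          moreover have "0 \<le> snd (rho S k) * S" using rr S_pos by simp
          ultimately have mods: "snd (rho S k) * S mod 2 ^ w = snd (rho S k) * S" "2 * r mod 2 ^ w = 2 * r"
            using r2 word_bounds S_powers by (intro modW; linarith)+
          show "hoare w ?end 5 \<rho>5 \<mu>5 ?Q"
            by (rule hoare_Blk) (use c5 r5 mods in \<open>simp_all add: rS consts_ok_def del: rho.simps\<close>)
        qed simp
      qed simp
    qed simp
  next
    fix \<rho>' :: rfile and \<mu>' assume "?I \<kappa> \<rho>' \<mu>'"
    then show "same 30 \<rho> \<rho>' \<and> twiddles_at \<mu>' \<and> frame TB TBL \<mu> \<mu>'"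
      using table_upto_end[of \<mu> \<mu>'] by (simp add: N_def)
  qed (use R1 in \<open>auto simp: same_def\<close>)
next
  have "\<kappa> < N" by (simp add: N_def)
  then have "192 * (\<kappa> * \<kappa>) \<le> 192 * (N * \<kappa>)" by (intro mult_left_mono mult_right_mono) auto
  moreover have "16 * \<kappa> \<le> N * \<kappa>" using N16 by (intro mult_right_mono) auto
  moreover have "\<kappa> * (25 * N + 192 * \<kappa> + 28 + 5) = 25 * (N * \<kappa>) + 192 * (\<kappa> * \<kappa>) + 33 * \<kappa>" by (simp add: algebra_simps)
  ultimately show "6 + (\<kappa> * (25 * N + 192 * \<kappa> + 28 + 5) + 3) \<le> 300 * N * \<kappa>"
    using \<kappa> by linarith
qed

lemma init_out_spec:
  assumes c: "consts_ok \<rho>"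
  shows "hoare w init_out (9 * n + 3) \<rho> \<mu> (\<lambda>\<rho>' \<mu>'. same 30 \<rho> \<rho>' \<and> frame OUT ACC \<mu> \<mu>' \<and>
    (\<forall>l < n. \<mu>' (OUT + 2 * int l) = \<mu> (OUT + 2 * int l) \<and> \<mu>' (OUT + 2 * int l + 1) = 1))"
  unfolding init_out_def
proof (rule hoare_mono[OF hoare_For[where n = n and tb = 4 and
      I = "\<lambda>j \<rho>' \<mu>'. same 30 \<rho> \<rho>' \<and> frame OUT ACC \<mu> \<mu>' \<and>
        (\<forall>l < n. \<mu>' (OUT + 2 * int l) = \<mu> (OUT + 2 * int l) \<and> (l < j \<longrightarrow> \<mu>' (OUT + 2 * int l + 1) = 1))"]])
  show "\<rho> 0 = int n" using c by (simp add: consts_ok_def)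
  show "n < 2 ^ w" using layout by (intro nat_less_W) linarith
  fix j and \<rho>' :: rfile and \<mu>'
  assume j: "j < n" "\<rho>' 30 = int j" "\<rho>' 0 = int n"
    and I: "same 30 \<rho> \<rho>' \<and> frame OUT ACC \<mu> \<mu>' \<and>
        (\<forall>l < n. \<mu>' (OUT + 2 * int l) = \<mu> (OUT + 2 * int l) \<and> (l < j \<longrightarrow> \<mu>' (OUT + 2 * int l + 1) = 1))"
  have c': "consts_ok \<rho>'" by (rule consts_ok_same[OF c]) (use I in auto)
  have jz: "int j < int n" using j by simp
  have a: "2 * int j + OUT + 1 = OUT + 2 * int j + 1" by simp
  have mods: "(OUT + 2 * int j + 1) mod 2 ^ w = OUT + 2 * int j + 1" using layout jz by (intro modW; linarith)
  have "frame OUT ACC \<mu> (\<mu>'(OUT + 2 * int j + 1 := 1))" using I layout jz by (intro frame_upd) auto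
  moreover have "OUT + 2 * int l \<noteq> OUT + 2 * int j + 1" for l by presburger
  ultimately show "hoare w (Blk [Arith Add 31 30 30, Arith Add 31 31 16, Arith Add 31 31 5, Store 31 5]) 4 \<rho>' \<mu>'
    (\<lambda>\<rho>'' \<mu>''. \<rho>'' 30 = int j \<and> \<rho>'' 0 = int n \<and> same 30 \<rho> \<rho>'' \<and> frame OUT ACC \<mu> \<mu>'' \<and>
        (\<forall>l < n. \<mu>'' (OUT + 2 * int l) = \<mu> (OUT + 2 * int l) \<and> (l < Suc j \<longrightarrow> \<mu>'' (OUT + 2 * int l + 1) = 1)))"
    using c' I j(2,3) mods
    by (intro hoare_Blk) (simp_all add: consts_ok_def a less_Suc_eq)
qed (auto simp: same_def)

lemma setup_spec:
  assumes "\<rho> 0 = int n" "\<rho> 1 = int m" "\<rho> 3 = int E" "\<rho> 4 = 0"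
  shows "hoare w setup_code (27 * n + 300 * N * \<kappa> + 43) \<rho> \<mu> (\<lambda>\<rho>' \<mu>'. consts_ok \<rho>' \<and> \<rho>' 13 = 2 * int logn \<and>
    twiddles_at \<mu>' \<and> (\<forall>a < HX. \<mu>' a = \<mu> a) \<and>
    (\<forall>l < n. \<mu>' (OUT + 2 * int l) = \<mu> (OUT + 2 * int l) \<and> \<mu>' (OUT + 2 * int l + 1) = 1))"
  unfolding setup_code_def
proof (rule hoare_Seq[OF sizing_spec[OF assms], where ?t2.0 = "26 + (300 * N * \<kappa> + (9 * n + 3))"])
  let ?Q = "\<lambda>\<rho>' \<mu>'. consts_ok \<rho>' \<and> \<rho>' 13 = 2 * int logn \<and>
    twiddles_at \<mu>' \<and> (\<forall>a < HX. \<mu>' a = \<mu> a) \<and>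
    (\<forall>l < n. \<mu>' (OUT + 2 * int l) = \<mu> (OUT + 2 * int l) \<and> \<mu>' (OUT + 2 * int l + 1) = 1)"
  fix \<rho>1 :: rfile and \<mu>1
  assume R1: "\<mu>1 = \<mu> \<and> \<rho>1 0 = int n \<and> \<rho>1 1 = int m \<and> \<rho>1 3 = int E \<and>
    \<rho>1 4 = 0 \<and> \<rho>1 5 = 1 \<and> \<rho>1 6 = 2 \<and> \<rho>1 7 = int N \<and> \<rho>1 8 = int \<kappa> \<and> \<rho>1 24 = int n + int m \<and> \<rho>1 13 = int logn"
  show "hoare w (constants ;; twiddles ;; init_out) (26 + (300 * N * \<kappa> + (9 * n + 3))) \<rho>1 \<mu>1 ?Q"
  proof (rule hoare_Seq[OF constants_spec, where ?t2.0 = "300 * N * \<kappa> + (9 * n + 3)"])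
    fix \<rho>2 :: rfile and \<mu>2
    assume R2: "\<mu>2 = \<mu>1 \<and> consts_ok \<rho>2 \<and> \<rho>2 13 = 2 * int logn"
    then have c2: "consts_ok \<rho>2" by blast
    show "hoare w (twiddles ;; init_out) (300 * N * \<kappa> + (9 * n + 3)) \<rho>2 \<mu>2 ?Q"
    proof (rule hoare_Seq[OF twiddles_spec[OF c2], where ?t2.0 = "9 * n + 3"])
      fix \<rho>3 :: rfile and \<mu>3
      assume R3: "same 30 \<rho>2 \<rho>3 \<and> twiddles_at \<mu>3 \<and> frame TB TBL \<mu>2 \<mu>3"
      have c3: "consts_ok \<rho>3" by (rule consts_ok_same[OF c2]) (use R3 in auto)
      have fr: "\<mu>3 a = \<mu> a" if "a < TB" for a using R1 R2 R3 that by (auto simp: frame_def)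
      show "hoare w init_out (9 * n + 3) \<rho>3 \<mu>3 ?Q"
      proof (rule hoare_mono[OF init_out_spec[OF c3] order_refl])
        fix \<rho>4 :: rfile and \<mu>4
        assume R4: "same 30 \<rho>3 \<rho>4 \<and> frame OUT ACC \<mu>3 \<mu>4 \<and>
          (\<forall>l < n. \<mu>4 (OUT + 2 * int l) = \<mu>3 (OUT + 2 * int l) \<and> \<mu>4 (OUT + 2 * int l + 1) = 1)"
        have "consts_ok \<rho>4" by (rule consts_ok_same[OF c3]) (use R4 in auto)
        moreover have "\<rho>4 13 = 2 * int logn" using R2 R3 R4 by (simp add: same_def)
        moreover have "twiddles_at \<mu>4" by (rule twiddles_at_frame[of \<mu>3 OUT ACC]) (use R3 R4 layout in auto)
        moreover have "\<mu>4 a = \<mu> a" if "a < HX" for a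
          using R4 that layout fr[of a] by (auto simp: frame_def)
        moreover have "\<mu>3 (OUT + 2 * int l) = \<mu> (OUT + 2 * int l)" if "l < n" for l
          using that layout by (intro fr) auto
        ultimately show "?Q \<rho>4 \<mu>4" using R4 by simp
      qed
    qed simp
  qed (use R1 in auto)
qed simp

end

section \<open>Random hashing of the alphabet\<close>

text \<open>
  Overwriting the table entry of every input symbol with a fresh random number leaves independent
  uniform values at all symbols that occur, whatever the table contained before.
\<close>

primrec overwrite :: "nat \<Rightarrow> nat list \<Rightarrow> (nat \<Rightarrow> int) \<Rightarrow> (nat \<Rightarrow> int) pmf" where
  "overwrite K [] \<tau> = return_pmf \<tau>"
| "overwrite K (x # xs) \<tau> = bind_pmf (pmf_of_set {..<K}) (\<lambda>v. overwrite K xs (\<tau>(x := int v)))"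

lemma overwrite_other: "x \<notin> set xs \<Longrightarrow> \<tau>' \<in> set_pmf (overwrite K xs \<tau>) \<Longrightarrow> \<tau>' x = \<tau> x"
proof (induction xs arbitrary: \<tau>)
  case (Cons z xs)
  then obtain v where "\<tau>' \<in> set_pmf (overwrite K xs (\<tau>(z := int v)))" by auto
  from Cons.IH[OF _ this] Cons.prems show ?case by simp
qed simp

lemma nn_integral_pmf_const_bound:
  fixes c :: ennreal
  assumes "\<And>x. f x \<le> c"
  shows "(\<integral>\<^sup>+ x. f x \<partial>measure_pmf p) \<le> c"
proof -
  have "(\<integral>\<^sup>+ x. f x \<partial>measure_pmf p) \<le> (\<integral>\<^sup>+ x. c \<partial>measure_pmf p)" by (intro nn_integral_mono assms)
  then show ?thesis by (simp add: measure_pmf.emeasure_space_1)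
qed

lemma uniform_hits:
  assumes "0 < K"
  shows "(\<integral>\<^sup>+ v. of_bool (int v = c) \<partial>measure_pmf (pmf_of_set {..<K})) \<le> ennreal (1 / real K)"
proof -
  have ne: "{..<K} \<noteq> {}" using assms by auto
  have "(\<integral>\<^sup>+ v. of_bool (int v = c) \<partial>measure_pmf (pmf_of_set {..<K})) =
      (\<integral>\<^sup>+ v. indicator {v. int v = c} v \<partial>measure_pmf (pmf_of_set {..<K}))"
    by (intro nn_integral_cong) (auto simp: indicator_def)
  also have "\<dots> = emeasure (measure_pmf (pmf_of_set {..<K})) {v. int v = c}" by simp
  also have "\<dots> \<le> emeasure (measure_pmf (pmf_of_set {..<K})) {nat c}" by (intro emeasure_mono) auto
  also have "\<dots> \<le> ennreal (1 / real K)"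
    using ne by (simp add: emeasure_pmf_single pmf_of_set indicator_def ennreal_leI)
  finally show ?thesis .
qed

text \<open>The last draw for \<open>x\<close> or \<open>y\<close> decides: by then the value of the
  other symbol is fixed, and a uniform draw hits a given value with probability at most 1 /
  K.\<close>

lemma collision_probability:
  assumes K: "0 < K" and "x \<noteq> y" "x \<in> set xs"
  shows "(\<integral>\<^sup>+ \<tau>'. of_bool (\<tau>' x = \<tau>' y) \<partial>measure_pmf (overwrite K xs \<tau>)) \<le> ennreal (1 / real K)"
proof -
  have "(\<integral>\<^sup>+ \<tau>'. of_bool (\<tau>' x = \<tau>' y) \<partial>measure_pmf (overwrite K xs \<tau>)) \<le> ennreal (1 / real K)"
    if "x \<in> set xs \<or> y \<in> set xs" for \<tau>
    using that
  proof (induction xs arbitrary: \<tau>)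
    case (Cons z xs)
    show ?case
    proof (cases "x \<in> set xs \<or> y \<in> set xs")
      case True
      then show ?thesis using Cons.IH by (simp add: nn_integral_bind_pmf nn_integral_pmf_const_bound)
    next
      case False
      \<comment> \<open>The value of the symbol that is not drawn here; no later draw changes
        it.\<close>
      define c where "c = (if z = x then \<tau> y else \<tau> x)"
      have "(\<integral>\<^sup>+ \<tau>'. of_bool (\<tau>' x = \<tau>' y) \<partial>measure_pmf (overwrite K xs (\<tau>(z := int v)))) = of_bool (int v = c)" for v
      proof -
        have "(\<integral>\<^sup>+ \<tau>'. of_bool (\<tau>' x = \<tau>' y) \<partial>measure_pmf (overwrite K xs (\<tau>(z := int v)))) =
            (\<integral>\<^sup>+ \<tau>'. of_bool (int v = c) \<partial>measure_pmf (overwrite K xs (\<tau>(z := int v))))"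
        proof (intro nn_integral_cong_AE AE_pmfI)
          fix \<tau>' assume "\<tau>' \<in> set_pmf (overwrite K xs (\<tau>(z := int v)))"
          then have "\<tau>' x = (\<tau>(z := int v)) x" "\<tau>' y = (\<tau>(z := int v)) y"
            using overwrite_other False by blast+
          then show "of_bool (\<tau>' x = \<tau>' y) = (of_bool (int v = c) :: ennreal)"
            using Cons.prems False assms(2) by (auto simp: c_def)
        qed
        then show ?thesis by (simp add: measure_pmf.emeasure_space_1)
      qed
      then show ?thesis using uniform_hits[OF K] by (simp add: nn_integral_bind_pmf)
    qed
  qed simp
  then show ?thesis using assms by blast
qed

text \<open>Markov's inequality with the event written without division. Each mismatch collides with
  probability at most 1 / (2 * E), so at most card D / (2 * E) collisions are expected, half of the
  threshold card D / E. An empty \<open>D\<close> is treated separately because the proof divides by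
  its size.\<close>

lemma few_collisions:
  fixes D :: "nat set" and a b :: "nat \<Rightarrow> nat"
  assumes D: "finite D" "\<And>j. j \<in> D \<Longrightarrow> a j \<noteq> b j \<and> a j \<in> set xs" and E: "1 \<le> E"
  shows "(\<integral>\<^sup>+ \<tau>. of_bool (card D < E * card {j \<in> D. \<tau> (a j) = \<tau> (b j)}) \<partial>measure_pmf (overwrite (2 * E) xs \<tau>0)) \<le> ennreal (1 / 2)"
proof (cases "card D = 0")
  case True
  then show ?thesis using D by simp
next
  case False
  define d where "d = card D"
  have d: "0 < real d" using False by (simp add: d_def)
  let ?p = "overwrite (2 * E) xs \<tau>0"
  have "of_bool (card D < E * card {j \<in> D. \<tau> (a j) = \<tau> (b j)}) \<le>
      ennreal (real E / real d) * (\<Sum>j\<in>D. of_bool (\<tau> (a j) = \<tau> (b j)))" for \<tau> :: "nat \<Rightarrow> int"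
  proof -
    define c where "c = card {j \<in> D. \<tau> (a j) = \<tau> (b j)}"
    have "(\<Sum>j\<in>D. of_bool (\<tau> (a j) = \<tau> (b j))) = (of_nat c :: ennreal)"
      using D(1) by (simp add: c_def sum_of_bool_eq Int_def)
    then have "ennreal (real E / real d) * (\<Sum>j\<in>D. of_bool (\<tau> (a j) = \<tau> (b j))) = ennreal (real E / real d) * ennreal (real c)"
      by (simp only: ennreal_of_nat_eq_real_of_nat)
    also have "\<dots> = ennreal (real E / real d * real c)" by (rule ennreal_mult[symmetric]) auto
    finally have "ennreal (real E / real d) * (\<Sum>j\<in>D. of_bool (\<tau> (a j) = \<tau> (b j))) = ennreal (real E / real d * real c)" .
    moreover have "1 \<le> real E / real d * real c" if "d < E * c"
    proof -
      have "real d \<le> real (E * c)" using that by (simp only: of_nat_le_iff less_imp_le)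
      then show ?thesis using d by (simp add: field_simps)
    qed
    ultimately show ?thesis by (auto simp: c_def[symmetric] d_def[symmetric] ennreal_leI simp flip: ennreal_1)
  qed
  then have "(\<integral>\<^sup>+ \<tau>. of_bool (card D < E * card {j \<in> D. \<tau> (a j) = \<tau> (b j)}) \<partial>measure_pmf ?p) \<le>
      (\<integral>\<^sup>+ \<tau>. ennreal (real E / real d) * (\<Sum>j\<in>D. of_bool (\<tau> (a j) = \<tau> (b j))) \<partial>measure_pmf ?p)"
    by (intro nn_integral_mono)
  also have "\<dots> = ennreal (real E / real d) * (\<Sum>j\<in>D. \<integral>\<^sup>+ \<tau>. of_bool (\<tau> (a j) = \<tau> (b j)) \<partial>measure_pmf ?p)"
    by (simp add: nn_integral_cmult nn_integral_sum)
  also have "\<dots> \<le> ennreal (real E / real d) * (\<Sum>j\<in>D. ennreal (1 / real (2 * E)))"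
    using D E by (intro mult_left_mono sum_mono collision_probability) auto
  also have "\<dots> = ennreal (real E / real d) * ennreal (real d * (1 / real (2 * E)))"
    by (subst sum_ennreal) (simp_all add: d_def)
  also have "\<dots> = ennreal (real E / real d * (real d * (1 / real (2 * E))))"
    using d by (intro ennreal_mult[symmetric]) auto
  also have "real E / real d * (real d * (1 / real (2 * E))) = 1 / 2" using d E by (simp add: field_simps)
  finally show ?thesis .
qed

context machine
begin

definition fill :: com where
  "fill = For 31 24 (Blk [Load 32 31, Arith Add 32 32 21] ;; Blk [Rand 33 12] ;; Blk [Store 32 33])"

definition copy :: com where
  "copy = For 31 24 (Blk [Load 32 31, Arith Add 32 32 21, Load 33 32, Arith Add 34 15 31, Store 34 33])"

definition main :: com where
  "main = setup_code ;; For 30 13 (fill ;; copy ;; scan) ;; Blk [Arith Add 0 16 4]"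

definition table :: "memory \<Rightarrow> nat \<Rightarrow> int" where
  "table \<mu> x = \<mu> (TBL + int x)"

end

locale hashing = algorithm +
  fixes I :: "nat list"
  assumes length_I: "length I = n + m" and set_I: "set I \<subseteq> {1..\<sigma>}"
begin

definition input_at :: "memory \<Rightarrow> bool" where
  "input_at \<mu> \<longleftrightarrow> (\<forall>q < n + m. \<mu> (int q) = int (I ! q))"

lemma input_at_frame: "input_at \<mu> \<Longrightarrow> frame lo hi \<mu> \<mu>' \<Longrightarrow> HX \<le> lo \<Longrightarrow> input_at \<mu>'"
  using layout by (auto simp: input_at_def frame_def)

lemma symbol: "q < n + m \<Longrightarrow> I ! q \<in> set I \<and> 1 \<le> I ! q \<and> I ! q \<le> \<sigma>"
  using subsetD[OF set_I nth_mem[of q I]] length_I by auto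

definition filled :: "nat \<Rightarrow> memory \<Rightarrow> bool" where
  "filled k \<mu> \<longleftrightarrow> (\<forall>q < k. 0 \<le> table \<mu> (I ! q) \<and> table \<mu> (I ! q) < 2 * int E)"

text \<open>\<Psi> is an arbitrary functional of the final table, so the loop is captured as far as
  any expectation over the table is concerned. The potential before round \<open>k\<close> is the
  expectation over the draws still to come, those for \<open>drop k I\<close>; each round peels one
  draw off \<open>overwrite\<close>.\<close>

lemma fill_bounds:
  assumes c: "consts_ok \<rho>" and inp: "input_at \<mu>"
  shows "bounds w fill ((n + m) * 9 + 3) \<rho> \<mu> (\<integral>\<^sup>+ \<tau>. \<Psi> \<tau> \<partial>measure_pmf (overwrite (2 * E) I (table \<mu>)))
    (\<lambda>\<rho>' \<mu>'. if same 31 \<rho> \<rho>' \<and> frame TBL (TBL + int \<sigma> + 1) \<mu> \<mu>' \<and> filled (n + m) \<mu>' then \<Psi> (table \<mu>') else \<top>)"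
proof -
  define ok where "ok k \<rho>' \<mu>' \<longleftrightarrow> same 31 \<rho> \<rho>' \<and> frame TBL (TBL + int \<sigma> + 1) \<mu> \<mu>' \<and> filled k \<mu>'" for k \<rho>' \<mu>'
  define f where "f k \<rho>' \<mu>' = (if ok k \<rho>' \<mu>' then (\<integral>\<^sup>+ \<tau>. \<Psi> \<tau> \<partial>measure_pmf (overwrite (2 * E) (drop k I) (table \<mu>'))) else \<top>)" for k \<rho>' \<mu>'
  have "bounds w fill ((n + m) * (4 + 5) + 3) \<rho> \<mu> (\<integral>\<^sup>+ \<tau>. \<Psi> \<tau> \<partial>measure_pmf (overwrite (2 * E) I (table \<mu>))) (f (n + m))"
    unfolding fill_def
  proof (rule bounds_For[where r = 24 and \<rho> = \<rho> and n = "n + m" and i = 31])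
    show "\<rho> 24 = int (n + m)" using c by (simp add: consts_ok_def)
    show "n + m < 2 ^ w" using layout N16 by (intro nat_less_W) linarith
    show "f 0 \<rho> \<mu> \<le> (\<integral>\<^sup>+ \<tau>. \<Psi> \<tau> \<partial>measure_pmf (overwrite (2 * E) I (table \<mu>)))"
      by (simp add: f_def ok_def filled_def)
    show "f k (\<rho>'(31 := x, tmp := y)) \<mu>' \<le> f k \<rho>' \<mu>'" for k \<rho>' \<mu>' x y
      by (simp add: f_def ok_def)
    fix k and \<rho>' :: rfile and \<mu>'
    assume k: "k < n + m" "\<rho>' 31 = int k" "\<rho>' 24 = int (n + m)"
    let ?g = "\<lambda>\<rho>'' \<mu>''. if \<rho>'' 31 = int k \<and> \<rho>'' 24 = int (n + m) then f (Suc k) \<rho>'' \<mu>'' else \<top>"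
    show "bounds w (Blk [Load 32 31, Arith Add 32 32 21] ;; Blk [Rand 33 12] ;; Blk [Store 32 33]) 4 \<rho>' \<mu>' (f k \<rho>' \<mu>') ?g"
    proof (cases "ok k \<rho>' \<mu>'")
      case False
      then show ?thesis by (simp add: f_def bounds_infinity)
    next
      case True
      define x where "x = I ! k"
      have x: "1 \<le> x" "x \<le> \<sigma>" using symbol[OF k(1)] by (simp_all add: x_def)
      have c': "consts_ok \<rho>'" by (rule consts_ok_same[OF c same_mono[of 31]]) (use True in \<open>auto simp: ok_def\<close>)
      have inp': "\<mu>' (int k) = int x"
      proof -
        have "input_at \<mu>'"
          by (rule input_at_frame[OF inp, of TBL "TBL + int \<sigma> + 1"]) (use True layout in \<open>auto simp: ok_def\<close>)
        then show ?thesis using k(1) by (simp add: input_at_def x_def)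
      qed
      \<comment> \<open>\<open>h1\<close> is the value just before the draw, \<open>h2\<close> the
        value once register 33 holds the drawn number.\<close>
      define h1 where "h1 \<rho>1 \<mu>1 = (if same 32 \<rho>' \<rho>1 \<and> \<rho>1 32 = TBL + int x \<and> \<mu>1 = \<mu>' then f k \<rho>' \<mu>' else \<top>)" for \<rho>1 :: rfile and \<mu>1 :: memory
      define h2 where "h2 \<rho>2 \<mu>2 = (if same 32 \<rho>' \<rho>2 \<and> \<rho>2 32 = TBL + int x \<and> \<mu>2 = \<mu>' \<and> 0 \<le> \<rho>2 33 \<and> \<rho>2 33 < 2 * int E
          then (\<integral>\<^sup>+ \<tau>. \<Psi> \<tau> \<partial>measure_pmf (overwrite (2 * E) (drop (Suc k) I) ((table \<mu>')(x := \<rho>2 33)))) else \<top>)"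
        for \<rho>2 :: rfile and \<mu>2 :: memory
      have dr: "drop k I = x # drop (Suc k) I" using k length_I by (simp add: x_def Cons_nth_drop_Suc)
      show ?thesis
      proof (rule bounds_Seq[where ?t1.0 = 2 and ?t2.0 = 2 and h = h1])
        have "hoare w (Blk [Load 32 31, Arith Add 32 32 21]) 2 \<rho>' \<mu>' (\<lambda>\<rho>1 \<mu>1. same 32 \<rho>' \<rho>1 \<and> \<rho>1 32 = TBL + int x \<and> \<mu>1 = \<mu>')"
        proof (rule hoare_Blk)
          have "int k mod 2 ^ w = int k" using k layout N16 by (intro modW) auto
          then show "iexecs w [Load 32 31, Arith Add 32 32 21] \<rho>' \<mu>' (\<lambda>\<rho>1 \<mu>1. same 32 \<rho>' \<rho>1 \<and> \<rho>1 32 = TBL + int x \<and> \<mu>1 = \<mu>')"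
            using k c' inp' by (simp add: consts_ok_def)
        qed simp_all
        then show "bounds w (Blk [Load 32 31, Arith Add 32 32 21]) 2 \<rho>' \<mu>' (f k \<rho>' \<mu>') h1"
          by (rule bounds_hoare) (simp add: h1_def)
        fix \<rho>1 :: rfile and \<mu>1
        show "bounds w (Blk [Rand 33 12] ;; Blk [Store 32 33]) 2 \<rho>1 \<mu>1 (h1 \<rho>1 \<mu>1) ?g"
        proof (cases "same 32 \<rho>' \<rho>1 \<and> \<rho>1 32 = TBL + int x \<and> \<mu>1 = \<mu>'")
          case False
          then show ?thesis by (simp only: h1_def if_False bounds_infinity)
        next
          case R1: True
          have r12: "\<rho>1 12 = 2 * int E" using R1 c' by (simp add: consts_ok_def same_def)
          show ?thesis
          proof (rule bounds_Seq[where ?t1.0 = 1 and ?t2.0 = 1 and h = h2])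
            show "bounds w (Blk [Rand 33 12]) 1 \<rho>1 \<mu>1 (h1 \<rho>1 \<mu>1) h2"
            proof (rule bounds_Rand)
              have "nat (\<rho>1 12) = 2 * E" using r12 by simp
              moreover have "(\<integral>\<^sup>+ v. h2 (\<rho>1(33 := int v)) \<mu>1 \<partial>measure_pmf (pmf_of_set {..<2 * E})) =
                (\<integral>\<^sup>+ v. (\<integral>\<^sup>+ \<tau>. \<Psi> \<tau> \<partial>measure_pmf (overwrite (2 * E) (drop (Suc k) I) ((table \<mu>')(x := int v)))) \<partial>measure_pmf (pmf_of_set {..<2 * E}))"
              proof (intro nn_integral_cong_AE AE_pmfI)
                fix v assume "v \<in> set_pmf (pmf_of_set {..<2 * E})"
                moreover have "{..<2 * E} \<noteq> {}" using E by (simp add: lessThan_empty_iff bot_nat_def)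
                ultimately have "v < 2 * E" by (subst (asm) set_pmf_of_set) auto
                then show "h2 (\<rho>1(33 := int v)) \<mu>1 =
                    (\<integral>\<^sup>+ \<tau>. \<Psi> \<tau> \<partial>measure_pmf (overwrite (2 * E) (drop (Suc k) I) ((table \<mu>')(x := int v))))"
                  using R1 by (simp add: h2_def)
              qed
              moreover have "h1 \<rho>1 \<mu>1 = (\<integral>\<^sup>+ v. (\<integral>\<^sup>+ \<tau>. \<Psi> \<tau> \<partial>measure_pmf (overwrite (2 * E) (drop (Suc k) I) ((table \<mu>')(x := int v)))) \<partial>measure_pmf (pmf_of_set {..<2 * E}))"
                using R1 True by (simp add: h1_def f_def dr nn_integral_bind_pmf)
              ultimately show "(\<integral>\<^sup>+ v. h2 (\<rho>1(33 := int v)) \<mu>1 \<partial>measure_pmf (pmf_of_set {..<nat (\<rho>1 12)})) \<le> h1 \<rho>1 \<mu>1" by simp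
            qed (use r12 E in auto)
            fix \<rho>2 :: rfile and \<mu>2
            show "bounds w (Blk [Store 32 33]) 1 \<rho>2 \<mu>2 (h2 \<rho>2 \<mu>2) ?g"
            proof (cases "same 32 \<rho>' \<rho>2 \<and> \<rho>2 32 = TBL + int x \<and> \<mu>2 = \<mu>' \<and> 0 \<le> \<rho>2 33 \<and> \<rho>2 33 < 2 * int E")
              case False
              then show ?thesis by (simp only: h2_def if_False bounds_infinity)
            next
              case R2: True
              define \<mu>3 where "\<mu>3 = \<mu>'(TBL + int x := \<rho>2 33)"
              have t3: "table \<mu>3 = (table \<mu>')(x := \<rho>2 33)" by (rule ext) (simp add: table_def \<mu>3_def)
              have "hoare w (Blk [Store 32 33]) 1 \<rho>2 \<mu>2 (\<lambda>\<rho>3 \<mu>3'. \<rho>3 = \<rho>2 \<and> \<mu>3' = \<mu>3)"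
              proof (rule hoare_Blk)
                have "(TBL + int x) mod 2 ^ w = TBL + int x" using layout x by (intro modW) auto
                then show "iexecs w [Store 32 33] \<rho>2 \<mu>2 (\<lambda>\<rho>3 \<mu>3'. \<rho>3 = \<rho>2 \<and> \<mu>3' = \<mu>3)"
                  using R2 by (simp add: \<mu>3_def)
              qed simp_all
              then show ?thesis
              proof (rule bounds_hoare)
                have "same 31 \<rho> \<rho>2" using True R2 by (auto simp: ok_def same_def)
                moreover have "frame TBL (TBL + int \<sigma> + 1) \<mu> \<mu>3"
                  unfolding \<mu>3_def using True x by (intro frame_upd) (auto simp: ok_def)
                moreover have "filled (Suc k) \<mu>3"
                  using True R2 by (auto simp: ok_def filled_def t3 less_Suc_eq x_def)
                ultimately have "ok (Suc k) \<rho>2 \<mu>3" by (simp add: ok_def)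
                moreover have "\<rho>2 31 = int k" "\<rho>2 24 = int (n + m)" using R2 k by (simp_all add: same_def)
                ultimately have "?g \<rho>2 \<mu>3 = h2 \<rho>2 \<mu>2" using R2 by (simp add: f_def h2_def t3)
                then show "?g \<rho>3 \<mu>3' \<le> h2 \<rho>2 \<mu>2" if "\<rho>3 = \<rho>2 \<and> \<mu>3' = \<mu>3" for \<rho>3 \<mu>3'
                  using that by (simp only: order_refl)
              qed
            qed
          qed simp
        qed
      qed simp
    qed
  qed simp_all
  then show ?thesis
    by (rule bounds_mono) (auto simp: f_def ok_def length_I)
qed

lemma copy_spec:
  assumes c: "consts_ok \<rho>" and inp: "input_at \<mu>" and fl: "filled (n + m) \<mu>"
  shows "hoare w copy ((n + m) * 10 + 3) \<rho> \<mu> (\<lambda>\<rho>' \<mu>'. same 31 \<rho> \<rho>' \<and> frame HX OUT \<mu> \<mu>' \<and>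
    hashed \<mu>' (\<lambda>q. table \<mu> (I ! q)))"
  unfolding copy_def
proof (rule hoare_mono[OF hoare_For[where n = "n + m" and tb = 5 and
      I = "\<lambda>k \<rho>' \<mu>'. same 31 \<rho> \<rho>' \<and> frame HX OUT \<mu> \<mu>' \<and> (\<forall>q < k. \<mu>' (HX + int q) = table \<mu> (I ! q))"]])
  show "\<rho> 24 = int (n + m)" using c by (simp add: consts_ok_def)
  show "n + m < 2 ^ w" using layout N16 by (intro nat_less_W) linarith
  fix k and \<rho>' :: rfile and \<mu>'
  assume k: "k < n + m" "\<rho>' 31 = int k" "\<rho>' 24 = int (n + m)"
    and I: "same 31 \<rho> \<rho>' \<and> frame HX OUT \<mu> \<mu>' \<and> (\<forall>q < k. \<mu>' (HX + int q) = table \<mu> (I ! q))"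
  have c': "consts_ok \<rho>'" by (rule consts_ok_same[OF c same_mono[of 31]]) (use I in auto)
  define x where "x = I ! k"
  have x: "1 \<le> x" "x \<le> \<sigma>" using symbol[OF k(1)] by (simp_all add: x_def)
  have kz: "int k < int (n + m)" using k(1) by linarith
  have mods: "int k mod 2 ^ w = int k" "(int x + TBL) mod 2 ^ w = int x + TBL" "(HX + int k) mod 2 ^ w = HX + int k"
    using layout x kz by (intro modW; linarith)+
  have ld: "\<mu>' (int k) = int x" "\<mu>' (int x + TBL) = table \<mu> x"
    using I inp k layout by (auto simp: frame_def input_at_def x_def table_def add.commute)
  have fr: "frame HX OUT \<mu> (\<mu>'(HX + int k := z))" for z
    using I layout kz by (intro frame_upd) auto
  show "hoare w (Blk [Load 32 31, Arith Add 32 32 21, Load 33 32, Arith Add 34 15 31, Store 34 33]) 5 \<rho>' \<mu>'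
     (\<lambda>\<rho>'' \<mu>''. \<rho>'' 31 = int k \<and> \<rho>'' 24 = int (n + m) \<and> same 31 \<rho> \<rho>'' \<and> frame HX OUT \<mu> \<mu>'' \<and>
        (\<forall>q < Suc k. \<mu>'' (HX + int q) = table \<mu> (I ! q)))"
    by (rule hoare_Blk) (use c' k(2,3) mods ld fr I in \<open>auto simp: consts_ok_def less_Suc_eq x_def\<close>)
next
  fix \<rho>' :: rfile and \<mu>'
  assume "same 31 \<rho> \<rho>' \<and> frame HX OUT \<mu> \<mu>' \<and> (\<forall>q < n + m. \<mu>' (HX + int q) = table \<mu> (I ! q))"
  then show "same 31 \<rho> \<rho>' \<and> frame HX OUT \<mu> \<mu>' \<and> hashed \<mu>' (\<lambda>q. table \<mu> (I ! q))"
    using fl by (auto simp: hashed_def filled_def)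
qed (auto simp: same_def)

end

section \<open>Failure probability\<close>

context hashing
begin

definition differing :: "nat \<Rightarrow> nat set" where
  "differing l = {j. j < m \<and> I ! (l + j) \<noteq> I ! (n + j)}"

text \<open>The inequality v < (1 - 1 / E) * d for the true distance d, cleared of
  denominators.\<close>

definition bad :: "nat \<Rightarrow> int \<Rightarrow> bool" where
  "bad l v \<longleftrightarrow> int E * v < (int E - 1) * int (card (differing l))"

text \<open>The upper bound on the estimates is one-sidedness as an invariant; it supplies one half
  of the approximation with certainty.\<close>

definition state_ok :: "memory \<Rightarrow> bool" where
  "state_ok \<mu> \<longleftrightarrow> input_at \<mu> \<and> twiddles_at \<mu> \<and>
     (\<forall>l. l + m \<le> n \<longrightarrow> 0 \<le> \<mu> (OUT + 2 * int l) \<and> \<mu> (OUT + 2 * int l) \<le> int (card (differing l))) \<and>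
     (\<forall>l < n. \<mu> (OUT + 2 * int l + 1) = 1)"

text \<open>
  The potential of the main loop: a location whose current estimate is too small survives each of the
  \<open>k\<close> remaining rounds with probability at most \<open>1 / 2\<close>.
\<close>

definition risk :: "nat \<Rightarrow> memory \<Rightarrow> ennreal" where
  "risk k \<mu> = (\<Sum>l\<le>n - m. of_bool (bad l (\<mu> (OUT + 2 * int l))) * ennreal ((1 / 2) ^ k))"

definition hash_mismatches :: "(nat \<Rightarrow> int) \<Rightarrow> nat \<Rightarrow> nat" where
  "hash_mismatches \<tau> l = mismatches (\<lambda>q. \<tau> (I ! q)) l"

lemma finite_differing [simp]: "finite (differing l)"
  by (simp add: differing_def)

lemma card_differing_le: "card (differing l) \<le> m"
  using card_mono[of "{..<m}" "differing l"] by (auto simp: differing_def)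

text \<open>Equal symbols have equal hash values, so the only discrepancy consists of mismatches
  that collide.\<close>

lemma hash_mismatches_eq:
  "hash_mismatches \<tau> l + card {j \<in> differing l. \<tau> (I ! (l + j)) = \<tau> (I ! (n + j))} = card (differing l)"
proof -
  have "hash_mismatches \<tau> l = card (differing l - {j \<in> differing l. \<tau> (I ! (l + j)) = \<tau> (I ! (n + j))})"
    unfolding hash_mismatches_def mismatches_def by (rule arg_cong[where f = card]) (auto simp: differing_def)
  also have "\<dots> = card (differing l) - card {j \<in> differing l. \<tau> (I ! (l + j)) = \<tau> (I ! (n + j))}"
    by (rule card_Diff_subset) auto
  finally show ?thesis using card_mono[of "differing l" "{j \<in> differing l. \<tau> (I ! (l + j)) = \<tau> (I ! (n + j))}"] by simp
qed

text \<open>For c collisions, E * (d - c) < (E - 1) * d is equivalent to d < E * c, the event of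
  \<open>few_collisions\<close>.\<close>

lemma bad_hash:
  "bad l (int (hash_mismatches \<tau> l)) \<longleftrightarrow>
     card (differing l) < E * card {j \<in> differing l. \<tau> (I ! (l + j)) = \<tau> (I ! (n + j))}"
proof -
  define c where "c = card {j \<in> differing l. \<tau> (I ! (l + j)) = \<tau> (I ! (n + j))}"
  have hm: "int (hash_mismatches \<tau> l) = int (card (differing l)) - int c"
    using hash_mismatches_eq[of \<tau> l] by (simp add: c_def)
  have "bad l (int (hash_mismatches \<tau> l)) \<longleftrightarrow> int (card (differing l)) < int E * int c"
    unfolding bad_def hm by (simp add: algebra_simps)
  then show ?thesis by (simp add: c_def flip: of_nat_mult)
qed

lemma bad_probability:
  assumes "l + m \<le> n"
  shows "(\<integral>\<^sup>+ \<tau>. of_bool (bad l (int (hash_mismatches \<tau> l))) \<partial>measure_pmf (overwrite (2 * E) I \<tau>0)) \<le> ennreal (1 / 2)"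
  unfolding bad_hash
  by (rule few_collisions) (use assms E symbol in \<open>auto simp: differing_def\<close>)

text \<open>Being bad is downward closed in the estimate, so a location stays bad only if every
  single round is bad for it.\<close>

lemma bad_max: "bad l (max x y) \<longleftrightarrow> bad l x \<and> bad l y"
  using mult_left_mono[of x y "int E"] mult_left_mono[of y x "int E"] by (auto simp: bad_def max_def)

text \<open>The potential after a round, expressed through the table drawn in it; the memory
  argument is still the one before the round.\<close>

definition surviving :: "nat \<Rightarrow> memory \<Rightarrow> (nat \<Rightarrow> int) \<Rightarrow> ennreal" where
  "surviving k \<mu> \<tau> = (\<Sum>l\<le>n - m. of_bool (bad l (\<mu> (OUT + 2 * int l)) \<and> bad l (int (hash_mismatches \<tau> l))) * ennreal ((1 / 2) ^ k))"

text \<open>The estimates are fixed before the table is drawn, so every term is at most halved in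
  expectation, which is the factor that \<open>risk\<close> anticipates for one round.\<close>

lemma surviving_bound:
  "(\<integral>\<^sup>+ \<tau>. surviving k \<mu> \<tau> \<partial>measure_pmf (overwrite (2 * E) I \<tau>0)) \<le> risk (Suc k) \<mu>"
proof -
  let ?p = "overwrite (2 * E) I \<tau>0"
  have "(\<integral>\<^sup>+ \<tau>. surviving k \<mu> \<tau> \<partial>measure_pmf ?p) =
    (\<Sum>l\<le>n - m. of_bool (bad l (\<mu> (OUT + 2 * int l))) * ennreal ((1 / 2) ^ k) *
      (\<integral>\<^sup>+ \<tau>. of_bool (bad l (int (hash_mismatches \<tau> l))) \<partial>measure_pmf ?p))"
    unfolding surviving_def of_bool_conj
    by (simp add: nn_integral_sum nn_integral_cmult nn_integral_multc mult_ac)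
  also have "\<dots> \<le> (\<Sum>l\<le>n - m. of_bool (bad l (\<mu> (OUT + 2 * int l))) * ennreal ((1 / 2) ^ k) * ennreal (1 / 2))"
    using m by (intro sum_mono mult_left_mono bad_probability) auto
  also have "\<dots> = risk (Suc k) \<mu>"
    unfolding risk_def by (intro sum.cong refl) (simp add: ennreal_mult[symmetric] mult.assoc del: ennreal_half)
  finally show ?thesis .
qed

definition rep_time :: nat where
  "rep_time = ((n + m) * 9 + 3) + (((n + m) * 10 + 3) + (n div m * (220 * E * N * \<kappa> + 5) + 3))"

text \<open>Only \<open>fill\<close> is random. Given its table, \<open>copy\<close> and
  \<open>scan\<close> determine the new estimates, and \<open>risk\<close> of the new memory equals
  \<open>surviving\<close> for that table.\<close>

lemma rep_bounds:
  assumes c: "consts_ok \<rho>" and ok: "state_ok \<mu>"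
  shows "bounds w (fill ;; copy ;; scan) rep_time \<rho> \<mu> (risk (Suc k) \<mu>)
    (\<lambda>\<rho>' \<mu>'. if same 31 \<rho> \<rho>' \<and> state_ok \<mu>' then risk k \<mu>' else \<top>)"
proof -
  have inp: "input_at \<mu>" and tws: "twiddles_at \<mu>" using ok by (simp_all add: state_ok_def)
  let ?g = "\<lambda>\<rho>' \<mu>'. if same 31 \<rho> \<rho>' \<and> state_ok \<mu>' then risk k \<mu>' else \<top>"
  have "bounds w (fill ;; copy ;; scan) rep_time \<rho> \<mu>
      (\<integral>\<^sup>+ \<tau>. surviving k \<mu> \<tau> \<partial>measure_pmf (overwrite (2 * E) I (table \<mu>))) ?g"
  proof (rule bounds_Seq[OF fill_bounds[OF c inp]])
    fix \<rho>1 :: rfile and \<mu>1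
    show "bounds w (copy ;; scan) (((n + m) * 10 + 3) + (n div m * (220 * E * N * \<kappa> + 5) + 3)) \<rho>1 \<mu>1
      (if same 31 \<rho> \<rho>1 \<and> frame TBL (TBL + int \<sigma> + 1) \<mu> \<mu>1 \<and> filled (n + m) \<mu>1 then surviving k \<mu> (table \<mu>1) else \<top>) ?g"
    proof (cases "same 31 \<rho> \<rho>1 \<and> frame TBL (TBL + int \<sigma> + 1) \<mu> \<mu>1 \<and> filled (n + m) \<mu>1")
      case False
      then show ?thesis by (simp only: if_False bounds_infinity)
    next
      case R1: True
      define hx where "hx q = table \<mu>1 (I ! q)" for q
      have c1: "consts_ok \<rho>1" by (rule consts_ok_same[OF c same_mono[of 31]]) (use R1 in auto)
      have inp1: "input_at \<mu>1" by (rule input_at_frame[OF inp, of TBL "TBL + int \<sigma> + 1"]) (use R1 layout in auto)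
      have fr1: "\<mu>1 a = \<mu> a" if "a < TBL" for a using R1 that by (auto simp: frame_def)
      have tws1: "twiddles_at \<mu>1" using tws fr1 layout by (auto simp: twiddles_at_def)
      have "hoare w (copy ;; scan) (((n + m) * 10 + 3) + (n div m * (220 * E * N * \<kappa> + 5) + 3)) \<rho>1 \<mu>1
          (\<lambda>\<rho>3 \<mu>3. same 31 \<rho> \<rho>3 \<and> state_ok \<mu>3 \<and>
            (\<forall>l\<le>n - m. \<mu>3 (OUT + 2 * int l) = max (\<mu> (OUT + 2 * int l)) (int (hash_mismatches (table \<mu>1) l))))"
      proof (rule hoare_Seq[OF copy_spec[OF c1 inp1] _ order_refl])
        show "filled (n + m) \<mu>1" using R1 by blast
        fix \<rho>2 :: rfile and \<mu>2
        assume R2: "same 31 \<rho>1 \<rho>2 \<and> frame HX OUT \<mu>1 \<mu>2 \<and> hashed \<mu>2 (\<lambda>q. table \<mu>1 (I ! q))"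
        have c2: "consts_ok \<rho>2" by (rule consts_ok_same[OF c1 same_mono[of 31]]) (use R2 in auto)
        have fr2: "\<mu>2 a = \<mu>1 a" if "a < HX \<or> OUT \<le> a" for a using R2 that by (auto simp: frame_def)
        have tws2: "twiddles_at \<mu>2" by (rule twiddles_at_frame[OF tws1, of HX OUT]) (use R2 layout in auto)
        have out2: "\<mu>2 (OUT + 2 * int l) = \<mu> (OUT + 2 * int l)" "\<mu>2 (OUT + 2 * int l + 1) = \<mu> (OUT + 2 * int l + 1)" if "l < n" for l
          using fr1 fr2 layout that by auto
        have rng: "out_range \<mu>2"
          unfolding out_range_def
        proof (intro allI impI)
          fix l assume l: "l + m \<le> n"
          have "0 \<le> \<mu> (OUT + 2 * int l)" "\<mu> (OUT + 2 * int l) \<le> int (card (differing l))"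
            using ok l by (simp_all add: state_ok_def)
          then show "0 \<le> \<mu>2 (OUT + 2 * int l) \<and> \<mu>2 (OUT + 2 * int l) \<le> int m"
            using out2(1)[of l] card_differing_le[of l] l m(1) by auto
        qed
        show "hoare w scan (n div m * (220 * E * N * \<kappa> + 5) + 3) \<rho>2 \<mu>2
          (\<lambda>\<rho>3 \<mu>3. same 31 \<rho> \<rho>3 \<and> state_ok \<mu>3 \<and>
            (\<forall>l\<le>n - m. \<mu>3 (OUT + 2 * int l) = max (\<mu> (OUT + 2 * int l)) (int (hash_mismatches (table \<mu>1) l))))"
        proof (rule hoare_mono[OF scan_spec[OF c2 _ tws2 rng] order_refl])
          show "hashed \<mu>2 hx" using R2 by (simp add: hx_def[abs_def])
          fix \<rho>3 :: rfile and \<mu>3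
          assume R3: "same 31 \<rho>2 \<rho>3 \<and> scanned 0 n hx \<mu>2 \<mu>3"
          have fr3: "\<mu>3 a = \<mu>2 a" if "a < OUT \<or> TB \<le> a" for a using R3 that by (auto simp: scanned_def frame_def)
          have new: "\<mu>3 (OUT + 2 * int l) = max (\<mu> (OUT + 2 * int l)) (int (hash_mismatches (table \<mu>1) l))" if "l + m \<le> n" for l
            using R3 that m(1) out2(1)[of l] by (auto simp: scanned_def hash_mismatches_def hx_def[abs_def])
          have "input_at \<mu>3" using inp1 fr2 fr3 layout by (auto simp: input_at_def)
          moreover have "twiddles_at \<mu>3" using tws2 fr3 layout by (auto simp: twiddles_at_def)
          moreover have "0 \<le> \<mu>3 (OUT + 2 * int l) \<and> \<mu>3 (OUT + 2 * int l) \<le> int (card (differing l))" if "l + m \<le> n" for l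
            unfolding new[OF that] using ok that hash_mismatches_eq[of "table \<mu>1" l] by (simp add: state_ok_def)
          moreover have "\<mu>3 (OUT + 2 * int l + 1) = 1" if "l < n" for l
            using R3 out2(2)[OF that] ok that by (simp add: scanned_def state_ok_def)
          ultimately have "state_ok \<mu>3" by (simp add: state_ok_def)
          moreover have "same 31 \<rho> \<rho>3" using R1 R2 R3 by (auto simp: same_def)
          ultimately show "same 31 \<rho> \<rho>3 \<and> state_ok \<mu>3 \<and>
            (\<forall>l\<le>n - m. \<mu>3 (OUT + 2 * int l) = max (\<mu> (OUT + 2 * int l)) (int (hash_mismatches (table \<mu>1) l)))"
            using new m by auto
        qed
      qed
      then have "bounds w (copy ;; scan) (((n + m) * 10 + 3) + (n div m * (220 * E * N * \<kappa> + 5) + 3)) \<rho>1 \<mu>1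
          (surviving k \<mu> (table \<mu>1)) ?g"
      proof (rule bounds_hoare)
        fix \<rho>3 :: rfile and \<mu>3
        assume R3: "same 31 \<rho> \<rho>3 \<and> state_ok \<mu>3 \<and>
            (\<forall>l\<le>n - m. \<mu>3 (OUT + 2 * int l) = max (\<mu> (OUT + 2 * int l)) (int (hash_mismatches (table \<mu>1) l)))"
        then have "risk k \<mu>3 = surviving k \<mu> (table \<mu>1)"
          by (simp add: risk_def surviving_def bad_max)
        then show "?g \<rho>3 \<mu>3 \<le> surviving k \<mu> (table \<mu>1)" using R3 by simp
      qed
      then show ?thesis unfolding if_P[OF R1] .
    qed
  qed (simp add: rep_time_def)
  then show ?thesis
    by (rule bounds_mono[OF _ order_refl surviving_bound order_refl])
qed

definition main_time :: nat where
  "main_time = (27 * n + 300 * N * \<kappa> + 43) + ((2 * logn * (rep_time + 5) + 3) + 1)"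

lemma main_bounds:
  assumes \<rho>: "\<rho> 0 = int n" "\<rho> 1 = int m" "\<rho> 3 = int E" "\<rho> 4 = 0"
    and inp: "input_at \<mu>" and out: "\<And>l. l < n \<Longrightarrow> \<mu> (OUT + 2 * int l) = 0"
  shows "bounds w main main_time \<rho> \<mu> (ennreal (1 / real n))
    (\<lambda>\<rho>' \<mu>'. if \<rho>' 0 = OUT \<and> state_ok \<mu>' then risk 0 \<mu>' else \<top>)"
  unfolding main_def
proof (rule bounds_Seq)
  let ?g = "\<lambda>\<rho>' \<mu>'. if \<rho>' 0 = OUT \<and> state_ok \<mu>' then risk 0 \<mu>' else \<top>"
  let ?v = "ennreal (1 / real n)"
  define h where "h \<rho>1 \<mu>1 = (if consts_ok \<rho>1 \<and> \<rho>1 13 = 2 * int logn \<and> state_ok \<mu>1 then ?v else \<top>)" for \<rho>1 :: rfile and \<mu>1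
  show "bounds w setup_code (27 * n + 300 * N * \<kappa> + 43) \<rho> \<mu> ?v h"
  proof (rule bounds_hoare[OF setup_spec[OF \<rho>]])
    fix \<rho>1 :: rfile and \<mu>1
    assume R1: "consts_ok \<rho>1 \<and> \<rho>1 13 = 2 * int logn \<and> twiddles_at \<mu>1 \<and> (\<forall>a < HX. \<mu>1 a = \<mu> a) \<and>
      (\<forall>l < n. \<mu>1 (OUT + 2 * int l) = \<mu> (OUT + 2 * int l) \<and> \<mu>1 (OUT + 2 * int l + 1) = 1)"
    have "input_at \<mu>1" using inp R1 layout by (auto simp: input_at_def)
    then have "state_ok \<mu>1" using R1 out m by (auto simp: state_ok_def)
    then show "h \<rho>1 \<mu>1 \<le> ?v" using R1 by (simp add: h_def)
  qed
  fix \<rho>1 :: rfile and \<mu>1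
  show "bounds w (For 30 13 (fill ;; copy ;; scan) ;; Blk [Arith Add 0 16 4]) ((2 * logn * (rep_time + 5) + 3) + 1) \<rho>1 \<mu>1 (h \<rho>1 \<mu>1) ?g"
  proof (cases "consts_ok \<rho>1 \<and> \<rho>1 13 = 2 * int logn \<and> state_ok \<mu>1")
    case False
    then show ?thesis by (simp only: h_def if_False bounds_infinity)
  next
    case R1: True
    define f where "f r \<rho>' \<mu>' = (if consts_ok \<rho>' \<and> state_ok \<mu>' then risk (2 * logn - r) \<mu>' else \<top>)" for r and \<rho>' :: rfile and \<mu>'
    \<comment> \<open>Union bound: at most n locations, each of weight (1 / 2) ^ (2 * logn) \<le> 1
      / n ^ 2.\<close>
    have "risk (2 * logn) \<mu>1 \<le> ?v"
    proof -
      have "risk (2 * logn) \<mu>1 \<le> (\<Sum>l\<le>n - m. 1 * ennreal ((1 / 2) ^ (2 * logn)))"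
        unfolding risk_def by (intro sum_mono mult_right_mono) auto
      also have "\<dots> = ennreal (\<Sum>l\<le>n - m. (1 / 2) ^ (2 * logn))" by (subst sum_ennreal[symmetric]) simp_all
      also have "\<dots> \<le> ennreal (1 / real n)"
      proof (rule ennreal_leI)
        have "real n \<le> real (2 ^ logn)" using logn_bounds(1) by (simp only: of_nat_le_iff)
        then have n2: "real n \<le> 2 ^ logn" by simp
        have n0: "0 < real n" using m by simp
        have "(\<Sum>l\<le>n - m. (1 / 2) ^ (2 * logn)) = real (n - m + 1) * (1 / (2 ^ logn * 2 ^ logn))"
          by (simp add: power_one_over power_mult mult.commute[of 2] power2_eq_square)
        also have "\<dots> \<le> real n * (1 / (real n * real n))"
          using n2 n0 m by (intro mult_mono divide_left_mono) auto
        also have "\<dots> = 1 / real n" using n0 by simp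
        finally show "(\<Sum>l\<le>n - m. (1 / 2) ^ (2 * logn)) \<le> 1 / real n" .
      qed
      finally show ?thesis .
    qed
    then have f0: "f 0 \<rho>1 \<mu>1 \<le> ?v" using R1 by (simp add: f_def)
    have lW: "2 * logn < 2 ^ w"
    proof (rule nat_less_W)
      have "logn \<le> n" unfolding logn_least by (rule Least_le) (simp add: less_imp_le)
      then show "int (2 * logn) < W" using layout m N16 by simp
    qed
    have "bounds w (For 30 13 (fill ;; copy ;; scan)) (2 * logn * (rep_time + 5) + 3) \<rho>1 \<mu>1 ?v (f (2 * logn))"
    proof (rule bounds_For[where r = 13 and \<rho> = \<rho>1 and n = "2 * logn" and i = 30])
      show "\<rho>1 13 = int (2 * logn)" using R1 by simp
      show "f k (\<rho>'(30 := x, tmp := y)) \<mu>' \<le> f k \<rho>' \<mu>'" for k \<rho>' \<mu>' x y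
        by (simp add: f_def consts_ok_def)
      fix r and \<rho>' :: rfile and \<mu>'
      assume r: "r < 2 * logn" "\<rho>' 30 = int r" "\<rho>' 13 = int (2 * logn)"
      show "bounds w (fill ;; copy ;; scan) rep_time \<rho>' \<mu>' (f r \<rho>' \<mu>')
        (\<lambda>\<rho>'' \<mu>''. if \<rho>'' 30 = int r \<and> \<rho>'' 13 = int (2 * logn) then f (Suc r) \<rho>'' \<mu>'' else \<top>)"
      proof (cases "consts_ok \<rho>' \<and> state_ok \<mu>'")
        case False
        then show ?thesis by (simp only: f_def if_False bounds_infinity)
      next
        case True
        have e: "2 * logn - r = Suc (2 * logn - Suc r)" using r by simp
        have "f r \<rho>' \<mu>' = risk (Suc (2 * logn - Suc r)) \<mu>'" using True by (simp add: f_def e)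
        then show ?thesis
        proof (elim ssubst, intro bounds_mono[OF rep_bounds order_refl order_refl])
          fix \<rho>'' :: rfile and \<mu>''
          show "(if \<rho>'' 30 = int r \<and> \<rho>'' 13 = int (2 * logn) then f (Suc r) \<rho>'' \<mu>'' else \<top>) \<le>
            (if same 31 \<rho>' \<rho>'' \<and> state_ok \<mu>'' then risk (2 * logn - Suc r) \<mu>'' else \<top>)"
          proof (cases "same 31 \<rho>' \<rho>'' \<and> state_ok \<mu>''")
            case s: True
            have "consts_ok \<rho>''" by (rule consts_ok_same[OF _ same_mono[of 31]]) (use True s in auto)
            then show ?thesis using s r by (simp add: f_def same_def)
          next
            case False
            then show ?thesis by (simp only: if_False top_greatest)
          qed
        qed (use True in auto)
      qed
    qed (use f0 lW in auto)
    then have "bounds w (For 30 13 (fill ;; copy ;; scan) ;; Blk [Arith Add 0 16 4]) ((2 * logn * (rep_time + 5) + 3) + 1) \<rho>1 \<mu>1 ?v ?g"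
    proof (rule bounds_Seq[OF _ _ order_refl])
      fix \<rho>2 :: rfile and \<mu>2
      show "bounds w (Blk [Arith Add 0 16 4]) 1 \<rho>2 \<mu>2 (f (2 * logn) \<rho>2 \<mu>2) ?g"
      proof (cases "consts_ok \<rho>2 \<and> state_ok \<mu>2")
        case False
        then show ?thesis by (simp only: f_def if_False bounds_infinity)
      next
        case True
        have "hoare w (Blk [Arith Add 0 16 4]) 1 \<rho>2 \<mu>2 (\<lambda>\<rho>3 \<mu>3. \<rho>3 0 = OUT \<and> \<mu>3 = \<mu>2)"
          by (rule hoare_Blk) (use True in \<open>simp_all add: consts_ok_def\<close>)
        then show ?thesis by (rule bounds_hoare) (use True in \<open>simp add: f_def\<close>)
      qed
    qed
    then show ?thesis unfolding h_def if_P[OF R1] .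
  qed
qed (simp add: main_time_def)

end

lemma run_halted: "halted prog c \<Longrightarrow> run w prog T c = return_pmf c"
  by (induction T) (simp_all add: step_def bind_return_pmf)

context hashing
begin

text \<open>E \<ge> 1 / \<epsilon> turns the guarantee 1 - 1 / E into 1 - \<epsilon>; the upper
  inequality comes from one-sidedness. All values and addresses involved are in range, so words and
  integers coincide.\<close>

lemma no_bad_correct:
  fixes T P :: "nat list" and \<epsilon> :: real
  assumes I: "I = T @ P" "length T = n" "length P = m" and \<epsilon>: "0 < \<epsilon>" "1 / \<epsilon> \<le> real E"
    and rep: "represents w c \<rho> \<mu>" and \<rho>: "\<rho> 0 = OUT" and ok: "state_ok \<mu>"
    and good: "\<And>l. l \<le> n - m \<Longrightarrow> \<not> bad l (\<mu> (OUT + 2 * int l))"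
  shows "correct_output \<epsilon> T P c"
proof -
  have OUT0: "0 \<le> OUT" "OUT < W" using layout by simp_all
  define a where "a l = nat OUT + 2 * l" for l
  have r0: "regs c 0 = nat OUT"
    using rep \<rho> OUT0 by (simp add: represents_def enc_def W_def)
  have mem: "mem c (nat x) = nat (\<mu> x)" if "0 \<le> x" "x < W" "0 \<le> \<mu> x" "\<mu> x < W" for x
  proof -
    have "nat x < 2 ^ w" using that(1,2) by (simp add: W_def nat_less_iff)
    then have "mem c (nat x) = enc w (\<mu> (int (nat x)))" using rep by (simp only: represents_def)
    then show ?thesis using that by (simp add: enc_def W_def)
  qed
  have val: "out_den c i = 1 \<and> out_num c i = nat (\<mu> (OUT + 2 * int (i - 1)))" if i: "1 \<le> i" "i \<le> n - m + 1" for i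
  proof -
    define l where "l = i - 1"
    have l: "l + m \<le> n" "l < n" using i m by (auto simp: l_def)
    have lz: "int l < int n" using l by simp
    have in_range: "0 \<le> OUT + 2 * int l" "OUT + 2 * int l + 1 < W" using layout lz by linarith+
    have o: "0 \<le> \<mu> (OUT + 2 * int l)" "\<mu> (OUT + 2 * int l) \<le> int m"
      using ok l card_differing_le[of l] by (auto simp: state_ok_def intro: order_trans)
    have one: "\<mu> (OUT + 2 * int l + 1) = 1" using ok l by (simp add: state_ok_def)
    have mW: "int m < W" "1 < W" using layout two_m N16 by linarith+
    have "nat OUT + 2 * l = nat (OUT + 2 * int l)" "nat OUT + 2 * l + 1 = nat (OUT + 2 * int l + 1)"
      using OUT0 by (simp_all add: nat_add_distrib)
    then show ?thesis
      unfolding out_den_def out_num_def r0 l_def[symmetric]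
      using mem[of "OUT + 2 * int l"] mem[of "OUT + 2 * int l + 1"] in_range o one mW by simp
  qed
  have ham: "hamming (window T m i) P = card (differing (i - 1))" if i: "1 \<le> i" "i \<le> n - m + 1" for i
    unfolding hamming_def differing_def
  proof (rule arg_cong[where f = card], rule Collect_cong)
    fix j
    have len: "length (window T m i) = m" using I i m by (simp add: window_def)
    have "i - 1 + j < n" if "j < m" using that i m by linarith
    then show "j < length (window T m i) \<and> window T m i ! j \<noteq> P ! j \<longleftrightarrow> j < m \<and> I ! (i - 1 + j) \<noteq> I ! (n + j)"
      unfolding len using I m by (auto simp: window_def nth_append)
  qed
  have E0: "0 < real E" using E by simp
  have eE: "1 \<le> \<epsilon> * real E" using \<epsilon> by (simp add: field_simps)
  show ?thesis
    unfolding correct_output_def approximates_hamming_def I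
  proof (intro conjI ballI)
    fix i assume "i \<in> {1..n - m + 1}"
    then have i: "1 \<le> i" "i \<le> n - m + 1" by auto
    show "0 < out_den c i" using val[OF i] by simp
    define l where "l = i - 1"
    define d where "d = card (differing l)"
    define v where "v = \<mu> (OUT + 2 * int l)"
    have l: "l \<le> n - m" "l + m \<le> n" using i m by (auto simp: l_def)
    have v: "0 \<le> v" "v \<le> int d" using ok l by (simp_all add: state_ok_def v_def d_def)
    have "(int E - 1) * int d \<le> int E * v" using good[OF l(1)] by (simp add: bad_def v_def d_def)
    then have "real_of_int ((int E - 1) * int d) \<le> real_of_int (int E * v)" by (simp only: of_int_le_iff)
    then have "(real E - 1) * real d \<le> real E * of_int v" by simp
    moreover have "(1 - \<epsilon>) * real E * real d \<le> (real E - 1) * real d"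
      using eE by (intro mult_right_mono) (auto simp: algebra_simps)
    ultimately have "real E * ((1 - \<epsilon>) * real d) \<le> real E * of_int v" by (simp add: mult_ac)
    then have lo: "(1 - \<epsilon>) * real d \<le> of_int v" using E0 by (simp only: mult_le_cancel_left_pos)
    have "of_int v \<le> real d" using v by linarith
    also have "\<dots> \<le> (1 + \<epsilon>) * real d" using \<epsilon> by (simp add: distrib_right)
    finally have hi: "of_int v \<le> (1 + \<epsilon>) * real d" .
    have out: "real (out_num c i) / real (out_den c i) = of_int v"
      using val[OF i] v by (simp add: v_def l_def)
    show "(1 - \<epsilon>) * real (hamming (window T m i) P) \<le> real (out_num c i) / real (out_den c i)"
      "real (out_num c i) / real (out_den c i) \<le> (1 + \<epsilon>) * real (hamming (window T m i) P)"
      unfolding out ham[OF i] using lo hi by (simp_all add: d_def l_def)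
  qed
qed

text \<open>Configurations that have not halted are given failure \<infinity>. A finite expectation
  excludes them from the support, so the program halts with certainty and not just with high
  probability; on the support the expectation is then the probability of an incorrect
  output.\<close>

theorem main_correct:
  fixes T P :: "nat list" and \<epsilon> :: real
  assumes I: "I = T @ P" "length T = n" "length P = m" and \<epsilon>: "0 < \<epsilon>" "E = nat \<lceil>1 / \<epsilon>\<rceil>"
  defines "D \<equiv> run w (compile 0 main) main_time (initial_config \<epsilon> \<sigma> T P)"
  shows "\<forall>c \<in> set_pmf D. halted (compile 0 main) c"
    "measure_pmf.prob D {c. correct_output \<epsilon> T P c} \<ge> 1 - 1 / real n"
proof -
  let ?prog = "compile 0 main"
  let ?c0 = "initial_config \<epsilon> \<sigma> T P"
  define fail :: "config \<Rightarrow> ennreal" where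
    "fail c = (if halted ?prog c then of_bool (\<not> correct_output \<epsilon> T P c) else \<top>)" for c
  define \<rho>0 :: rfile where "\<rho>0 r = int (regs ?c0 r)" for r
  define \<mu>0 :: memory where "\<mu>0 a = (if 0 \<le> a \<and> a < HX then int (I ! nat a) else 0)" for a
  have \<sigma>W: "int \<sigma> < W" using layout N16 by linarith
  have rep: "represents w ?c0 \<rho>0 \<mu>0"
    unfolding represents_def
  proof (intro conjI allI impI)
    fix r
    have "int n < W" "int m < W" using layout two_m N16 by linarith+
    moreover have "int E < W" using E(2) unfolding W_def by linarith
    ultimately have "regs ?c0 r < 2 ^ w" using \<sigma>W I by (auto simp: initial_config_def W_def \<epsilon>(2)[symmetric])
    then show "regs ?c0 r = enc w (\<rho>0 r)" by (simp add: \<rho>0_def enc_int)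
  next
    fix a :: nat
    show "mem ?c0 a = enc w (\<mu>0 (int a))"
    proof (cases "a < n + m")
      case True
      have "int (I ! a) < W" using symbol[OF True] \<sigma>W by linarith
      then show ?thesis using True I by (simp add: initial_config_def \<mu>0_def HX_def enc_int W_def)
    next
      case False
      then show ?thesis using I by (simp add: initial_config_def \<mu>0_def HX_def enc_def)
    qed
  qed
  have "expect w ?prog fail main_time ?c0 \<le> ennreal (1 / real n)"
  proof (rule boundsD[OF main_bounds, where T = 0])
    show "\<rho>0 0 = int n" "\<rho>0 1 = int m" "\<rho>0 3 = int E" "\<rho>0 4 = 0"
      using I \<epsilon> by (simp_all add: \<rho>0_def initial_config_def)
    show "input_at \<mu>0" using layout by (auto simp: input_at_def \<mu>0_def)
    show "\<mu>0 (OUT + 2 * int l) = 0" if "l < n" for l using layout by (simp add: \<mu>0_def)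
    show "placed ?prog 0 (compile 0 main)" by (simp add: placed_def)
    show "pc ?c0 = 0" by (simp add: initial_config_def)
    show "represents w ?c0 \<rho>0 \<mu>0" by (fact rep)
    fix x \<rho>' \<mu>' T'
    assume x: "pc x = 0 + clen main" "represents w x \<rho>' \<mu>'"
    have h: "halted ?prog x" using x by (simp add: halted_def)
    then have e: "expect w ?prog fail T' x = of_bool (\<not> correct_output \<epsilon> T P x)"
      by (simp add: expect_def run_halted nn_integral_return fail_def)
    show "expect w ?prog fail T' x \<le> (if \<rho>' 0 = OUT \<and> state_ok \<mu>' then risk 0 \<mu>' else \<top>)"
    proof (cases "\<rho>' 0 = OUT \<and> state_ok \<mu>'")
      case ok: True
      show ?thesis
      proof (cases "\<exists>l\<le>n - m. bad l (\<mu>' (OUT + 2 * int l))")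
        case True
        then obtain l where l: "l \<le> n - m" "bad l (\<mu>' (OUT + 2 * int l))" by blast
        have "of_bool (\<not> correct_output \<epsilon> T P x) \<le> (1 :: ennreal)" by simp
        \<comment> \<open>With no rounds left, a bad location contributes 1 to the potential, which
          pays for the failure.\<close>
        also have "\<dots> = of_bool (bad l (\<mu>' (OUT + 2 * int l))) * ennreal ((1 / 2) ^ 0)" using l by simp
        also have "\<dots> \<le> risk 0 \<mu>'"
          unfolding risk_def by (rule member_le_sum) (use l in auto)
        finally show ?thesis using ok e by simp
      next
        case False
        have "1 / \<epsilon> \<le> real E" using \<epsilon> by (simp add: of_nat_ceiling)
        then have "correct_output \<epsilon> T P x"
          using no_bad_correct[OF I \<epsilon>(1) _ x(2)] ok False by blast
        then show ?thesis using e by simp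
      qed
    qed (simp only: if_False top_greatest)
  qed simp
  then have int: "(\<integral>\<^sup>+ c. fail c \<partial>measure_pmf D) \<le> ennreal (1 / real n)"
    by (simp add: expect_def D_def)
  then have "(\<integral>\<^sup>+ c. fail c \<partial>measure_pmf D) \<noteq> \<infinity>" by (auto simp: top_unique)
  then have "AE c in measure_pmf D. fail c \<noteq> \<infinity>"
    by (intro nn_integral_PInf_AE) auto
  then show halts: "\<forall>c \<in> set_pmf D. halted ?prog c"
    by (auto simp: AE_measure_pmf_iff fail_def split: if_splits)
  have "emeasure (measure_pmf D) {c. \<not> correct_output \<epsilon> T P c} =
      (\<integral>\<^sup>+ c. indicator {c. \<not> correct_output \<epsilon> T P c} c \<partial>measure_pmf D)" by simp
  also have "\<dots> = (\<integral>\<^sup>+ c. fail c \<partial>measure_pmf D)"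
    by (intro nn_integral_cong_AE AE_pmfI) (use halts in \<open>auto simp: fail_def indicator_def\<close>)
  finally have "ennreal (measure_pmf.prob D {c. \<not> correct_output \<epsilon> T P c}) \<le> ennreal (1 / real n)"
    using int by (simp only: measure_pmf.emeasure_eq_measure)
  then have "measure_pmf.prob D {c. \<not> correct_output \<epsilon> T P c} \<le> 1 / real n"
    by (subst (asm) ennreal_le_iff) auto
  moreover have "measure_pmf.prob D {c. \<not> correct_output \<epsilon> T P c} = 1 - measure_pmf.prob D {c. correct_output \<epsilon> T P c}"
    using measure_pmf.prob_compl[of "{c. correct_output \<epsilon> T P c}" D]
    by (simp add: Compl_eq_Diff_UNIV[symmetric] Collect_neg_eq)
  ultimately show "measure_pmf.prob D {c. correct_output \<epsilon> T P c} \<ge> 1 - 1 / real n" by simp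
qed

end

section \<open>Running time\<close>

text \<open>The power with the least exponent overshoots its target by at most a factor 2; the floor
  4 for \<kappa> costs 2 ^ 4 = 16 \<le> 16 * m.\<close>

lemma size_bounds:
  fixes m n :: nat
  assumes "1 \<le> m" "1 \<le> n"
  defines "\<kappa> \<equiv> LEAST k. 4 \<le> k \<and> 2 * m \<le> 2 ^ k" and "l \<equiv> LEAST k. n \<le> 2 ^ k"
  shows "4 \<le> \<kappa>" "2 * m \<le> 2 ^ \<kappa>" "2 ^ \<kappa> \<le> 16 * m" "2 ^ l \<le> 2 * n"
proof -
  have "m \<le> 8 * 2 ^ m" using less_exp[of m] by linarith
  then have "4 \<le> 4 + m \<and> 2 * m \<le> 2 ^ (4 + m)" by (simp only: power_add) simp
  then have "4 \<le> \<kappa> \<and> 2 * m \<le> 2 ^ \<kappa>" unfolding \<kappa>_def by (rule LeastI)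
  then show \<kappa>: "4 \<le> \<kappa>" "2 * m \<le> 2 ^ \<kappa>" by auto
  show "2 ^ \<kappa> \<le> 16 * m"
  proof (cases "\<kappa> = 4")
    case False
    then obtain k where k: "\<kappa> = Suc k" "4 \<le> k" using \<kappa>(1) by (cases \<kappa>) auto
    then have "\<not> (4 \<le> k \<and> 2 * m \<le> 2 ^ k)" unfolding \<kappa>_def by (intro not_less_Least) simp
    then show ?thesis using k by simp
  qed (use assms in simp)
  show "2 ^ l \<le> 2 * n"
  proof (cases l)
    case (Suc k)
    then have "\<not> n \<le> 2 ^ k" unfolding l_def by (intro not_less_Least) simp
    then show ?thesis using Suc by simp
  qed (use assms in simp)
qed

context hashing
begin

text \<open>N \<le> 16 * m gives (n div m) * N \<le> 16 * n, which removes m except inside \<kappa>.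
  Scanning costs 220 * 2 * 5 * 16 = 35200 units per round, 35257 includes the linear terms, 141028 =
  4 * 35257 accounts for 2 * logn \<le> 4 * y rounds, and 24074 = 27 + 300 * 80 + 47 for the
  set-up.\<close>

lemma main_time_bound:
  fixes x y M :: real
  assumes x: "1 \<le> x" "real \<kappa> \<le> 5 * x" and y: "1 \<le> y" "real logn \<le> 2 * y" and M: "1 \<le> M" "real E \<le> 2 * M"
    and N: "N \<le> 16 * m"
  shows "real main_time \<le> 200000 * (real n * M * x * y)"
proof -
  define A where "A = real n * M * x"
  have n1: "1 \<le> real n" using m by simp
  have nx: "real n \<le> real n * x" using x n1 by simp
  have nxA: "real n * x \<le> A"
    unfolding A_def using M(1) x n1 by (simp add: mult_right_mono)
  have "n div m * N \<le> n div m * (16 * m)" using N by (intro mult_left_mono) auto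
  also have "\<dots> \<le> 16 * n" by (simp add: mult.commute[of _ m] mult.left_commute)
  finally have nbN: "n div m * N \<le> 16 * n" .
  have E\<kappa>: "real E * real \<kappa> \<le> (2 * M) * (5 * x)" using x M by (intro mult_mono) auto
  have "real (n div m * (220 * E * N * \<kappa>)) = 220 * (real E * real \<kappa>) * real (n div m * N)" by simp
  also have "\<dots> \<le> 220 * ((2 * M) * (5 * x)) * real (16 * n)"
    using E\<kappa> nbN x M by (intro mult_mono) (auto simp only: of_nat_le_iff, auto)
  also have "\<dots> = 35200 * A" by (simp add: A_def)
  finally have big: "real (n div m * (220 * E * N * \<kappa>)) \<le> 35200 * A" .
  have "n div m \<le> n" by simp
  then have "rep_time \<le> 43 * n + 9 + n div m * (220 * E * N * \<kappa>)"
    using m unfolding rep_time_def distrib_left distrib_right by linarith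
  then have "real rep_time \<le> 43 * real n + 9 + real (n div m * (220 * E * N * \<kappa>))"
    by (metis (mono_tags) of_nat_add of_nat_le_iff of_nat_mult of_nat_numeral)
  then have rep: "real rep_time + 5 \<le> 35257 * A" using big n1 nx nxA by linarith
  have A0: "0 \<le> A" using n1 nx nxA by linarith
  have "real (2 * logn * (rep_time + 5)) = 2 * real logn * (real rep_time + 5)" by simp
  also have "\<dots> \<le> (2 * (2 * y)) * (35257 * A)" using rep y by (intro mult_mono) auto
  finally have loops: "real (2 * logn * (rep_time + 5)) \<le> 141028 * (A * y)" by simp
  have "real (N * \<kappa>) \<le> (16 * real n) * (5 * x)"
    unfolding of_nat_mult using x N m by (intro mult_mono) auto
  then have N\<kappa>: "real (N * \<kappa>) \<le> 80 * (real n * x)" by simp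
  have "real main_time = 27 * real n + 300 * real (N * \<kappa>) + 47 + real (2 * logn * (rep_time + 5))"
    by (simp add: main_time_def)
  also have "\<dots> \<le> 24074 * A + 141028 * (A * y)" using N\<kappa> loops n1 nx nxA by linarith
  also have "A * 1 \<le> A * y" using y A0 by (intro mult_left_mono) auto
  then have "24074 * A + 141028 * (A * y) \<le> 200000 * (A * y)" using A0 y by simp
  finally show ?thesis by (simp add: A_def)
qed

end

text \<open>One program serves all inputs and word sizes: \<open>machine.main\<close> is defined
  inside a locale but does not depend on its parameters. A word must hold 2 * S ^ 3 = 2 * N ^ 48;
  with Q for the sum inside the logarithm of the word-size condition, N \<le> Q ^ 4 and 2 \<le> Q
  bound this by Q ^ 193, and 200 leaves a margin.\<close>

theorem theorem1:
  shows "\<exists>(prog :: instr list) (a :: real) (C :: real) (\<gamma> :: real).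
    1 \<le> a \<and> 0 < \<gamma> \<and>
    (\<forall>(\<epsilon> :: real) (\<sigma> :: nat) (T :: nat list) (P :: nat list) (w :: nat).
      0 < \<epsilon> \<longrightarrow>
      1 \<le> length P \<longrightarrow>
      length P \<le> length T \<longrightarrow>
      set T \<subseteq> {1..\<sigma>} \<longrightarrow>
      set P \<subseteq> {1..\<sigma>} \<longrightarrow>
      admissible_word_size a \<epsilon> (length T) (length P) \<sigma> w \<longrightarrow>
      (\<exists>t :: nat.
        real t \<le> C * time_bound \<epsilon> (length T) (length P) \<sigma> \<and>
        (\<forall>c \<in> set_pmf (run w prog t (initial_config \<epsilon> \<sigma> T P)). halted prog c) \<and>
        measure_pmf.prob (run w prog t (initial_config \<epsilon> \<sigma> T P)) {c. correct_output \<epsilon> T P c}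
          \<ge> 1 - real (length T) powr (- \<gamma>)))"
proof (rule exI[of _ "compile 0 machine.main"], rule exI[of _ 200], rule exI[of _ 200000], rule exI[of _ 1],
    intro conjI allI impI)
  fix \<epsilon> :: real and \<sigma> :: nat and T P :: "nat list" and w :: nat
  assume \<epsilon>: "0 < \<epsilon>" and m1: "1 \<le> length P" and mn: "length P \<le> length T"
    and sets: "set T \<subseteq> {1..\<sigma>}" "set P \<subseteq> {1..\<sigma>}"
    and adm: "admissible_word_size 200 \<epsilon> (length T) (length P) \<sigma> w"
  define n where "n = length T"
  define m where "m = length P"
  define E where "E = nat \<lceil>1 / \<epsilon>\<rceil>"
  define \<kappa> where "\<kappa> = (LEAST k. 4 \<le> k \<and> 2 * m \<le> 2 ^ k)"
  define l where "l = (LEAST k. n \<le> 2 ^ k)"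
  have nm: "1 \<le> m" "m \<le> n" "1 \<le> n" using m1 mn by (simp_all add: n_def m_def)
  note sz = size_bounds[OF nm(1,3), folded \<kappa>_def l_def]
  define Q where "Q = real n + real m + real \<sigma> + 1 / \<epsilon>"
  obtain p where "p \<in> set P" using m1 by (cases P) auto
  then have \<sigma>1: "1 \<le> \<sigma>" using sets by fastforce
  have i\<epsilon>: "0 < 1 / \<epsilon>" using \<epsilon> by simp
  have Q3: "3 \<le> Q"
  proof -
    have "1 \<le> real n" "1 \<le> real m" "1 \<le> real \<sigma>" using nm \<sigma>1 by simp_all
    then show ?thesis using i\<epsilon> unfolding Q_def by linarith
  qed
  have E1: "1 \<le> E" using i\<epsilon> by (simp add: E_def Suc_le_eq)
  have EQ: "real E \<le> 1 / \<epsilon> + 1" using i\<epsilon> by (simp add: E_def)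
  have QW: "Q ^ 200 \<le> 2 ^ w"
  proof -
    have "200 * log 2 Q \<le> real w" using adm by (simp add: admissible_word_size_def n_def m_def Q_def)
    then have "2 powr (200 * log 2 Q) \<le> 2 powr real w" by simp
    moreover have "2 powr (200 * log 2 Q) = Q powr 200"
      using Q3 by (simp add: powr_powr[symmetric] mult.commute[of 200])
    moreover have "Q powr 200 = Q ^ 200" using Q3 powr_realpow[of Q 200] by simp
    ultimately show ?thesis by (simp add: powr_realpow)
  qed
  \<comment> \<open>104 covers the memory layout 4 * n + 3 * m + 6 * N + \<sigma> with N \<le> 16 *
    m: 4 + 3 + 96 + 1.\<close>
  have Q6: "104 * Q \<le> 2 ^ w"
  proof -
    have "3 ^ 5 \<le> Q ^ 5" using Q3 by (intro power_mono) auto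
    then have "104 * Q \<le> Q ^ 5 * Q" using Q3 by (intro mult_right_mono) auto
    also have "\<dots> = Q ^ 6" by (simp flip: power_Suc2)
    also have "\<dots> \<le> Q ^ 200" using Q3 by (intro power_increasing) auto
    finally show ?thesis using QW by linarith
  qed
  have Nm: "real (2 ^ \<kappa>) \<le> 16 * real m" using sz(3) by (metis of_nat_le_iff of_nat_mult of_nat_numeral)
  have parts: "real n \<le> Q" "real m \<le> Q" "real \<sigma> \<le> Q" "1 / \<epsilon> + 1 \<le> Q" "real n + real m + real \<sigma> \<le> Q"
    using nm \<sigma>1 i\<epsilon> by (simp_all add: Q_def)
  \<comment> \<open>Text, pattern and alphabet are non-empty, which gave \<open>Q \<ge> 3\<close>;
    hence 16 \<le> Q ^ 3.\<close>
  have NQ: "real (2 ^ \<kappa>) \<le> Q ^ 4"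
  proof -
    have "3 ^ 3 \<le> Q ^ 3" using Q3 by (intro power_mono) auto
    then have "16 * real m \<le> Q ^ 3 * Q" using Q3 parts by (intro mult_mono) auto
    then show ?thesis using Nm by (simp flip: power_Suc2)
  qed
  have real_less: "x < 2 ^ w" if "real_of_int x < 2 ^ w" for x :: int
  proof -
    have "real_of_int x < real_of_int (2 ^ w)" using that by simp
    then show ?thesis by (simp only: of_int_less_iff)
  qed
  have H: "hashing w n m \<sigma> E \<kappa> l (T @ P)"
  proof unfold_locales
    show "2 * int E < 2 ^ w" using EQ parts Q6 Q3 by (intro real_less) simp
    show "2 * (int n + int m) + 2 * int n + int m + 2 * int (2 ^ \<kappa>) + 2 * int (2 ^ \<kappa>) + 2 * int (2 ^ \<kappa>) + int \<sigma> < 2 ^ w"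
    proof (rule real_less)
      have "4 * real n + 3 * real m + 6 * real (2 ^ \<kappa>) + real \<sigma> < 104 * Q" using Nm parts nm Q3 by linarith
      then show "real_of_int (2 * (int n + int m) + 2 * int n + int m + 2 * int (2 ^ \<kappa>) + 2 * int (2 ^ \<kappa>) + 2 * int (2 ^ \<kappa>) + int \<sigma>) < 2 ^ w"
        using Q6 by simp
    qed
    have "2 * real (2 ^ \<kappa>) ^ 48 \<le> Q * (Q ^ 4) ^ 48" using Q3 NQ by (intro mult_mono power_mono) auto
    also have "\<dots> = Q ^ 193" by (simp flip: power_mult power_Suc)
    also have "\<dots> \<le> Q ^ 200" using Q3 by (intro power_increasing) auto
    finally have "real_of_int (2 * (2 ^ (16 * \<kappa>) * 2 ^ (16 * \<kappa>) * 2 ^ (16 * \<kappa>))) \<le> real_of_int (2 ^ w)"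
      using QW by (simp add: mult.commute flip: power_mult power_add)
    then show "2 * (2 ^ (16 * \<kappa>) * 2 ^ (16 * \<kappa>) * 2 ^ (16 * \<kappa>)) \<le> (2 :: int) ^ w"
      by (simp only: of_int_le_iff)
  qed (use sz nm E1 sets in \<open>auto simp: \<kappa>_def l_def n_def m_def\<close>)
  define N :: nat where "N = 2 ^ \<kappa>"
  interpret hashing w n m \<sigma> E \<kappa> N "2 ^ (16 * \<kappa>)" "2 ^ w" "int n + int m" "2 * (int n + int m)"
    "2 * (int n + int m) + 2 * int n" "2 * (int n + int m) + 2 * int n + int m"
    "2 * (int n + int m) + 2 * int n + int m + 2 * int N"
    "2 * (int n + int m) + 2 * int n + int m + 2 * int N + 2 * int N"
    "2 * (int n + int m) + 2 * int n + int m + 2 * int N + 2 * int N + 2 * int N" l "T @ P"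
    using H by (simp_all add: N_def)
  have \<kappa>x: "real \<kappa> \<le> 5 * lg (real m)"
  proof -
    have "real \<kappa> \<le> log 2 (real (16 * m))" by (rule le_log2_of_power[OF sz(3)])
    also have "\<dots> = 4 + log 2 (real m)" using nm log2_of_power_eq[of 16 4] by (simp add: log_mult)
    finally show ?thesis by (simp add: lg_def)
  qed
  have ly: "real l \<le> 2 * lg (real n)"
  proof -
    have "real l \<le> log 2 (real (2 * n))" by (rule le_log2_of_power[OF sz(4)])
    also have "\<dots> = 1 + log 2 (real n)" using nm by (simp add: log_mult)
    finally show ?thesis by (simp add: lg_def)
  qed
  have EM: "real E \<le> 2 * max 1 (1 / \<epsilon>)" using EQ by linarith
  show "\<exists>t. real t \<le> 200000 * time_bound \<epsilon> (length T) (length P) \<sigma> \<and>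
      (\<forall>c \<in> set_pmf (run w (compile 0 machine.main) t (initial_config \<epsilon> \<sigma> T P)). halted (compile 0 machine.main) c) \<and>
      measure_pmf.prob (run w (compile 0 machine.main) t (initial_config \<epsilon> \<sigma> T P)) {c. correct_output \<epsilon> T P c}
        \<ge> 1 - real (length T) powr (- 1)"
  proof (intro exI conjI)
    have "real main_time \<le> 200000 * (real n * max 1 (1 / \<epsilon>) * lg (real m) * lg (real n))"
      using sz(3) by (intro main_time_bound \<kappa>x ly EM) (auto simp: lg_def N_def)
    also have "\<dots> \<le> 200000 * time_bound \<epsilon> (length T) (length P) \<sigma>"
    proof (rule mult_left_mono)
      let ?B = "real n * max 1 (1 / \<epsilon>) * lg (real m) * lg (real n)"
      have B: "0 \<le> ?B" by (simp add: lg_def)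
      have "?B * 1 \<le> ?B * (lg (1 / \<epsilon>) * lg (real \<sigma>))"
        by (intro mult_left_mono B mult_ge1_I) (auto simp: lg_def)
      also have "\<dots> = time_bound \<epsilon> (length T) (length P) \<sigma>"
        by (simp add: time_bound_def n_def m_def mult_ac)
      finally show "?B \<le> time_bound \<epsilon> (length T) (length P) \<sigma>" by simp
    qed simp
    finally show "real main_time \<le> 200000 * time_bound \<epsilon> (length T) (length P) \<sigma>" .
    note mc = main_correct[OF refl n_def[symmetric] m_def[symmetric] \<epsilon> E_def]
    show "\<forall>c \<in> set_pmf (run w (compile 0 machine.main) main_time (initial_config \<epsilon> \<sigma> T P)). halted (compile 0 machine.main) c"
      by (rule mc(1))
    show "measure_pmf.prob (run w (compile 0 machine.main) main_time (initial_config \<epsilon> \<sigma> T P)) {c. correct_output \<epsilon> T P c}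
        \<ge> 1 - real (length T) powr (- 1)"
      using mc(2) nm by (simp add: powr_minus_divide n_def)
  qed
qed simp_all

end
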